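(* There exist three-dimensional conformally compactifiable asymptotically locally hyperbolic (ALH) Riemannian manifolds $(M,g)$ without boundary at finite distance, with constant scalar curvature, with conformal boundary at infinity a surface of genus two, and with negative mass.
   Context: A Riemannian manifold $(M,g)$ has a conformal completion $(\bar M,\bar g)$ if $\bar M$ is a manifold with boundary and there is a function $\Omega\ge0$ on $\bar M$, vanishing exactly on the boundary at infinity $\bar M\setminus M$, with $d\Omega\ne0$ there, and $g=\Omega^{-2}\bar g$ on $M$. It is conformally compactifiable if $\bar M$ is compact. "Without boundary at finite distance" means that $M$ itself has no boundary, so that the boundary of $\bar M$ is the conformal boundary at infinity. $(M,g)$ is ALH if its scalar curvature approaches a (negative) constant at the conformal boundary at infinity; this constant is normalised to $-n(n-1)=-6$. Mass (dimension $3$). Let $N$ be the conformal boundary at infinity (a closed surface) and let $h_k$ be a metric of constant Gauss curvature $k\in\{0,\pm1\}$ in the conformal class at infinity (for genus two, $k=-1$ and $h_{-1}$ is unique). The background is $b=\frac{dr^2}{r^2+k}+r^2h_k$ on $[r_0,\infty)\times N$, identified with a neighbourhood of infinity in $M$, with $b$-orthonormal frame $f_i=r^{-1}\epsilon_i$ ($i=1,2$, $\epsilon_i$ an $h_k$-orthonormal frame), $f_3=\sqrt{r^2+k}\,\partial_r$. With frame components $g_{ij}=g(f_i,f_j)$, $b_{ij}=\delta_{ij}$, it is assumed that $g$ is uniformly equivalent to $b$, that $\sum|g_{ij}-b_{ij}|+\sum|f_k(g_{ij})|=o(r^{-3/2})$, and that $\int\big(\sum|g_{ij}-b_{ij}|^2+\sum|f_k(g_{ij})|^2\big)r\,d\mu_g<\infty$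 and $\int|R_g-R_b|\,r\,d\mu_g<\infty$ near infinity. With $V=\sqrt{r^2+k}$, the mass is (up to a positive multiplicative constant) $$m=-\lim_{\rho\to\infty}\int_{\{r=\rho\}}D^jV\Big(R^i{}_j-\frac{R}{3}\delta^i_j\Big)d\sigma_i,$$ where $D$, $R_{ij}$, $R$ are the Levi-Civita connection, Ricci tensor and scalar curvature of $g$, and $d\sigma_i=\sqrt{\det g}\,\partial_i\rfloor dx^1\wedge dx^2\wedge dx^3$ (oriented by increasing $r$). *)

theory Defs
  imports "HOL-Analysis.Analysis"
begin

fun Ck_on :: "nat \<Rightarrow> 'a::euclidean_space set \<Rightarrow> ('a \<Rightarrow> 'b::real_normed_vector) \<Rightarrow> bool" where
  "Ck_on 0 U f \<longleftrightarrow> continuous_on U f"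
| "Ck_on (Suc k) U f \<longleftrightarrow>
     (\<forall>x\<in>U. f differentiable (at x)) \<and>
     (\<forall>v\<in>Basis. Ck_on k U (\<lambda>x. frechet_derivative f (at x) v))"

text \<open>\<open>S\<close> need not be open (it will be a relatively open subset of a half-space):
  smooth means smoothly extendible to a Euclidean neighbourhood of each point.
  The predicate \<open>Ck_on\<close> is only meaningful on open sets.\<close>

definition smooth_on :: "'a::euclidean_space set \<Rightarrow> ('a \<Rightarrow> 'b::real_normed_vector) \<Rightarrow> bool" where
  "smooth_on S f \<longleftrightarrow>
     (\<forall>x\<in>S. \<exists>U F. open U \<and> x \<in> U \<and> (\<forall>k. Ck_on k U F) \<and> (\<forall>y\<in>S \<inter> U. F y = f y))"

text \<open>A chart is a pair of a domain and a coordinate map; the values of the coordinate map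
  outside the domain are irrelevant.\<close>

type_synonym ('a, 'n) chart = "'a set \<times> ('a \<Rightarrow> real ^ 'n)"

record ('a, 'n) manifold =
  Top :: "'a topology"
  Atlas :: "('a, 'n) chart set"

abbreviation Points :: "('a, 'n) manifold \<Rightarrow> 'a set" where
  "Points M \<equiv> topspace (Top M)"

text \<open>The model space \<open>H\<close> is \<open>UNIV\<close> for manifolds without boundary and \<open>half_space\<close> for
  three-manifolds with boundary.\<close>

definition half_space :: "(real ^ 3) set" where
  "half_space = {x. 0 \<le> x $ 3}"

definition is_chart :: "(real ^ 'n::finite) set \<Rightarrow> 'a topology \<Rightarrow> ('a, 'n) chart \<Rightarrow> bool" where
  "is_chart H X c \<longleftrightarrow>
     openin X (fst c) \<and> openin (top_of_set H) (snd c ` fst c) \<and>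
     homeomorphic_map (subtopology X (fst c)) (top_of_set (snd c ` fst c)) (snd c)"

definition transition :: "('a, 'n::finite) chart \<Rightarrow> ('a, 'n) chart \<Rightarrow> real ^ 'n \<Rightarrow> real ^ 'n" where
  "transition c d = snd d \<circ> inv_into (fst c) (snd c)"

definition compatible :: "('a, 'n::finite) chart \<Rightarrow> ('a, 'n) chart \<Rightarrow> bool" where
  "compatible c d \<longleftrightarrow>
     smooth_on (snd c ` (fst c \<inter> fst d)) (transition c d) \<and>
     smooth_on (snd d ` (fst c \<inter> fst d)) (transition d c)"

definition smooth_manifold :: "(real ^ 'n::finite) set \<Rightarrow> ('a, 'n) manifold \<Rightarrow> bool" where
  "smooth_manifold H M \<longleftrightarrow>
     Hausdorff_space (Top M) \<and> second_countable (Top M) \<and>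
     (\<forall>c\<in>Atlas M. is_chart H (Top M) c) \<and>
     (\<Union>c\<in>Atlas M. fst c) = Points M \<and>
     (\<forall>c\<in>Atlas M. \<forall>d\<in>Atlas M. compatible c d) \<and>
     (\<forall>c. is_chart H (Top M) c \<and> (\<forall>d\<in>Atlas M. compatible c d) \<longrightarrow> c \<in> Atlas M)"

definition chart_at :: "('a, 'n) manifold \<Rightarrow> 'a \<Rightarrow> ('a, 'n) chart" where
  "chart_at M p = (SOME c. c \<in> Atlas M \<and> p \<in> fst c)"

definition boundary_points :: "('a, 3) manifold \<Rightarrow> 'a set" where
  "boundary_points M = {p. \<exists>c\<in>Atlas M. p \<in> fst c \<and> snd c p $ 3 = 0}"

definition boundary_chart :: "('a, 3) manifold \<Rightarrow> ('a, 3) chart \<Rightarrow> ('a, 2) chart" where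
  "boundary_chart M c =
     (fst c \<inter> boundary_points M, \<lambda>p. vector [snd c p $ 1, snd c p $ 2])"

text \<open>The boundary with the maximal atlas generated by the restricted charts.\<close>

definition boundary_manifold :: "('a, 3) manifold \<Rightarrow> ('a, 2) manifold" where
  "boundary_manifold M =
     \<lparr> Top = subtopology (Top M) (boundary_points M),
       Atlas = {c. is_chart UNIV (subtopology (Top M) (boundary_points M)) c \<and>
                   (\<forall>d\<in>Atlas M. compatible c (boundary_chart M d))} \<rparr>"

definition open_submanifold :: "('a, 'n) manifold \<Rightarrow> 'a set \<Rightarrow> ('a, 'n) manifold" where
  "open_submanifold M S =
     \<lparr> Top = subtopology (Top M) S, Atlas = {c \<in> Atlas M. fst c \<subseteq> S} \<rparr>"

definition smooth_function :: "('a, 'n::finite) manifold \<Rightarrow> ('a \<Rightarrow> real) \<Rightarrow> bool" where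
  "smooth_function M f \<longleftrightarrow>
     (\<forall>c\<in>Atlas M. smooth_on (snd c ` fst c) (f \<circ> inv_into (fst c) (snd c)))"

text \<open>A covariant two-tensor is given by its component matrices as functions of the coordinates,
  one for each chart.\<close>

type_synonym ('a, 'n) tensor2 = "('a, 'n) chart \<Rightarrow> real ^ 'n \<Rightarrow> real ^ 'n ^ 'n"

definition bilin :: "real ^ 'n::finite ^ 'n \<Rightarrow> real ^ 'n \<Rightarrow> real ^ 'n \<Rightarrow> real" where
  "bilin G u v = (\<Sum>i\<in>UNIV. \<Sum>j\<in>UNIV. G $ i $ j * u $ i * v $ j)"

definition riemannian_metric :: "('a, 'n::finite) manifold \<Rightarrow> ('a, 'n) tensor2 \<Rightarrow> bool" where
  "riemannian_metric M g \<longleftrightarrow>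
     (\<forall>c\<in>Atlas M.
        smooth_on (snd c ` fst c) (g c) \<and>
        (\<forall>x\<in>snd c ` fst c. transpose (g c x) = g c x \<and> (\<forall>v. v \<noteq> 0 \<longrightarrow> 0 < bilin (g c x) v v))) \<and>
     (\<forall>c\<in>Atlas M. \<forall>d\<in>Atlas M. \<forall>p\<in>fst c \<inter> fst d. \<forall>D.
        (transition c d has_derivative D) (at (snd c p) within snd c ` (fst c \<inter> fst d)) \<longrightarrow>
        (\<forall>u v. bilin (g c (snd c p)) u v = bilin (g d (snd d p)) (D u) (D v)))"

text \<open>The unique Borel measure with density \<open>sqrt (det g)\<close> in every chart.\<close>

definition riemannian_measure :: "('a, 'n::finite) manifold \<Rightarrow> ('a, 'n) tensor2 \<Rightarrow> 'a measure" where
  "riemannian_measure M g =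
     (THE \<mu>. space \<mu> = Points M \<and> sets \<mu> = sigma_sets (Points M) {U. openin (Top M) U} \<and>
        (\<forall>c\<in>Atlas M. \<forall>B\<in>sets \<mu>. B \<subseteq> fst c \<longrightarrow>
           emeasure \<mu> B =
             (\<integral>\<^sup>+x. ennreal (sqrt (det (g c x))) * indicator (snd c ` B) x \<partial>lborel)))"

definition partial :: "'n::finite \<Rightarrow> (real ^ 'n \<Rightarrow> real) \<Rightarrow> real ^ 'n \<Rightarrow> real" where
  "partial i f x = frechet_derivative f (at x) (axis i 1)"

text \<open>\<open>christoffel G k i j\<close> has upper index \<open>k\<close>; \<open>riemann G k l i j\<close> is the \<open>k\<close>-th component
  of \<open>R(\<partial>\<^sub>i, \<partial>\<^sub>j) \<partial>\<^sub>l\<close>. The sign convention makes round spheres positively curved.\<close>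

definition christoffel ::
    "(real ^ 'n::finite \<Rightarrow> real ^ 'n ^ 'n) \<Rightarrow> 'n \<Rightarrow> 'n \<Rightarrow> 'n \<Rightarrow> real ^ 'n \<Rightarrow> real" where
  "christoffel G k i j x =
     (\<Sum>l\<in>UNIV. matrix_inv (G x) $ k $ l *
        (partial i (\<lambda>y. G y $ j $ l) x + partial j (\<lambda>y. G y $ i $ l) x
           - partial l (\<lambda>y. G y $ i $ j) x)) / 2"

definition riemann ::
    "(real ^ 'n::finite \<Rightarrow> real ^ 'n ^ 'n) \<Rightarrow> 'n \<Rightarrow> 'n \<Rightarrow> 'n \<Rightarrow> 'n \<Rightarrow> real ^ 'n \<Rightarrow> real" where
  "riemann G k l i j x =
     partial i (christoffel G k j l) x - partial j (christoffel G k i l) x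
     + (\<Sum>m\<in>UNIV. christoffel G k i m x * christoffel G m j l x
                 - christoffel G k j m x * christoffel G m i l x)"

definition ricci ::
    "(real ^ 'n::finite \<Rightarrow> real ^ 'n ^ 'n) \<Rightarrow> 'n \<Rightarrow> 'n \<Rightarrow> real ^ 'n \<Rightarrow> real" where
  "ricci G i j x = (\<Sum>k\<in>UNIV. riemann G k i k j x)"

definition scalar :: "(real ^ 'n::finite \<Rightarrow> real ^ 'n ^ 'n) \<Rightarrow> real ^ 'n \<Rightarrow> real" where
  "scalar G x = (\<Sum>i\<in>UNIV. \<Sum>j\<in>UNIV. matrix_inv (G x) $ i $ j * ricci G i j x)"

definition gauss :: "(real ^ 2 \<Rightarrow> real ^ 2 ^ 2) \<Rightarrow> real ^ 2 \<Rightarrow> real" where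
  "gauss G x = (\<Sum>k\<in>UNIV. G x $ 1 $ k * riemann G k 2 1 2 x) / det (G x)"

text \<open>The scalar curvature is chart-independent, so the choice in \<open>chart_at\<close> is harmless.\<close>

definition scalar_curvature :: "('a, 'n::finite) manifold \<Rightarrow> ('a, 'n) tensor2 \<Rightarrow> 'a \<Rightarrow> real" where
  "scalar_curvature M g p = scalar (g (chart_at M p)) (snd (chart_at M p) p)"

definition constant_scalar_curvature :: "('a, 'n::finite) manifold \<Rightarrow> ('a, 'n) tensor2 \<Rightarrow> bool" where
  "constant_scalar_curvature M g \<longleftrightarrow> (\<exists>\<kappa>. \<forall>p\<in>Points M. scalar_curvature M g p = \<kappa>)"

definition conformal_completion ::
    "('a, 3) manifold \<Rightarrow> ('a, 3) tensor2 \<Rightarrow>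
     ('a, 3) manifold \<Rightarrow> ('a, 3) tensor2 \<Rightarrow> ('a \<Rightarrow> real) \<Rightarrow> bool" where
  "conformal_completion M g Mbar gbar \<Omega> \<longleftrightarrow>
     smooth_manifold half_space Mbar \<and> riemannian_metric Mbar gbar \<and>
     openin (Top Mbar) (Points M) \<and> M = open_submanifold Mbar (Points M) \<and>
     Points Mbar - Points M \<subseteq> boundary_points Mbar \<and>
     smooth_function Mbar \<Omega> \<and>
     (\<forall>p\<in>Points Mbar. 0 \<le> \<Omega> p \<and> (\<Omega> p = 0 \<longleftrightarrow> p \<notin> Points M)) \<and>
     (\<forall>c\<in>Atlas Mbar. \<forall>p\<in>fst c - Points M. \<exists>D.
        (\<Omega> \<circ> inv_into (fst c) (snd c) has_derivative D) (at (snd c p) within snd c ` fst c) \<and>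
        D \<noteq> (\<lambda>v. 0)) \<and>
     (\<forall>c\<in>Atlas M. \<forall>p\<in>fst c. g c (snd c p) = (1 / (\<Omega> p)\<^sup>2) *\<^sub>R gbar c (snd c p))"

text \<open>The limiting value of the scalar curvature is normalised to \<open>-n(n-1) = -6\<close>.\<close>

definition ALH :: "('a, 3) manifold \<Rightarrow> ('a, 3) tensor2 \<Rightarrow> ('a, 3) manifold \<Rightarrow> bool" where
  "ALH M g Mbar \<longleftrightarrow>
     (\<forall>q\<in>Points Mbar - Points M.
        (scalar_curvature M g \<longlongrightarrow> -6) (atin_within (Top Mbar) q (Points M)))"

text \<open>The standard closed orientable surface of genus two in three-space. The function
  \<open>x\<^sup>2 - x\<^sup>4 - y\<^sup>2\<close> has two maxima, with value 1/4, and one saddle, with value 0, so the planar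
  region where its modulus is at most 1/10 is a disc with two holes (a neighbourhood of a figure
  eight); the surface consists of two copies of this region glued along their boundaries.\<close>

definition double_torus :: "(real ^ 3) set" where
  "double_torus = {x. ((x $ 1)\<^sup>2 - (x $ 1) ^ 4 - (x $ 2)\<^sup>2)\<^sup>2 + (x $ 3)\<^sup>2 = (1 / 10)\<^sup>2}"

definition genus_two :: "'a topology \<Rightarrow> bool" where
  "genus_two X \<longleftrightarrow> X homeomorphic_space top_of_set double_torus"

text \<open>Coordinates \<open>y\<close> on \<open>(r\<^sub>0,\<infinity>) \<times> N\<close>: the first two are coordinates on \<open>N\<close>, the third is \<open>r\<close>.\<close>

definition hor :: "real ^ 3 \<Rightarrow> real ^ 2" where
  "hor y = vector [y $ 1, y $ 2]"

definition lift :: "real ^ 2 \<Rightarrow> real \<Rightarrow> real ^ 3" where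
  "lift x t = vector [x $ 1, x $ 2, t]"

text \<open>The background \<open>b = dr\<^sup>2/(r\<^sup>2+k) + r\<^sup>2 h\<^sub>k\<close> with \<open>k = -1\<close>.\<close>

definition background :: "(real ^ 2 \<Rightarrow> real ^ 2 ^ 2) \<Rightarrow> real ^ 3 \<Rightarrow> real ^ 3 ^ 3" where
  "background h y = vector
     [vector [(y $ 3)\<^sup>2 * h (hor y) $ 1 $ 1, (y $ 3)\<^sup>2 * h (hor y) $ 1 $ 2, 0],
      vector [(y $ 3)\<^sup>2 * h (hor y) $ 2 $ 1, (y $ 3)\<^sup>2 * h (hor y) $ 2 $ 2, 0],
      vector [0, 0, 1 / ((y $ 3)\<^sup>2 - 1)]]"

definition static_potential :: "real ^ 3 \<Rightarrow> real" where
  "static_potential y = sqrt ((y $ 3)\<^sup>2 - 1)"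

definition frame ::
    "(real ^ 2 \<Rightarrow> real ^ 2) \<Rightarrow> (real ^ 2 \<Rightarrow> real ^ 2) \<Rightarrow> 3 \<Rightarrow> real ^ 3 \<Rightarrow> real ^ 3" where
  "frame \<epsilon>1 \<epsilon>2 i y =
     (if i = 1 then (1 / y $ 3) *\<^sub>R lift (\<epsilon>1 (hor y)) 0
      else if i = 2 then (1 / y $ 3) *\<^sub>R lift (\<epsilon>2 (hor y)) 0
      else lift 0 (sqrt ((y $ 3)\<^sup>2 - 1)))"

definition orthonormal_frame ::
    "(real ^ 2 \<Rightarrow> real ^ 2 ^ 2) \<Rightarrow> (real ^ 2) set \<Rightarrow>
     (real ^ 2 \<Rightarrow> real ^ 2) \<Rightarrow> (real ^ 2 \<Rightarrow> real ^ 2) \<Rightarrow> bool" where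
  "orthonormal_frame h S \<epsilon>1 \<epsilon>2 \<longleftrightarrow>
     smooth_on S \<epsilon>1 \<and> smooth_on S \<epsilon>2 \<and>
     (\<forall>x\<in>S. bilin (h x) (\<epsilon>1 x) (\<epsilon>1 x) = 1 \<and> bilin (h x) (\<epsilon>2 x) (\<epsilon>2 x) = 1 \<and>
            bilin (h x) (\<epsilon>1 x) (\<epsilon>2 x) = 0)"

text \<open>With \<open>f\<close> the above frame and \<open>g\<^sub>i\<^sub>j = g(f\<^sub>i, f\<^sub>j)\<close>: the sum of all \<open>\<phi>(g\<^sub>i\<^sub>j - \<delta>\<^sub>i\<^sub>j)\<close> and
  all \<open>\<phi>(f\<^sub>k(g\<^sub>i\<^sub>j))\<close>.\<close>

definition deviation ::
    "(real \<Rightarrow> real) \<Rightarrow> (real ^ 3 \<Rightarrow> real ^ 3 ^ 3) \<Rightarrow>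
     (real ^ 2 \<Rightarrow> real ^ 2) \<Rightarrow> (real ^ 2 \<Rightarrow> real ^ 2) \<Rightarrow> real ^ 3 \<Rightarrow> real" where
  "deviation \<phi> G \<epsilon>1 \<epsilon>2 y =
     (let gf = (\<lambda>i j z. bilin (G z) (frame \<epsilon>1 \<epsilon>2 i z) (frame \<epsilon>1 \<epsilon>2 j z)) in
       (\<Sum>i\<in>UNIV. \<Sum>j\<in>UNIV. \<phi> (gf i j y - (if i = j then 1 else 0))) +
       (\<Sum>i\<in>UNIV. \<Sum>j\<in>UNIV. \<Sum>k\<in>UNIV.
          \<phi> (frechet_derivative (gf i j) (at y) (frame \<epsilon>1 \<epsilon>2 k y))))"

text \<open>An open end \<open>E\<close> with functions \<open>r\<close> and \<open>\<pi>\<close> identifying it with \<open>(r\<^sub>0,\<infinity>) \<times> N\<close>; each chart of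
  \<open>N\<close> then induces a chart of \<open>M\<close>.\<close>

definition end_chart ::
    "'a set \<Rightarrow> ('a \<Rightarrow> real) \<Rightarrow> ('a \<Rightarrow> 'a) \<Rightarrow> ('a, 2) chart \<Rightarrow> ('a, 3) chart" where
  "end_chart E r \<pi> c = ({p \<in> E. \<pi> p \<in> fst c}, \<lambda>p. lift (snd c (\<pi> p)) (r p))"

text \<open>A diffeomorphism between a neighbourhood of infinity and \<open>(r\<^sub>0,\<infinity>) \<times> N\<close>, where \<open>N\<close> is the
  boundary at infinity, extending continuously by the identity of \<open>N\<close> at \<open>r = \<infinity>\<close>.
  (\<open>r\<^sub>0 > 1\<close> ensures that the background is defined.)\<close>

definition end_identification ::
    "('a, 3) manifold \<Rightarrow> ('a, 3) manifold \<Rightarrow> 'a set \<Rightarrow> real \<Rightarrow> ('a \<Rightarrow> real) \<Rightarrow> ('a \<Rightarrow> 'a) \<Rightarrow> bool" where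
  "end_identification M Mbar E r0 r \<pi> \<longleftrightarrow>
     (let N = boundary_manifold Mbar in
       1 < r0 \<and> E \<subseteq> Points M \<and> openin (Top Mbar) (E \<union> boundary_points Mbar) \<and>
       bij_betw (\<lambda>p. (r p, \<pi> p)) E ({r0<..} \<times> Points N) \<and>
       (\<forall>c\<in>Atlas N. end_chart E r \<pi> c \<in> Atlas M) \<and>
       (\<forall>q\<in>Points N.
          filterlim r at_top (atin_within (Top Mbar) q (Points M)) \<and>
          limitin (Top Mbar) \<pi> q (atin_within (Top Mbar) q (Points M))))"

text \<open>\<open>h\<close> is a metric of Gauss curvature \<open>-1\<close> in the conformal class which \<open>gbar\<close> induces on the
  boundary.\<close>

definition hyperbolic_representative ::
    "('a, 3) manifold \<Rightarrow> ('a, 3) tensor2 \<Rightarrow> ('a, 2) tensor2 \<Rightarrow> bool" where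
  "hyperbolic_representative Mbar gbar h \<longleftrightarrow>
     (let N = boundary_manifold Mbar in
       riemannian_metric N h \<and>
       (\<forall>c\<in>Atlas N. \<forall>p\<in>fst c. gauss (h c) (snd c p) = -1) \<and>
       (\<exists>u. \<forall>c\<in>Atlas Mbar. \<forall>p\<in>fst c \<inter> boundary_points Mbar.
          0 < u p \<and>
          (\<forall>v w. bilin (h (boundary_chart Mbar c) (snd (boundary_chart Mbar c) p)) v w =
                 u p * bilin (gbar c (snd c p)) (lift v 0) (lift w 0))))"

text \<open>A closed surface has in general no global frame, so the decay conditions are imposed with
  respect to local frames near each point; by compactness finitely many suffice.\<close>

definition asymptotic_to_background ::
    "('a, 3) manifold \<Rightarrow> ('a, 3) tensor2 \<Rightarrow> ('a, 2) manifold \<Rightarrow> ('a, 2) tensor2 \<Rightarrow>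
     'a set \<Rightarrow> ('a \<Rightarrow> real) \<Rightarrow> ('a \<Rightarrow> 'a) \<Rightarrow> bool" where
  "asymptotic_to_background M g N h E r \<pi> \<longleftrightarrow>
     (\<exists>C>0. \<forall>c\<in>Atlas N. \<forall>y\<in>snd (end_chart E r \<pi> c) ` fst (end_chart E r \<pi> c). \<forall>v.
        bilin (background (h c) y) v v / C \<le> bilin (g (end_chart E r \<pi> c) y) v v \<and>
        bilin (g (end_chart E r \<pi> c) y) v v \<le> C * bilin (background (h c) y) v v) \<and>
     (\<forall>q\<in>Points N. \<exists>c\<in>Atlas N. q \<in> fst c \<and>
        (\<exists>\<epsilon>1 \<epsilon>2. orthonormal_frame (h c) (snd c ` fst c) \<epsilon>1 \<epsilon>2 \<and>
           (let d = end_chart E r \<pi> c; G = g d in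
             (\<forall>\<delta>>0. \<exists>\<rho>. \<forall>y\<in>snd d ` fst d. \<rho> < y $ 3 \<longrightarrow>
                deviation abs G \<epsilon>1 \<epsilon>2 y \<le> \<delta> * (y $ 3) powr (-3/2)) \<and>
             (\<integral>\<^sup>+p\<in>fst d. ennreal (deviation (\<lambda>t. t\<^sup>2) G \<epsilon>1 \<epsilon>2 (snd d p) * r p)
                \<partial>riemannian_measure M g) < \<infinity> \<and>
             (\<integral>\<^sup>+p\<in>fst d. ennreal
                  (\<bar>scalar G (snd d p) - scalar (background (h c)) (snd d p)\<bar> * r p)
                \<partial>riemannian_measure M g) < \<infinity>)))"

text \<open>The pull-back of \<open>D\<^sup>jV (R\<^sup>i\<^sub>j - (R/3) \<delta>\<^sup>i\<^sub>j) d\<sigma>\<^sub>i\<close> to a level set of the third coordinate \<open>r\<close>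
  is \<open>mass_density dx\<^sup>1 \<and> dx\<^sup>2\<close>: only \<open>i = 3\<close> contributes.\<close>

definition mass_density :: "(real ^ 3 \<Rightarrow> real ^ 3 ^ 3) \<Rightarrow> real ^ 3 \<Rightarrow> real" where
  "mass_density G y =
     (\<Sum>j\<in>UNIV.
        (\<Sum>l\<in>UNIV. matrix_inv (G y) $ j $ l * partial l static_potential y) *
        ((\<Sum>l\<in>UNIV. matrix_inv (G y) $ 3 $ l * ricci G l j y)
           - (if j = 3 then scalar G y / 3 else 0))) * sqrt (det (G y))"

text \<open>The integral of this density over the level set \<open>{r = \<rho>}\<close>, a copy of \<open>N\<close>, written as the
  integral over \<open>N\<close>, with respect to the area measure of \<open>h\<close>, of the chart-independent quotient of
  \<open>mass_density\<close> by the area density \<open>sqrt (det h)\<close>.\<close>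

definition mass_flux ::
    "('a, 3) tensor2 \<Rightarrow> ('a, 2) manifold \<Rightarrow> ('a, 2) tensor2 \<Rightarrow>
     'a set \<Rightarrow> ('a \<Rightarrow> real) \<Rightarrow> ('a \<Rightarrow> 'a) \<Rightarrow> real \<Rightarrow> real" where
  "mass_flux g N h E r \<pi> \<rho> =
     (\<integral>q. (let c = chart_at N q in
            mass_density (g (end_chart E r \<pi> c)) (lift (snd c q) \<rho>) / sqrt (det (h c (snd c q))))
        \<partial>riemannian_measure N h)"

definition has_mass ::
    "('a, 3) manifold \<Rightarrow> ('a, 3) tensor2 \<Rightarrow> ('a, 3) manifold \<Rightarrow> ('a, 3) tensor2 \<Rightarrow> real \<Rightarrow> bool" where
  "has_mass M g Mbar gbar m \<longleftrightarrow>
     (\<exists>h E r0 r \<pi>.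
        hyperbolic_representative Mbar gbar h \<and>
        end_identification M Mbar E r0 r \<pi> \<and>
        asymptotic_to_background M g (boundary_manifold Mbar) h E r \<pi> \<and>
        ((\<lambda>\<rho>. - mass_flux g (boundary_manifold Mbar) h E r \<pi> \<rho>) \<longlongrightarrow> m) at_top)"

end

theory Submission
  imports Defs
begin

text \<open>The example is a geon built from the Kottler metric with negative mass parameter.
  Let \<open>S\<close> be the surface of genus two with a hyperbolic metric \<open>h\<close> invariant under the free involution
  \<open>p \<mapsto> - p\<close>, put \<open>\<Omega> = 1 - s\<^sup>2\<close>, and let \<open>Mbar\<close> be the quotient of \<open>S \<times> [-1, 1]\<close> by
  \<open>(p, s) \<mapsto> (- p, - s)\<close>, whose boundary is one copy of \<open>S\<close>. With \<open>r = 1 / (\<surd>2 \<Omega>)\<close> the metric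
  \<open>\<Omega>\<^sup>-\<^sup>2 (4 ds\<^sup>2 / (1 + \<Omega> - \<Omega>\<^sup>2) + h / 2)\<close> is \<open>dr\<^sup>2 / f + r\<^sup>2 h\<close> with \<open>f = r\<^sup>2 - 1 + \<kappa> / r\<close>
  and \<open>\<kappa> = 1 / (2 \<surd>2)\<close>: the Kottler metric doubled across its horizon \<open>s = 0\<close>. It has scalar
  curvature \<open>-6\<close>, and its mass is \<open>- \<kappa>\<close> times the area of \<open>h\<close>. The metric \<open>h\<close> comes from
  identifying each octant of \<open>S\<close> with a right-angled hyperbolic pentagon.\<close>

section \<open>Smooth maps on open sets\<close>

text \<open>With a hyperbolic cross-section the profile
  \<open>f = r\<^sup>2 - 1 + \<kappa> / r\<close> keeps a simple positive zero for small positive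
  \<open>\<kappa>\<close>, so a horizon survives at negative mass. The value of
  \<open>\<kappa>\<close> puts that zero at \<open>r = 1 / sqrt 2\<close>, which is
  \<open>\<Omega> = 1\<close>. Then \<open>f = (1 + \<Omega> - \<Omega>\<^sup>2) * (1 - \<Omega>) /
  (2 * \<Omega>\<^sup>2)\<close>, and the factor \<open>1 - \<Omega> = s\<^sup>2\<close> cancels in
  \<open>dr\<^sup>2 / f\<close>; this is why the metric is smooth across \<open>s = 0\<close>. The
  quotient turns the two ends of the double into one. The boundary need only be homeomorphic to
  \<open>double_torus\<close>: its smooth structure comes from the hyperbolic charts and not from
  the embedding in space, so a merely continuous matching of octants with pentagons is enough.
  Hyperboloid coordinates are used because hyperbolic isometries become linear Lorentz maps in them.
  The points of the quotient are to be real numbers, so orbits are described by invariants in a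
  Euclidean space, which are then encoded.\<close>

abbreviation "Dat f x \<equiv> frechet_derivative f (at x)"

definition C_inf :: "'a::euclidean_space set => ('a => 'b::real_normed_vector) => bool" where
  "C_inf U f \<longleftrightarrow> (\<forall>k. Ck_on k U f)"

lemma Ck_on_cong:
  assumes "open U" "\<And>x. x \<in> U ==> f x = g x" "Ck_on k U f"
  shows "Ck_on k U g"
  using assms(2,3)
proof (induction k arbitrary: f g)
  case 0
  then show ?case by (simp cong: continuous_on_cong)
next
  case (Suc k)
  have d: "f differentiable at x" "g differentiable at x" if "x \<in> U" for x
  proof -
    show "f differentiable at x" using Suc.prems that by simp
    then obtain D where "(f has_derivative D) (at x)" unfolding differentiable_def by blast
    then have "(g has_derivative D) (at x)"
      using has_derivative_transform_within_open[OF _ assms(1) that] Suc.prems(1) by blast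
    then show "g differentiable at x" unfolding differentiable_def by blast
  qed
  have e: "Dat f x v = Dat g x v" if "x \<in> U" for x v
    using frechet_derivative_transform_within_open[OF d(1)[OF that] assms(1) that] Suc.prems(1)
    by metis
  have "Ck_on k U (%x. Dat g x v)" if "v \<in> Basis" for v
    by (rule Suc.IH[of "%x. Dat f x v"]) (use e Suc.prems that in auto)
  then show ?case using d by simp
qed

text \<open>Derivatives at interior points are unique, so any family \<open>f'\<close> may stand for
  \<open>frechet_derivative\<close>; the rules of calculus can be plugged in directly.\<close>

lemma Ck_on_SucI:
  assumes "open U" "\<And>x. x \<in> U ==> (f has_derivative f' x) (at x)"
    "\<And>v. v \<in> Basis ==> Ck_on k U (%x. f' x v)"
  shows "Ck_on (Suc k) U f"
  unfolding Ck_on.simps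
proof (intro conjI ballI)
  show "f differentiable at x" if "x \<in> U" for x
    using assms(2)[OF that] unfolding differentiable_def by blast
  show "Ck_on k U (%x. Dat f x v)" if "v \<in> Basis" for v
    by (rule Ck_on_cong[OF assms(1) _ assms(3)[OF that]]) (metis assms(2) frechet_derivative_at)
qed

lemma Ck_on_SucD:
  assumes "Ck_on (Suc k) U f"
  shows "\<And>x. x \<in> U ==> (f has_derivative Dat f x) (at x)"
    "\<And>v. v \<in> Basis ==> Ck_on k U (%x. Dat f x v)"
  using assms by (auto simp: frechet_derivative_works[symmetric])

lemma Ck_on_subset: "Ck_on k U f ==> V \<subseteq> U ==> Ck_on k V f"
  by (induction k arbitrary: f) (auto intro: continuous_on_subset)

lemma Ck_on_continuous: "Ck_on k U f ==> continuous_on U f"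
  by (cases k) (auto simp: differentiable_imp_continuous_on differentiable_at_imp_differentiable_on)

lemma Ck_on_lower: "Ck_on (Suc k) U f ==> Ck_on k U f"
proof (induction k arbitrary: f)
  case 0
  then show ?case using Ck_on_continuous by (metis Ck_on.simps(1))
next
  case (Suc k)
  then show ?case by (metis Ck_on.simps(2))
qed

lemma Ck_on_const: "open U ==> Ck_on k U (%x. c)"
proof (induction k arbitrary: c)
  case (Suc k)
  show ?case by (rule Ck_on_SucI[OF Suc.prems has_derivative_const]) (use Suc in auto)
qed simp

lemma Ck_on_linear_comp:
  assumes "open U" "bounded_linear L" "Ck_on k U f"
  shows "Ck_on k U (%x. L (f x))"
  using assms(3)
proof (induction k arbitrary: f)
  case 0
  then show ?case using assms(2) by (simp add: bounded_linear.continuous_on)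
next
  case (Suc k)
  show ?case
    by (rule Ck_on_SucI[OF assms(1)
          bounded_linear.has_derivative[OF assms(2) Ck_on_SucD(1)[OF Suc.prems]]])
      (use Suc Ck_on_SucD(2) in blast)+
qed

lemma Ck_on_linear: "open U ==> bounded_linear L ==> Ck_on k U L"
proof (cases k)
  case (Suc n)
  assume "open U" "bounded_linear L"
  then show ?thesis unfolding Suc
    by (intro Ck_on_SucI[where f'="%x. L"] bounded_linear_imp_has_derivative Ck_on_const)
qed (simp add: linear_continuous_on)

lemma Ck_on_add:
  assumes "open U" "Ck_on k U f" "Ck_on k U g"
  shows "Ck_on k U (%x. f x + g x)"
  using assms(2,3)
proof (induction k arbitrary: f g)
  case 0
  then show ?case by (simp add: continuous_on_add)
next
  case (Suc k)
  show ?case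
    by (rule Ck_on_SucI[OF assms(1)
          has_derivative_add[OF Ck_on_SucD(1)[OF Suc.prems(1)] Ck_on_SucD(1)[OF Suc.prems(2)]]])
      (use Suc Ck_on_SucD(2) in blast)+
qed

lemma Ck_on_bilinear:
  assumes "open U" "bounded_bilinear B" "Ck_on k U f" "Ck_on k U g"
  shows "Ck_on k U (%x. B (f x) (g x))"
  using assms(3,4)
proof (induction k arbitrary: f g)
  case 0
  then show ?case using assms(2) by (simp add: bounded_bilinear.continuous_on)
next
  case (Suc k)
  show ?case
  proof (rule Ck_on_SucI[OF assms(1)
          bounded_bilinear.FDERIV[OF assms(2) Ck_on_SucD(1)[OF Suc.prems(1)] Ck_on_SucD(1)[OF Suc.prems(2)]]])
    fix v :: 'a assume v: "v \<in> Basis"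
    show "Ck_on k U (%x. B (f x) (Dat g x v) + B (Dat f x v) (g x))"
      by (intro Ck_on_add assms Suc.IH Ck_on_SucD(2)[OF Suc.prems(1) v] Ck_on_SucD(2)[OF Suc.prems(2) v]
          Ck_on_lower[OF Suc.prems(1)] Ck_on_lower[OF Suc.prems(2)])
  qed
qed

lemma Ck_on_sum:
  assumes "open U" "\<And>i. i \<in> I ==> Ck_on k U (f i)"
  shows "Ck_on k U (%x. \<Sum>i\<in>I. f i x)"
proof (cases "finite I")
  case True
  then show ?thesis using assms(2)
    by (induction I) (auto simp: Ck_on_const Ck_on_add assms(1))
qed (simp add: Ck_on_const assms(1))

text \<open>The induction generalises over the outer map only: the derivative of the composite
  contains derivatives of \<open>g\<close>, composed with the same \<open>f\<close>.\<close>

lemma Ck_on_compose: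
  fixes f :: "'a::euclidean_space => 'b::euclidean_space" and g :: "'b => 'c::real_normed_vector"
  assumes "open U" "open V" "f ` U \<subseteq> V" "Ck_on k U f" "Ck_on k V g"
  shows "Ck_on k U (%x. g (f x))"
  using assms(4,5)
proof (induction k arbitrary: g)
  case 0
  then show ?case using assms(3) by (simp add: continuous_on_compose2)
next
  case (Suc k)
  have d: "((%x. g (f x)) has_derivative
      (%v. \<Sum>b\<in>Basis. (Dat f x v \<bullet> b) *\<^sub>R Dat g (f x) b)) (at x)"
    if x: "x \<in> U" for x
  proof -
    have fx: "f x \<in> V" using x assms(3) by auto
    note dg = Ck_on_SucD(1)[OF Suc.prems(2) fx]
    interpret bounded_linear "Dat g (f x)" using dg by (rule has_derivative_bounded_linear)
    \<comment> \<open>Expansion in a basis replaces the operator \<open>Dat g (f x)\<close>, which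
      varies with \<open>x\<close>, by finitely many products of scalars and vectors, to which the
      induction hypothesis and the product rule apply.\<close>
    have "Dat g (f x) w =
        (\<Sum>b\<in>Basis. (w \<bullet> b) *\<^sub>R Dat g (f x) b)" for w
      by (subst euclidean_representation[symmetric, of w]) (simp only: sum scaleR)
    then have "(%v. Dat g (f x) (Dat f x v)) =
        (%v. \<Sum>b\<in>Basis. (Dat f x v \<bullet> b) *\<^sub>R Dat g (f x) b)"
      by blast
    then show ?thesis
      using has_derivative_compose[OF Ck_on_SucD(1)[OF Suc.prems(1) x] dg] by simp
  qed
  show ?case
  proof (rule Ck_on_SucI[OF assms(1) d])
    fix v :: 'a assume v: "v \<in> Basis"
    have 1: "Ck_on k U (%x. Dat f x v \<bullet> b)" for b
      by (rule Ck_on_linear_comp[OF assms(1) bounded_linear_inner_left Ck_on_SucD(2)[OF Suc.prems(1) v]])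
    have 2: "Ck_on k U (%x. Dat g (f x) b)" if "b \<in> Basis" for b
      by (rule Suc.IH[OF Ck_on_lower[OF Suc.prems(1)] Ck_on_SucD(2)[OF Suc.prems(2) that]])
    show "Ck_on k U (%x. \<Sum>b\<in>Basis. (Dat f x v \<bullet> b) *\<^sub>R Dat g (f x) b)"
      by (intro Ck_on_sum Ck_on_bilinear[OF assms(1) bounded_bilinear_scaleR] 1 2 assms(1))
  qed
qed

text \<open>The derivative is a polynomial in \<open>inverse\<close> itself, so each order follows
  from the preceding one; the square root below is treated in the same way.\<close>

lemma Ck_on_inverse: "Ck_on k (- {0}) (inverse :: real => real)"
proof (induction k)
  case 0
  then show ?case by (auto intro!: continuous_intros)
next
  case (Suc k)
  have "((inverse :: real => real) has_derivative (%h. - (inverse x * h * inverse x))) (at x)"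
    if "x \<in> - {0}" for x
    using that by (intro has_derivative_inverse') simp
  moreover have "Ck_on k (- {0}) (%x::real. - (inverse x * v * inverse x))" for v
    by (intro Ck_on_linear_comp[where L=uminus] bounded_linear_minus bounded_linear_ident
        Ck_on_bilinear[OF _ bounded_bilinear_mult] Suc Ck_on_const open_Compl closed_singleton)
  ultimately show ?case
    by (rule Ck_on_SucI[OF open_Compl[OF closed_singleton]]) auto
qed

lemma Ck_on_sqrt: "Ck_on k {0<..} sqrt"
proof (induction k)
  case 0
  then show ?case by (auto intro!: continuous_intros)
next
  case (Suc k)
  have "(sqrt has_derivative (%h. h * (inverse (sqrt x) / 2))) (at x)" if "x \<in> {0<..}" for x
    using DERIV_real_sqrt[of x] that by (simp add: has_field_derivative_def mult.commute[of _ "_ / _"] times_divide_eq_left[symmetric] del: times_divide_eq_left times_divide_eq_right)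
  moreover have "Ck_on k {0<..} (%x. v * (inverse (sqrt x) / 2))" for v
    by (intro Ck_on_bilinear[OF _ bounded_bilinear_mult] Ck_on_const
        Ck_on_linear_comp[where L="%x. x / 2"] bounded_linear_divide
        Ck_on_compose[where g=inverse and f=sqrt, OF _ _ _ Suc Ck_on_inverse]) auto
  ultimately show ?case by (rule Ck_on_SucI[rotated]) auto
qed

lemma C_inf_cong: "open U ==> (\<And>x. x \<in> U ==> f x = g x) ==> C_inf U f ==> C_inf U g"
  unfolding C_inf_def using Ck_on_cong by blast

lemma C_inf_subset: "C_inf U f ==> V \<subseteq> U ==> C_inf V f"
  unfolding C_inf_def using Ck_on_subset by blast

lemma C_inf_continuous: "C_inf U f ==> continuous_on U f"
  unfolding C_inf_def using Ck_on_continuous by blast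

lemma C_inf_differentiable: "C_inf U f ==> x \<in> U ==> f differentiable (at x)"
  unfolding C_inf_def by (metis Ck_on.simps(2))

lemma C_inf_has_derivative: "C_inf U f ==> x \<in> U ==> (f has_derivative Dat f x) (at x)"
  using C_inf_differentiable frechet_derivative_works by blast

lemma C_inf_const: "open U ==> C_inf U (%x. c)"
  by (simp add: C_inf_def Ck_on_const)

lemma C_inf_linear_comp: "open U ==> bounded_linear L ==> C_inf U f ==> C_inf U (%x. L (f x))"
  by (simp add: C_inf_def Ck_on_linear_comp)

lemma C_inf_linear: "open U ==> bounded_linear L ==> C_inf U L"
  by (simp add: C_inf_def Ck_on_linear)

lemma C_inf_add: "open U ==> C_inf U f ==> C_inf U g ==> C_inf U (%x. f x + g x)"
  by (simp add: C_inf_def Ck_on_add)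

lemma C_inf_bilinear:
  "open U ==> bounded_bilinear B ==> C_inf U f ==> C_inf U g ==> C_inf U (%x. B (f x) (g x))"
  by (simp add: C_inf_def Ck_on_bilinear)

lemma C_inf_minus: "open U ==> C_inf U f ==> C_inf U (%x. - f x)"
  by (rule C_inf_linear_comp) (auto intro: bounded_linear_minus bounded_linear_ident)

lemma C_inf_diff: "open U ==> C_inf U f ==> C_inf U g ==> C_inf U (%x. f x - g x)"
  using C_inf_add[of U f "%x. - g x"] C_inf_minus[of U g] by simp

lemma C_inf_mult:
  fixes f g :: "'a::euclidean_space => real"
  shows "open U ==> C_inf U f ==> C_inf U g ==> C_inf U (%x. f x * g x)"
  by (rule C_inf_bilinear[OF _ bounded_bilinear_mult])

lemma C_inf_scaleR: "open U ==> C_inf U f ==> C_inf U g ==> C_inf U (%x. f x *\<^sub>R g x)"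
  by (rule C_inf_bilinear[OF _ bounded_bilinear_scaleR])

lemma C_inf_sum: "open U ==> (\<And>i. i \<in> I ==> C_inf U (f i)) ==> C_inf U (%x. \<Sum>i\<in>I. f i x)"
  by (simp add: C_inf_def Ck_on_sum)

lemma C_inf_compose:
  fixes f :: "'a::euclidean_space => 'b::euclidean_space"
  shows "open U ==> open V ==> f ` U \<subseteq> V ==> C_inf U f ==> C_inf V g ==> C_inf U (%x. g (f x))"
  unfolding C_inf_def using Ck_on_compose by blast

lemma C_inf_inverse:
  fixes f :: "'a::euclidean_space => real"
  shows "open U ==> C_inf U f ==> (\<And>x. x \<in> U ==> f x ~= 0) ==> C_inf U (%x. inverse (f x))"
  by (rule C_inf_compose[where V="-{0}"]) (auto simp: C_inf_def Ck_on_inverse open_delete)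

lemma C_inf_divide:
  fixes f :: "'a::euclidean_space => real"
  shows "open U ==> C_inf U f ==> C_inf U g ==> (\<And>x. x \<in> U ==> g x ~= 0) ==> C_inf U (%x. f x / g x)"
  unfolding divide_inverse by (intro C_inf_mult C_inf_inverse)

lemma C_inf_sqrt:
  fixes f :: "'a::euclidean_space => real"
  shows "open U ==> C_inf U f ==> (\<And>x. x \<in> U ==> f x > 0) ==> C_inf U (%x. sqrt (f x))"
  by (rule C_inf_compose[where V="{0<..}"]) (auto simp: C_inf_def Ck_on_sqrt)

lemma C_inf_power:
  fixes f :: "'a::euclidean_space => real"
  shows "open U ==> C_inf U f ==> C_inf U (%x. f x ^ n)"
  by (induction n) (auto intro: C_inf_const C_inf_mult)

lemma C_inf_id: "open U ==> C_inf U (%x. x)"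
  by (rule C_inf_linear[OF _ bounded_linear_ident])

lemma C_inf_nth: "open U ==> C_inf U f ==> C_inf U (%x. f x $ i)"
  by (rule C_inf_linear_comp[OF _ bounded_linear_vec_nth])

lemma vec_eq_sum_axis: "v = (\<Sum>i\<in>UNIV. (%c. \<chi> j. if j = i then c else 0) (v $ i))"
  by (simp add: vec_eq_iff if_distrib sum.If_cases cong: if_cong)

lemma C_inf_vec:
  fixes f :: "'a::euclidean_space => 'b::euclidean_space ^ 'n::finite"
  assumes "open U" "\<And>i. C_inf U (%x. f x $ i)"
  shows "C_inf U f"
proof -
  have L: "bounded_linear (%c::'b. (\<chi> j::'n. if j = i then c else 0))" for i
    by (intro linear_conv_bounded_linear[THEN iffD1] linearI) (auto simp: vec_eq_iff)
  have "C_inf U (%x. \<Sum>i\<in>UNIV. (%c. \<chi> j. if j = i then c else 0) (f x $ i))"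
    by (intro C_inf_sum assms C_inf_linear_comp[OF _ L])
  then show ?thesis by (subst (asm) vec_eq_sum_axis[symmetric])
qed

text \<open>\<open>Ck_on\<close> controls the basis directions only; linearity of the derivative
  supplies an arbitrary direction \<open>v\<close>.\<close>

lemma C_inf_frechet:
  assumes "open U" "C_inf U f"
  shows "C_inf U (%x. Dat f x v)"
proof -
  have b: "C_inf U (%x. Dat f x b)" if "b \<in> Basis" for b
    unfolding C_inf_def
  proof
    fix k
    have "Ck_on (Suc k) U f" using assms(2) unfolding C_inf_def by blast
    then show "Ck_on k U (%x. Dat f x b)" using Ck_on_SucD(2) that by blast
  qed
  have "Dat f x v = (\<Sum>b\<in>Basis. (v \<bullet> b) *\<^sub>R Dat f x b)"
    if "x \<in> U" for x
  proof -
    interpret bounded_linear "Dat f x"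
      using C_inf_has_derivative[OF assms(2) that] by (rule has_derivative_bounded_linear)
    show ?thesis by (subst euclidean_representation[symmetric, of v]) (simp only: sum scaleR)
  qed
  moreover have "C_inf U (%x. \<Sum>b\<in>Basis. (v \<bullet> b) *\<^sub>R Dat f x b)"
    by (intro C_inf_sum C_inf_scaleR C_inf_const assms b)
  ultimately show ?thesis by (metis (no_types, lifting) C_inf_cong assms(1))
qed

text \<open>The second difference of \<open>f\<close> is evaluated by the mean value theorem in both orders.\<close>

lemma mixed_derivatives_point:
  fixes f :: "'a::euclidean_space => real"
  assumes f: "C_inf (ball x e) f" and h: "0 < h" "h * norm u + h * norm v < e"
  obtains y where "dist x y \<le> h * norm u + h * norm v"
    "f (x + h *\<^sub>R u + h *\<^sub>R v) - f (x + h *\<^sub>R u) - f (x + h *\<^sub>R v) + f x =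
      h * h * Dat (%z. frechet_derivative f (at z) u) y v"
proof -
  define fu where "fu z = Dat f z u" for z
  have fu: "C_inf (ball x e) fu" unfolding fu_def[abs_def] by (rule C_inf_frechet) (auto intro: f)
  have n: "norm (a *\<^sub>R u + b *\<^sub>R v) \<le> h * norm u + h * norm v" if "0 \<le> a" "a \<le> h" "0 \<le> b" "b \<le> h" for a b
    by (rule order_trans[OF norm_triangle_ineq]) (use that in "auto intro!: add_mono mult_right_mono")
  have B: "x + a *\<^sub>R u + b *\<^sub>R v \<in> ball x e" if "0 \<le> a" "a \<le> h" "0 \<le> b" "b \<le> h" for a b
    using n[OF that] h(2) by (simp add: dist_norm add.assoc norm_minus_commute)
      (metis add_uminus_conv_diff minus_add_distrib norm_minus_cancel order_le_less_trans add.commute)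
  have d1: "((%a. f (x + a *\<^sub>R u + b *\<^sub>R v)) has_real_derivative fu (x + a *\<^sub>R u + b *\<^sub>R v)) (at a)"
    if "0 \<le> a" "a \<le> h" "0 \<le> b" "b \<le> h" for a b
  proof -
    note d = C_inf_has_derivative[OF f B[OF that]]
    then interpret bounded_linear "Dat f (x + a *\<^sub>R u + b *\<^sub>R v)"
      by (rule has_derivative_bounded_linear)
    have "((%a. f (x + a *\<^sub>R u + b *\<^sub>R v)) has_derivative
        (%t. Dat f (x + a *\<^sub>R u + b *\<^sub>R v) (t *\<^sub>R u))) (at a)"
      by (rule has_derivative_compose[where f="%a. x + a *\<^sub>R u + b *\<^sub>R v", OF _ d])
        (auto intro!: derivative_eq_intros)
    then show ?thesis by (simp add: has_field_derivative_def fu_def scaleR mult_commute_abs)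
  qed
  have d2: "((%b. fu (x + a *\<^sub>R u + b *\<^sub>R v)) has_real_derivative
      Dat fu (x + a *\<^sub>R u + b *\<^sub>R v) v) (at b)"
    if "0 \<le> a" "a \<le> h" "0 \<le> b" "b \<le> h" for a b
  proof -
    note d = C_inf_has_derivative[OF fu B[OF that]]
    then interpret bounded_linear "Dat fu (x + a *\<^sub>R u + b *\<^sub>R v)"
      by (rule has_derivative_bounded_linear)
    have "((%b. fu (x + a *\<^sub>R u + b *\<^sub>R v)) has_derivative
        (%t. Dat fu (x + a *\<^sub>R u + b *\<^sub>R v) (t *\<^sub>R v))) (at b)"
      by (rule has_derivative_compose[where f="%b. x + a *\<^sub>R u + b *\<^sub>R v", OF _ d])
        (auto intro!: derivative_eq_intros)
    then show ?thesis by (simp add: has_field_derivative_def scaleR mult_commute_abs)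
  qed
  have "\<exists>a. a > 0 \<and> a < h \<and> (f (x + h *\<^sub>R u + h *\<^sub>R v) - f (x + h *\<^sub>R u + 0 *\<^sub>R v)) -
      (f (x + 0 *\<^sub>R u + h *\<^sub>R v) - f (x + 0 *\<^sub>R u + 0 *\<^sub>R v)) =
      (h - 0) * (fu (x + a *\<^sub>R u + h *\<^sub>R v) - fu (x + a *\<^sub>R u + 0 *\<^sub>R v))"
  proof (rule MVT2[OF h(1)])
    fix a :: real assume "0 \<le> a" "a \<le> h"
    then show "((%a. f (x + a *\<^sub>R u + h *\<^sub>R v) - f (x + a *\<^sub>R u + 0 *\<^sub>R v)) has_real_derivative
      fu (x + a *\<^sub>R u + h *\<^sub>R v) - fu (x + a *\<^sub>R u + 0 *\<^sub>R v)) (at a)"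
      using h(1) by (intro DERIV_diff d1) auto
  qed
  then obtain a where a: "a > 0" "a < h"
    "f (x + h *\<^sub>R u + h *\<^sub>R v) - f (x + h *\<^sub>R u) - (f (x + h *\<^sub>R v) - f x) =
      h * (fu (x + a *\<^sub>R u + h *\<^sub>R v) - fu (x + a *\<^sub>R u + 0 *\<^sub>R v))" by auto
  have "\<exists>b. b > 0 \<and> b < h \<and> fu (x + a *\<^sub>R u + h *\<^sub>R v) - fu (x + a *\<^sub>R u + 0 *\<^sub>R v) =
      (h - 0) * Dat fu (x + a *\<^sub>R u + b *\<^sub>R v) v"
    by (rule MVT2[OF h(1)]) (use a in "auto intro!: d2")
  then obtain b where b: "b > 0" "b < h" "fu (x + a *\<^sub>R u + h *\<^sub>R v) - fu (x + a *\<^sub>R u + 0 *\<^sub>R v) =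
      h * Dat fu (x + a *\<^sub>R u + b *\<^sub>R v) v" by auto
  show thesis
  proof (rule that[of "x + a *\<^sub>R u + b *\<^sub>R v"])
    show "dist x (x + a *\<^sub>R u + b *\<^sub>R v) \<le> h * norm u + h * norm v"
      using n[of a b] a b by (simp add: dist_norm norm_minus_commute add.assoc)
        (metis add_uminus_conv_diff minus_add_distrib norm_minus_cancel add.commute)
    show "f (x + h *\<^sub>R u + h *\<^sub>R v) - f (x + h *\<^sub>R u) - f (x + h *\<^sub>R v) + f x =
      h * h * Dat (%z. frechet_derivative f (at z) u) (x + a *\<^sub>R u + b *\<^sub>R v) v"
      using a b unfolding fu_def[abs_def] by (simp add: algebra_simps)
  qed
qed

text \<open>One and the same second difference equals \<open>h * h * P y\<close> and
  \<open>h * h * Q z\<close> for points \<open>y\<close> and \<open>z\<close> close to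
  \<open>x\<close>; continuity of both mixed derivatives then forbids a gap between
  \<open>P x\<close> and \<open>Q x\<close>.\<close>

lemma mixed_derivatives_commute:
  fixes f :: "'a::euclidean_space => real"
  assumes "open U" "C_inf U f" "x \<in> U"
  shows "Dat (%y. frechet_derivative f (at y) u) x v =
    Dat (%y. frechet_derivative f (at y) v) x u"
proof -
  define P where "P y = Dat (%y. frechet_derivative f (at y) u) y v" for y
  define Q where "Q y = Dat (%y. frechet_derivative f (at y) v) y u" for y
  obtain e where e: "e > 0" "ball x e \<subseteq> U" using assms open_contains_ball by blast
  have f: "C_inf (ball x e) f" using assms(2) e(2) by (rule C_inf_subset)
  have "C_inf U P" "C_inf U Q" unfolding P_def[abs_def] Q_def[abs_def] by (intro C_inf_frechet assms)+
  then have cont: "isCont P x" "isCont Q x"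
    using C_inf_continuous assms(1,3) continuous_on_eq_continuous_at by blast+
  have "P x = Q x"
  proof (rule ccontr)
    assume ne: "P x ~= Q x"
    define d where "d = \<bar>P x - Q x\<bar> / 2"
    have "d > 0" using ne by (simp add: d_def)
    then obtain r1 r2 where r: "r1 > 0" "\<And>y. dist y x < r1 ==> dist (P y) (P x) < d"
      "r2 > 0" "\<And>y. dist y x < r2 ==> dist (Q y) (Q x) < d"
      using cont unfolding continuous_at_eps_delta dist_real_def
      by (metis dist_commute dist_real_def)
    define m where "m = min e (min r1 r2)"
    \<comment> \<open>The summand \<open>1\<close> keeps the denominator positive when
      \<open>u\<close> and \<open>v\<close> both vanish.\<close>
    define h where "h = m / (2 * (norm u + norm v + 1))"
    have "m > 0" using e r by (simp add: m_def)
    have pos: "norm u + norm v + 1 > 0" by (smt (verit) norm_ge_zero)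
    have h: "h > 0" using \<open>m > 0\<close> pos by (simp add: h_def)
    have "h * (norm u + norm v) \<le> h * (norm u + norm v + 1)" using h by simp
    also have "\<dots> = m / 2" using pos unfolding h_def
      by (metis less_irrefl nonzero_mult_divide_mult_cancel_right times_divide_eq_left)
    also have "\<dots> < m" using \<open>m > 0\<close> by simp
    finally have hm: "h * norm u + h * norm v < m" by (simp add: algebra_simps)
    obtain y where y: "dist x y \<le> h * norm u + h * norm v"
      "f (x + h *\<^sub>R u + h *\<^sub>R v) - f (x + h *\<^sub>R u) - f (x + h *\<^sub>R v) + f x = h * h * P y"
      using mixed_derivatives_point[OF f h, of u v] hm unfolding P_def m_def by auto
    obtain z where z: "dist x z \<le> h * norm v + h * norm u"
      "f (x + h *\<^sub>R v + h *\<^sub>R u) - f (x + h *\<^sub>R v) - f (x + h *\<^sub>R u) + f x = h * h * Q z"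
      using mixed_derivatives_point[OF f h, of v u] hm unfolding Q_def m_def by auto
    have "h * h * P y = h * h * Q z" using y(2) z(2) by (simp add: algebra_simps)
    then have "P y = Q z" using h by simp
    moreover have "dist (P y) (P x) < d" "dist (Q z) (Q x) < d"
      using r(2)[of y] r(4)[of z] y(1) z(1) hm by (auto simp: m_def dist_commute)
    ultimately show False unfolding d_def dist_real_def by (auto simp: abs_if split: if_splits)
  qed
  then show ?thesis by (simp add: P_def Q_def)
qed

section \<open>Smooth maps on arbitrary sets\<close>

lemma smooth_on_def': "smooth_on S f \<longleftrightarrow>
  (\<forall>x\<in>S. \<exists>U F. open U \<and> x \<in> U \<and> C_inf U F \<and> (\<forall>y\<in>S \<inter> U. F y = f y))"
  unfolding smooth_on_def C_inf_def ..

lemma smooth_on_C_inf: "open U ==> C_inf U f ==> S \<subseteq> U ==> smooth_on S f"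
  unfolding smooth_on_def' by blast

text \<open>On an open set a local extension coincides with \<open>f\<close> near each point and has
  the same derivatives there. Hence each directional derivative of \<open>f\<close> is again
  \<open>smooth_on\<close>, which drives the induction over the order.\<close>

lemma smooth_on_openD:
  assumes "open S" "smooth_on S f"
  shows "C_inf S f"
proof -
  have "Ck_on k S f" for k
    using assms(2)
  proof (induction k arbitrary: f)
    case 0
    have "isCont f x" if x: "x \<in> S" for x
    proof -
      obtain U F where U: "open U" "x \<in> U" "C_inf U F" "\<forall>y\<in>S \<inter> U. F y = f y"
        using 0 x unfolding smooth_on_def' by blast
      have "continuous_on (S \<inter> U) f"
        using C_inf_continuous[OF C_inf_subset[OF U(3), of "S \<inter> U"]] U(4)
        by (metis Int_lower2 continuous_on_cong)
      then show ?thesis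
        using continuous_on_eq_continuous_at[of "S \<inter> U"] U assms(1) x by blast
    qed
    then show ?case unfolding Ck_on.simps by (intro continuous_at_imp_continuous_on ballI)
  next
    case (Suc k)
    have loc: "\<exists>U F. open U \<and> x \<in> U \<and> U \<subseteq> S \<and> C_inf U F \<and> (\<forall>y\<in>U. F y = f y)" if x: "x \<in> S" for x
    proof -
      obtain U F where U: "open U" "x \<in> U" "C_inf U F" "\<forall>y\<in>S \<inter> U. F y = f y"
        using Suc.prems x unfolding smooth_on_def' by blast
      show ?thesis
        by (rule exI[of _ "S \<inter> U"], rule exI[of _ F]) (use U assms(1) x C_inf_subset[OF U(3), of "S \<inter> U"] in auto)
    qed
    have D: "f differentiable at x" if x: "x \<in> S" for x
    proof -
      obtain U F where U: "open U" "x \<in> U" "C_inf U F" "\<forall>y\<in>U. F y = f y" using loc[OF x] by blast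
      then have "(f has_derivative Dat F x) (at x)"
        using has_derivative_transform_within_open[OF C_inf_has_derivative[OF U(3,2)] U(1,2)] by blast
      then show ?thesis unfolding differentiable_def by blast
    qed
    have "smooth_on S (%x. Dat f x v)" for v
      unfolding smooth_on_def'
    proof
      fix x assume "x \<in> S"
      from loc[OF this] obtain U F where U: "open U" "x \<in> U" "U \<subseteq> S" "C_inf U F" "\<forall>y\<in>U. F y = f y" by blast
      have "Dat F y v = Dat f y v" if "y \<in> U" for y
        using frechet_derivative_transform_within_open[OF C_inf_differentiable[OF U(4) that] U(1) that] U(5)
        by metis
      then show "\<exists>U F. open U \<and> x \<in> U \<and> C_inf U F \<and> (\<forall>y\<in>S \<inter> U. F y = Dat f y v)"
        using U C_inf_frechet[OF U(1,4), of v] by blast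
    qed
    then show ?case using Suc.IH D by simp
  qed
  then show ?thesis by (simp add: C_inf_def)
qed

lemma smooth_on_subset: "smooth_on S f ==> T \<subseteq> S ==> smooth_on T f"
  unfolding smooth_on_def'
proof
  fix x assume "\<forall>x\<in>S. \<exists>U F. open U \<and> x \<in> U \<and> C_inf U F \<and> (\<forall>y\<in>S \<inter> U. F y = f y)" "T \<subseteq> S" "x \<in> T"
  then obtain U F where "open U" "x \<in> U" "C_inf U F" "\<forall>y\<in>S \<inter> U. F y = f y" by blast
  then show "\<exists>U F. open U \<and> x \<in> U \<and> C_inf U F \<and> (\<forall>y\<in>T \<inter> U. F y = f y)"
    using \<open>T \<subseteq> S\<close> by (intro exI[of _ U] exI[of _ F]) auto
qed

lemma smooth_on_cong: "(\<And>x. x \<in> S ==> f x = g x) ==> smooth_on S f ==> smooth_on S g"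
  unfolding smooth_on_def' by (metis IntD1)

lemma smooth_on_continuous:
  assumes "smooth_on S f"
  shows "continuous_on S f"
  unfolding continuous_on_eq_continuous_within
proof
  fix x assume x: "x \<in> S"
  obtain U F where U: "open U" "x \<in> U" "C_inf U F" "\<forall>y\<in>S \<inter> U. F y = f y"
    using assms x unfolding smooth_on_def' by blast
  have "continuous_on (S \<inter> U) f"
    using C_inf_continuous[OF C_inf_subset[OF U(3), of "S \<inter> U"]] U(4)
    by (metis Int_lower2 continuous_on_cong)
  then have "continuous (at x within S \<inter> U) f"
    using x U by (simp add: continuous_on_eq_continuous_within)
  then show "continuous (at x within S) f"
    using at_within_nhd[OF U(2,1), of "S \<inter> U" S] by (simp add: continuous_within Int_assoc)
qed

lemma smooth_on_local:
  assumes "\<And>x. x \<in> S ==> \<exists>U. open U \<and> x \<in> U \<and> smooth_on (S \<inter> U) f"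
  shows "smooth_on S f"
  unfolding smooth_on_def'
proof
  fix x assume x: "x \<in> S"
  then obtain U where U: "open U" "x \<in> U" "smooth_on (S \<inter> U) f" using assms by blast
  then obtain V F where V: "open V" "x \<in> V" "C_inf V F" "\<forall>y\<in>S \<inter> U \<inter> V. F y = f y"
    using x unfolding smooth_on_def' by blast
  show "\<exists>U F. open U \<and> x \<in> U \<and> C_inf U F \<and> (\<forall>y\<in>S \<inter> U. F y = f y)"
    by (rule exI[of _ "U \<inter> V"], rule exI[of _ F]) (use U V C_inf_subset[OF V(3), of "U \<inter> V"] in auto)
qed

lemma smooth_on_compose:
  fixes f :: "'a::euclidean_space => 'b::euclidean_space"
  assumes "smooth_on S f" "smooth_on T g" "f ` S \<subseteq> T"
  shows "smooth_on S (%x. g (f x))"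
  unfolding smooth_on_def'
proof
  fix x assume x: "x \<in> S"
  obtain U F where U: "open U" "x \<in> U" "C_inf U F" "\<forall>y\<in>S \<inter> U. F y = f y"
    using assms(1) x unfolding smooth_on_def' by blast
  obtain V G where V: "open V" "f x \<in> V" "C_inf V G" "\<forall>y\<in>T \<inter> V. G y = g y"
    using assms(2,3) x unfolding smooth_on_def' by blast
  define W where "W = U \<inter> F -` V"
  have W: "open W" unfolding W_def
    using C_inf_continuous[OF U(3)] U(1) V(1) by (rule continuous_open_preimage)
  have "C_inf W (%x. G (F x))"
    by (rule C_inf_compose[OF W V(1) _ C_inf_subset[OF U(3)] V(3)]) (auto simp: W_def)
  moreover have "x \<in> W" using x U V by (auto simp: W_def)
  moreover have "\<forall>y\<in>S \<inter> W. G (F y) = g (f y)"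
    using U(4) V(4) assms(3) by (auto simp: W_def)
  ultimately show "\<exists>U F. open U \<and> x \<in> U \<and> C_inf U F \<and> (\<forall>y\<in>S \<inter> U. F y = g (f y))"
    using W by blast
qed

text \<open>Closure of \<open>C_inf\<close> under \<open>B\<close> is assumed in place of
  bilinearity, so that the lemma covers \<open>scaleR\<close> as well as \<open>lift\<close>, which
  is linear only in the pair of its arguments.\<close>

lemma smooth_on_combine:
  fixes f :: "'a::euclidean_space => 'b::euclidean_space" and g :: "'a => 'c::euclidean_space"
  assumes "smooth_on S f" "smooth_on S g"
    and B: "\<And>(U::'a set) F G. open U ==> C_inf U F ==> C_inf U G ==> C_inf U (%x. B (F x) (G x))"
  shows "smooth_on S (%x. B (f x) (g x))"
  unfolding smooth_on_def'
proof
  fix x assume x: "x \<in> S"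
  obtain U F where U: "open U" "x \<in> U" "C_inf U F" "\<forall>y\<in>S \<inter> U. F y = f y"
    using assms(1) x unfolding smooth_on_def' by blast
  obtain V G where V: "open V" "x \<in> V" "C_inf V G" "\<forall>y\<in>S \<inter> V. G y = g y"
    using assms(2) x unfolding smooth_on_def' by blast
  have "C_inf (U \<inter> V) (%x. B (F x) (G x))"
    by (rule B) (use U V C_inf_subset[OF U(3), of "U \<inter> V"] C_inf_subset[OF V(3), of "U \<inter> V"] in auto)
  then show "\<exists>U F. open U \<and> x \<in> U \<and> C_inf U F \<and> (\<forall>y\<in>S \<inter> U. F y = B (f y) (g y))"
    using U V by (intro exI[of _ "U \<inter> V"] exI[of _ "%x. B (F x) (G x)"]) auto
qed

lemma smooth_on_has_derivative:
  assumes "smooth_on S f" "x \<in> S"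
  shows "\<exists>D. (f has_derivative D) (at x within S)"
proof -
  obtain U F where U: "open U" "x \<in> U" "C_inf U F" "\<forall>y\<in>S \<inter> U. F y = f y"
    using assms unfolding smooth_on_def' by blast
  have "(F has_derivative Dat F x) (at x within S \<inter> U)"
    using C_inf_has_derivative[OF U(3,2)] by (rule has_derivative_at_withinI)
  then have "(f has_derivative Dat F x) (at x within S \<inter> U)"
    by (rule has_derivative_transform[rotated 2]) (use U assms in auto)
  then show ?thesis using at_within_nhd[OF U(2,1), of "S \<inter> U" S] by (auto simp: Int_assoc)
qed

section \<open>Charts and maximal atlases\<close>

lemma is_chart_inj: "is_chart H X c ==> inj_on (snd c) (fst c)"
  unfolding is_chart_def
  by (metis homeomorphic_imp_injective_map openin_subset topspace_subtopology_subset)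

lemma is_chart_subset: "is_chart H X c ==> fst c \<subseteq> topspace X"
  unfolding is_chart_def using openin_subset by blast

lemma is_chart_image_subset: "is_chart H X c ==> snd c ` fst c \<subseteq> H"
  unfolding is_chart_def by (metis openin_subset topspace_euclidean_subtopology)

lemma is_chart_image_openin:
  assumes "is_chart H X c" "openin X V" "V \<subseteq> fst c"
  shows "openin (top_of_set H) (snd c ` V)"
proof -
  have "openin (subtopology X (fst c)) V"
    using assms by (metis inf.absorb_iff2 openin_subtopology_Int2 inf_commute)
  then have "openin (top_of_set (snd c ` fst c)) (snd c ` V)"
    using assms(1) unfolding is_chart_def
    by (meson homeomorphic_imp_open_map open_map_def)
  then show ?thesis using assms(1) unfolding is_chart_def by (meson openin_trans)
qed

lemma is_chart_inv: "is_chart H X c ==> p \<in> fst c ==> inv_into (fst c) (snd c) (snd c p) = p"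
  by (simp add: is_chart_inj)

lemma transition_apply: "is_chart H X c ==> p \<in> fst c ==> transition c d (snd c p) = snd d p"
  by (simp add: transition_def is_chart_inv)

lemma is_chart_restrict:
  assumes "is_chart H X c" "openin X V"
  shows "is_chart H X (fst c \<inter> V, snd c)"
proof -
  have "homeomorphic_map (subtopology (subtopology X (fst c)) (fst c \<inter> V))
      (subtopology (top_of_set (snd c ` fst c)) (snd c ` (fst c \<inter> V))) (snd c)"
  proof (rule homeomorphic_map_subtopologies)
    show "homeomorphic_map (subtopology X (fst c)) (top_of_set (snd c ` fst c)) (snd c)"
      using assms unfolding is_chart_def by blast
    show "snd c ` (topspace (subtopology X (fst c)) \<inter> (fst c \<inter> V)) =
        topspace (top_of_set (snd c ` fst c)) \<inter> snd c ` (fst c \<inter> V)"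
      using is_chart_subset[OF assms(1)] by auto
  qed
  moreover have "subtopology (subtopology X (fst c)) (fst c \<inter> V) = subtopology X (fst c \<inter> V)"
    by (simp add: subtopology_subtopology)
  moreover have "subtopology (top_of_set (snd c ` fst c)) (snd c ` (fst c \<inter> V)) = top_of_set (snd c ` (fst c \<inter> V))"
    by (simp add: subtopology_subtopology Int_absorb1 image_mono)
  moreover have "openin (top_of_set H) (snd c ` (fst c \<inter> V))"
    by (rule is_chart_image_openin[OF assms(1)]) (use assms in "auto simp: is_chart_def")
  moreover have "openin X (fst c \<inter> V)" using assms by (auto simp: is_chart_def)
  ultimately show ?thesis unfolding is_chart_def by simp
qed

lemma is_chart_open_subtopology:
  assumes "openin X S"
  shows "is_chart H (subtopology X S) c \<longleftrightarrow> is_chart H X c \<and> fst c \<subseteq> S"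
proof (cases "fst c \<subseteq> S")
  case True
  then have "subtopology (subtopology X S) (fst c) = subtopology X (fst c)"
    by (simp add: subtopology_subtopology Int_absorb1)
  moreover have "openin (subtopology X S) (fst c) \<longleftrightarrow> openin X (fst c)"
    using assms True openin_open_subtopology by blast
  ultimately show ?thesis using True unfolding is_chart_def by simp
next
  case False
  then show ?thesis using is_chart_subset[of H "subtopology X S" c] by auto
qed

abbreviation tder where
  "tder c d p D \<equiv> (transition c d has_derivative D) (at (snd c p) within snd c ` (fst c \<inter> fst d))"

definition smooth_transition :: "('a, 'n::finite) chart => ('a, 'n) chart => bool" where
  "smooth_transition c d \<longleftrightarrow> smooth_on (snd c ` (fst c \<inter> fst d)) (transition c d)"

lemma compatible_iff: "compatible c d \<longleftrightarrow> smooth_transition c d \<and> smooth_transition d c"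
  by (simp add: compatible_def smooth_transition_def Int_commute)

lemma compatible_sym: "compatible c d \<longleftrightarrow> compatible d c"
  by (auto simp: compatible_iff)

lemma smooth_transition_local:
  assumes c: "is_chart H X c"
    and loc: "\<And>p. p \<in> fst c \<inter> fst d ==>
      \<exists>W. openin X W \<and> p \<in> W \<and> W \<subseteq> fst c \<inter> fst d \<and> smooth_on (snd c ` W) (transition c d)"
  shows "smooth_transition c d"
  unfolding smooth_transition_def
proof (rule smooth_on_local)
  fix x assume "x \<in> snd c ` (fst c \<inter> fst d)"
  then obtain p where p: "p \<in> fst c \<inter> fst d" "x = snd c p" by blast
  obtain W where W: "openin X W" "p \<in> W" "W \<subseteq> fst c \<inter> fst d" "smooth_on (snd c ` W) (transition c d)"
    using loc[OF p(1)] by blast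
  have "openin (top_of_set H) (snd c ` W)"
    by (rule is_chart_image_openin[OF c W(1)]) (use W in auto)
  then obtain U where U: "open U" "snd c ` W = H \<inter> U" by (meson openin_open)
  have "snd c ` (fst c \<inter> fst d) \<inter> U \<subseteq> snd c ` W" using U is_chart_image_subset[OF c] by auto
  then show "\<exists>U. open U \<and> x \<in> U \<and> smooth_on (snd c ` (fst c \<inter> fst d) \<inter> U) (transition c d)"
    using U W p by (intro exI[of _ U]) (auto intro: smooth_on_subset)
qed

text \<open>Smoothness is local, so the intermediate chart may change from point to point; near
  \<open>p\<close> the transition factors as \<open>transition e d\<close> after
  \<open>transition c e\<close>.\<close>

lemma smooth_transition_via:
  assumes c: "is_chart H X c" and d: "openin X (fst d)"
    and loc: "\<And>p. p \<in> fst c \<inter> fst d ==>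
      \<exists>e. is_chart H X e \<and> p \<in> fst e \<and> smooth_transition c e \<and> smooth_transition e d"
  shows "smooth_transition c d"
proof (rule smooth_transition_local[OF c])
  fix p assume p: "p \<in> fst c \<inter> fst d"
  then obtain e where e: "is_chart H X e" "p \<in> fst e" "smooth_transition c e" "smooth_transition e d"
    using loc by blast
  define W where "W = fst c \<inter> fst d \<inter> fst e"
  have "openin X W" using c d e unfolding W_def is_chart_def by auto
  moreover have "smooth_on (snd c ` W) (transition c d)"
  proof (rule smooth_on_cong)
    show "smooth_on (snd c ` W) (%x. transition e d (transition c e x))"
    proof (rule smooth_on_compose[where T="snd e ` W" and f="transition c e" and g="transition e d"])
      show "smooth_on (snd c ` W) (transition c e)"
        by (rule smooth_on_subset[OF e(3)[unfolded smooth_transition_def]]) (auto simp: W_def)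
      show "smooth_on (snd e ` W) (transition e d)"
        by (rule smooth_on_subset[OF e(4)[unfolded smooth_transition_def]]) (auto simp: W_def)
      show "transition c e ` snd c ` W \<subseteq> snd e ` W"
        using transition_apply[OF c, of _ e] by (auto simp: W_def)
    qed
    show "transition e d (transition c e x) = transition c d x" if "x \<in> snd c ` W" for x
      using that transition_apply[OF c, of _ e] transition_apply[OF c, of _ d]
        transition_apply[OF e(1), of _ d] by (auto simp: W_def)
  qed
  ultimately show "\<exists>W. openin X W \<and> p \<in> W \<and> W \<subseteq> fst c \<inter> fst d \<and> smooth_on (snd c ` W) (transition c d)"
    using p e by (intro exI[of _ W]) (auto simp: W_def)
qed

lemma compatible_via:
  assumes "is_chart H X c" "is_chart H X d"
    and "\<And>p. p \<in> fst c \<inter> fst d ==> \<exists>e. is_chart H X e \<and> p \<in> fst e \<and> compatible c e \<and> compatible e d"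
  shows "compatible c d"
  unfolding compatible_iff
proof
  show "smooth_transition c d"
  proof (rule smooth_transition_via[OF assms(1)])
    fix p assume "p \<in> fst c \<inter> fst d"
    then obtain e where "is_chart H X e \<and> p \<in> fst e \<and> compatible c e \<and> compatible e d"
      using assms(3)[of p] by auto
    then show "\<exists>e. is_chart H X e \<and> p \<in> fst e \<and> smooth_transition c e \<and> smooth_transition e d"
      unfolding compatible_iff by blast
  qed (use assms in "auto simp: is_chart_def")
  show "smooth_transition d c"
  proof (rule smooth_transition_via[OF assms(2)])
    fix p assume "p \<in> fst d \<inter> fst c"
    then obtain e where "is_chart H X e \<and> p \<in> fst e \<and> compatible c e \<and> compatible e d"
      using assms(3)[of p] by auto
    then show "\<exists>e. is_chart H X e \<and> p \<in> fst e \<and> smooth_transition d e \<and> smooth_transition e c"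
      unfolding compatible_iff by blast
  qed (use assms in "auto simp: is_chart_def")
qed

lemma smooth_transition_same:
  assumes c: "is_chart H X c" and "snd d = snd c"
  shows "smooth_transition c d"
  unfolding smooth_transition_def
proof (rule smooth_on_cong)
  show "smooth_on (snd c ` (fst c \<inter> fst d)) (%x. x)"
    by (rule smooth_on_C_inf[OF open_UNIV C_inf_id]) auto
  show "x = transition c d x" if "x \<in> snd c ` (fst c \<inter> fst d)" for x
    using that transition_apply[OF c, of _ d] assms(2) by auto
qed

section \<open>Maximal atlases generated by compatible charts\<close>

definition generated :: "(real ^ 'n::finite) set => 'a topology => ('a, 'n) chart set => ('a, 'n) manifold" where
  "generated H X B = \<lparr>Top = X, Atlas = {c. is_chart H X c \<and> (\<forall>d\<in>B. compatible c d)}\<rparr>"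

lemma Top_generated [simp]: "Top (generated H X B) = X"
  by (simp add: generated_def)

lemma Atlas_generated: "c \<in> Atlas (generated H X B) \<longleftrightarrow> is_chart H X c \<and> (\<forall>d\<in>B. compatible c d)"
  by (simp add: generated_def)

locale base_atlas =
  fixes H :: "(real ^ 'n::finite) set" and X :: "'a topology" and B :: "('a, 'n) chart set"
  assumes Hausdorff: "Hausdorff_space X" and countable_base: "second_countable X"
    and base_chart: "\<And>b. b \<in> B ==> is_chart H X b"
    and base_cover: "(\<Union>b\<in>B. fst b) = topspace X"
    and base_compatible: "\<And>b c. b \<in> B ==> c \<in> B ==> compatible b c"
begin

abbreviation "M \<equiv> generated H X B"

lemma base_in_Atlas: "b \<in> B ==> b \<in> Atlas M"
  by (simp add: Atlas_generated base_chart base_compatible)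

lemma obtain_base:
  assumes "p \<in> topspace X"
  obtains b where "b \<in> B" "p \<in> fst b"
  using assms base_cover by blast

text \<open>Two charts compatible with the base are compatible with each other by passing through a
  base chart at each common point. Maximality follows because the base itself belongs to the
  atlas.\<close>

lemma smooth_manifold_generated: "smooth_manifold H M"
  unfolding smooth_manifold_def
proof (intro conjI ballI allI impI)
  show "Hausdorff_space (Top M)" "second_countable (Top M)" using Hausdorff countable_base by auto
  show chart: "is_chart H (Top M) c" if "c \<in> Atlas M" for c using that by (simp add: Atlas_generated)
  show "\<Union> (fst ` Atlas M) = Points M"
  proof
    show "\<Union> (fst ` Atlas M) \<subseteq> Points M" using is_chart_subset[OF chart] by blast
    show "Points M \<subseteq> \<Union> (fst ` Atlas M)" using base_cover base_in_Atlas by (metis SUP_mono Top_generated order_refl)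
  qed
  show "compatible c d" if "c \<in> Atlas M" "d \<in> Atlas M" for c d
  proof (rule compatible_via[of H X])
    fix p assume "p \<in> fst c \<inter> fst d"
    then have "p \<in> topspace X" using is_chart_subset[OF chart[OF that(1)]] by auto
    then obtain b where "b \<in> B" "p \<in> fst b" by (rule obtain_base)
    then show "\<exists>e. is_chart H X e \<and> p \<in> fst e \<and> compatible c e \<and> compatible e d"
      using that base_chart compatible_sym[of b d] unfolding Atlas_generated by blast
  qed (use that in "auto simp: Atlas_generated")
  show "c \<in> Atlas M" if "is_chart H (Top M) c \<and> (\<forall>d\<in>Atlas M. compatible c d)" for c
    using that base_in_Atlas by (auto simp: Atlas_generated)
qed

end

lemma smooth_manifold_chart: "smooth_manifold H M ==> c \<in> Atlas M ==> is_chart H (Top M) c"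
  unfolding smooth_manifold_def by blast

lemma smooth_manifold_compatible:
  "smooth_manifold H M ==> c \<in> Atlas M ==> d \<in> Atlas M ==> compatible c d"
  unfolding smooth_manifold_def by blast

lemma smooth_manifold_cover:
  "smooth_manifold H M ==> p \<in> Points M ==> \<exists>c\<in>Atlas M. p \<in> fst c"
  unfolding smooth_manifold_def by blast

lemma smooth_manifold_maximal_local:
  assumes M: "smooth_manifold H M" and c: "is_chart H (Top M) c"
    and loc: "\<And>p. p \<in> fst c ==> \<exists>e\<in>Atlas M. p \<in> fst e \<and> compatible c e"
  shows "c \<in> Atlas M"
proof -
  have "compatible c d" if d: "d \<in> Atlas M" for d
  proof (rule compatible_via[OF c smooth_manifold_chart[OF M d]])
    fix p assume "p \<in> fst c \<inter> fst d"
    then obtain e where "e \<in> Atlas M" "p \<in> fst e" "compatible c e" using loc by blast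
    then show "\<exists>e. is_chart H (Top M) e \<and> p \<in> fst e \<and> compatible c e \<and> compatible e d"
      using smooth_manifold_chart[OF M] smooth_manifold_compatible[OF M _ d] by blast
  qed
  then show ?thesis using M c unfolding smooth_manifold_def by blast
qed

lemma restrict_in_Atlas:
  assumes M: "smooth_manifold H M" and c: "c \<in> Atlas M" and V: "openin (Top M) V"
  shows "(fst c \<inter> V, snd c) \<in> Atlas M"
proof (rule smooth_manifold_maximal_local[OF M])
  note ch = smooth_manifold_chart[OF M c]
  show r: "is_chart H (Top M) (fst c \<inter> V, snd c)" by (rule is_chart_restrict[OF ch V])
  have "compatible (fst c \<inter> V, snd c) c"
    unfolding compatible_iff using smooth_transition_same[OF ch] smooth_transition_same[OF r] by auto
  then show "\<exists>e\<in>Atlas M. p \<in> fst e \<and> compatible (fst c \<inter> V, snd c) e"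
    if "p \<in> fst (fst c \<inter> V, snd c)" for p using c that by auto
qed

lemma smooth_manifold_open_submanifold:
  assumes M: "smooth_manifold H M" and S: "openin (Top M) S"
  shows "smooth_manifold H (open_submanifold M S)"
  unfolding smooth_manifold_def
proof (intro conjI ballI allI impI)
  let ?N = "open_submanifold M S"
  have T: "Top ?N = subtopology (Top M) S" and A: "c \<in> Atlas ?N \<longleftrightarrow> c \<in> Atlas M \<and> fst c \<subseteq> S" for c
    by (auto simp: open_submanifold_def)
  have PS: "Points ?N = S" using openin_subset[OF S] by (auto simp: T)
  show "Hausdorff_space (Top ?N)" "second_countable (Top ?N)"
    using M by (auto simp: T smooth_manifold_def Hausdorff_space_subtopology second_countable_subtopology)
  show ch: "is_chart H (Top ?N) c" if "c \<in> Atlas ?N" for c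
    using that smooth_manifold_chart[OF M] unfolding T A is_chart_open_subtopology[OF S] by blast
  have "\<exists>c\<in>Atlas ?N. p \<in> fst c" if p: "p \<in> S" for p
  proof -
    obtain c where "c \<in> Atlas M" "p \<in> fst c"
      using smooth_manifold_cover[OF M] openin_subset[OF S] p by blast
    then have "(fst c \<inter> S, snd c) \<in> Atlas ?N" "p \<in> fst (fst c \<inter> S, snd c)"
      using p restrict_in_Atlas[OF M _ S] by (auto simp: A)
    then show ?thesis by blast
  qed
  then show "\<Union> (fst ` Atlas ?N) = Points ?N" unfolding PS using A by blast
  show "compatible c d" if "c \<in> Atlas ?N" "d \<in> Atlas ?N" for c d
    using that smooth_manifold_compatible[OF M] by (auto simp: A)
  show "c \<in> Atlas ?N" if *: "is_chart H (Top ?N) c \<and> (\<forall>d\<in>Atlas ?N. compatible c d)" for c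
  proof -
    have c: "is_chart H (Top M) c" "fst c \<subseteq> S" using * unfolding T is_chart_open_subtopology[OF S] by auto
    have "c \<in> Atlas M"
    proof (rule smooth_manifold_maximal_local[OF M c(1)])
      fix p assume "p \<in> fst c"
      then obtain d where "d \<in> Atlas ?N" "p \<in> fst d"
        using \<open>\<And>p. p \<in> S ==> \<exists>c\<in>Atlas ?N. p \<in> fst c\<close> c(2) by blast
      then show "\<exists>e\<in>Atlas M. p \<in> fst e \<and> compatible c e" using * by (auto simp: A)
    qed
    then show ?thesis using c by (simp add: A)
  qed
qed

text \<open>At the points of such a set, derivatives relative to relatively open subsets are unique.\<close>

definition thick :: "(real ^ 'n::finite) set => bool" where
  "thick H \<longleftrightarrow> (\<forall>x\<in>H. \<forall>i\<in>Basis. \<forall>e>0. \<exists>d. 0 < \<bar>d\<bar> \<and> \<bar>d\<bar> < e \<and> x + d *\<^sub>R i \<in> H)"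

lemma thick_UNIV: "thick UNIV"
  unfolding thick_def
proof (intro ballI allI impI)
  fix e :: real assume "e > 0"
  then show "\<exists>d. 0 < \<bar>d\<bar> \<and> \<bar>d\<bar> < e \<and> x + d *\<^sub>R i \<in> UNIV" for x i :: "real ^ 'n"
    by (intro exI[of _ "e / 2"]) auto
qed

lemma thick_half_space: "thick half_space"
  unfolding thick_def
proof (intro ballI allI impI)
  fix x i :: "real ^ 3" and e :: real assume "x \<in> half_space" "i \<in> Basis" "e > 0"
  then have "0 \<le> i $ 3" by (auto simp: Basis_vec_def axis_def)
  then show "\<exists>d. 0 < \<bar>d\<bar> \<and> \<bar>d\<bar> < e \<and> x + d *\<^sub>R i \<in> half_space"
    using \<open>x \<in> half_space\<close> \<open>e > 0\<close> by (intro exI[of _ "e / 2"]) (auto simp: half_space_def)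
qed

lemma thick_derivative_unique:
  fixes H :: "(real ^ 'n::finite) set" and f :: "real ^ 'n => 'b::real_normed_vector"
  assumes "thick H" "openin (top_of_set H) S" "x \<in> S"
    "(f has_derivative D) (at x within S)" "(f has_derivative D') (at x within S)"
  shows "D = D'"
proof (rule frechet_derivative_unique_within[OF assms(4,5)])
  fix i :: "real ^ 'n" and e :: real assume i: "i \<in> Basis" and "e > 0"
  obtain U where U: "open U" "S = H \<inter> U" using assms(2) by (meson openin_open)
  then obtain r where r: "r > 0" "ball x r \<subseteq> U" using assms(3) open_contains_ball by blast
  obtain d where d: "0 < \<bar>d\<bar>" "\<bar>d\<bar> < min e r" "x + d *\<^sub>R i \<in> H"
    using assms(1,3) U i r(1) \<open>e > 0\<close> unfolding thick_def by (metis IntD1 min_less_iff_conj)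
  have "x + d *\<^sub>R i \<in> ball x r" using d i by (simp add: dist_norm)
  then show "\<exists>d. 0 < \<bar>d\<bar> \<and> \<bar>d\<bar> < e \<and> x + d *\<^sub>R i \<in> S" using d r U by auto
qed

lemma transition_has_derivative:
  assumes "compatible c d" "p \<in> fst c \<inter> fst d"
  shows "\<exists>D. tder c d p D"
  using assms by (intro smooth_on_has_derivative) (auto simp: compatible_def)

lemma transition_derivative_compose:
  assumes H: "thick H" and ch: "is_chart H X c" "is_chart H X d" "is_chart H X e"
    and p: "p \<in> fst c \<inter> fst d \<inter> fst e"
    and D: "tder c d p D"
    and E: "tder d e p E"
    and F: "tder c e p F"
  shows "F = E \<circ> D"
proof -
  define W where "W = fst c \<inter> fst d \<inter> fst e"
  have "openin X W" using ch unfolding W_def is_chart_def by auto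
  then have W: "openin (top_of_set H) (snd c ` W)"
    by (rule is_chart_image_openin[OF ch(1)]) (auto simp: W_def)
  have D': "(transition c d has_derivative D) (at (snd c p) within snd c ` W)"
    by (rule has_derivative_subset[OF D]) (auto simp: W_def)
  have E': "(transition d e has_derivative E) (at (transition c d (snd c p)) within transition c d ` snd c ` W)"
    using p transition_apply[OF ch(1), of _ d]
    by (auto simp: W_def intro!: has_derivative_subset[OF E])
  have "((%x. transition d e (transition c d x)) has_derivative (%x. E (D x))) (at (snd c p) within snd c ` W)"
    by (rule has_derivative_in_compose[OF D' E'])
  then have "(transition c e has_derivative (%x. E (D x))) (at (snd c p) within snd c ` W)"
    by (rule has_derivative_transform[rotated 2])
      (use p transition_apply[OF ch(1), of _ d] transition_apply[OF ch(1), of _ e]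
        transition_apply[OF ch(2), of _ e] in "auto simp: W_def")
  moreover have "(transition c e has_derivative F) (at (snd c p) within snd c ` W)"
    by (rule has_derivative_subset[OF F]) (auto simp: W_def)
  ultimately have "(%x. E (D x)) = F"
    by (rule thick_derivative_unique[OF H W, rotated]) (use p in "auto simp: W_def")
  then show ?thesis by (auto simp: comp_def)
qed

lemma transition_derivative_self:
  assumes H: "thick H" and ch: "is_chart H X c" and p: "p \<in> fst c" and e: "snd e = snd c" "p \<in> fst e" "openin X (fst e)"
    and D: "tder c e p D"
  shows "D = id"
proof (rule thick_derivative_unique[OF H _ _ D])
  show "openin (top_of_set H) (snd c ` (fst c \<inter> fst e))"
    by (rule is_chart_image_openin[OF ch]) (use ch e in "auto simp: is_chart_def")
  have "((%x. x) has_derivative id) (at (snd c p) within snd c ` (fst c \<inter> fst e))"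
    by (simp add: id_def)
  then show "tder c e p id"
    by (rule has_derivative_transform[rotated 2]) (use p e transition_apply[OF ch, of _ e] in auto)
qed (use p e in auto)

lemma transition_derivative_inverse:
  assumes H: "thick H" and ch: "is_chart H X c" "is_chart H X d" and p: "p \<in> fst c \<inter> fst d"
    and D: "tder c d p D"
    and E: "tder d c p E"
  shows "E (D v) = v"
proof -
  have "smooth_on (snd c ` (fst c \<inter> fst c)) (transition c c)"
    using smooth_transition_same[OF ch(1), of c] by (simp add: smooth_transition_def)
  then obtain F where F: "tder c c p F"
    using smooth_on_has_derivative p by blast
  have "F = id" using transition_derivative_self[OF H ch(1) _ _ _ _ F] ch(1) p by (auto simp: is_chart_def)
  moreover have "F = E \<circ> D" using transition_derivative_compose[OF H ch ch(1) _ D E F] p by auto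
  ultimately show ?thesis by (metis comp_apply id_apply)
qed

text \<open>If \<open>snd d p\<close> were interior to the half-space, the third coordinate of
  \<open>transition d c\<close> would have a local minimum there. The third component of its
  derivative would vanish, although this derivative has a right inverse.\<close>

lemma boundary_invariant:
  assumes ch: "is_chart half_space X c" "is_chart half_space X d" and cd: "compatible c d"
    and p: "p \<in> fst c \<inter> fst d" and 0: "snd c p $ 3 = 0"
  shows "snd d p $ 3 = 0"
proof (rule ccontr)
  assume "snd d p $ 3 ~= 0"
  define x where "x = snd d p"
  have "x \<in> half_space" using is_chart_image_subset[OF ch(2)] p by (auto simp: x_def)
  then have x: "x $ 3 > 0" using \<open>snd d p $ 3 ~= 0\<close> by (simp add: half_space_def x_def)
  define S where "S = snd d ` (fst d \<inter> fst c)"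
  have "openin (top_of_set half_space) S"
    unfolding S_def by (rule is_chart_image_openin[OF ch(2)]) (use ch in "auto simp: is_chart_def")
  then obtain U where U: "open U" "S = half_space \<inter> U" by (meson openin_open)
  define V where "V = U \<inter> {y. y $ 3 > 0}"
  have V: "open V" "x \<in> V" "V \<subseteq> S"
    using U x p open_halfspace_component_gt_cart[of 0 3]
    by (auto simp: V_def half_space_def S_def x_def)
  obtain D where D: "(transition d c has_derivative D) (at x within S)"
    using transition_has_derivative[of d c p] cd p unfolding S_def x_def compatible_sym[of d] by auto
  obtain E where E: "tder c d p E"
    using transition_has_derivative[OF cd p] by blast
  have "(transition d c has_derivative D) (at x)"
    using has_derivative_subset[OF D V(3)] at_within_open[OF V(2,1)] by simp
  then have "((%y. transition d c y $ 3) has_derivative (%v. D v $ 3)) (at x)"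
    by (rule bounded_linear.has_derivative[OF bounded_linear_vec_nth])
  moreover have "eventually (%y. transition d c x $ 3 \<le> transition d c y $ 3) (at x)"
  proof -
    have "transition d c x $ 3 \<le> transition d c y $ 3" if y: "y \<in> V" for y
    proof -
      obtain q where q: "q \<in> fst d \<inter> fst c" "y = snd d q" using y V(3) by (auto simp: S_def)
      then have "transition d c y = snd c q" using transition_apply[OF ch(2), of _ c] by auto
      moreover have "snd c q \<in> half_space" using is_chart_image_subset[OF ch(1)] q by auto
      moreover have "transition d c x = snd c p" using transition_apply[OF ch(2), of _ c] p by (auto simp: x_def)
      ultimately show ?thesis using 0 by (simp add: half_space_def)
    qed
    then show ?thesis using V by (auto simp: eventually_at_topological)
  qed
  ultimately have "(%v. D v $ 3) = (%v. 0)" by (rule has_derivative_local_min)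
  moreover have "D (E (axis 3 1)) = axis 3 1"
    by (rule transition_derivative_inverse[OF thick_half_space ch p E]) (use D in "simp add: S_def x_def")
  ultimately have "(axis 3 1 :: real ^ 3) $ 3 = 0" by metis
  then show False by simp
qed

section \<open>Metrics given in a base atlas\<close>

lemma bilin_inner: "bilin G u v = u \<bullet> (G *v v)"
  by (simp add: bilin_def inner_vec_def matrix_vector_mult_def sum_distrib_left mult_ac)

lemma bilin_axis: "bilin G (axis i 1) (axis j 1) = G $ i $ j"
  by (simp add: bilin_inner inner_axis' matrix_vector_mult_basis column_def)

lemma bilin_ext: "(\<And>u v. bilin A u v = bilin B u v) ==> A = B"
  by (simp add: vec_eq_iff bilin_axis[symmetric])

definition pull :: "real ^ 'n::finite ^ 'n => real ^ 'n ^ 'n => real ^ 'n ^ 'n" where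
  "pull J G = transpose J ** G ** J"

lemma bilin_pull: "bilin (pull J G) u v = bilin G (J *v u) (J *v v)"
  unfolding pull_def bilin_inner
  by (metis dot_lmul_matrix matrix_vector_mul_assoc vector_transpose_matrix inner_commute transpose_transpose)

lemma transpose_pull: "transpose G = G ==> transpose (pull J G) = pull J G"
  by (simp add: pull_def matrix_transpose_mul matrix_mul_assoc)

lemma pull_nth: "pull J G $ i $ j = (\<Sum>k\<in>UNIV. (\<Sum>l\<in>UNIV. J $ l $ i * G $ l $ k) * J $ k $ j)"
  by (simp add: pull_def matrix_matrix_mult_def transpose_def)

lemma C_inf_pull:
  fixes J G :: "'a::euclidean_space => real ^ 'n::finite ^ 'n"
  assumes "open U" "C_inf U J" "C_inf U G"
  shows "C_inf U (%x. pull (J x) (G x))"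
  by (intro C_inf_vec assms(1); unfold pull_nth; intro C_inf_sum C_inf_mult C_inf_nth assms)

lemma matrix_nth: "matrix D $ i $ j = D (axis j 1) $ i"
  by (simp add: matrix_def)

text \<open>A geometric structure in the sense of locally homogeneous spaces: a single coefficient
  field \<open>\<gamma>\<close> serves every base chart because all base transitions preserve it.
  Components in other charts arise by pulling back.\<close>

locale model_metric = base_atlas H X B
  for H :: "(real ^ 'n::finite) set" and X :: "'a topology" and B :: "('a, 'n) chart set" +
  fixes \<gamma> :: "real ^ 'n => real ^ 'n ^ 'n" and V :: "(real ^ 'n) set"
  assumes thick: "thick H"
    and V: "open V" "C_inf V \<gamma>" "\<And>b. b \<in> B ==> snd b ` fst b \<subseteq> V"
    and sym: "\<And>x. x \<in> V ==> transpose (\<gamma> x) = \<gamma> x"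
    and pos: "\<And>x v. x \<in> V ==> v ~= 0 ==> 0 < bilin (\<gamma> x) v v"
    and isometric: "\<And>b c p D u v. b \<in> B ==> c \<in> B ==> p \<in> fst b \<inter> fst c ==>
        tder b c p D ==>
        bilin (\<gamma> (snd b p)) u v = bilin (\<gamma> (snd c p)) (D u) (D v)"
begin

text \<open>The base chart and the derivative are chosen separately at each point;
  \<open>metric_pull\<close> shows that the value is independent of both choices.\<close>

definition metric :: "('a, 'n) tensor2" where
  "metric c x =
    (let p = inv_into (fst c) (snd c) x;
         b = (SOME b. b \<in> B \<and> p \<in> fst b);
         D = (SOME D. (transition c b has_derivative D) (at x within snd c ` (fst c \<inter> fst b)))
     in pull (matrix D) (\<gamma> (snd b p)))"

lemma Atlas_chart: "c \<in> Atlas M ==> is_chart H X c"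
  by (simp add: Atlas_generated)

lemma Atlas_compatible: "c \<in> Atlas M ==> d \<in> Atlas M ==> compatible c d"
  using smooth_manifold_generated smooth_manifold_compatible by blast

lemma Atlas_openin: "c \<in> Atlas M ==> openin X (fst c)"
  using Atlas_chart by (auto simp: is_chart_def)

text \<open>Two choices differ by the derivative \<open>E\<close> of a base transition, and
  \<open>isometric\<close> makes this difference invisible.\<close>

lemma metric_pull:
  assumes c: "c \<in> Atlas M" "p \<in> fst c" and b: "b \<in> B" "p \<in> fst b"
    and D: "tder c b p D"
  shows "metric c (snd c p) = pull (matrix D) (\<gamma> (snd b p))"
proof -
  define b' where "b' = (SOME b. b \<in> B \<and> p \<in> fst b)"
  have b': "b' \<in> B" "p \<in> fst b'" unfolding b'_def using b by (metis (mono_tags, lifting) someI_ex)+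
  define D' where "D' = (SOME D. tder c b' p D)"
  have D': "tder c b' p D'"
    unfolding D'_def
    by (rule someI_ex[OF transition_has_derivative])
      (use c b' base_in_Atlas[OF b'(1)] Atlas_compatible in auto)
  obtain E where E: "tder b b' p E"
    using transition_has_derivative[of b b' p] base_compatible b b' by blast
  have DE: "D' = E \<circ> D"
    by (rule transition_derivative_compose[OF thick Atlas_chart[OF c(1)] base_chart[OF b(1)] base_chart[OF b'(1)] _ D E D'])
      (use c b b' in auto)
  have "metric c (snd c p) = pull (matrix D') (\<gamma> (snd b' p))"
    by (simp add: metric_def is_chart_inv[OF Atlas_chart[OF c(1)] c(2)] b'_def[symmetric] D'_def[symmetric])
  also have "\<dots> = pull (matrix D) (\<gamma> (snd b p))"
  proof (rule bilin_ext)
    fix u v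
    have "linear D" "linear D'" using D D' has_derivative_linear by blast+
    then show "bilin (pull (matrix D') (\<gamma> (snd b' p))) u v = bilin (pull (matrix D) (\<gamma> (snd b p))) u v"
      using isometric[OF b(1) b'(1) _ E, of "D u" "D v"] b(2) b'(2)
      by (simp add: bilin_pull DE matrix_works)
  qed
  finally show ?thesis .
qed

lemma metric_base: "b \<in> B ==> p \<in> fst b ==> metric b (snd b p) = \<gamma> (snd b p)"
proof -
  assume b: "b \<in> B" "p \<in> fst b"
  obtain D where D: "tder b b p D"
    using transition_has_derivative[of b b p] base_compatible b by blast
  have "D = id"
    by (rule transition_derivative_self[OF thick base_chart[OF b(1)] b(2) refl b(2) _ D])
      (use base_chart[OF b(1)] in "auto simp: is_chart_def")
  then show ?thesis
    using metric_pull[OF base_in_Atlas[OF b(1)] b(2) b D]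
    by (simp add: pull_def matrix_id_mat_1 matrix_mul_lid matrix_mul_rid)
qed

lemma metric_smooth:
  assumes c: "c \<in> Atlas M"
  shows "smooth_on (snd c ` fst c) (metric c)"
proof (rule smooth_on_local)
  fix x assume "x \<in> snd c ` fst c"
  then obtain p where p: "p \<in> fst c" "x = snd c p" by blast
  then have "p \<in> topspace X" using is_chart_subset[OF Atlas_chart[OF c]] by auto
  then obtain b where b: "b \<in> B" "p \<in> fst b" by (rule obtain_base)
  define S where "S = snd c ` (fst c \<inter> fst b)"
  have So: "openin (top_of_set H) S"
    unfolding S_def by (rule is_chart_image_openin[OF Atlas_chart[OF c]])
      (use Atlas_openin[OF c] Atlas_openin[OF base_in_Atlas[OF b(1)]] in auto)
  then obtain U where U: "open U" "S = H \<inter> U" by (meson openin_open)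
  have "smooth_on S (transition c b)"
    using Atlas_compatible[OF c base_in_Atlas[OF b(1)]] by (simp add: compatible_def S_def)
  then obtain W F where W: "open W" "x \<in> W" "C_inf W F" "\<forall>y\<in>S \<inter> W. F y = transition c b y"
    using p b unfolding smooth_on_def' S_def by blast
  define Z where "Z = U \<inter> (W \<inter> F -` V)"
  have Z: "open Z" unfolding Z_def
    using continuous_open_preimage[OF C_inf_continuous[OF W(3)] W(1) V(1)] U(1) by blast
  have Fp: "F x = snd b p"
    using W p b transition_apply[OF Atlas_chart[OF c] p(1), of b] by (auto simp: S_def)
  have "x \<in> Z" using W(2) p b V(3)[OF b(1)] Fp U(2) by (auto simp: Z_def S_def)
  \<comment> \<open>The image of a chart need not be open, so the Jacobian is taken of the smooth
    extension \<open>F\<close>; at points of the image it agrees with the relative derivative of the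
    transition.\<close>
  define J where "J y = matrix (Dat F y)" for y
  have FZ: "C_inf Z F" using W(3) by (rule C_inf_subset) (auto simp: Z_def)
  have "C_inf Z J"
    unfolding J_def by (intro C_inf_vec Z; unfold matrix_nth; intro C_inf_nth C_inf_frechet Z FZ)
  moreover have "C_inf Z (%y. \<gamma> (F y))"
    by (rule C_inf_compose[OF Z V(1) _ FZ V(2)]) (auto simp: Z_def)
  ultimately have "C_inf Z (%y. pull (J y) (\<gamma> (F y)))" by (rule C_inf_pull[OF Z])
  then have "smooth_on (snd c ` fst c \<inter> Z) (%y. pull (J y) (\<gamma> (F y)))"
    by (rule smooth_on_C_inf[OF Z]) auto
  moreover have "pull (J y) (\<gamma> (F y)) = metric c y" if y: "y \<in> snd c ` fst c \<inter> Z" for y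
  proof -
    have yS: "y \<in> S" using y is_chart_image_subset[OF Atlas_chart[OF c]] U(2) by (auto simp: Z_def)
    then obtain q where q: "q \<in> fst c" "q \<in> fst b" "y = snd c q" by (auto simp: S_def)
    have "(F has_derivative Dat F y) (at y within S)"
      by (rule has_derivative_at_withinI[OF C_inf_has_derivative[OF FZ]]) (use y in auto)
    then have "(F has_derivative Dat F y) (at y within S \<inter> W)"
      by (rule has_derivative_subset) auto
    then have "(transition c b has_derivative Dat F y) (at y within S \<inter> W)"
      by (rule has_derivative_transform[rotated 2]) (use W(4) y yS in "auto simp: Z_def")
    then have "(transition c b has_derivative Dat F y) (at y within S)"
      using at_within_nhd[of y W "S \<inter> W" S] y W(1) by (auto simp: Z_def Int_assoc)
    from metric_pull[OF c q(1) b(1) q(2) this[unfolded q(3) S_def]]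
    show ?thesis using W(4) y yS transition_apply[OF Atlas_chart[OF c] q(1), of b]
      by (simp add: J_def q(3) Z_def)
  qed
  ultimately have "smooth_on (snd c ` fst c \<inter> Z) (metric c)" by (rule smooth_on_cong[rotated])
  then show "\<exists>U. open U \<and> x \<in> U \<and> smooth_on (snd c ` fst c \<inter> U) (metric c)"
    using Z \<open>x \<in> Z\<close> by blast
qed

lemma riemannian_metric_metric: "riemannian_metric M metric"
  unfolding riemannian_metric_def
proof (intro conjI ballI allI impI)
  show "smooth_on (snd c ` fst c) (metric c)" if "c \<in> Atlas M" for c by (rule metric_smooth[OF that])
  have loc: "\<exists>b D. b \<in> B \<and> p \<in> fst b \<and>
      tder c b p D"
    if c: "c \<in> Atlas M" "p \<in> fst c" for c p
  proof -
    have "p \<in> topspace X" using is_chart_subset[OF Atlas_chart[OF c(1)]] c(2) by auto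
    then obtain b where b: "b \<in> B" "p \<in> fst b" by (rule obtain_base)
    then show ?thesis
      using transition_has_derivative[OF Atlas_compatible[OF c(1) base_in_Atlas[OF b(1)]], of p] c(2) by blast
  qed
  fix c x assume c: "c \<in> Atlas M" and "x \<in> snd c ` fst c"
  then obtain p where p: "p \<in> fst c" "x = snd c p" by blast
  obtain b D where b: "b \<in> B" "p \<in> fst b"
    and D: "tder c b p D"
    using loc[OF c p(1)] by blast
  have bV: "snd b p \<in> V" using V(3)[OF b(1)] b(2) by auto
  note eq = metric_pull[OF c p(1) b D]
  show "transpose (metric c x) = metric c x" unfolding p(2) eq by (rule transpose_pull[OF sym[OF bV]])
  fix v :: "real ^ 'n" assume "v ~= 0"
  obtain E where E: "tder b c p E"
    using transition_has_derivative[OF Atlas_compatible[OF base_in_Atlas[OF b(1)] c], of p] p b by blast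
  have "E (D v) = v"
    by (rule transition_derivative_inverse[OF thick Atlas_chart[OF c] base_chart[OF b(1)] _ D E]) (use p b in auto)
  moreover have "linear E" using E has_derivative_linear by blast
  ultimately have "D v ~= 0" using \<open>v ~= 0\<close> linear_0 by metis
  then show "0 < bilin (metric c x) v v"
    using pos[OF bV] has_derivative_linear[OF D] unfolding p(2) eq by (simp add: bilin_pull matrix_works)
next
  fix c d p D u v assume c: "c \<in> Atlas M" and d: "d \<in> Atlas M" and p: "p \<in> fst c \<inter> fst d"
    and D: "tder c d p D"
  have "p \<in> topspace X" using is_chart_subset[OF Atlas_chart[OF c]] p by auto
  then obtain b where b: "b \<in> B" "p \<in> fst b" by (rule obtain_base)
  obtain E where E: "tder d b p E"
    using transition_has_derivative[OF Atlas_compatible[OF d base_in_Atlas[OF b(1)]], of p] p b by blast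
  obtain F where F: "tder c b p F"
    using transition_has_derivative[OF Atlas_compatible[OF c base_in_Atlas[OF b(1)]], of p] p b by blast
  have "F = E \<circ> D"
    by (rule transition_derivative_compose[OF thick Atlas_chart[OF c] Atlas_chart[OF d] base_chart[OF b(1)] _ D E F])
      (use p b in auto)
  then show "bilin (metric c (snd c p)) u v = bilin (metric d (snd d p)) (D u) (D v)"
    using metric_pull[OF c _ b F] metric_pull[OF d _ b E] p has_derivative_linear[OF E] has_derivative_linear[OF F]
    by (simp add: bilin_pull matrix_works)
qed

end

section \<open>The boundary of a three-manifold\<close>

lemma hor_lift [simp]: "hor (lift x t) = x"
  by (simp add: hor_def lift_def vec_eq_iff forall_2)

lemma lift_nth [simp]: "lift x t $ 1 = x $ 1" "lift x t $ 2 = x $ 2" "lift x t $ 3 = t"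
  by (simp_all add: lift_def)

lemma hor_nth [simp]: "hor y $ 1 = y $ 1" "hor y $ 2 = y $ 2"
  by (simp_all add: hor_def)

lemma lift_hor [simp]: "lift (hor y) (y $ 3) = y"
  by (simp add: vec_eq_iff forall_3)

lemma linear_hor: "bounded_linear hor"
  by (intro linear_conv_bounded_linear[THEN iffD1] linearI) (auto simp: vec_eq_iff forall_2)

lemma linear_lift: "bounded_linear (%x. lift x 0)"
  by (intro linear_conv_bounded_linear[THEN iffD1] linearI) (auto simp: vec_eq_iff forall_3)

lemma C_inf_lift:
  assumes "open U" "C_inf U f" "C_inf U t"
  shows "C_inf U (%x. lift (f x) (t x))"
proof (rule C_inf_vec[OF assms(1)])
  fix i :: 3
  show "C_inf U (%x. lift (f x) (t x) $ i)"
    using exhaust_3[of i] C_inf_nth[OF assms(1,2)] assms(3) by auto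
qed

lemma has_derivative_lift:
  assumes "(f has_derivative f') F" "(t has_derivative t') F"
  shows "((%x. lift (f x) (t x)) has_derivative (%v. lift (f' v) (t' v))) F"
proof -
  have l: "lift u t = lift u 0 + t *\<^sub>R axis 3 1" for u t
    by (simp add: vec_eq_iff forall_3 axis_def)
  show ?thesis unfolding l[of _ "t _"] l[of _ "t' _"]
    by (intro has_derivative_add has_derivative_scaleR_left assms bounded_linear.has_derivative[OF linear_lift])
qed

lemma C_inf_hor: "open U ==> C_inf U f ==> C_inf U (%x. hor (f x))"
  by (rule C_inf_linear_comp[OF _ linear_hor])

lemma boundary_chart_alt: "boundary_chart M c = (fst c \<inter> boundary_points M, %p. hor (snd c p))"
  by (simp add: boundary_chart_def hor_def)

lemma boundary_points_iff:
  assumes "smooth_manifold half_space M" "c \<in> Atlas M" "p \<in> fst c"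
  shows "p \<in> boundary_points M \<longleftrightarrow> snd c p $ 3 = 0"
  using assms boundary_invariant[OF smooth_manifold_chart[OF assms(1)] smooth_manifold_chart[OF assms(1)]
      smooth_manifold_compatible[OF assms(1)]]
  unfolding boundary_points_def by blast

lemma boundary_chart_image:
  assumes M: "smooth_manifold half_space M" and c: "c \<in> Atlas M"
  shows "snd (boundary_chart M c) ` fst (boundary_chart M c) = {x. lift x 0 \<in> snd c ` fst c}"
proof (intro equalityI subsetI)
  fix x assume "x \<in> snd (boundary_chart M c) ` fst (boundary_chart M c)"
  then obtain p where p: "p \<in> fst c" "p \<in> boundary_points M" "x = hor (snd c p)"
    by (auto simp: boundary_chart_alt)
  then have "lift x 0 = snd c p" using boundary_points_iff[OF M c p(1)] lift_hor[of "snd c p"] by auto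
  then show "x \<in> {x. lift x 0 \<in> snd c ` fst c}" using p by auto
next
  fix x assume "x \<in> {x. lift x 0 \<in> snd c ` fst c}"
  then obtain p where p: "p \<in> fst c" "lift x 0 = snd c p" by auto
  then have "p \<in> boundary_points M" "x = hor (snd c p)"
    using boundary_points_iff[OF M c p(1)] p(2)[symmetric] by auto
  then show "x \<in> snd (boundary_chart M c) ` fst (boundary_chart M c)"
    using p by (auto simp: boundary_chart_alt)
qed

lemma is_chart_boundary_chart:
  assumes M: "smooth_manifold half_space M" and c: "c \<in> Atlas M"
  shows "is_chart UNIV (subtopology (Top M) (boundary_points M)) (boundary_chart M c)"
proof -
  note ch = smooth_manifold_chart[OF M c]
  define P where "P = fst c \<inter> boundary_points M"
  let ?X = "subtopology (Top M) (boundary_points M)"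
  have "openin ?X P" using ch unfolding P_def is_chart_def by (auto intro: openin_subtopology_Int)
  moreover have "open {x. lift x 0 \<in> snd c ` fst c}"
  proof -
    obtain U where U: "open U" "snd c ` fst c = half_space \<inter> U"
      using ch unfolding is_chart_def by (meson openin_open)
    have "{x. lift x 0 \<in> snd c ` fst c} = (%x. lift x 0) -` U" unfolding U(2) by (auto simp: half_space_def)
    moreover have "open ((%x. lift x 0) -` U)"
      by (rule continuous_open_vimage[OF U(1)]) (rule linear_continuous_at[OF linear_lift])
    ultimately show ?thesis by simp
  qed
  moreover have "homeomorphic_map (subtopology ?X P) (top_of_set ((%p. hor (snd c p)) ` P)) (%p. hor (snd c p))"
  proof -
    have "homeomorphic_map (subtopology (subtopology (Top M) (fst c)) P)
        (subtopology (top_of_set (snd c ` fst c)) (snd c ` P)) (snd c)"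
    proof (rule homeomorphic_map_subtopologies)
      show "homeomorphic_map (subtopology (Top M) (fst c)) (top_of_set (snd c ` fst c)) (snd c)"
        using ch unfolding is_chart_def by blast
      show "snd c ` (topspace (subtopology (Top M) (fst c)) \<inter> P) = topspace (top_of_set (snd c ` fst c)) \<inter> snd c ` P"
        using is_chart_subset[OF ch] by (auto simp: P_def)
    qed
    moreover have "subtopology (subtopology (Top M) (fst c)) P = subtopology ?X P"
      by (simp add: subtopology_subtopology P_def Int_ac)
    moreover have "subtopology (top_of_set (snd c ` fst c)) (snd c ` P) = top_of_set (snd c ` P)"
      by (simp add: subtopology_subtopology P_def Int_absorb1 image_mono)
    ultimately have 1: "homeomorphic_map (subtopology ?X P) (top_of_set (snd c ` P)) (snd c)" by simp
    have inv: "lift (hor y) 0 = y" if "y \<in> snd c ` P" for y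
    proof -
      have "y $ 3 = 0" using that boundary_points_iff[OF M c] by (auto simp: P_def)
      then show ?thesis using lift_hor[of y] by simp
    qed
    have "homeomorphic_maps (top_of_set (snd c ` P)) (top_of_set (hor ` snd c ` P)) hor (%x. lift x 0)"
      unfolding homeomorphic_maps_def continuous_map_subtopology_eu
      using inv by (auto intro!: linear_continuous_on linear_hor linear_lift)
    then have "homeomorphic_map (top_of_set (snd c ` P)) (top_of_set (hor ` snd c ` P)) hor"
      by (rule homeomorphic_maps_imp_map)
    from homeomorphic_map_compose[OF 1 this] show ?thesis by (simp add: comp_def image_image)
  qed
  ultimately show ?thesis
    using boundary_chart_image[OF M c] unfolding is_chart_def boundary_chart_alt P_def by simp
qed

lemma boundary_transition:
  assumes M: "smooth_manifold half_space M" and c: "c \<in> Atlas M"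
    and x: "x \<in> snd (boundary_chart M c) ` (fst (boundary_chart M c) \<inter> fst (boundary_chart M d))"
  shows "lift x 0 \<in> snd c ` (fst c \<inter> fst d)"
    "transition (boundary_chart M c) (boundary_chart M d) x = hor (transition c d (lift x 0))"
proof -
  obtain p where p: "p \<in> fst c" "p \<in> fst d" "p \<in> boundary_points M" "x = hor (snd c p)"
    using x by (auto simp: boundary_chart_alt)
  have e: "lift x 0 = snd c p"
    using p boundary_points_iff[OF M c p(1)] lift_hor[of "snd c p"] by auto
  show "lift x 0 \<in> snd c ` (fst c \<inter> fst d)" unfolding e using p by blast
  have "transition (boundary_chart M c) (boundary_chart M d) (snd (boundary_chart M c) p) =
      snd (boundary_chart M d) p"
    by (rule transition_apply[OF is_chart_boundary_chart[OF M c]]) (use p in "auto simp: boundary_chart_alt")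
  then show "transition (boundary_chart M c) (boundary_chart M d) x = hor (transition c d (lift x 0))"
    unfolding e transition_apply[OF smooth_manifold_chart[OF M c] p(1)]
    using p by (simp add: boundary_chart_alt)
qed

lemma boundary_smooth_transition:
  assumes M: "smooth_manifold half_space M" and c: "c \<in> Atlas M" and d: "d \<in> Atlas M"
  shows "smooth_transition (boundary_chart M c) (boundary_chart M d)"
  unfolding smooth_transition_def
proof (rule smooth_on_cong[OF boundary_transition(2)[OF M c, symmetric]])
  let ?S = "snd (boundary_chart M c) ` (fst (boundary_chart M c) \<inter> fst (boundary_chart M d))"
  have 1: "smooth_on (snd c ` (fst c \<inter> fst d)) (%y. hor (transition c d y))"
    by (rule smooth_on_compose[where T=UNIV])
      (use smooth_manifold_compatible[OF M c d] in "auto simp: compatible_def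
        intro!: smooth_on_C_inf[OF open_UNIV] C_inf_linear linear_hor")
  show "smooth_on ?S (%x. hor (transition c d (lift x 0)))"
    by (rule smooth_on_compose[where f="%x. lift x 0", OF _ 1])
      (use boundary_transition(1)[OF M c, of _ d] in "auto intro!: smooth_on_C_inf[OF open_UNIV] C_inf_linear linear_lift")
qed

text \<open>Transitions carry boundary points to boundary points, so the normal component of a
  transported tangential vector is the derivative of a function that is identically zero.\<close>

lemma boundary_transition_derivative:
  assumes M: "smooth_manifold half_space M" and c: "c \<in> Atlas M" and d: "d \<in> Atlas M"
    and p: "p \<in> fst c \<inter> fst d \<inter> boundary_points M"
    and D: "tder c d p D"
  shows "(transition (boundary_chart M c) (boundary_chart M d) has_derivative (%v. hor (D (lift v 0))))
      (at (snd (boundary_chart M c) p) within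
        snd (boundary_chart M c) ` (fst (boundary_chart M c) \<inter> fst (boundary_chart M d)))"
    "D (lift v 0) $ 3 = 0"
proof -
  let ?c = "boundary_chart M c" and ?d = "boundary_chart M d"
  define S where "S = snd ?c ` (fst ?c \<inter> fst ?d)"
  define x where "x = snd ?c p"
  have xS: "x \<in> S" using p by (auto simp: x_def S_def boundary_chart_alt)
  have e: "lift x 0 = snd c p"
    using p boundary_points_iff[OF M c, of p] lift_hor[of "snd c p"] by (auto simp: x_def boundary_chart_alt)
  have "((%x. lift x 0) has_derivative (%x. lift x 0)) (at x within S)"
    by (rule bounded_linear_imp_has_derivative[OF linear_lift])
  moreover have "(transition c d has_derivative D) (at (lift x 0) within (%x. lift x 0) ` S)"
    unfolding e using D by (rule has_derivative_subset) (use boundary_transition(1)[OF M c, of _ d] in "auto simp: S_def")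
  ultimately have 1: "((%x. transition c d (lift x 0)) has_derivative (%v. D (lift v 0))) (at x within S)"
    by (rule has_derivative_in_compose)
  have "((%x. hor (transition c d (lift x 0))) has_derivative (%v. hor (D (lift v 0)))) (at x within S)"
    by (rule bounded_linear.has_derivative[OF linear_hor 1])
  then show "(transition ?c ?d has_derivative (%v. hor (D (lift v 0)))) (at (snd ?c p) within snd ?c ` (fst ?c \<inter> fst ?d))"
    unfolding x_def[symmetric] S_def[symmetric]
    by (rule has_derivative_transform[OF xS, rotated]) (use boundary_transition(2)[OF M c] in "auto simp: S_def")
  have So: "openin (top_of_set UNIV) S"
    unfolding S_def
    by (rule is_chart_image_openin[OF is_chart_boundary_chart[OF M c]])
      (use is_chart_boundary_chart[OF M c] is_chart_boundary_chart[OF M d] in "auto simp: is_chart_def")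
  have "((%x. transition c d (lift x 0) $ 3) has_derivative (%v. D (lift v 0) $ 3)) (at x within S)"
    by (rule bounded_linear.has_derivative[OF bounded_linear_vec_nth 1])
  moreover have "((%x. transition c d (lift x 0) $ 3) has_derivative (%v. 0)) (at x within S)"
  proof (rule has_derivative_transform[OF xS, of _ "%_. 0"])
    fix y assume "y \<in> S"
    then obtain q where q: "q \<in> fst c" "q \<in> fst d" "q \<in> boundary_points M" "y = hor (snd c q)"
      by (auto simp: S_def boundary_chart_alt)
    then have "lift y 0 = snd c q" using boundary_points_iff[OF M c q(1)] lift_hor[of "snd c q"] by auto
    then show "transition c d (lift y 0) $ 3 = 0"
      using transition_apply[OF smooth_manifold_chart[OF M c] q(1), of d] boundary_points_iff[OF M d q(2)] q(3) by simp
  qed simp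
  ultimately have "(%v. D (lift v 0) $ 3) = (%v. 0)"
    by (rule thick_derivative_unique[OF thick_UNIV So xS])
  then show "D (lift v 0) $ 3 = 0" by metis
qed

lemma boundary_points_subset:
  "smooth_manifold H M ==> boundary_points M \<subseteq> Points M"
  unfolding boundary_points_def using is_chart_subset smooth_manifold_chart by blast

text \<open>Restrictions of any covering subfamily \<open>B\<close> determine the boundary atlas,
  since compatibility passes through them. The explicit charts can thus replace the restrictions of
  all charts in \<open>Atlas M\<close>.\<close>

lemma boundary_manifold_generated:
  assumes M: "smooth_manifold half_space M" and B: "B \<subseteq> Atlas M" "Points M \<subseteq> (\<Union>b\<in>B. fst b)"
  shows "base_atlas UNIV (subtopology (Top M) (boundary_points M)) (boundary_chart M ` B)"
    "boundary_manifold M = generated UNIV (subtopology (Top M) (boundary_points M)) (boundary_chart M ` B)"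
proof -
  let ?X = "subtopology (Top M) (boundary_points M)"
  have tX: "topspace ?X = boundary_points M" using boundary_points_subset[OF M] by auto
  have comp: "compatible (boundary_chart M c) (boundary_chart M d)" if "c \<in> Atlas M" "d \<in> Atlas M" for c d
    using that boundary_smooth_transition[OF M] by (simp add: compatible_iff)
  show "base_atlas UNIV ?X (boundary_chart M ` B)"
  proof
    show "Hausdorff_space ?X" "second_countable ?X"
      using M by (auto simp: smooth_manifold_def Hausdorff_space_subtopology second_countable_subtopology)
    show "is_chart UNIV ?X b" if "b \<in> boundary_chart M ` B" for b
      using that is_chart_boundary_chart[OF M] B by blast
    show "(\<Union>b\<in>boundary_chart M ` B. fst b) = topspace ?X"
      unfolding tX using B(2) boundary_points_subset[OF M] by (auto simp: boundary_chart_alt)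
    show "compatible b c" if "b \<in> boundary_chart M ` B" "c \<in> boundary_chart M ` B" for b c
      using that comp B by blast
  qed
  have "compatible c (boundary_chart M d)"
    if c: "is_chart UNIV ?X c" "\<forall>b\<in>boundary_chart M ` B. compatible c b" and d: "d \<in> Atlas M" for c d
  proof (rule compatible_via[OF c(1) is_chart_boundary_chart[OF M d]])
    fix p assume p: "p \<in> fst c \<inter> fst (boundary_chart M d)"
    then have "p \<in> Points M" "p \<in> boundary_points M" using is_chart_subset[OF c(1)] by auto
    then obtain b where "b \<in> B" "p \<in> fst b" using B(2) by blast
    then show "\<exists>e. is_chart UNIV ?X e \<and> p \<in> fst e \<and> compatible c e \<and> compatible e (boundary_chart M d)"
      using c(2) comp[OF _ d] B(1) is_chart_boundary_chart[OF M] \<open>p \<in> boundary_points M\<close>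
      by (intro exI[of _ "boundary_chart M b"]) (auto simp: boundary_chart_alt)
  qed
  then show "boundary_manifold M = generated UNIV ?X (boundary_chart M ` B)"
    unfolding boundary_manifold_def generated_def using B(1) by auto
qed

section \<open>The Riemannian measure\<close>

text \<open>Bounds on the image and on \<open>f\<close> give absolute integrability, the setting of
  the change of variables formula; unbounded densities are reached later by exhaustion.\<close>

lemma nn_integral_change_of_variables_bounded:
  fixes T :: "real ^ 'n::{finite,wellorder} => real ^ 'n::_"
  assumes S: "S \<in> sets borel" "T ` S \<in> sets borel" "bounded (T ` S)"
    and T: "\<And>x. x \<in> S ==> (T has_derivative T' x) (at x within S)" "inj_on T S"
    and f: "f \<in> borel_measurable borel" "\<And>x. 0 \<le> f x" "\<And>x. x \<in> T ` S ==> f x \<le> C"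
  shows "(\<integral>\<^sup>+x. ennreal (\<bar>det (matrix (T' x))\<bar> * f (T x)) * indicator S x \<partial>lborel) =
    (\<integral>\<^sup>+x. ennreal (f x) * indicator (T ` S) x \<partial>lborel)"
proof -
  have "emeasure lborel (T ` S) < \<infinity>" using emeasure_bounded_finite[OF S(3)] by simp
  then have "integrable lborel (%x. indicator (T ` S) x *\<^sub>R f x)"
    by (intro integrableI_bounded_set_indicator[where B=C]) (use S f in auto)
  then have fi: "f absolutely_integrable_on (T ` S)"
    unfolding set_integrable_def by (rule integrable_completion[THEN iffD2, rotated]) (use S f in auto)
  have cov: "(%x. \<bar>det (matrix (T' x))\<bar> * f (T x)) absolutely_integrable_on S \<and>
      integral S (%x. \<bar>det (matrix (T' x))\<bar> * f (T x)) = b \<longleftrightarrow>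
      f absolutely_integrable_on (T ` S) \<and> integral (T ` S) f = b" for b
  proof -
    \<comment> \<open>Scalars are carried as vectors of \<open>real ^ 1\<close>, the form in which
      the change of variables is applied.\<close>
    have "(%x. \<bar>det (matrix (T' x))\<bar> *\<^sub>R vec (f (T x)) :: real ^ 1) absolutely_integrable_on S \<and>
        integral S (%x. \<bar>det (matrix (T' x))\<bar> *\<^sub>R vec (f (T x))) = (vec b :: real ^ 1) \<longleftrightarrow>
        (%x. vec (f x) :: real ^ 1) absolutely_integrable_on (T ` S) \<and>
        integral (T ` S) (%x. vec (f x)) = (vec b :: real ^ 1)"
      by (rule has_absolute_integral_change_of_variables) (use S T in auto)
    then show ?thesis by (simp add: absolutely_integrable_on_1_iff integral_on_1_eq)
  qed
  have nn: "(\<integral>\<^sup>+x. ennreal (h x) * indicator A x \<partial>lborel) = ennreal (integral A h)"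
    if h: "h absolutely_integrable_on A" "\<And>x. 0 \<le> h x" for h :: "real ^ 'n::_ => real" and A
  proof -
    have "(\<integral>\<^sup>+x. ennreal (h x) * indicator A x \<partial>lborel) = (\<integral>\<^sup>+x. ennreal (indicator A x *\<^sub>R h x) \<partial>lebesgue)"
      unfolding nn_integral_completion by (rule nn_integral_cong) (auto split: split_indicator)
    also have "\<dots> = ennreal (LINT x|lebesgue. indicator A x *\<^sub>R h x)"
      by (rule nn_integral_eq_integral) (use h in "auto simp: set_integrable_def")
    also have "(LINT x|lebesgue. indicator A x *\<^sub>R h x) = integral A h"
      using set_lebesgue_integral_eq_integral(2)[OF h(1)] by (simp add: set_lebesgue_integral_def)
    finally show ?thesis .
  qed
  show ?thesis using cov[of "integral (T ` S) f"] fi f(2) by (simp add: nn)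
qed

text \<open>\<open>riemannian_measure\<close> is a definite description, so existence and uniqueness
  must be settled before any integral can be computed. Finitely many covering charts reduce both to
  a finite disjoint partition.\<close>

locale measured_manifold =
  fixes M :: "('a, 'n::{finite,wellorder}) manifold" and g :: "('a, 'n::_) tensor2"
    and bs :: "nat => ('a, 'n::_) chart" and k :: nat
  assumes chart: "\<And>c. c \<in> Atlas M ==> is_chart UNIV (Top M) c"
    and compat: "\<And>c d. c \<in> Atlas M ==> d \<in> Atlas M ==> compatible c d"
    and g: "riemannian_metric M g"
    and bs: "\<And>i. i < k ==> bs i \<in> Atlas M" "Points M \<subseteq> (\<Union>i<k. fst (bs i))"
begin

abbreviation "\<Sigma> \<equiv> sigma_sets (Points M) {U. openin (Top M) U}"

lemma Pow_open: "{U. openin (Top M) U} \<subseteq> Pow (Points M)"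
  using openin_subset by blast

sublocale sigma_algebra "Points M" \<Sigma>
  by (rule sigma_algebra_sigma_sets[OF Pow_open])

lemma open_in_sigma: "openin (Top M) U ==> U \<in> \<Sigma>"
  by (auto intro: sigma_sets.Basic)

lemma chart_in_sigma: "c \<in> Atlas M ==> fst c \<in> \<Sigma>"
  using chart open_in_sigma by (auto simp: is_chart_def)

lemma open_image: "c \<in> Atlas M ==> open (snd c ` fst c)"
  using chart by (fastforce simp: is_chart_def)

lemma image_borel':
  assumes c: "c \<in> Atlas M" and "A \<in> \<Sigma>"
  shows "snd c ` (A \<inter> fst c) \<in> sets borel"
  using assms(2)
proof induction
  case (Basic U)
  have "openin (top_of_set UNIV) (snd c ` (U \<inter> fst c))"
    by (rule is_chart_image_openin[OF chart[OF c]]) (use Basic chart[OF c] in "auto simp: is_chart_def")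
  then show ?case by simp
next
  case Empty
  then show ?case by simp
next
  case (Compl A)
  have "snd c ` ((Points M - A) \<inter> fst c) = snd c ` fst c - snd c ` (A \<inter> fst c)"
    using is_chart_inj[OF chart[OF c]] is_chart_subset[OF chart[OF c]] by (auto simp: inj_on_def)
  then show ?case using Compl.IH open_image[OF c] by auto
next
  case (Union A)
  have "snd c ` (\<Union> (range A) \<inter> fst c) = (\<Union>i. snd c ` (A i \<inter> fst c))" by auto
  then show ?case using Union.IH by auto
qed

lemma image_borel: "c \<in> Atlas M ==> A \<in> \<Sigma> ==> A \<subseteq> fst c ==> snd c ` A \<in> sets borel"
  using image_borel'[of c A] by (simp add: Int_absorb2)

lemma preimage_sigma:
  assumes c: "c \<in> Atlas M" and "E \<in> sets borel"
  shows "{p \<in> fst c. snd c p \<in> E} \<in> \<Sigma>"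
proof -
  have "E \<in> sigma_sets UNIV {S. open S}" using assms(2) by (simp add: borel_def)
  then show ?thesis
  proof induction
    case (Basic U)
    have "continuous_map (subtopology (Top M) (fst c)) (top_of_set (snd c ` fst c)) (snd c)"
      using chart[OF c] unfolding is_chart_def by (meson homeomorphic_imp_continuous_map)
    then have "continuous_map (subtopology (Top M) (fst c)) euclidean (snd c)"
      by (simp add: continuous_map_in_subtopology)
    then have "openin (subtopology (Top M) (fst c)) {p \<in> topspace (subtopology (Top M) (fst c)). snd c p \<in> U}"
      by (rule openin_continuous_map_preimage) (use Basic in simp)
    moreover have "{p \<in> topspace (subtopology (Top M) (fst c)). snd c p \<in> U} = {p \<in> fst c. snd c p \<in> U}"
      using is_chart_subset[OF chart[OF c]] by auto
    ultimately have "openin (Top M) {p \<in> fst c. snd c p \<in> U}"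
      using chart[OF c] unfolding is_chart_def by (metis openin_trans_full)
    then show ?case by (rule open_in_sigma)
  next
    case Empty
    then show ?case by simp
  next
    case (Compl A)
    have "{p \<in> fst c. snd c p \<in> UNIV - A} = fst c - {p \<in> fst c. snd c p \<in> A}" by auto
    then show ?case using Compl.IH chart_in_sigma[OF c] by auto
  next
    case (Union A)
    have "{p \<in> fst c. snd c p \<in> \<Union> (range A)} = (\<Union>i. {p \<in> fst c. snd c p \<in> A i})" by auto
    then show ?case using Union.IH by auto
  qed
qed

text \<open>Tensor components are unconstrained off the chart image; the indicator and
  \<open>max\<close> turn the density into a nonnegative Borel function on the whole coordinate
  space.\<close>

definition dens :: "('a, 'n) chart => real ^ 'n::_ => real" where
  "dens c x = indicator (snd c ` fst c) x *\<^sub>R max 0 (sqrt (det (g c x)))"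

definition \<nu> :: "('a, 'n) chart => (real ^ 'n::_) measure" where
  "\<nu> c = density lborel (%x. ennreal (dens c x))"

lemma dens_nonneg: "0 \<le> dens c x"
  by (simp add: dens_def)

lemma dens_measurable: "c \<in> Atlas M ==> dens c \<in> borel_measurable borel"
  unfolding dens_def
proof (rule borel_measurable_continuous_on_indicator)
  assume c: "c \<in> Atlas M"
  have "continuous_on (snd c ` fst c) (g c)"
    using g c smooth_on_continuous unfolding riemannian_metric_def by blast
  then show "continuous_on (snd c ` fst c) (%x. max 0 (sqrt (det (g c x))))"
    unfolding det_def by (intro continuous_intros) auto
  show "snd c ` fst c \<in> sets borel" using open_image[OF c] by simp
qed

lemma emeasure_\<nu>:
  assumes c: "c \<in> Atlas M" and E: "E \<in> sets borel"
  shows "emeasure (\<nu> c) E = (\<integral>\<^sup>+x. ennreal (dens c x) * indicator E x \<partial>lborel)"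
  unfolding \<nu>_def by (rule emeasure_density) (use dens_measurable[OF c] E in auto)

lemma emeasure_\<nu>_image:
  assumes c: "c \<in> Atlas M" and A: "A \<in> \<Sigma>" "A \<subseteq> fst c"
  shows "emeasure (\<nu> c) (snd c ` A) = (\<integral>\<^sup>+x. ennreal (sqrt (det (g c x))) * indicator (snd c ` A) x \<partial>lborel)"
  unfolding emeasure_\<nu>[OF c image_borel[OF c A]]
proof (rule nn_integral_cong)
  fix x
  show "ennreal (dens c x) * indicator (snd c ` A) x = ennreal (sqrt (det (g c x))) * indicator (snd c ` A) x"
    using A(2) by (cases "x \<in> snd c ` A") (auto simp: dens_def max_def ennreal_neg)
qed

lemma dens_transform:
  assumes c: "c \<in> Atlas M" and d: "d \<in> Atlas M" and p: "p \<in> fst c \<inter> fst d"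
    and D: "tder c d p D"
  shows "dens c (snd c p) = \<bar>det (matrix D)\<bar> * dens d (snd d p)"
proof -
  have "g c (snd c p) = pull (matrix D) (g d (snd d p))"
  proof (rule bilin_ext)
    fix u v
    show "bilin (g c (snd c p)) u v = bilin (pull (matrix D) (g d (snd d p))) u v"
      using g c d p D has_derivative_linear[OF D] unfolding riemannian_metric_def bilin_pull
      by (simp add: matrix_works)
  qed
  then have "det (g c (snd c p)) = (det (matrix D))\<^sup>2 * det (g d (snd d p))"
    by (simp add: pull_def det_mul det_transpose power2_eq_square)
  then show ?thesis
    using p by (auto simp: dens_def real_sqrt_mult max_def zero_le_mult_iff mult_le_0_iff)
qed

text \<open>The Jacobian determinant relates the two densities. The sets \<open>A' n\<close>, on
  which the coordinates and the density in \<open>d\<close> are bounded by \<open>n\<close>, reduce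
  the change of variables to the bounded case, and continuity from below finishes.\<close>

lemma \<nu>_independent:
  assumes c: "c \<in> Atlas M" and d: "d \<in> Atlas M" and A: "A \<in> \<Sigma>" "A \<subseteq> fst c \<inter> fst d"
  shows "emeasure (\<nu> c) (snd c ` A) = emeasure (\<nu> d) (snd d ` A)"
proof -
  let ?T = "transition c d"
  define K where "K n = {y. norm y \<le> real n \<and> dens d y \<le> real n}" for n :: nat
  have "{y. norm y \<le> real n} \<inter> {y. dens d y \<le> real n} \<in> sets borel" for n
  proof (rule sets.Int)
    show "{y::real ^ 'n::_. norm y \<le> real n} \<in> sets borel" by (intro borel_closed closed_Collect_le continuous_intros)
    show "{y. dens d y \<le> real n} \<in> sets borel"
      using borel_measurable_le[OF dens_measurable[OF d] borel_measurable_const[of "real n"]] by simp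
  qed
  then have K: "K n \<in> sets borel" for n by (simp add: K_def Collect_conj_eq)
  define A' where "A' n = A \<inter> {p \<in> fst d. snd d p \<in> K n}" for n
  have A': "A' n \<in> \<Sigma>" for n unfolding A'_def using A(1) preimage_sigma[OF d K] by blast
  have sub: "A' n \<subseteq> fst c" "A' n \<subseteq> fst d" for n using A by (auto simp: A'_def)
  have inc: "incseq A'"
    unfolding incseq_def A'_def K_def by (auto intro: order_trans)
  have Un: "(\<Union>n. A' n) = A"
  proof -
    have "\<exists>n. p \<in> A' n" if "p \<in> A" for p
    proof -
      obtain n :: nat where "max (norm (snd d p)) (dens d (snd d p)) \<le> real n" using real_arch_simple by blast
      then show ?thesis using that A(2) by (intro exI[of _ n]) (auto simp: A'_def K_def)
    qed
    then show ?thesis by (auto simp: A'_def)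
  qed
  have eq: "emeasure (\<nu> c) (snd c ` A' n) = emeasure (\<nu> d) (snd d ` A' n)" for n
  proof -
    define D where "D x = (SOME D. (?T has_derivative D) (at x within snd c ` (fst c \<inter> fst d)))" for x
    have D: "(?T has_derivative D (snd c p)) (at (snd c p) within snd c ` (fst c \<inter> fst d))"
      if "p \<in> fst c \<inter> fst d" for p
      unfolding D_def by (rule someI_ex[OF transition_has_derivative[OF compat[OF c d] that]])
    have Tp: "?T (snd c p) = snd d p" if "p \<in> fst c" for p using transition_apply[OF chart[OF c] that] .
    have im: "?T ` snd c ` A' n = snd d ` A' n" using Tp sub(1)[of n] by (force simp: image_iff)
    have "(\<integral>\<^sup>+x. ennreal (\<bar>det (matrix (D x))\<bar> * dens d (?T x)) * indicator (snd c ` A' n) x \<partial>lborel) =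
      (\<integral>\<^sup>+x. ennreal (dens d x) * indicator (?T ` snd c ` A' n) x \<partial>lborel)"
    proof (rule nn_integral_change_of_variables_bounded[where C="real n"])
      show "snd c ` A' n \<in> sets borel" by (rule image_borel[OF c A' sub(1)])
      show "?T ` snd c ` A' n \<in> sets borel" unfolding im by (rule image_borel[OF d A' sub(2)])
      show "bounded (?T ` snd c ` A' n)" unfolding im by (rule boundedI[where B="real n"]) (auto simp: A'_def K_def)
      show "(?T has_derivative D x) (at x within snd c ` A' n)" if x: "x \<in> snd c ` A' n" for x
      proof -
        obtain p where p: "p \<in> A' n" "x = snd c p" using x by blast
        show ?thesis unfolding p(2) by (rule has_derivative_subset[OF D]) (use p sub[of n] in auto)
      qed
      show "inj_on ?T (snd c ` A' n)"
        using is_chart_inj[OF chart[OF d]] sub[of n] Tp by (auto simp: inj_on_def) (metis subsetD)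
      show "dens d x \<le> real n" if "x \<in> ?T ` snd c ` A' n" for x
        using that unfolding im by (auto simp: A'_def K_def)
    qed (auto simp: dens_nonneg dens_measurable[OF d])
    moreover have "ennreal (\<bar>det (matrix (D x))\<bar> * dens d (?T x)) * indicator (snd c ` A' n) x =
        ennreal (dens c x) * indicator (snd c ` A' n) x" for x
    proof (cases "x \<in> snd c ` A' n")
      case True
      then obtain p where p: "p \<in> A' n" "x = snd c p" by blast
      then have "p \<in> fst c \<inter> fst d" using sub[of n] by auto
      then show ?thesis using dens_transform[OF c d _ D, of p] p Tp by auto
    qed simp
    ultimately show ?thesis
      unfolding im using emeasure_\<nu>[OF c image_borel[OF c A' sub(1)]] emeasure_\<nu>[OF d image_borel[OF d A' sub(2)]]
      by simp
  qed
  have lim: "emeasure (\<nu> e) (snd e ` A) = (SUP n. emeasure (\<nu> e) (snd e ` A' n))"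
    if e: "e \<in> Atlas M" "\<And>n. A' n \<subseteq> fst e" for e
  proof -
    have "snd e ` A = (\<Union>n. snd e ` A' n)" unfolding Un[symmetric] by auto
    moreover have "incseq (%n. snd e ` A' n)"
      using inc unfolding incseq_def by (meson image_mono)
    moreover have "range (%n. snd e ` A' n) \<subseteq> sets (\<nu> e)"
      using image_borel[OF e(1) A' e(2)] by (auto simp: \<nu>_def)
    ultimately show ?thesis using SUP_emeasure_incseq by metis
  qed
  show ?thesis unfolding lim[OF c sub(1)] lim[OF d sub(2)] eq ..
qed

definition D :: "nat => 'a set" where
  "D i = fst (bs i) - (\<Union>j<i. fst (bs j))"

lemma D: "i < k ==> D i \<in> \<Sigma>" "D i \<subseteq> fst (bs i)" "disjoint_family_on D {..<k}" "(\<Union>i<k. D i) = Points M"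
proof -
  show "D i \<in> \<Sigma>" if "i < k"
    unfolding D_def using that chart_in_sigma[OF bs(1)] by (intro Diff finite_UN) auto
  show "D i \<subseteq> fst (bs i)" by (auto simp: D_def)
  show "disjoint_family_on D {..<k}"
    unfolding disjoint_family_on_def
  proof (intro ballI impI)
    fix m n :: nat assume "m ~= n"
    then consider "m < n" | "n < m" by linarith
    then show "D m \<inter> D n = {}" by cases (auto simp: D_def)
  qed
  have "\<exists>i<k. p \<in> D i" if p: "p \<in> Points M" for p
  proof -
    define i where "i = (LEAST i. p \<in> fst (bs i))"
    obtain j where j: "j < k" "p \<in> fst (bs j)" using bs(2) p by auto
    have "p \<in> fst (bs i)" "i \<le> j" unfolding i_def using j(2) by (auto intro: LeastI Least_le)
    moreover have "p \<notin> fst (bs l)" if "l < i" for l using that not_less_Least unfolding i_def by blast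
    ultimately show ?thesis using j by (intro exI[of _ i]) (auto simp: D_def)
  qed
  moreover have "D i \<subseteq> Points M" if "i < k" for i
    using is_chart_subset[OF chart[OF bs(1)[OF that]]] by (auto simp: D_def)
  ultimately show "(\<Union>i<k. D i) = Points M" by blast
qed

definition vol :: "'a set => ennreal" where
  "vol A = (\<Sum>i<k. emeasure (\<nu> (bs i)) (snd (bs i) ` (A \<inter> D i)))"

lemma inter_D: "A \<in> \<Sigma> ==> i < k ==> A \<inter> D i \<in> \<Sigma>" "A \<inter> D i \<subseteq> fst (bs i)"
  using D(1,2) by (blast, blast)

lemma \<nu>_partition:
  assumes A: "A \<in> \<Sigma>" "A \<subseteq> fst c" and c: "c \<in> Atlas M"
  shows "emeasure (\<nu> c) (snd c ` A) = (\<Sum>i<k. emeasure (\<nu> c) (snd c ` (A \<inter> D i)))"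
proof -
  have "A \<subseteq> Points M" using A is_chart_subset[OF chart[OF c]] by blast
  then have "A = (\<Union>i<k. A \<inter> D i)" using D(4) by blast
  then have e: "snd c ` A = (\<Union>i<k. snd c ` (A \<inter> D i))" by (metis image_UN)
  show ?thesis
    unfolding e
  proof (rule sum_emeasure[symmetric])
    show "(%i. snd c ` (A \<inter> D i)) ` {..<k} \<subseteq> sets (\<nu> c)"
      using image_borel[OF c inter_D(1)[OF A(1)]] A(2) by (auto simp: \<nu>_def le_infI1)
    show "disjoint_family_on (%i. snd c ` (A \<inter> D i)) {..<k}"
      using D(3) is_chart_inj[OF chart[OF c]] A(2) unfolding disjoint_family_on_def inj_on_def by blast
  qed simp
qed

lemma vol_chart:
  assumes c: "c \<in> Atlas M" and A: "A \<in> \<Sigma>" "A \<subseteq> fst c"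
  shows "vol A = emeasure (\<nu> c) (snd c ` A)"
  unfolding \<nu>_partition[OF A c] vol_def
proof (rule sum.cong[OF refl])
  fix i assume i: "i \<in> {..<k}"
  show "emeasure (\<nu> (bs i)) (snd (bs i) ` (A \<inter> D i)) = emeasure (\<nu> c) (snd c ` (A \<inter> D i))"
    by (rule \<nu>_independent[OF bs(1) c inter_D(1)]) (use i A D(2)[of i] in auto)
qed

lemma vol_countably_additive: "countably_additive \<Sigma> vol"
  unfolding countably_additive_def
proof (intro allI impI)
  fix A :: "nat => 'a set" assume A: "range A \<subseteq> \<Sigma>" "disjoint_family A"
  have "(\<Sum>n. emeasure (\<nu> (bs i)) (snd (bs i) ` (A n \<inter> D i))) = emeasure (\<nu> (bs i)) (snd (bs i) ` (\<Union> (range A) \<inter> D i))"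
    if i: "i < k" for i
  proof -
    have e: "snd (bs i) ` (\<Union> (range A) \<inter> D i) = (\<Union>n. snd (bs i) ` (A n \<inter> D i))" by auto
    have "snd (bs i) ` (A n \<inter> D i) \<in> sets borel" for n
      by (rule image_borel[OF bs(1)[OF i] inter_D(1)[OF _ i] inter_D(2)]) (use A(1) in auto)
    moreover have "disjoint_family (%n. snd (bs i) ` (A n \<inter> D i))"
      using A(2) is_chart_inj[OF chart[OF bs(1)[OF i]]] D(2)[of i]
      unfolding disjoint_family_on_def inj_on_def by blast
    ultimately show ?thesis unfolding e by (intro suminf_emeasure) (auto simp: \<nu>_def)
  qed
  then show "(\<Sum>n. vol (A n)) = vol (\<Union> (range A))"
    unfolding vol_def by (subst suminf_sum) auto
qed

text \<open>Each piece \<open>A \<inter> D i\<close> lies in a single chart, where the defining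
  property fixes its measure; additivity over the finite partition makes every candidate equal to
  \<open>vol\<close>.\<close>

lemma riemannian_measure_spec:
  "space (riemannian_measure M g) = Points M"
  "sets (riemannian_measure M g) = \<Sigma>"
  "\<And>c A. c \<in> Atlas M ==> A \<in> \<Sigma> ==> A \<subseteq> fst c ==>
    emeasure (riemannian_measure M g) A = emeasure (\<nu> c) (snd c ` A)"
proof -
  let ?P = "%\<mu>. space \<mu> = Points M \<and> sets \<mu> = \<Sigma> \<and>
        (\<forall>c\<in>Atlas M. \<forall>B\<in>sets \<mu>. B \<subseteq> fst c -->
           emeasure \<mu> B = (\<integral>\<^sup>+x. ennreal (sqrt (det (g c x))) * indicator (snd c ` B) x \<partial>lborel))"
  define \<mu> where "\<mu> = measure_of (Points M) \<Sigma> vol"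
  have S: "\<Sigma> \<subseteq> Pow (Points M)" using space_closed .
  have sp: "space \<mu> = Points M" "sets \<mu> = \<Sigma>" unfolding \<mu>_def using S by auto
  have em: "emeasure \<mu> A = vol A" if "A \<in> \<Sigma>" for A
    unfolding \<mu>_def
    by (rule emeasure_measure_of_sigma[OF sigma_algebra_axioms _ vol_countably_additive that])
      (auto simp: positive_def vol_def)
  have P: "?P \<mu>"
    using sp em vol_chart emeasure_\<nu>_image by auto
  have part: "emeasure \<mu>' A = (\<Sum>i<k. emeasure \<mu>' (A \<inter> D i))" if \<mu>': "sets \<mu>' = \<Sigma>" and A: "A \<in> \<Sigma>" for \<mu>' A
  proof -
    have "A = (\<Union>i<k. A \<inter> D i)" using D(4) A S by blast
    then have "emeasure \<mu>' A = emeasure \<mu>' (\<Union>i<k. A \<inter> D i)" by simp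
    also have "\<dots> = (\<Sum>i<k. emeasure \<mu>' (A \<inter> D i))"
      by (rule sum_emeasure[symmetric])
        (use D(3) inter_D(1)[OF A] \<mu>' in "auto simp: disjoint_family_on_def")
    finally show ?thesis .
  qed
  have "\<mu>' = \<mu>" if P': "?P \<mu>'" for \<mu>'
  proof (rule measure_eqI)
    show "sets \<mu>' = sets \<mu>" using P' sp by simp
    fix A assume "A \<in> sets \<mu>'"
    then have A: "A \<in> \<Sigma>" using P' by simp
    have "emeasure \<mu>' (A \<inter> D i) = emeasure \<mu> (A \<inter> D i)" if i: "i < k" for i
    proof -
      have "emeasure \<mu>'' (A \<inter> D i) =
          (\<integral>\<^sup>+x. ennreal (sqrt (det (g (bs i) x))) * indicator (snd (bs i) ` (A \<inter> D i)) x \<partial>lborel)"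
        if "?P \<mu>''" for \<mu>''
        using that inter_D(1)[OF A i] inter_D(2)[of A i] bs(1)[OF i] by blast
      from this[OF P] this[OF P'] show ?thesis by simp
    qed
    then show "emeasure \<mu>' A = emeasure \<mu> A"
      using part[of \<mu>' A] part[of \<mu> A] P' sp(2) A by simp
  qed
  then have "riemannian_measure M g = \<mu>"
    unfolding riemannian_measure_def by (intro the_equality P)
  then show "space (riemannian_measure M g) = Points M" "sets (riemannian_measure M g) = \<Sigma>"
    "\<And>c A. c \<in> Atlas M ==> A \<in> \<Sigma> ==> A \<subseteq> fst c ==>
      emeasure (riemannian_measure M g) A = emeasure (\<nu> c) (snd c ` A)"
    using sp em vol_chart by auto
qed

text \<open>The chart pushes the restricted measure forward to \<open>\<nu> c\<close>, because both
  give the same mass to preimages of Borel sets.\<close>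

lemma riemannian_nn_integral:
  assumes c: "c \<in> Atlas M" and \<phi>: "\<phi> \<in> borel_measurable borel"
  shows "(\<integral>\<^sup>+p\<in>fst c. \<phi> (snd c p) \<partial>riemannian_measure M g) = (\<integral>\<^sup>+x. ennreal (dens c x) * \<phi> x \<partial>lborel)"
proof -
  let ?\<mu> = "riemannian_measure M g"
  let ?R = "restrict_space ?\<mu> (fst c)"
  have fc: "fst c \<inter> space ?\<mu> \<in> sets ?\<mu>" "fst c \<inter> space ?\<mu> = fst c"
    using chart_in_sigma[OF c] is_chart_subset[OF chart[OF c]] riemannian_measure_spec(1,2) by (auto simp: Int_absorb2)
  have meas: "snd c \<in> measurable ?R borel"
  proof (rule measurableI)
    fix E :: "(real ^ 'n::_) set" assume E: "E \<in> sets borel"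
    have "snd c -` E \<inter> space ?R = {p \<in> fst c. snd c p \<in> E}"
      using fc(2) by (auto simp: space_restrict_space)
    then show "snd c -` E \<inter> space ?R \<in> sets ?R"
      using preimage_sigma[OF c E] fc riemannian_measure_spec(2) by (auto simp: sets_restrict_space_iff)
  qed simp
  have "distr ?R borel (snd c) = \<nu> c"
  proof (rule measure_eqI)
    show "sets (distr ?R borel (snd c)) = sets (\<nu> c)" by (simp add: \<nu>_def)
    fix E assume "E \<in> sets (distr ?R borel (snd c))"
    then have E: "E \<in> sets borel" by simp
    let ?A = "{p \<in> fst c. snd c p \<in> E}"
    have "emeasure (distr ?R borel (snd c)) E = emeasure ?R ?A"
      using fc(2) by (subst emeasure_distr[OF meas E]) (auto simp: space_restrict_space intro!: arg_cong[where f="emeasure _"])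
    also have "\<dots> = emeasure ?\<mu> ?A" by (rule emeasure_restrict_space[OF fc(1)]) auto
    also have "\<dots> = emeasure (\<nu> c) (snd c ` ?A)"
      by (rule riemannian_measure_spec(3)[OF c preimage_sigma[OF c E]]) auto
    also have "\<dots> = emeasure (\<nu> c) E"
      unfolding emeasure_\<nu>[OF c E] emeasure_\<nu>[OF c image_borel[OF c preimage_sigma[OF c E] Collect_restrict]]
      by (rule nn_integral_cong) (auto simp: dens_def split: split_indicator)
    finally show "emeasure (distr ?R borel (snd c)) E = emeasure (\<nu> c) E" .
  qed
  then have "(\<integral>\<^sup>+x. \<phi> x \<partial>\<nu> c) = (\<integral>\<^sup>+p. \<phi> (snd c p) \<partial>?R)"
    using nn_integral_distr[OF meas, of \<phi>] \<phi> by (simp add: \<nu>_def)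
  also have "\<dots> = (\<integral>\<^sup>+p\<in>fst c. \<phi> (snd c p) \<partial>?\<mu>)" by (rule nn_integral_restrict_space[OF fc(1)])
  finally show ?thesis
    unfolding \<nu>_def using nn_integral_density[of "%x. ennreal (dens c x)" lborel \<phi>] dens_measurable[OF c] \<phi> by simp
qed

end

section \<open>Invariance of curvature\<close>

definition Pd :: "'n::finite => (real ^ 'n => 'b::real_normed_vector) => real ^ 'n => 'b" where
  "Pd i F x = Dat F x (axis i 1)"

lemma partial_Pd: "partial = Pd"
  by (intro ext) (simp add: partial_def Pd_def)

lemma Pd_eqI: "(F has_derivative F') (at x) ==> Pd i F x = F' (axis i 1)"
  unfolding Pd_def using frechet_derivative_at by metis

lemma C_inf_Pd: "open U ==> C_inf U F ==> C_inf U (Pd i F)"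
  unfolding Pd_def[abs_def] by (rule C_inf_frechet)

lemma Pd_cong: "open U ==> C_inf U F ==> x \<in> U ==> (\<And>y. y \<in> U ==> F y = H y) ==> Pd i F x = Pd i H x"
  unfolding Pd_def using frechet_derivative_transform_within_open C_inf_differentiable by metis

lemma Pd_linear:
  "bounded_linear L ==> C_inf U F ==> x \<in> U ==> Pd i (%y. L (F y)) x = L (Pd i F x)"
  using Pd_eqI[OF bounded_linear.has_derivative[OF _ C_inf_has_derivative]] by (simp add: Pd_def)

lemma Pd_nth: "C_inf U F ==> x \<in> U ==> Pd i (%y. F y $ k) x = Pd i F x $ k"
  by (rule Pd_linear[OF bounded_linear_vec_nth])

lemma Pd_bilinear:
  assumes "bounded_bilinear B" "C_inf U F" "C_inf U H" "x \<in> U"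
  shows "Pd i (%y. B (F y) (H y)) x = B (Pd i F x) (H x) + B (F x) (Pd i H x)"
  using Pd_eqI[OF bounded_bilinear.FDERIV[OF assms(1) C_inf_has_derivative[OF assms(2,4)]
        C_inf_has_derivative[OF assms(3,4)]]]
  by (simp add: Pd_def add.commute)

lemma Pd_diff:
  assumes "C_inf U F" "C_inf U H" "x \<in> U"
  shows "Pd i (%y. F y - H y) x = Pd i F x - Pd i H x"
  using Pd_eqI[OF has_derivative_diff[OF C_inf_has_derivative[OF assms(1,3)] C_inf_has_derivative[OF assms(2,3)]]]
  by (simp add: Pd_def)

lemma Pd_sum:
  assumes "\<And>a. a \<in> I ==> C_inf U (F a)" "x \<in> U"
  shows "Pd i (%y. \<Sum>a\<in>I. F a y) x = (\<Sum>a\<in>I. Pd i (F a) x)"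
  using Pd_eqI[OF has_derivative_sum[OF C_inf_has_derivative[OF assms]]] by (simp add: Pd_def)

lemma Pd_chain:
  assumes "C_inf U \<phi>" "C_inf V F" "x \<in> U" "\<phi> x \<in> V"
  shows "Pd i (%y. F (\<phi> y)) x = (\<Sum>a\<in>UNIV. (Pd i \<phi> x $ a) *\<^sub>R Pd a F (\<phi> x))"
proof -
  note dF = C_inf_has_derivative[OF assms(2,4)]
  interpret bounded_linear "Dat F (\<phi> x)" using dF by (rule has_derivative_bounded_linear)
  have "Pd i (%y. F (\<phi> y)) x = Dat F (\<phi> x) (Pd i \<phi> x)"
    using Pd_eqI[OF has_derivative_compose[OF C_inf_has_derivative[OF assms(1,3)] dF]] by (simp add: Pd_def)
  also have "\<dots> = Dat F (\<phi> x) (\<Sum>a\<in>UNIV. (Pd i \<phi> x $ a) *\<^sub>R axis a 1)"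
    using basis_expansion[of "Pd i \<phi> x"] by (simp add: scalar_mult_eq_scaleR)
  finally show ?thesis by (simp add: sum scaleR Pd_def)
qed

lemma Pd_commute:
  fixes F :: "real ^ 'n::finite => real ^ 'm::finite"
  assumes "open U" "C_inf U F" "x \<in> U"
  shows "Pd i (Pd j F) x = Pd j (Pd i F) x"
proof (rule vec_eq_iff[THEN iffD2], rule allI)
  fix k
  have "Pd i (Pd j F) x $ k = Pd i (Pd j (%y. F y $ k)) x" for i j
  proof -
    have "Pd i (Pd j F) x $ k = Pd i (%y. Pd j F y $ k) x"
      by (rule Pd_nth[OF C_inf_Pd[OF assms(1,2)] assms(3), symmetric])
    also have "\<dots> = Pd i (Pd j (%y. F y $ k)) x"
      by (rule Pd_cong[OF assms(1) C_inf_nth[OF assms(1) C_inf_Pd[OF assms(1,2)]] assms(3)])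
        (rule Pd_nth[OF assms(2), symmetric])
    finally show ?thesis .
  qed
  then show "Pd i (Pd j F) x $ k = Pd j (Pd i F) x $ k"
    using mixed_derivatives_commute[OF assms(1) C_inf_nth[OF assms(1,2)] assms(3)]
    unfolding Pd_def[abs_def] by metis
qed

lemma bounded_bilinear_matrix: "bounded_bilinear ((**) :: real ^ 'n::finite ^ 'm::finite => real ^ 'k::finite ^ 'n => _)"
  by (intro bilinear_conv_bounded_bilinear[THEN iffD1])
    (auto simp: bilinear_def matrix_matrix_mult_def vec_eq_iff sum.distrib algebra_simps sum_distrib_left intro!: linearI)

interpretation mm: bounded_bilinear "(**) :: real ^ 'n::finite ^ 'm::finite => real ^ 'k::finite ^ 'n => _"
  by (rule bounded_bilinear_matrix)

lemma matrix_inv_works: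
  fixes A :: "real ^ 'n::finite ^ 'n"
  assumes "det A ~= 0"
  shows "matrix_inv A ** A = mat 1" "A ** matrix_inv A = mat 1"
proof -
  have "\<exists>B. A ** B = mat 1 \<and> B ** A = mat 1"
    using assms invertible_det_nz[of A] by (simp add: invertible_def)
  then have "A ** matrix_inv A = mat 1 \<and> matrix_inv A ** A = mat 1"
    unfolding matrix_inv_def by (rule someI_ex)
  then show "matrix_inv A ** A = mat 1" "A ** matrix_inv A = mat 1" by auto
qed

lemma C_inf_prod:
  fixes f :: "'i => 'a::euclidean_space => real"
  assumes "open U" "\<And>i. i \<in> I ==> C_inf U (f i)"
  shows "C_inf U (%x. \<Prod>i\<in>I. f i x)"
proof (cases "finite I")
  case True
  then show ?thesis using assms(2) by (induction I) (auto simp: assms(1) intro: C_inf_const C_inf_mult)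
qed (simp add: C_inf_const assms(1))

lemma C_inf_det:
  fixes A :: "'a::euclidean_space => real ^ 'n::finite ^ 'n"
  shows "open U ==> C_inf U A ==> C_inf U (%x. det (A x))"
  unfolding det_def by (intro C_inf_sum C_inf_mult C_inf_const C_inf_prod C_inf_nth)

text \<open>By Cramer's rule the entries of the inverse are quotients of determinants.\<close>

lemma C_inf_matrix_inv:
  fixes A :: "'a::euclidean_space => real ^ 'n::finite ^ 'n"
  assumes U: "open U" "C_inf U A" and d: "\<And>x. x \<in> U ==> det (A x) ~= 0"
  shows "C_inf U (%x. matrix_inv (A x))"
proof (intro C_inf_vec U(1))
  fix k l :: 'n
  let ?C = "%x. (\<chi> i j. if j = k then axis l 1 $ i else A x $ i $ j) :: real ^ 'n ^ 'n"
  have "C_inf U ?C"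
  proof (intro C_inf_vec U(1))
    fix i j
    show "C_inf U (%x. ?C x $ i $ j)"
      by (cases "j = k") (auto intro!: C_inf_const C_inf_nth U)
  qed
  then have 1: "C_inf U (%x. det (?C x) / det (A x))"
    by (intro C_inf_divide C_inf_det U d) auto
  show "C_inf U (%x. matrix_inv (A x) $ k $ l)"
  proof (rule C_inf_cong[OF U(1) _ 1])
    fix x assume x: "x \<in> U"
    have "A x *v (matrix_inv (A x) *v axis l 1) = axis l 1"
      by (simp add: matrix_vector_mul_assoc matrix_inv_works(2)[OF d[OF x]])
    then have "matrix_inv (A x) *v axis l 1 = (\<chi> k. det (\<chi> i j. if j = k then axis l 1 $ i else A x $ i $ j) / det (A x))"
      using cramer[OF d[OF x]] by blast
    moreover have "matrix_inv (A x) $ k $ l = (matrix_inv (A x) *v axis l 1) $ k"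
      by (simp add: matrix_vector_mult_basis column_def)
    ultimately show "det (?C x) / det (A x) = matrix_inv (A x) $ k $ l" by simp
  qed
qed

lemma C_inf_christoffel:
  assumes U: "open U" "C_inf U G" "\<And>x. x \<in> U ==> det (G x) ~= 0"
  shows "C_inf U (christoffel G k i j)"
proof -
  have "C_inf U (%x. (\<Sum>l\<in>UNIV. matrix_inv (G x) $ k $ l *
        (Pd i (%y. G y $ j $ l) x + Pd j (%y. G y $ i $ l) x - Pd l (%y. G y $ i $ j) x)) / 2)"
    by (intro C_inf_divide C_inf_sum C_inf_mult C_inf_diff C_inf_add C_inf_nth C_inf_matrix_inv C_inf_Pd[unfolded Pd_def] C_inf_const U
        C_inf_Pd) auto
  then show ?thesis unfolding christoffel_def[abs_def] partial_Pd .
qed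

text \<open>The matrix of the connection form in direction \<open>i\<close>. With it the curvature
  takes the form \<open>dA + A \<and> A\<close>, and its transformation becomes matrix
  algebra.\<close>

definition conn :: "(real ^ 'n::finite => real ^ 'n ^ 'n) => 'n => real ^ 'n => real ^ 'n ^ 'n" where
  "conn G i x = (\<chi> k l. christoffel G k i l x)"

definition curv :: "(real ^ 'n::finite => real ^ 'n ^ 'n) => 'n => 'n => real ^ 'n => real ^ 'n ^ 'n" where
  "curv G i j x = Pd i (conn G j) x - Pd j (conn G i) x + (conn G i x ** conn G j x - conn G j x ** conn G i x)"

lemma C_inf_conn:
  assumes "open U" "C_inf U G" "\<And>x. x \<in> U ==> det (G x) ~= 0"
  shows "C_inf U (conn G i)"
  by (intro C_inf_vec assms(1)) (simp add: conn_def C_inf_christoffel[OF assms])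

lemma riemann_curv:
  assumes "open U" "C_inf U G" "\<And>x. x \<in> U ==> det (G x) ~= 0" "x \<in> U"
  shows "riemann G k l i j x = curv G i j x $ k $ l"
proof -
  note c = C_inf_conn[OF assms(1-3)]
  have "Pd i (christoffel G k j l) x = Pd i (conn G j) x $ k $ l" for i j
  proof -
    have "Pd i (%y. conn G j y $ k $ l) x = Pd i (conn G j) x $ k $ l"
      using Pd_nth[OF C_inf_nth[OF assms(1) c] assms(4)] Pd_nth[OF c assms(4)] by simp
    then show ?thesis by (simp add: conn_def)
  qed
  then show ?thesis
    by (simp add: riemann_def partial_Pd curv_def matrix_matrix_mult_def conn_def sum_subtractf)
qed

section \<open>Connection and curvature under a change of coordinates\<close>

locale coordinate_change =
  fixes U V :: "(real ^ 'n::finite) set" and \<phi> :: "real ^ 'n => real ^ 'n"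
    and G G' :: "real ^ 'n => real ^ 'n ^ 'n"
  assumes U: "open U" "C_inf U \<phi>" and V: "open V" "C_inf V G" and im: "\<phi> ` U \<subseteq> V"
    and G': "\<And>x. x \<in> U ==> G' x = pull (matrix (Dat \<phi> x)) (G (\<phi> x))"
    and J0: "\<And>x. x \<in> U ==> det (matrix (Dat \<phi> x)) ~= 0"
    and G: "\<And>y. y \<in> V ==> transpose (G y) = G y" "\<And>y. y \<in> V ==> det (G y) ~= 0"
begin

definition J :: "real ^ 'n => real ^ 'n ^ 'n" where "J x = matrix (Dat \<phi> x)"

lemma J_nth: "J x $ a $ i = Pd i \<phi> x $ a"
  by (simp add: J_def matrix_def Pd_def)

lemma C_inf_J: "C_inf U J"
  by (intro C_inf_vec U(1); unfold J_nth; intro C_inf_nth C_inf_Pd U)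

lemma G'_pull: "x \<in> U ==> G' x = pull (J x) (G (\<phi> x))"
  by (simp add: G' J_def)

lemma C_inf_G\<phi>: "C_inf U (%x. G (\<phi> x))"
  by (rule C_inf_compose[OF U(1) V(1) im U(2) V(2)])

lemma C_inf_G': "C_inf U G'"
  by (rule C_inf_cong[OF U(1) _ C_inf_pull[OF U(1) C_inf_J C_inf_G\<phi>]]) (simp add: G'_pull)

lemma det_G': "x \<in> U ==> det (G' x) ~= 0"
  using J0[of x] G(2) im by (auto simp: G'_pull pull_def det_mul det_transpose J_def)

lemma inv_J: "x \<in> U ==> matrix_inv (J x) ** J x = mat 1" "x \<in> U ==> J x ** matrix_inv (J x) = mat 1"
  using J0[of x] by (auto simp: J_def intro: matrix_inv_works)

abbreviation "HH i j x \<equiv> Pd i (Pd j \<phi>) x"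

lemma H_sym: "x \<in> U ==> HH i j x = HH j i x"
  by (rule Pd_commute[OF U])

lemma Pd_J: "x \<in> U ==> Pd i J x $ a $ l = HH i l x $ a"
proof -
  assume x: "x \<in> U"
  have "Pd i J x $ a $ l = Pd i (%y. J y $ a $ l) x"
    using Pd_nth[OF C_inf_nth[OF U(1) C_inf_J] x] Pd_nth[OF C_inf_J x] by simp
  also have "\<dots> = HH i l x $ a" unfolding J_nth by (rule Pd_nth[OF C_inf_Pd[OF U] x])
  finally show ?thesis .
qed

lemma G'_nth: "x \<in> U ==> G' x $ i $ j = bilin (G (\<phi> x)) (Pd i \<phi> x) (Pd j \<phi> x)"
proof -
  assume x: "x \<in> U"
  have "J x *v axis i 1 = Pd i \<phi> x" for i
    by (simp add: matrix_vector_mult_basis column_def vec_eq_iff) (simp add: J_nth)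
  then show ?thesis
    using bilin_axis[of "G' x" i j] bilin_pull[of "J x" "G (\<phi> x)" "axis i 1" "axis j 1"] by (simp add: G'_pull[OF x])
qed

lemma bilin_sym: "y \<in> V ==> bilin (G y) u v = bilin (G y) v u"
  using G(1)[of y] unfolding bilin_inner by (metis dot_lmul_matrix inner_commute vector_transpose_matrix)

definition D3 :: "real ^ 'n => real ^ 'n => real ^ 'n => real ^ 'n => real" where
  "D3 y u v w = (\<Sum>c\<in>UNIV. u $ c * bilin (Pd c G y) v w)"

lemma Pd_G':
  assumes x: "x \<in> U"
  shows "Pd k (%y. G' y $ i $ j) x = bilin (G (\<phi> x)) (HH k i x) (Pd j \<phi> x)
    + bilin (G (\<phi> x)) (Pd i \<phi> x) (HH k j x) + D3 (\<phi> x) (Pd k \<phi> x) (Pd i \<phi> x) (Pd j \<phi> x)"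
proof -
  note Pi = C_inf_Pd[OF U]
  have fx: "\<phi> x \<in> V" using im x by auto
  have e: "bilin (G (\<phi> y)) (Pd i \<phi> y) (Pd j \<phi> y) = (\<Sum>a\<in>UNIV. \<Sum>b\<in>UNIV. (G (\<phi> y) $ a $ b) * (Pd i \<phi> y $ a * Pd j \<phi> y $ b))" for y
    by (simp add: bilin_def mult.assoc)
  have "Pd k (%y. G' y $ i $ j) x = Pd k (%y. bilin (G (\<phi> y)) (Pd i \<phi> y) (Pd j \<phi> y)) x"
    by (rule Pd_cong[OF U(1) _ x]) (auto simp: G'_nth intro!: C_inf_nth C_inf_G' U)
  also have "\<dots> = (\<Sum>a\<in>UNIV. \<Sum>b\<in>UNIV. Pd k (%y. (G (\<phi> y) $ a $ b) * (Pd i \<phi> y $ a * Pd j \<phi> y $ b)) x)"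
    unfolding e by (subst Pd_sum[OF _ x]; (subst Pd_sum[OF _ x])?)
      (auto intro!: C_inf_sum C_inf_mult C_inf_nth C_inf_G\<phi> Pi U sum.cong Pd_sum[OF _ x])
  also have "\<dots> = (\<Sum>a\<in>UNIV. \<Sum>b\<in>UNIV. (Pd k (%y. G (\<phi> y)) x $ a $ b) * (Pd i \<phi> x $ a * Pd j \<phi> x $ b)
      + (G (\<phi> x) $ a $ b) * (HH k i x $ a * Pd j \<phi> x $ b + Pd i \<phi> x $ a * HH k j x $ b))"
  proof (intro sum.cong refl)
    fix a b
    show "Pd k (%y. (G (\<phi> y) $ a $ b) * (Pd i \<phi> y $ a * Pd j \<phi> y $ b)) x =
      (Pd k (%y. G (\<phi> y)) x $ a $ b) * (Pd i \<phi> x $ a * Pd j \<phi> x $ b)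
      + (G (\<phi> x) $ a $ b) * (HH k i x $ a * Pd j \<phi> x $ b + Pd i \<phi> x $ a * HH k j x $ b)"
      using Pd_bilinear[OF bounded_bilinear_mult C_inf_nth[OF U(1) C_inf_nth[OF U(1) C_inf_G\<phi>]]
          C_inf_mult[OF U(1) C_inf_nth[OF U(1) Pi] C_inf_nth[OF U(1) Pi]] x, of k a b i a j b]
        Pd_bilinear[OF bounded_bilinear_mult C_inf_nth[OF U(1) Pi] C_inf_nth[OF U(1) Pi] x, of k i a j b]
        Pd_nth[OF C_inf_nth[OF U(1) C_inf_G\<phi>] x] Pd_nth[OF C_inf_G\<phi> x] Pd_nth[OF Pi x]
      by simp
  qed
  also have "\<dots> = (\<Sum>a\<in>UNIV. \<Sum>b\<in>UNIV. (Pd k (%y. G (\<phi> y)) x $ a $ b) * Pd i \<phi> x $ a * Pd j \<phi> x $ b)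
      + bilin (G (\<phi> x)) (HH k i x) (Pd j \<phi> x) + bilin (G (\<phi> x)) (Pd i \<phi> x) (HH k j x)"
    by (simp add: bilin_def sum.distrib algebra_simps)
  also have "(\<Sum>a\<in>UNIV. \<Sum>b\<in>UNIV. (Pd k (%y. G (\<phi> y)) x $ a $ b) * Pd i \<phi> x $ a * Pd j \<phi> x $ b)
      = D3 (\<phi> x) (Pd k \<phi> x) (Pd i \<phi> x) (Pd j \<phi> x)"
  proof -
    have "(\<Sum>a\<in>UNIV. \<Sum>b\<in>UNIV. (Pd k (%y. G (\<phi> y)) x $ a $ b) * Pd i \<phi> x $ a * Pd j \<phi> x $ b)
      = (\<Sum>a\<in>UNIV. \<Sum>b\<in>UNIV. \<Sum>c\<in>UNIV. Pd k \<phi> x $ c * (Pd c G (\<phi> x) $ a $ b * Pd i \<phi> x $ a * Pd j \<phi> x $ b))"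
      by (simp add: Pd_chain[OF U(2) V(2) x fx] sum_distrib_right sum_distrib_left mult_ac)
    also have "\<dots> = (\<Sum>a\<in>UNIV. \<Sum>c\<in>UNIV. \<Sum>b\<in>UNIV. Pd k \<phi> x $ c * (Pd c G (\<phi> x) $ a $ b * Pd i \<phi> x $ a * Pd j \<phi> x $ b))"
      by (intro sum.cong refl sum.swap)
    also have "\<dots> = (\<Sum>c\<in>UNIV. \<Sum>a\<in>UNIV. \<Sum>b\<in>UNIV. Pd k \<phi> x $ c * (Pd c G (\<phi> x) $ a $ b * Pd i \<phi> x $ a * Pd j \<phi> x $ b))"
      by (rule sum.swap)
    finally show ?thesis by (simp add: D3_def bilin_def sum_distrib_left)
  qed
  finally show ?thesis by simp
qed

definition Gam :: "(real ^ 'n => real ^ 'n ^ 'n) => 'n => 'n => real ^ 'n => real ^ 'n" where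
  "Gam F i j x = (\<chi> k. christoffel F k i j x)"

lemma lower_Gam:
  assumes "det (F x) ~= 0"
  shows "F x *v Gam F i j x = (\<chi> l. (Pd i (%y. F y $ j $ l) x + Pd j (%y. F y $ i $ l) x - Pd l (%y. F y $ i $ j) x) / 2)"
proof -
  have "Gam F i j x = matrix_inv (F x) *v (\<chi> l. (Pd i (%y. F y $ j $ l) x + Pd j (%y. F y $ i $ l) x - Pd l (%y. F y $ i $ j) x) / 2)"
    by (simp add: vec_eq_iff Gam_def christoffel_def partial_Pd matrix_vector_mult_def sum_divide_distrib)
  moreover have "F x ** matrix_inv (F x) = mat 1" by (rule matrix_inv_works(2)[OF assms])
  ultimately show ?thesis by (simp add: matrix_vector_mul_assoc)
qed

lemma transpose_J_nth: "(transpose (J x) *v q) $ l = Pd l \<phi> x \<bullet> q"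
  by (simp add: matrix_vector_mult_def transpose_def inner_vec_def) (simp add: J_nth)

text \<open>Both sides are compared after applying \<open>transpose (J x)\<close> and the metric,
  which lowers the index. Of the six terms with second derivatives of \<open>\<phi>\<close> all but
  the two equal ones with \<open>HH i j x\<close> cancel, by symmetry of \<open>HH\<close> and of
  the metric.\<close>

lemma christoffel_transform:
  assumes x: "x \<in> U"
  shows "J x *v Gam G' i j x = HH i j x +
    (\<Sum>a\<in>UNIV. \<Sum>b\<in>UNIV. (Pd i \<phi> x $ a * Pd j \<phi> x $ b) *\<^sub>R Gam G a b (\<phi> x))"
proof -
  define y where "y = \<phi> x"
  have y: "y \<in> V" using im x by (auto simp: y_def)
  define Z where "Z = HH i j x + (\<Sum>a\<in>UNIV. \<Sum>b\<in>UNIV. (Pd i \<phi> x $ a * Pd j \<phi> x $ b) *\<^sub>R Gam G a b y)"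
  have D3e: "D3 y (Pd i \<phi> x) (Pd j \<phi> x) w = (\<Sum>a\<in>UNIV. \<Sum>b\<in>UNIV. \<Sum>c\<in>UNIV.
      Pd i \<phi> x $ a * Pd j \<phi> x $ b * w $ c * Pd a G y $ b $ c)" for i j w
    by (simp add: D3_def bilin_def sum_distrib_left mult_ac)
  have D3l: "D3 y (Pd l \<phi> x) (Pd i \<phi> x) (Pd j \<phi> x) = (\<Sum>a\<in>UNIV. \<Sum>b\<in>UNIV. \<Sum>c\<in>UNIV.
      Pd i \<phi> x $ a * Pd j \<phi> x $ b * Pd l \<phi> x $ c * Pd c G y $ a $ b)" for l
  proof -
    have "D3 y (Pd l \<phi> x) (Pd i \<phi> x) (Pd j \<phi> x) = (\<Sum>c\<in>UNIV. \<Sum>a\<in>UNIV. \<Sum>b\<in>UNIV.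
      Pd i \<phi> x $ a * Pd j \<phi> x $ b * Pd l \<phi> x $ c * Pd c G y $ a $ b)"
      by (simp add: D3_def bilin_def sum_distrib_left mult_ac)
    also have "\<dots> = (\<Sum>a\<in>UNIV. \<Sum>c\<in>UNIV. \<Sum>b\<in>UNIV.
      Pd i \<phi> x $ a * Pd j \<phi> x $ b * Pd l \<phi> x $ c * Pd c G y $ a $ b)" by (rule sum.swap)
    also have "\<dots> = (\<Sum>a\<in>UNIV. \<Sum>b\<in>UNIV. \<Sum>c\<in>UNIV.
      Pd i \<phi> x $ a * Pd j \<phi> x $ b * Pd l \<phi> x $ c * Pd c G y $ a $ b)" by (intro sum.cong refl sum.swap)
    finally show ?thesis .
  qed
  have D3j: "D3 y (Pd j \<phi> x) (Pd i \<phi> x) w = (\<Sum>a\<in>UNIV. \<Sum>b\<in>UNIV. \<Sum>c\<in>UNIV.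
      Pd i \<phi> x $ a * Pd j \<phi> x $ b * w $ c * Pd b G y $ a $ c)" for w
    unfolding D3e by (subst sum.swap) (simp add: mult_ac)
  have Gy: "bilin (G y) (Gam G a b y) w = (\<Sum>c\<in>UNIV. w $ c * ((Pd a G y $ b $ c + Pd b G y $ a $ c - Pd c G y $ a $ b) / 2))" for a b w
  proof -
    have n: "Pd c (%y. G y $ a $ b) y = Pd c G y $ a $ b" for a b c
      using Pd_nth[OF C_inf_nth[OF V] y] Pd_nth[OF V(2) y] by simp
    have "bilin (G y) (Gam G a b y) w = w \<bullet> (G y *v Gam G a b y)"
      using bilin_sym[OF y] by (simp add: bilin_inner)
    then show ?thesis unfolding lower_Gam[of G, OF G(2)[OF y]] n by (simp add: inner_vec_def)
  qed
  have "transpose (J x) *v (G y *v (J x *v Gam G' i j x)) = G' x *v Gam G' i j x"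
    by (simp add: G'_pull[OF x] pull_def y_def matrix_vector_mul_assoc matrix_mul_assoc)
  also have "\<dots> = transpose (J x) *v (G y *v Z)"
    unfolding lower_Gam[of G', OF det_G'[OF x]]
  proof (rule vec_eq_iff[THEN iffD2], rule allI)
    fix l
    let ?w = "Pd l \<phi> x"
    have "(Pd i (%y. G' y $ j $ l) x + Pd j (%y. G' y $ i $ l) x - Pd l (%y. G' y $ i $ j) x) / 2
      = bilin (G y) (HH i j x) ?w +
        (D3 y (Pd i \<phi> x) (Pd j \<phi> x) ?w + D3 y (Pd j \<phi> x) (Pd i \<phi> x) ?w - D3 y ?w (Pd i \<phi> x) (Pd j \<phi> x)) / 2"
      unfolding Pd_G'[OF x] y_def[symmetric]
      using H_sym[OF x, of i j] H_sym[OF x, of i l] H_sym[OF x, of j l] bilin_sym[OF y, of "HH l i x"]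
      by (simp add: field_simps)
    also have "(D3 y (Pd i \<phi> x) (Pd j \<phi> x) ?w + D3 y (Pd j \<phi> x) (Pd i \<phi> x) ?w - D3 y ?w (Pd i \<phi> x) (Pd j \<phi> x)) / 2 =
       (\<Sum>a\<in>UNIV. \<Sum>b\<in>UNIV. (Pd i \<phi> x $ a * Pd j \<phi> x $ b) * bilin (G y) (Gam G a b y) ?w)"
      unfolding D3e[of i j] D3l D3j Gy
      by (simp add: sum.distrib[symmetric] sum_subtractf[symmetric] sum_divide_distrib sum_distrib_left)
        (intro sum.cong refl, simp add: field_simps)
    also have "bilin (G y) (HH i j x) ?w + \<dots> = bilin (G y) Z ?w"
      unfolding Z_def bilin_inner
      by (simp add: inner_add_left inner_sum_left)
    also have "\<dots> = ?w \<bullet> (G y *v Z)" using bilin_sym[OF y] by (simp add: bilin_inner)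
    also have "\<dots> = (transpose (J x) *v (G y *v Z)) $ l"
      by (rule transpose_J_nth[symmetric])
    finally show "(\<chi> l. (Pd i (%y. G' y $ j $ l) x + Pd j (%y. G' y $ i $ l) x - Pd l (%y. G' y $ i $ j) x) / 2) $ l
      = (transpose (J x) *v (G y *v Z)) $ l" by simp
  qed
  finally have 1: "transpose (J x) *v (G y *v (J x *v Gam G' i j x)) = transpose (J x) *v (G y *v Z)" .
  have "det (transpose (J x)) ~= 0" using J0[OF x] by (simp add: J_def det_transpose)
  then have "J x *v Gam G' i j x = Z"
    using 1 matrix_inv_works(1)[OF G(2)[OF y]] matrix_inv_works(1)[of "transpose (J x)"]
    by (metis matrix_vector_mul_assoc matrix_vector_mul_lid)
  then show ?thesis by (simp add: Z_def y_def)
qed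

text \<open>The connection form of \<open>G\<close> pulled back along \<open>\<phi>\<close>, still
  expressed in the coordinate frame of the target.\<close>

definition Bc :: "'n => real ^ 'n => real ^ 'n ^ 'n" where
  "Bc i x = (\<Sum>a\<in>UNIV. (Pd i \<phi> x $ a) *\<^sub>R conn G a (\<phi> x))"

lemma C_inf_conn\<phi>: "C_inf U (%x. conn G a (\<phi> x))"
  by (rule C_inf_compose[OF U(1) V(1) im U(2) C_inf_conn[OF V G(2)]])

lemma C_inf_Bc: "C_inf U (Bc i)"
  unfolding Bc_def[abs_def] by (intro C_inf_sum C_inf_scaleR C_inf_nth C_inf_Pd C_inf_conn\<phi> U)

lemma C_inf_conn': "C_inf U (conn G' i)"
  by (rule C_inf_conn[OF U(1) C_inf_G' det_G'])

text \<open>The inhomogeneous law for Christoffel symbols, read as the gauge transformation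
  \<open>dJ = J A' - B J\<close>; second derivatives of \<open>\<phi>\<close> occur only as
  derivatives of \<open>J\<close>.\<close>

lemma Pd_J_conn:
  assumes x: "x \<in> U"
  shows "Pd i J x = J x ** conn G' i x - Bc i x ** J x"
proof (rule vec_eq_iff[THEN iffD2], rule allI, rule vec_eq_iff[THEN iffD2], rule allI)
  fix c l
  have "(J x ** conn G' i x) $ c $ l = (J x *v Gam G' i l x) $ c"
    by (simp add: matrix_matrix_mult_def matrix_vector_mult_def conn_def Gam_def)
  also have "\<dots> = HH i l x $ c + (\<Sum>a\<in>UNIV. \<Sum>b\<in>UNIV. Pd i \<phi> x $ a * Pd l \<phi> x $ b * christoffel G c a b (\<phi> x))"
    unfolding christoffel_transform[OF x] by (simp add: Gam_def)
  also have "(\<Sum>a\<in>UNIV. \<Sum>b\<in>UNIV. Pd i \<phi> x $ a * Pd l \<phi> x $ b * christoffel G c a b (\<phi> x)) = (Bc i x ** J x) $ c $ l"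
    by (subst sum.swap) (simp add: matrix_matrix_mult_def Bc_def conn_def J_nth sum_distrib_right sum_distrib_left mult_ac)
  finally show "Pd i J x $ c $ l = (J x ** conn G' i x - Bc i x ** J x) $ c $ l"
    by (simp add: Pd_J[OF x])
qed

lemma Pd_Pd_J:
  assumes x: "x \<in> U"
  shows "Pd j (Pd i J) x = Pd j J x ** conn G' i x + J x ** Pd j (conn G' i) x
    - (Pd j (Bc i) x ** J x + Bc i x ** Pd j J x)"
proof -
  have "Pd j (Pd i J) x = Pd j (%x. J x ** conn G' i x - Bc i x ** J x) x"
    by (rule Pd_cong[OF U(1) C_inf_Pd[OF U(1) C_inf_J] x Pd_J_conn])
  also have "\<dots> = Pd j (%x. J x ** conn G' i x) x - Pd j (%x. Bc i x ** J x) x"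
    by (rule Pd_diff[OF _ _ x]) (intro C_inf_bilinear[OF U(1) bounded_bilinear_matrix] C_inf_J C_inf_conn' C_inf_Bc)+
  also have "\<dots> = Pd j J x ** conn G' i x + J x ** Pd j (conn G' i) x
    - (Pd j (Bc i) x ** J x + Bc i x ** Pd j J x)"
    using Pd_bilinear[OF bounded_bilinear_matrix C_inf_J C_inf_conn' x]
      Pd_bilinear[OF bounded_bilinear_matrix C_inf_Bc C_inf_J x] by simp
  finally show ?thesis .
qed

lemma Pd_J_commute: "x \<in> U ==> Pd j (Pd i J) x = Pd i (Pd j J) x"
proof (rule vec_eq_iff[THEN iffD2], rule allI)
  fix a assume x: "x \<in> U"
  have "Pd j (Pd i J) x $ a = Pd j (Pd i (%y. J y $ a)) x" for i j
    using Pd_nth[OF C_inf_Pd[OF U(1) C_inf_J] x, of j i a]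
      Pd_cong[OF U(1) C_inf_nth[OF U(1) C_inf_Pd[OF U(1) C_inf_J]] x, of i a "Pd i (%y. J y $ a)" j]
      Pd_nth[OF C_inf_J, symmetric] by metis
  then show "Pd j (Pd i J) x $ a = Pd i (Pd j J) x $ a"
    using Pd_commute[OF U(1) C_inf_nth[OF U(1) C_inf_J] x] by metis
qed

definition curvB :: "'n => 'n => real ^ 'n => real ^ 'n ^ 'n" where
  "curvB i j x = Pd i (Bc j) x - Pd j (Bc i) x + (Bc i x ** Bc j x - Bc j x ** Bc i x)"

text \<open>Equality of the mixed second derivatives of \<open>J\<close>, both computed from
  \<open>Pd_J_conn\<close>, is exactly the covariance of curvature under the gauge transformation
  \<open>J\<close>.\<close>

lemma curv_gauge:
  assumes x: "x \<in> U"
  shows "J x ** curv G' i j x = curvB i j x ** J x"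
proof -
  have "Pd i (Pd j J) x - Pd j (Pd i J) x = 0" using Pd_J_commute[OF x] by simp
  then have "J x ** curv G' i j x - curvB i j x ** J x = 0"
    unfolding Pd_Pd_J[OF x] Pd_J_conn[OF x] curv_def curvB_def
    by (simp add: mm.add_left mm.add_right mm.diff_left mm.diff_right matrix_mul_assoc algebra_simps)
  then show ?thesis by simp
qed

lemma Pd_Bc:
  assumes x: "x \<in> U"
  shows "Pd i (Bc j) x = (\<Sum>a\<in>UNIV. (HH i j x $ a) *\<^sub>R conn G a (\<phi> x)) +
    (\<Sum>a\<in>UNIV. \<Sum>b\<in>UNIV. (Pd i \<phi> x $ a * Pd j \<phi> x $ b) *\<^sub>R Pd a (conn G b) (\<phi> x))"
proof -
  have fx: "\<phi> x \<in> V" using im x by auto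
  note Cj = C_inf_nth[OF U(1) C_inf_Pd[OF U]]
  have "Pd i (Bc j) x = (\<Sum>b\<in>UNIV. Pd i (%x. (Pd j \<phi> x $ b) *\<^sub>R conn G b (\<phi> x)) x)"
    unfolding Bc_def[abs_def] by (rule Pd_sum[OF _ x]) (intro C_inf_scaleR Cj C_inf_conn\<phi> U(1))
  also have "\<dots> = (\<Sum>b\<in>UNIV. (HH i j x $ b) *\<^sub>R conn G b (\<phi> x) +
      (Pd j \<phi> x $ b) *\<^sub>R (\<Sum>a\<in>UNIV. (Pd i \<phi> x $ a) *\<^sub>R Pd a (conn G b) (\<phi> x)))"
    using Pd_bilinear[OF bounded_bilinear_scaleR Cj C_inf_conn\<phi> x]
      Pd_nth[OF C_inf_Pd[OF U] x] Pd_chain[OF U(2) C_inf_conn[OF V G(2)] x fx]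
    by simp
  also have "\<dots> = (\<Sum>b\<in>UNIV. (HH i j x $ b) *\<^sub>R conn G b (\<phi> x)) +
      (\<Sum>b\<in>UNIV. \<Sum>a\<in>UNIV. (Pd i \<phi> x $ a * Pd j \<phi> x $ b) *\<^sub>R Pd a (conn G b) (\<phi> x))"
    by (simp add: sum.distrib scaleR_sum_right mult.commute)
  also have "(\<Sum>b\<in>UNIV. \<Sum>a\<in>UNIV. (Pd i \<phi> x $ a * Pd j \<phi> x $ b) *\<^sub>R Pd a (conn G b) (\<phi> x)) =
      (\<Sum>a\<in>UNIV. \<Sum>b\<in>UNIV. (Pd i \<phi> x $ a * Pd j \<phi> x $ b) *\<^sub>R Pd a (conn G b) (\<phi> x))"
    by (rule sum.swap)
  finally show ?thesis .
qed

text \<open>Curvature commutes with pull-back: the terms with second derivatives of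
  \<open>\<phi>\<close> are symmetric in \<open>i\<close> and \<open>j\<close> and drop out of the
  difference.\<close>

lemma curvB:
  assumes x: "x \<in> U"
  shows "curvB i j x = (\<Sum>a\<in>UNIV. \<Sum>b\<in>UNIV. (Pd i \<phi> x $ a * Pd j \<phi> x $ b) *\<^sub>R curv G a b (\<phi> x))"
proof -
  let ?w = "%a b. Pd i \<phi> x $ a * Pd j \<phi> x $ b"
  have 1: "Pd i (Bc j) x - Pd j (Bc i) x =
    (\<Sum>a\<in>UNIV. \<Sum>b\<in>UNIV. ?w a b *\<^sub>R (Pd a (conn G b) (\<phi> x) - Pd b (conn G a) (\<phi> x)))"
  proof -
    have "(\<Sum>a\<in>UNIV. \<Sum>b\<in>UNIV. (Pd j \<phi> x $ a * Pd i \<phi> x $ b) *\<^sub>R Pd a (conn G b) (\<phi> x)) =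
        (\<Sum>a\<in>UNIV. \<Sum>b\<in>UNIV. ?w a b *\<^sub>R Pd b (conn G a) (\<phi> x))"
      by (subst sum.swap) (simp add: mult.commute)
    then show ?thesis
      unfolding Pd_Bc[OF x] using H_sym[OF x, of i j] by (simp add: scaleR_diff_right sum_subtractf)
  qed
  have 2: "Bc i x ** Bc j x = (\<Sum>a\<in>UNIV. \<Sum>b\<in>UNIV. (Pd i \<phi> x $ a * Pd j \<phi> x $ b) *\<^sub>R (conn G a (\<phi> x) ** conn G b (\<phi> x)))" for i j
    unfolding Bc_def
    by (subst sum.swap) (simp add: mm.sum_left mm.sum_right mm.scaleR_left mm.scaleR_right scaleR_sum_right mult.commute)
  have 3: "Bc j x ** Bc i x = (\<Sum>a\<in>UNIV. \<Sum>b\<in>UNIV. ?w a b *\<^sub>R (conn G b (\<phi> x) ** conn G a (\<phi> x)))"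
    unfolding 2 by (subst sum.swap) (simp add: mult.commute)
  show ?thesis
    unfolding curvB_def 1 2 3[unfolded 2] curv_def
    by (simp add: scaleR_add_right scaleR_diff_right sum.distrib sum_subtractf)
qed

theorem riemann_transform:
  assumes x: "x \<in> U"
  shows "(\<Sum>k\<in>UNIV. J x $ c $ k * riemann G' k l i j x) =
    (\<Sum>a\<in>UNIV. \<Sum>b\<in>UNIV. \<Sum>d\<in>UNIV. J x $ a $ i * J x $ b $ j * J x $ d $ l * riemann G c d a b (\<phi> x))"
proof -
  have fx: "\<phi> x \<in> V" using im x by auto
  have "(\<Sum>k\<in>UNIV. J x $ c $ k * riemann G' k l i j x) = (J x ** curv G' i j x) $ c $ l"
    by (simp add: riemann_curv[OF U(1) C_inf_G' det_G' x] matrix_matrix_mult_def)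
  also have "\<dots> = (\<Sum>d\<in>UNIV. curvB i j x $ c $ d * J x $ d $ l)"
    unfolding curv_gauge[OF x] by (simp add: matrix_matrix_mult_def)
  also have "\<dots> = (\<Sum>d\<in>UNIV. \<Sum>a\<in>UNIV. \<Sum>b\<in>UNIV. J x $ a $ i * J x $ b $ j * J x $ d $ l * riemann G c d a b (\<phi> x))"
    unfolding curvB[OF x]
    by (simp add: riemann_curv[OF V(1,2) G(2) fx] sum_distrib_right sum_distrib_left J_nth mult_ac)
  also have "\<dots> = (\<Sum>a\<in>UNIV. \<Sum>d\<in>UNIV. \<Sum>b\<in>UNIV. J x $ a $ i * J x $ b $ j * J x $ d $ l * riemann G c d a b (\<phi> x))"
    by (rule sum.swap)
  also have "\<dots> = (\<Sum>a\<in>UNIV. \<Sum>b\<in>UNIV. \<Sum>d\<in>UNIV. J x $ a $ i * J x $ b $ j * J x $ d $ l * riemann G c d a b (\<phi> x))"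
    by (intro sum.cong refl sum.swap)
  finally show ?thesis .
qed

lemma JK: "x \<in> U ==> (\<Sum>m\<in>UNIV. J x $ a $ m * matrix_inv (J x) $ m $ c) = (if a = c then 1 else 0)"
  using inv_J(2)[of x] by (simp add: vec_eq_iff matrix_matrix_mult_def mat_def)

lemma KJ: "x \<in> U ==> (\<Sum>c\<in>UNIV. matrix_inv (J x) $ m $ c * J x $ c $ k) = (if m = k then 1 else 0)"
  using inv_J(1)[of x] by (simp add: vec_eq_iff matrix_matrix_mult_def mat_def)

lemma ricci_transform:
  assumes x: "x \<in> U"
  shows "(\<chi> i j. ricci G' i j x) = pull (J x) (\<chi> i j. ricci G i j (\<phi> x))"
proof (rule vec_eq_iff[THEN iffD2], rule allI, rule vec_eq_iff[THEN iffD2], rule allI)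
  fix l j
  let ?K = "matrix_inv (J x)"
  \<comment> \<open>This leaves the contracted pair \<open>a\<close>, \<open>c\<close> free; the
    product of \<open>J\<close> with its inverse then forces \<open>a = c\<close>.\<close>
  define S where "S a c = (\<Sum>b\<in>UNIV. \<Sum>d\<in>UNIV. J x $ b $ j * J x $ d $ l * riemann G c d a b (\<phi> x))" for a c
  have "riemann G' m l m j x = (\<Sum>c\<in>UNIV. ?K $ m $ c * (\<Sum>a\<in>UNIV. J x $ a $ m * S a c))" for m
  proof -
    have "(\<Sum>c\<in>UNIV. ?K $ m $ c * (\<Sum>a\<in>UNIV. J x $ a $ m * S a c))
      = (\<Sum>c\<in>UNIV. ?K $ m $ c * (\<Sum>k\<in>UNIV. J x $ c $ k * riemann G' k l m j x))"
      unfolding riemann_transform[OF x] S_def by (simp add: sum_distrib_left mult_ac)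
    also have "\<dots> = (\<Sum>k\<in>UNIV. (\<Sum>c\<in>UNIV. ?K $ m $ c * J x $ c $ k) * riemann G' k l m j x)"
      by (simp add: sum_distrib_left sum_distrib_right mult.assoc) (rule sum.swap)
    also have "\<dots> = riemann G' m l m j x"
      unfolding KJ[OF x] by (simp add: if_distrib[of "%t. t * _"] cong: if_cong)
    finally show ?thesis ..
  qed
  then have "ricci G' l j x = (\<Sum>m\<in>UNIV. \<Sum>c\<in>UNIV. \<Sum>a\<in>UNIV. J x $ a $ m * ?K $ m $ c * S a c)"
    by (simp add: ricci_def sum_distrib_left mult_ac)
  also have "\<dots> = (\<Sum>c\<in>UNIV. \<Sum>m\<in>UNIV. \<Sum>a\<in>UNIV. J x $ a $ m * ?K $ m $ c * S a c)"
    by (rule sum.swap)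
  also have "\<dots> = (\<Sum>c\<in>UNIV. \<Sum>a\<in>UNIV. \<Sum>m\<in>UNIV. J x $ a $ m * ?K $ m $ c * S a c)"
    by (intro sum.cong refl sum.swap)
  also have "\<dots> = (\<Sum>c\<in>UNIV. S c c)"
    unfolding sum_distrib_right[symmetric] JK[OF x] by (simp add: if_distrib[of "%t. t * _"] cong: if_cong)
  also have "\<dots> = (\<Sum>b\<in>UNIV. \<Sum>c\<in>UNIV. \<Sum>d\<in>UNIV. J x $ b $ j * J x $ d $ l * riemann G c d c b (\<phi> x))"
    unfolding S_def by (rule sum.swap)
  also have "\<dots> = (\<Sum>b\<in>UNIV. \<Sum>d\<in>UNIV. \<Sum>c\<in>UNIV. J x $ b $ j * J x $ d $ l * riemann G c d c b (\<phi> x))"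
    by (intro sum.cong refl sum.swap)
  also have "\<dots> = pull (J x) (\<chi> i j. ricci G i j (\<phi> x)) $ l $ j"
    by (simp add: pull_nth ricci_def sum_distrib_left sum_distrib_right mult_ac)
  finally show "(\<chi> i j. ricci G' i j x) $ l $ j = pull (J x) (\<chi> i j. ricci G i j (\<phi> x)) $ l $ j" by simp
qed

text \<open>Written as a trace, the contraction turns the change of coordinates into a conjugation
  by \<open>J x\<close>, which the trace does not see.\<close>

theorem scalar_transform:
  assumes x: "x \<in> U"
  shows "scalar G' x = scalar G (\<phi> x)"
proof -
  let ?K = "matrix_inv (J x)" and ?I = "matrix_inv (G (\<phi> x))"
  have fx: "\<phi> x \<in> V" using im x by auto
  have tr: "scalar F x = trace (transpose (matrix_inv (F x)) ** (\<chi> i j. ricci F i j x))" for F :: "real ^ 'n => real ^ 'n ^ 'n" and x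
    unfolding scalar_def by (subst sum.swap) (simp add: trace_def matrix_matrix_mult_def transpose_def)
  have KJt: "transpose (J x) ** transpose ?K = mat 1" "transpose ?K ** transpose (J x) = mat 1"
    using inv_J[OF x] by (metis matrix_transpose_mul transpose_mat)+
  have "(?K ** ?I ** transpose ?K) ** G' x = ?K ** (?I ** ((transpose ?K ** transpose (J x)) ** (G (\<phi> x) ** J x)))"
    by (simp add: G'_pull[OF x] pull_def matrix_mul_assoc)
  also have "\<dots> = ?K ** ((?I ** G (\<phi> x)) ** J x)" by (simp add: KJt matrix_mul_assoc)
  also have "\<dots> = mat 1" by (simp add: matrix_inv_works[OF G(2)[OF fx]] inv_J[OF x])
  finally have 1: "(?K ** ?I ** transpose ?K) ** G' x = mat 1" .
  have inv: "matrix_inv (G' x) = ?K ** ?I ** transpose ?K"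
    using 1 matrix_inv_works(2)[OF det_G'[OF x]] by (metis matrix_mul_assoc matrix_mul_lid matrix_mul_rid)
  define R where "R = (\<chi> i j. ricci G i j (\<phi> x))"
  have "transpose (matrix_inv (G' x)) ** (\<chi> i j. ricci G' i j x) =
      ?K ** ((transpose ?I ** ((transpose ?K ** transpose (J x)) ** R)) ** J x)"
    unfolding inv ricci_transform[OF x] R_def[symmetric]
    by (simp add: pull_def matrix_transpose_mul matrix_mul_assoc)
  also have "\<dots> = ?K ** ((transpose ?I ** R) ** J x)" by (simp add: KJt)
  finally have "scalar G' x = trace (?K ** ((transpose ?I ** R) ** J x))" by (simp add: tr)
  also have "\<dots> = trace (((transpose ?I ** R) ** J x) ** ?K)" by (rule trace_mul_sym)
  also have "\<dots> = trace (transpose ?I ** R)" by (simp add: matrix_mul_assoc[symmetric] inv_J[OF x])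
  finally show ?thesis by (simp add: tr R_def)
qed

end

text \<open>Sectional curvature \<open>-1\<close>, as an identity for the curvature tensor.\<close>

definition hyperbolic_at :: "(real ^ 'n::finite => real ^ 'n ^ 'n) => real ^ 'n => bool" where
  "hyperbolic_at G x \<longleftrightarrow> (\<forall>k l i j. riemann G k l i j x =
     (if k = j then G x $ l $ i else 0) - (if k = i then G x $ l $ j else 0))"

context coordinate_change begin

text \<open>Both sides of \<open>hyperbolic_at\<close> transform as tensors; they are compared after
  multiplication by the invertible matrix \<open>J x\<close>.\<close>

lemma hyperbolic_transform:
  assumes x: "x \<in> U" and h: "hyperbolic_at G (\<phi> x)"
  shows "hyperbolic_at G' x"
  unfolding hyperbolic_at_def
proof (intro allI)
  fix k l i j
  define X where "X k = (if k = j then G' x $ l $ i else 0) - (if k = i then G' x $ l $ j else 0)" for k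
  have G'n: "G' x $ l $ i = (\<Sum>b\<in>UNIV. \<Sum>d\<in>UNIV. J x $ b $ i * J x $ d $ l * G (\<phi> x) $ d $ b)" for l i
    by (simp add: G'_pull[OF x] pull_nth sum_distrib_left sum_distrib_right mult_ac)
  have "(\<Sum>k\<in>UNIV. J x $ c $ k * riemann G' k l i j x) = (\<Sum>k\<in>UNIV. J x $ c $ k * X k)" for c
  proof -
    have "(\<Sum>k\<in>UNIV. J x $ c $ k * riemann G' k l i j x) = (\<Sum>a\<in>UNIV. \<Sum>b\<in>UNIV. \<Sum>d\<in>UNIV.
      (if c = b then J x $ b $ j * (J x $ a $ i * J x $ d $ l * G (\<phi> x) $ d $ a) else 0)
      - (if c = a then J x $ a $ i * (J x $ b $ j * J x $ d $ l * G (\<phi> x) $ d $ b) else 0))"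
      unfolding riemann_transform[OF x]
    proof (intro sum.cong refl)
      fix a b d
      have r: "riemann G c d a b (\<phi> x) = (if c = b then G (\<phi> x) $ d $ a else 0) - (if c = a then G (\<phi> x) $ d $ b else 0)"
        using h by (simp add: hyperbolic_at_def)
      show "J x $ a $ i * J x $ b $ j * J x $ d $ l * riemann G c d a b (\<phi> x) =
        (if c = b then J x $ b $ j * (J x $ a $ i * J x $ d $ l * G (\<phi> x) $ d $ a) else 0)
        - (if c = a then J x $ a $ i * (J x $ b $ j * J x $ d $ l * G (\<phi> x) $ d $ b) else 0)"
        unfolding r by (cases "c = a"; cases "c = b") (simp_all add: algebra_simps)
    qed
    also have "\<dots> = (\<Sum>a\<in>UNIV. \<Sum>b\<in>UNIV. if c = b then J x $ b $ j * (\<Sum>d\<in>UNIV. J x $ a $ i * J x $ d $ l * G (\<phi> x) $ d $ a) else 0)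
      - (\<Sum>a\<in>UNIV. \<Sum>b\<in>UNIV. if c = a then J x $ a $ i * (\<Sum>d\<in>UNIV. J x $ b $ j * J x $ d $ l * G (\<phi> x) $ d $ b) else 0)"
      unfolding sum_subtractf by (intro arg_cong2[where f="(-)"] sum.cong refl) (auto simp: sum_distrib_left)
    also have "(\<Sum>a\<in>UNIV. \<Sum>b\<in>UNIV. if c = b then J x $ b $ j * (\<Sum>d\<in>UNIV. J x $ a $ i * J x $ d $ l * G (\<phi> x) $ d $ a) else 0)
      = J x $ c $ j * G' x $ l $ i"
      by (simp add: G'n sum_distrib_left)
    also have "(\<Sum>a\<in>UNIV. \<Sum>b\<in>UNIV. if c = a then J x $ a $ i * (\<Sum>d\<in>UNIV. J x $ b $ j * J x $ d $ l * G (\<phi> x) $ d $ b) else 0)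
      = J x $ c $ i * G' x $ l $ j"
      by (subst sum.swap) (simp add: G'n sum_distrib_left)
    also have "J x $ c $ j * G' x $ l $ i - J x $ c $ i * G' x $ l $ j = (\<Sum>k\<in>UNIV. J x $ c $ k * X k)"
      by (simp add: X_def right_diff_distrib sum_subtractf if_distrib[of "%t. _ * t"] cong: if_cong)
    finally show ?thesis .
  qed
  then have "J x *v (\<chi> k. riemann G' k l i j x) = J x *v (\<chi> k. X k)"
    by (simp add: vec_eq_iff matrix_vector_mult_def)
  then have "(\<chi> k. riemann G' k l i j x) = (\<chi> k. X k)"
    using inv_J(1)[OF x] by (metis matrix_vector_mul_assoc matrix_vector_mul_lid)
  then show "riemann G' k l i j x = (if k = j then G' x $ l $ i else 0) - (if k = i then G' x $ l $ j else 0)"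
    by (simp add: vec_eq_iff X_def)
qed

end

lemma gauss_hyperbolic: "hyperbolic_at G x ==> det (G x) ~= 0 ==> gauss G x = -1"
proof -
  assume h: "hyperbolic_at G x" and d: "det (G x) ~= 0"
  have "riemann G 1 2 1 2 x = - (G x $ 2 $ 2)" "riemann G 2 2 1 2 x = G x $ 2 $ 1"
    using h by (simp_all add: hyperbolic_at_def)
  then have "(\<Sum>k\<in>UNIV. G x $ 1 $ k * riemann G k 2 1 2 x) = - det (G x)"
    by (simp add: sum_2 det_2)
  then show ?thesis using d by (simp add: gauss_def)
qed

section \<open>The hyperbolic metric in hyperboloid coordinates\<close>

text \<open>The graph \<open>x\<^sub>0 = sqrt (1 + |x|\<^sup>2)\<close> in Minkowski space, parametrised by its spatial coordinates.\<close>

definition hyp_metric :: "real ^ 'n::finite => real ^ 'n ^ 'n" where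
  "hyp_metric x = (\<chi> i j. (if i = j then 1 else 0) - x $ i * x $ j / (1 + x \<bullet> x))"

lemma one_plus_inner_pos: "0 < 1 + (x::'a::real_inner) \<bullet> x"
  using inner_ge_zero[of x] by linarith

lemma C_inf_inner_self: "C_inf UNIV (%x::'a::euclidean_space. 1 + x \<bullet> x)"
  by (intro C_inf_add C_inf_const C_inf_bilinear[OF _ bounded_bilinear_inner] C_inf_id open_UNIV)

lemma C_inf_hyp_metric: "C_inf UNIV hyp_metric"
proof (intro C_inf_vec open_UNIV)
  fix i j
  show "C_inf UNIV (%x. hyp_metric x $ i $ j)"
    unfolding hyp_metric_def vec_lambda_beta
    by (intro C_inf_diff C_inf_const C_inf_divide C_inf_mult C_inf_nth C_inf_id C_inf_inner_self open_UNIV)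
      (use one_plus_inner_pos in "auto simp: less_le")
qed

lemma transpose_hyp_metric: "transpose (hyp_metric x) = hyp_metric x"
  by (auto simp: vec_eq_iff transpose_def hyp_metric_def mult.commute)

lemma bilin_hyp_metric: "bilin (hyp_metric x) u v = u \<bullet> v - (x \<bullet> u) * (x \<bullet> v) / (1 + x \<bullet> x)"
proof -
  have "bilin (hyp_metric x) u v = (\<Sum>i\<in>UNIV. \<Sum>j\<in>UNIV. (if i = j then u $ i * v $ j else 0)
      - (x $ i * u $ i) * (x $ j * v $ j) / (1 + x \<bullet> x))"
    unfolding bilin_def hyp_metric_def by (intro sum.cong refl) (auto simp: algebra_simps)
  also have "\<dots> = (\<Sum>i\<in>UNIV. u $ i * v $ i) - (\<Sum>i\<in>UNIV. x $ i * u $ i) * (\<Sum>j\<in>UNIV. x $ j * v $ j) / (1 + x \<bullet> x)"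
    by (simp add: sum_subtractf sum_divide_distrib sum_product)
  finally show ?thesis by (simp add: inner_vec_def)
qed

lemma hyp_metric_pos:
  assumes "v ~= 0"
  shows "0 < bilin (hyp_metric x) v v"
proof -
  have "(x \<bullet> v)\<^sup>2 \<le> (x \<bullet> x) * (v \<bullet> v)" by (rule Cauchy_Schwarz_ineq)
  moreover have "0 < v \<bullet> v" using assms by simp
  moreover have "(v \<bullet> v) * (1 + x \<bullet> x) = v \<bullet> v + (x \<bullet> x) * (v \<bullet> v)" by (simp add: algebra_simps)
  ultimately have "(x \<bullet> v) * (x \<bullet> v) < (v \<bullet> v) * (1 + x \<bullet> x)" unfolding power2_eq_square by linarith
  then have "(x \<bullet> v) * (x \<bullet> v) / (1 + x \<bullet> x) < v \<bullet> v"
    using one_plus_inner_pos[of x] by (simp add: pos_divide_less_eq)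
  then show ?thesis by (simp add: bilin_hyp_metric)
qed

lemma positive_det_nz:
  assumes "\<And>v. v ~= 0 ==> 0 < bilin G v v"
  shows "det G ~= 0"
proof
  assume "det G = 0"
  then obtain v where "v ~= 0" "G *v v = 0"
    using invertible_det_nz[of G] matrix_left_invertible_ker[of G] invertible_left_inverse[of G] by blast
  then show False using assms[of v] by (simp add: bilin_inner)
qed

lemma sum_hyp_metric: "(\<Sum>m\<in>UNIV. x $ m * hyp_metric x $ m $ i) = x $ i / (1 + x \<bullet> x)"
  "(\<Sum>m\<in>UNIV. x $ m * hyp_metric x $ i $ m) = x $ i / (1 + x \<bullet> x)"
proof -
  have "(\<Sum>m\<in>UNIV. x $ m * hyp_metric x $ m $ i) = (\<Sum>m\<in>UNIV. (if m = i then x $ m else 0) - x $ i * (x $ m * x $ m) / (1 + x \<bullet> x))"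
    unfolding hyp_metric_def by (intro sum.cong refl) (auto simp: algebra_simps)
  also have "\<dots> = x $ i - x $ i * (x \<bullet> x) / (1 + x \<bullet> x)"
    by (simp add: sum_subtractf sum_divide_distrib[symmetric] sum_distrib_left[symmetric] inner_vec_def)
  also have "\<dots> = x $ i / (1 + x \<bullet> x)" using one_plus_inner_pos[of x] by (simp add: field_simps)
  finally show 1: "(\<Sum>m\<in>UNIV. x $ m * hyp_metric x $ m $ i) = x $ i / (1 + x \<bullet> x)" .
  have "hyp_metric x $ i $ m = hyp_metric x $ m $ i" for m by (auto simp: hyp_metric_def mult.commute)
  then show "(\<Sum>m\<in>UNIV. x $ m * hyp_metric x $ i $ m) = x $ i / (1 + x \<bullet> x)" using 1 by simp
qed

lemma inverse_unique:
  fixes A B :: "real ^ 'n::finite ^ 'n"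
  assumes "A ** B = mat 1"
  shows "matrix_inv A = B"
proof -
  have "det A * det B = 1" using assms by (metis det_mul det_I)
  then have "det A ~= 0" by auto
  then show ?thesis using matrix_inv_works(1)[of A] assms by (metis matrix_mul_assoc matrix_mul_lid matrix_mul_rid)
qed

text \<open>The Sherman-Morrison formula for a rank-one perturbation of the identity.\<close>

lemma inv_hyp_metric: "matrix_inv (hyp_metric x) = (\<chi> i j. (if i = j then 1 else 0) + x $ i * x $ j)"
proof (rule inverse_unique)
  have "(\<Sum>k\<in>UNIV. hyp_metric x $ i $ k * ((if k = j then 1 else 0) + x $ k * x $ j)) = (if i = j then 1 else 0)" for i j
  proof -
    have "(\<Sum>k\<in>UNIV. hyp_metric x $ i $ k * ((if k = j then 1 else 0) + x $ k * x $ j)) =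
        (\<Sum>k\<in>UNIV. (if k = j then hyp_metric x $ i $ k else 0) + x $ j * (x $ k * hyp_metric x $ i $ k))"
      by (intro sum.cong refl) (auto simp: algebra_simps)
    also have "\<dots> = hyp_metric x $ i $ j + x $ j * (x $ i / (1 + x \<bullet> x))"
      by (simp add: sum.distrib sum_distrib_left[symmetric] sum_hyp_metric)
    finally show ?thesis by (simp add: hyp_metric_def mult.commute)
  qed
  then show "hyp_metric x ** (\<chi> i j. (if i = j then 1 else 0) + x $ i * x $ j) = mat 1"
    by (simp add: vec_eq_iff matrix_matrix_mult_def mat_def)
qed

definition hq :: "'a::real_inner => real" where "hq x = 1 / (1 + x \<bullet> x)"

lemma hyp_metric_hq: "hyp_metric x $ i $ j = (if i = j then 1 else 0) - x $ i * x $ j * hq x"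
  by (simp add: hyp_metric_def hq_def)

lemma partial_hyp_metric:
  fixes x :: "real ^ 'n::finite"
  shows "partial k (%x. hyp_metric x $ i $ j) x =
    - ((if i = k then x $ j else 0) + (if j = k then x $ i else 0)) * hq x
    + 2 * x $ i * x $ j * x $ k * hq x * hq x"
proof -
  have alg: "- ((A * W - B) / (W * W)) = - A * (1 / W) + B * (1 / W) * (1 / W)" if "W ~= 0" for A B W :: real
    using that by (simp add: field_simps)
  have n: "((%x. x $ i) has_derivative (%v. v $ i)) (at x)" for i :: 'n and x :: "real ^ 'n"
    by (rule bounded_linear_imp_has_derivative[OF bounded_linear_vec_nth])
  have W: "1 + x \<bullet> x ~= 0" using one_plus_inner_pos[of x] by simp
  have 1: "((%x. x $ i * x $ j) has_derivative (%v. x $ i * v $ j + v $ i * x $ j)) (at x)"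
    by (rule has_derivative_mult[OF n n])
  have 2: "((%x. 1 + x \<bullet> x) has_derivative (%v. 2 * (x \<bullet> v))) (at x)"
    by (auto intro!: derivative_eq_intros simp: inner_commute)
  have "((%x. hyp_metric x $ i $ j) has_derivative
      (%v. 0 - ((x $ i * v $ j + v $ i * x $ j) * (1 + x \<bullet> x) - x $ i * x $ j * (2 * (x \<bullet> v))) / ((1 + x \<bullet> x) * (1 + x \<bullet> x)))) (at x)"
    unfolding hyp_metric_def vec_lambda_beta
    by (rule has_derivative_diff[OF has_derivative_const has_derivative_divide'[OF 1 2 W]])
  from Pd_eqI[OF this, of k] have "partial k (%x. hyp_metric x $ i $ j) x =
      - (((x $ i * axis k 1 $ j + axis k 1 $ i * x $ j) * (1 + x \<bullet> x) - x $ i * x $ j * (2 * x $ k)) / ((1 + x \<bullet> x) * (1 + x \<bullet> x)))"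
    by (simp add: partial_Pd inner_axis)
  then have "partial k (%x. hyp_metric x $ i $ j) x =
      - (x $ i * axis k 1 $ j + axis k 1 $ i * x $ j) * hq x + x $ i * x $ j * (2 * x $ k) * hq x * hq x"
    unfolding alg[OF W] hq_def .
  then show ?thesis by (auto simp: axis_def)
qed

text \<open>The position vector is normal to the hyperboloid in Minkowski space, so each ambient
  coordinate \<open>x $ k\<close> has Hessian \<open>x $ k\<close> times the metric. In the chart
  formed by these coordinates the Hessian of \<open>x $ k\<close> is minus the Christoffel
  symbol.\<close>

lemma christoffel_hyp_metric: "christoffel hyp_metric k i j x = - x $ k * hyp_metric x $ i $ j"
proof -
  let ?W = "1 + x \<bullet> x"
  have W: "?W > 0" by (rule one_plus_inner_pos)
  define c where "c l = x $ l * hyp_metric x $ i $ j / ?W" for l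
  have P: "partial i (%y. hyp_metric y $ j $ l) x + partial j (%y. hyp_metric y $ i $ l) x - partial l (%y. hyp_metric y $ i $ j) x
    = - 2 * c l" for l
  proof -
    have "partial i (%y. hyp_metric y $ j $ l) x + partial j (%y. hyp_metric y $ i $ l) x - partial l (%y. hyp_metric y $ i $ j) x
      = - 2 * (x $ l * hyp_metric x $ i $ j * hq x)"
      unfolding partial_hyp_metric unfolding hyp_metric_hq by (auto simp: algebra_simps)
    then show ?thesis by (simp add: hq_def c_def)
  qed
  have "christoffel hyp_metric k i j x = (\<Sum>l\<in>UNIV. (if k = l then - c l else 0) - x $ k * x $ l * c l)"
    unfolding christoffel_def inv_hyp_metric P sum_divide_distrib
    by (intro sum.cong refl) (auto simp: field_simps)
  also have "\<dots> = - c k - (x $ k * hyp_metric x $ i $ j / ?W) * (x \<bullet> x)"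
    by (simp add: sum_subtractf c_def sum_distrib_left sum_divide_distrib inner_vec_def mult_ac)
  also have "\<dots> = - x $ k * hyp_metric x $ i $ j"
  proof -
    have "- (m / w) - (m / w) * (w - 1) = - m" if "w ~= 0" for m w :: real
      using that by (simp add: field_simps)
    from this[of ?W "x $ k * hyp_metric x $ i $ j"] show ?thesis using W by (simp add: c_def)
  qed
  finally show ?thesis .
qed

lemma hyperbolic_hyp_metric: "hyperbolic_at hyp_metric x"
  unfolding hyperbolic_at_def
proof (intro allI)
  fix k l i j
  let ?W = "1 + x \<bullet> x" and ?h = "hyp_metric"
  have W: "?W > 0" by (rule one_plus_inner_pos)
  have d: "partial i (christoffel ?h k j l) x = - (if k = i then 1 else 0) * ?h x $ j $ l - x $ k * partial i (%y. ?h y $ j $ l) x" for i j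
  proof -
    note c = C_inf_nth[OF open_UNIV C_inf_id[OF open_UNIV], of k]
    note h = C_inf_nth[OF open_UNIV C_inf_nth[OF open_UNIV C_inf_hyp_metric], of j l]
    have "Pd i (%y. - y $ k * ?h y $ j $ l) x = Pd i (%y. - y $ k) x * ?h x $ j $ l + - x $ k * Pd i (%y. ?h y $ j $ l) x"
      using Pd_bilinear[OF bounded_bilinear_mult C_inf_minus[OF open_UNIV c] h UNIV_I] by simp
    moreover have "Pd i (%y. - y $ k) x = - (if k = i then 1 else 0)"
      using Pd_eqI[OF has_derivative_minus[OF bounded_linear_imp_has_derivative[OF bounded_linear_vec_nth]], of i k x]
      by (simp add: axis_def)
    moreover have "christoffel ?h k j l = (%y. - y $ k * ?h y $ j $ l)" by (rule ext) (rule christoffel_hyp_metric)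
    ultimately show ?thesis by (simp add: partial_Pd)
  qed
  have s: "(\<Sum>m\<in>UNIV. christoffel ?h k i m x * christoffel ?h m j l x - christoffel ?h k j m x * christoffel ?h m i l x) =
    x $ k * ?h x $ j $ l * (x $ i * hq x) - x $ k * ?h x $ i $ l * (x $ j * hq x)"
    using sum_hyp_metric(2)[of x]
    by (simp add: christoffel_hyp_metric hq_def sum_hyp_metric(2)[symmetric] sum_subtractf sum_distrib_left mult_ac)
  have sym: "?h x $ j $ l = ?h x $ l $ j" "?h x $ i $ l = ?h x $ l $ i"
    by (auto simp: hyp_metric_def mult.commute)
  have "- x $ k * partial i (%y. ?h y $ j $ l) x + x $ k * partial j (%y. ?h y $ i $ l) x
    + x $ k * ?h x $ j $ l * (x $ i * hq x) - x $ k * ?h x $ i $ l * (x $ j * hq x) = 0"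
    unfolding partial_hyp_metric unfolding hyp_metric_hq by (auto simp: algebra_simps)
  then show "riemann ?h k l i j x = (if k = j then ?h x $ l $ i else 0) - (if k = i then ?h x $ l $ j else 0)"
    unfolding riemann_def d s using sym by (auto simp: algebra_simps)
qed

section \<open>Warped products over a hyperbolic surface\<close>

text \<open>A common form for the background, the compactified metric and the Kottler metric, which
  differ only in the two radial coefficients.\<close>

definition warp :: "(real => real) => (real => real) => (real ^ 2 => real ^ 2 ^ 2) => real ^ 3 => real ^ 3 ^ 3" where
  "warp b e h y = vector
     [vector [b (y $ 3) * h (hor y) $ 1 $ 1, b (y $ 3) * h (hor y) $ 1 $ 2, 0],
      vector [b (y $ 3) * h (hor y) $ 2 $ 1, b (y $ 3) * h (hor y) $ 2 $ 2, 0],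
      vector [0, 0, e (y $ 3)]]"

text \<open>Splits the indices of type \<open>3\<close> into the surface directions, in the image of
  \<open>up\<close>, and the radial index \<open>3\<close>; sums and case distinctions follow this
  splitting.\<close>

definition up :: "2 => 3" where "up a = (if a = 1 then 1 else 2)"

lemma up_simps [simp]: "up 1 = 1" "up 2 = 2" "up a ~= 3" "3 ~= up a" "up a = up b \<longleftrightarrow> a = b"
  using exhaust_2[of a] exhaust_2[of b] by (auto simp: up_def)

lemma sum_up: "(\<Sum>k\<in>(UNIV::3 set). f k) = (\<Sum>a\<in>(UNIV::2 set). f (up a)) + f 3"
  by (simp add: sum_3 sum_2)

lemma cases_up: obtains a where "k = up a" | "k = 3"
  using exhaust_3[of k] up_simps(1,2) by metis

lemma hor_up [simp]: "hor y $ a = y $ up a"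
  using exhaust_2[of a] by auto

lemma warp_nth [simp]:
  "warp b e h y $ up i $ up j = b (y $ 3) * h (hor y) $ i $ j"
  "warp b e h y $ up i $ 3 = 0" "warp b e h y $ 3 $ up i = 0" "warp b e h y $ 3 $ 3 = e (y $ 3)"
  using exhaust_2[of i] exhaust_2[of j] by (auto simp: warp_def)

lemma bilin_warp:
  "bilin (warp b e h y) u v = b (y $ 3) * bilin (h (hor y)) (hor u) (hor v) + e (y $ 3) * u $ 3 * v $ 3"
  unfolding bilin_def sum_up by (simp add: sum_distrib_left mult_ac)

lemma hor_axis [simp]: "hor (axis (up i) 1) = axis i 1" "hor (axis 3 1) = 0"
  using exhaust_2[of i] by (auto simp: vec_eq_iff forall_2 axis_def)

lemma axis_up_3 [simp]: "axis (up i) (1::real) $ 3 = 0" "axis 3 (1::real) $ 3 = 1"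
  by (auto simp: axis_def)

lemma det_warp: "det (warp b e h y) = (b (y $ 3))\<^sup>2 * e (y $ 3) * det (h (hor y))"
  by (simp add: det_3 det_2 warp_def power2_eq_square algebra_simps)

lemma partial_product:
  assumes f: "(f has_real_derivative f') (at (y $ 3))" and u: "u differentiable (at (hor y))"
  shows "partial (up i) (%y. f (y $ 3) * u (hor y)) y = f (y $ 3) * partial i u (hor y)"
    "partial 3 (%y. f (y $ 3) * u (hor y)) y = f' * u (hor y)"
proof -
  have df: "((%y. f (y $ 3)) has_derivative (%v. f' * v $ 3)) (at y)"
    by (rule has_derivative_compose[OF bounded_linear_imp_has_derivative[OF bounded_linear_vec_nth]])
      (use f in "simp add: has_field_derivative_def")
  have du: "((%y. u (hor y)) has_derivative (%v. Dat u (hor y) (hor v))) (at y)"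
    by (rule has_derivative_compose[OF bounded_linear_imp_has_derivative[OF linear_hor]])
      (use u frechet_derivative_works in blast)
  have l: "Dat u (hor y) 0 = 0"
    using u frechet_derivative_works linear_0 has_derivative_linear by blast
  have "((%y. f (y $ 3) * u (hor y)) has_derivative
      (%v. f (y $ 3) * Dat u (hor y) (hor v) + f' * v $ 3 * u (hor y))) (at y)"
    by (rule has_derivative_mult[OF df du])
  then show "partial (up i) (%y. f (y $ 3) * u (hor y)) y = f (y $ 3) * partial i u (hor y)"
    "partial 3 (%y. f (y $ 3) * u (hor y)) y = f' * u (hor y)"
    unfolding partial_Pd by (subst Pd_eqI, assumption, simp add: l Pd_def)+
qed

lemma partial_vertical:
  assumes "(f has_real_derivative f') (at (y $ 3))"
  shows "partial (up i) (%y. f (y $ 3)) y = 0" "partial 3 (%y. f (y $ 3)) y = f'"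
  using partial_product(1)[OF assms, of "%_. 1" i] partial_product(2)[OF assms, of "%_. 1"] by (simp_all add: partial_def frechet_derivative_const)

lemma partial_horizontal:
  assumes "u differentiable (at (hor y))"
  shows "partial (up i) (%y. u (hor y)) y = partial i u (hor y)" "partial 3 (%y. u (hor y)) y = 0"
  using partial_product(1)[of "%_. 1" 0 y u i] partial_product(2)[of "%_. 1" 0 y u] assms by simp_all

text \<open>If neither function is differentiable, \<open>frechet_derivative\<close> is a choice
  governed by the same empty set of candidates, so the equality persists.\<close>

lemma partial_cong:
  assumes "open U" "x \<in> U" "\<And>y. y \<in> U ==> f y = g y"
  shows "partial i f x = partial i g x"
proof (cases "f differentiable (at x)")
  case True
  then show ?thesis unfolding partial_def using frechet_derivative_transform_within_open[OF True assms(1,2)] assms(3) by metis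
next
  case False
  have "(f has_derivative D) (at x) \<longleftrightarrow> (g has_derivative D) (at x)" for D
    using has_derivative_transform_within_open[OF _ assms(1,2)] assms(3) by metis
  then show ?thesis unfolding partial_def frechet_derivative_def by simp
qed

locale warped =
  fixes S :: "(real ^ 2) set" and h :: "real ^ 2 => real ^ 2 ^ 2" and T :: "real set"
    and b b1 b2 e e1 :: "real => real"
  assumes S: "open S" and T: "open T" and h: "C_inf S h" "\<And>x. x \<in> S ==> det (h x) ~= 0"
    and h_sym: "\<And>x. x \<in> S ==> transpose (h x) = h x"
    and b: "\<And>t. t \<in> T ==> (b has_real_derivative b1 t) (at t)" "\<And>t. t \<in> T ==> (b1 has_real_derivative b2 t) (at t)"
    and e: "\<And>t. t \<in> T ==> (e has_real_derivative e1 t) (at t)"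
    and nz: "\<And>t. t \<in> T ==> b t ~= 0" "\<And>t. t \<in> T ==> e t ~= 0"
begin

abbreviation "G \<equiv> warp b e h"

definition R where "R = {y::real ^ 3. hor y \<in> S \<and> y $ 3 \<in> T}"

lemma R: "open R"
proof -
  have "R = hor -` S \<inter> (%y. y $ 3) -` T" by (auto simp: R_def)
  moreover have "open (hor -` S)"
    by (rule continuous_open_vimage[OF S]) (rule linear_continuous_at[OF linear_hor])
  moreover have "open ((%y::real ^ 3. y $ 3) -` T)"
    by (rule continuous_open_vimage[OF T]) (rule linear_continuous_at[OF bounded_linear_vec_nth])
  ultimately show ?thesis by auto
qed

lemma h_inv: "x \<in> S ==> (\<Sum>l\<in>UNIV. matrix_inv (h x) $ k $ l * h x $ l $ i) = (if k = i then 1 else 0)"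
  "x \<in> S ==> (\<Sum>l\<in>UNIV. h x $ k $ l * matrix_inv (h x) $ l $ i) = (if k = i then 1 else 0)"
  using matrix_inv_works[OF h(2), of x] by (auto simp: vec_eq_iff matrix_matrix_mult_def mat_def)

lemma inv_G:
  assumes y: "y \<in> R"
  shows "matrix_inv (G y) $ up i $ up j = matrix_inv (h (hor y)) $ i $ j / b (y $ 3)"
    "matrix_inv (G y) $ up i $ 3 = 0" "matrix_inv (G y) $ 3 $ up i = 0" "matrix_inv (G y) $ 3 $ 3 = 1 / e (y $ 3)"
proof -
  define K where "K = warp (%t. 1 / b t) (%t. 1 / e t) (%x. matrix_inv (h x)) y"
  have hy: "hor y \<in> S" "b (y $ 3) ~= 0" "e (y $ 3) ~= 0" using y nz by (auto simp: R_def)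
  have "(G y ** K) $ i $ j = mat 1 $ i $ j" for i j
  proof -
    have *: "(\<Sum>k\<in>UNIV. b (y $ 3) * h (hor y) $ a $ k * (matrix_inv (h (hor y)) $ k $ c / b (y $ 3))) = (if a = c then 1 else 0)" for a c
      using hy by (simp add: h_inv(2)[OF hy(1), symmetric])
    show ?thesis
      by (cases i rule: cases_up; cases j rule: cases_up)
        (use hy * in "simp_all add: matrix_matrix_mult_def sum_up K_def mat_def")
  qed
  then have "matrix_inv (G y) = K" by (intro inverse_unique) (simp add: vec_eq_iff)
  then show "matrix_inv (G y) $ up i $ up j = matrix_inv (h (hor y)) $ i $ j / b (y $ 3)"
    "matrix_inv (G y) $ up i $ 3 = 0" "matrix_inv (G y) $ 3 $ up i = 0" "matrix_inv (G y) $ 3 $ 3 = 1 / e (y $ 3)"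
    by (simp_all add: K_def)
qed

lemma h_diff: "x \<in> S ==> (%x. h x $ i $ j) differentiable (at x)"
  by (rule C_inf_differentiable[OF C_inf_nth[OF S C_inf_nth[OF S h(1)]]])

lemma partial_G:
  assumes y: "y \<in> R"
  shows "partial (up k) (%y. G y $ up i $ up j) y = b (y $ 3) * partial k (%x. h x $ i $ j) (hor y)"
    "partial 3 (%y. G y $ up i $ up j) y = b1 (y $ 3) * h (hor y) $ i $ j"
    "partial n (%y. G y $ up i $ 3) y = 0" "partial n (%y. G y $ 3 $ up i) y = 0"
    "partial (up k) (%y. G y $ 3 $ 3) y = 0" "partial 3 (%y. G y $ 3 $ 3) y = e1 (y $ 3)"
proof -
  have hy: "hor y \<in> S" "y $ 3 \<in> T" using y by (auto simp: R_def)
  show "partial (up k) (%y. G y $ up i $ up j) y = b (y $ 3) * partial k (%x. h x $ i $ j) (hor y)"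
    "partial 3 (%y. G y $ up i $ up j) y = b1 (y $ 3) * h (hor y) $ i $ j"
    unfolding warp_nth by (rule partial_product[OF b(1)[OF hy(2)] h_diff[OF hy(1)]])+
  show "partial (up k) (%y. G y $ 3 $ 3) y = 0" "partial 3 (%y. G y $ 3 $ 3) y = e1 (y $ 3)"
    unfolding warp_nth by (rule partial_vertical[OF e[OF hy(2)]])+
  show "partial n (%y. G y $ up i $ 3) y = 0" "partial n (%y. G y $ 3 $ up i) y = 0"
    unfolding warp_nth by (simp_all add: partial_def frechet_derivative_const)
qed

text \<open>The radial Christoffel symbols: \<open>\<beta>\<close> multiplies the identity in the
  mixed symbols with upper surface index, \<open>\<psi>\<close> multiplies \<open>h\<close> in those
  with upper index \<open>3\<close>, and \<open>\<eta>\<close> is the purely radial one.\<close>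

definition \<beta> where "\<beta> t = b1 t / (2 * b t)"
definition \<eta> where "\<eta> t = e1 t / (2 * e t)"
definition \<psi> where "\<psi> t = - b1 t / (2 * e t)"

lemma christoffel_G:
  assumes y: "y \<in> R"
  shows "christoffel G (up k) (up i) (up j) y = christoffel h k i j (hor y)"
    "christoffel G (up k) (up i) 3 y = (if k = i then \<beta> (y $ 3) else 0)"
    "christoffel G (up k) 3 (up i) y = (if k = i then \<beta> (y $ 3) else 0)"
    "christoffel G (up k) 3 3 y = 0"
    "christoffel G 3 (up i) (up j) y = \<psi> (y $ 3) * h (hor y) $ i $ j"
    "christoffel G 3 (up i) 3 y = 0" "christoffel G 3 3 (up i) y = 0"
    "christoffel G 3 3 3 y = \<eta> (y $ 3)"
proof -
  have hy: "hor y \<in> S" "b (y $ 3) ~= 0" "e (y $ 3) ~= 0" using y nz by (auto simp: R_def)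
  have sym: "h (hor y) $ a $ c = h (hor y) $ c $ a" for a c
  proof -
    have "transpose (h (hor y)) $ a $ c = h (hor y) $ c $ a" by (simp add: transpose_def)
    then show ?thesis by (simp add: h_sym[OF hy(1)] del: hor_up)
  qed
  have *: "(\<Sum>l\<in>UNIV. matrix_inv (h (hor y)) $ k $ l / b (y $ 3) * (b1 (y $ 3) * h (hor y) $ i $ l)) = (if k = i then 2 * \<beta> (y $ 3) else 0)" for k i
  proof -
    have "(\<Sum>l\<in>UNIV. matrix_inv (h (hor y)) $ k $ l / b (y $ 3) * (b1 (y $ 3) * h (hor y) $ i $ l)) =
      b1 (y $ 3) / b (y $ 3) * (\<Sum>l\<in>UNIV. matrix_inv (h (hor y)) $ k $ l * h (hor y) $ l $ i)"
      by (simp add: sum_distrib_left sym[of i] mult_ac)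
    then show ?thesis unfolding h_inv(1)[OF hy(1)] by (simp add: \<beta>_def)
  qed
  show "christoffel G (up k) (up i) (up j) y = christoffel h k i j (hor y)"
  proof -
    have c: "p / b (y $ 3) * (b (y $ 3) * p1 + b (y $ 3) * p2 - b (y $ 3) * p3) = p * (p1 + p2 - p3)" for p p1 p2 p3
      using hy(2) by (simp add: distrib_left[symmetric] right_diff_distrib[symmetric])
    show ?thesis unfolding christoffel_def sum_up inv_G[OF y] partial_G[OF y] c by simp
  qed
  show "christoffel G (up k) 3 3 y = 0" "christoffel G 3 (up i) 3 y = 0" "christoffel G 3 3 (up i) y = 0"
    unfolding christoffel_def sum_up inv_G[OF y] partial_G[OF y] by simp_all
  show "christoffel G 3 (up i) (up j) y = \<psi> (y $ 3) * h (hor y) $ i $ j" "christoffel G 3 3 3 y = \<eta> (y $ 3)"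
    unfolding christoffel_def sum_up inv_G[OF y] partial_G[OF y] \<psi>_def \<eta>_def by simp_all
  show "christoffel G (up k) (up i) 3 y = (if k = i then \<beta> (y $ 3) else 0)"
    "christoffel G (up k) 3 (up i) y = (if k = i then \<beta> (y $ 3) else 0)"
    using * unfolding christoffel_def sum_up inv_G[OF y] partial_G[OF y] by simp_all
qed

definition \<beta>1 where "\<beta>1 t = (b2 t * b t - b1 t * b1 t) / (2 * b t * b t)"
definition \<psi>1 where "\<psi>1 t = - (b2 t * e t - b1 t * e1 t) / (2 * e t * e t)"

lemma deriv_\<beta>: "t \<in> T ==> (\<beta> has_real_derivative \<beta>1 t) (at t)"
  unfolding \<beta>_def[abs_def] \<beta>1_def using b[of t] nz(1)[of t]
  by (auto intro!: derivative_eq_intros simp: field_simps)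

lemma deriv_\<psi>: "t \<in> T ==> (\<psi> has_real_derivative \<psi>1 t) (at t)"
  unfolding \<psi>_def[abs_def] \<psi>1_def using b[of t] e[of t] nz(2)[of t]
  by (auto intro!: derivative_eq_intros simp: field_simps)

lemma partial_christoffel:
  assumes y: "y \<in> R"
  shows "partial (up l) (christoffel G (up k) (up i) (up j)) y = partial l (christoffel h k i j) (hor y)"
    "partial 3 (christoffel G (up k) (up i) 3) y = (if k = i then \<beta>1 (y $ 3) else 0)"
    "partial n (christoffel G (up k) 3 3) y = 0"
    "partial 3 (christoffel G 3 (up i) (up j)) y = \<psi>1 (y $ 3) * h (hor y) $ i $ j"
    "partial n (christoffel G 3 3 (up i)) y = 0"
proof -
  have hy: "hor y \<in> S" "y $ 3 \<in> T" using y by (auto simp: R_def)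
  have "partial (up l) (christoffel G (up k) (up i) (up j)) y = partial (up l) (%y. christoffel h k i j (hor y)) y"
    by (rule partial_cong[OF R y christoffel_G(1)])
  also have "\<dots> = partial l (christoffel h k i j) (hor y)"
    by (rule partial_horizontal(1)[OF C_inf_differentiable[OF C_inf_christoffel[OF S h] hy(1)]])
  finally show "partial (up l) (christoffel G (up k) (up i) (up j)) y = partial l (christoffel h k i j) (hor y)" .
  have "partial 3 (christoffel G (up k) (up i) 3) y = partial 3 (%y. if k = i then \<beta> (y $ 3) else 0) y"
    by (rule partial_cong[OF R y christoffel_G(2)])
  also have "\<dots> = (if k = i then \<beta>1 (y $ 3) else 0)"
    using partial_vertical(2)[OF deriv_\<beta>[OF hy(2)]] by (simp add: partial_def frechet_derivative_const)
  finally show "partial 3 (christoffel G (up k) (up i) 3) y = (if k = i then \<beta>1 (y $ 3) else 0)" .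
  have "partial n (christoffel G (up k) 3 3) y = partial n (%y. 0) y"
    by (rule partial_cong[OF R y christoffel_G(4)])
  then show "partial n (christoffel G (up k) 3 3) y = 0" by (simp add: partial_def frechet_derivative_const)
  have "partial 3 (christoffel G 3 (up i) (up j)) y = partial 3 (%y. \<psi> (y $ 3) * h (hor y) $ i $ j) y"
    by (rule partial_cong[OF R y christoffel_G(5)])
  also have "\<dots> = \<psi>1 (y $ 3) * h (hor y) $ i $ j"
    by (rule partial_product(2)[OF deriv_\<psi>[OF hy(2)] h_diff[OF hy(1)]])
  finally show "partial 3 (christoffel G 3 (up i) (up j)) y = \<psi>1 (y $ 3) * h (hor y) $ i $ j" .
  have "partial n (christoffel G 3 3 (up i)) y = partial n (%y. 0) y"
    by (rule partial_cong[OF R y christoffel_G(7)])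
  then show "partial n (christoffel G 3 3 (up i)) y = 0" by (simp add: partial_def frechet_derivative_const)
qed

text \<open>The components contracted in the two diagonal blocks of the Ricci tensor; the inverse
  metric is block diagonal and pairs with these.\<close>

lemma riemann_G:
  assumes y: "y \<in> R"
  shows "riemann G (up c) 3 (up c) 3 y = - \<beta>1 (y $ 3) - (\<beta> (y $ 3))\<^sup>2 + \<beta> (y $ 3) * \<eta> (y $ 3)"
    "riemann G 3 3 3 3 y = 0"
    "riemann G (up c) (up i) (up c) (up j) y = riemann h c i c j (hor y)
      + \<beta> (y $ 3) * \<psi> (y $ 3) * (h (hor y) $ j $ i - (if c = j then h (hor y) $ c $ i else 0))"
    "riemann G 3 (up i) 3 (up j) y = (\<psi>1 (y $ 3) + \<eta> (y $ 3) * \<psi> (y $ 3) - \<psi> (y $ 3) * \<beta> (y $ 3)) * h (hor y) $ j $ i"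
proof -
  note c = christoffel_G[OF y] and p = partial_christoffel[OF y]
  show "riemann G 3 3 3 3 y = 0" by (simp add: riemann_def)
  show "riemann G (up c) 3 (up c) 3 y = - \<beta>1 (y $ 3) - (\<beta> (y $ 3))\<^sup>2 + \<beta> (y $ 3) * \<eta> (y $ 3)"
    unfolding riemann_def sum_up c p
    by (simp add: power2_eq_square if_distrib[of "%t. t * _"] if_distrib[of "%t. - t"] sum_negf cong: if_cong)
  show "riemann G (up c) (up i) (up c) (up j) y = riemann h c i c j (hor y)
      + \<beta> (y $ 3) * \<psi> (y $ 3) * (h (hor y) $ j $ i - (if c = j then h (hor y) $ c $ i else 0))"
    unfolding riemann_def sum_up c p by (simp add: algebra_simps)
  show "riemann G 3 (up i) 3 (up j) y = (\<psi>1 (y $ 3) + \<eta> (y $ 3) * \<psi> (y $ 3) - \<psi> (y $ 3) * \<beta> (y $ 3)) * h (hor y) $ j $ i"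
    unfolding riemann_def sum_up c p
    by (simp add: algebra_simps if_distrib[of "%t. _ * t"] sum_subtractf sum_negf cong: if_cong)
qed

lemma ricci_33:
  assumes y: "y \<in> R"
  shows "ricci G 3 3 y = 2 * (\<beta> (y $ 3) * \<eta> (y $ 3) - \<beta>1 (y $ 3) - (\<beta> (y $ 3))\<^sup>2)"
  unfolding ricci_def sum_up riemann_G[OF y] by simp

lemma ricci_up:
  assumes y: "y \<in> R" and hyp: "hyperbolic_at h (hor y)"
  shows "ricci G (up i) (up j) y = (\<psi>1 (y $ 3) + \<eta> (y $ 3) * \<psi> (y $ 3) - 1) * h (hor y) $ j $ i"
proof -
  have hy: "hor y \<in> S" using y by (auto simp: R_def)
  have sym: "h (hor y) $ a $ c = h (hor y) $ c $ a" for a c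
  proof -
    have "transpose (h (hor y)) $ a $ c = h (hor y) $ c $ a" by (simp add: transpose_def)
    then show ?thesis by (simp add: h_sym[OF hy] del: hor_up)
  qed
  have r: "riemann h c i c j (hor y) = (if c = j then h (hor y) $ i $ c else 0) - h (hor y) $ i $ j" for c
    using hyp by (simp add: hyperbolic_at_def)
  show ?thesis
    unfolding ricci_def sum_up riemann_G[OF y] r
    using sym[of i j] by (simp add: sum.distrib sum_subtractf sum_distrib_left[symmetric]) (simp add: algebra_simps)
qed

lemma scalar_warp:
  assumes y: "y \<in> R" and hyp: "hyperbolic_at h (hor y)"
  shows "scalar G y = 2 * (\<psi>1 (y $ 3) + \<eta> (y $ 3) * \<psi> (y $ 3) - 1) / b (y $ 3)
    + 2 * (\<beta> (y $ 3) * \<eta> (y $ 3) - \<beta>1 (y $ 3) - (\<beta> (y $ 3))\<^sup>2) / e (y $ 3)"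
proof -
  have hy: "hor y \<in> S" using y by (auto simp: R_def)
  have "scalar G y = (\<Sum>i\<in>UNIV. \<Sum>j\<in>UNIV. matrix_inv (h (hor y)) $ i $ j / b (y $ 3) *
      ((\<psi>1 (y $ 3) + \<eta> (y $ 3) * \<psi> (y $ 3) - 1) * h (hor y) $ j $ i)) + 1 / e (y $ 3) * ricci G 3 3 y"
    unfolding scalar_def sum_up inv_G[OF y] ricci_up[OF y hyp] by simp
  also have "(\<Sum>i\<in>UNIV. \<Sum>j\<in>UNIV. matrix_inv (h (hor y)) $ i $ j / b (y $ 3) *
      ((\<psi>1 (y $ 3) + \<eta> (y $ 3) * \<psi> (y $ 3) - 1) * h (hor y) $ j $ i))
     = (\<psi>1 (y $ 3) + \<eta> (y $ 3) * \<psi> (y $ 3) - 1) / b (y $ 3) * (\<Sum>i\<in>UNIV. \<Sum>j\<in>UNIV. matrix_inv (h (hor y)) $ i $ j * h (hor y) $ j $ i)"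
    unfolding sum_distrib_left by (intro sum.cong refl) simp
  also have "\<dots> = (\<psi>1 (y $ 3) + \<eta> (y $ 3) * \<psi> (y $ 3) - 1) / b (y $ 3) * 2"
    unfolding h_inv(1)[OF hy] by simp
  finally show ?thesis by (simp add: ricci_33[OF y])
qed

end

section \<open>The genus two surface as eight right-angled pentagons\<close>

text \<open>The reflections in the coordinate planes cut the surface into eight octants, each bounded by
  five arcs, which lie in "y = 0", \<open>z = 0\<close>, \<open>x = 0\<close>, \<open>y = 0\<close>, \<open>z = 0\<close> in cyclic order. An octant is
  mapped to a right-angled pentagon in the Klein model, whose normalised coordinates are
  \<open>0 \<le> a, b \<le> 1\<close> with \<open>3 a / 4 + b / 2 \<le> 1\<close>; the coordinate \<open>b\<close> is \<open>5 \<tau>\<close>, and \<open>a\<close> is affine in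
  \<open>x\<^sup>2\<close> on each level set of \<open>\<tau>\<close>, where \<open>x\<^sup>2\<close> varies between \<open>lo \<tau>\<close> and \<open>hi \<tau>\<close>.\<close>

definition tau :: "real ^ 3 => real" where
  "tau p = (p $ 1)\<^sup>2 - (p $ 1) ^ 4 - (p $ 2)\<^sup>2 + 1 / 10"

text \<open>By \<open>y_square\<close>, a real \<open>y\<close> on the level
  \<open>tau p = t\<close> means \<open>(x\<^sup>2 - 1 / 2)\<^sup>2 \<le> 7 / 20 - t\<close>. The
  functions \<open>lo\<close> and \<open>hi\<close> are the ends of the resulting interval for
  \<open>x\<^sup>2\<close>, cut off below at \<open>0\<close>.\<close>

definition hi :: "real => real" where "hi t = 1 / 2 + sqrt (7 / 20 - t)"
definition lo :: "real => real" where "lo t = max 0 (1 / 2 - sqrt (7 / 20 - t))"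
text \<open>The largest \<open>a\<close> in the pentagon at height \<open>b\<close>. It bends at
  \<open>b = 1 / 2\<close>, that is at \<open>tau p = 1 / 10\<close>, exactly where
  \<open>lo\<close> becomes positive: below, the interval for \<open>x\<^sup>2\<close> ends at the
  plane \<open>x = 0\<close> and the side is \<open>a = 1\<close>; above, it ends at
  \<open>y = 0\<close> and the side is the slanted one.\<close>

definition Ka :: "real => real" where "Ka b = min 1 ((1 - b / 2) * (4 / 3))"

definition pa :: "real ^ 3 => real" where
  "pa p = Ka (5 * tau p) * ((hi (tau p) - (p $ 1)\<^sup>2) / (hi (tau p) - lo (tau p)))"

definition pb :: "real ^ 3 => real" where "pb p = 5 * tau p"

definition pent :: "real => real => bool" where
  "pent a b \<longleftrightarrow> 0 \<le> a \<and> a \<le> 1 \<and> 0 \<le> b \<and> b \<le> 1 \<and> 3 / 4 * a + b / 2 \<le> 1"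

lemma double_torus_iff: "p \<in> double_torus \<longleftrightarrow> (p $ 3)\<^sup>2 = tau p * (1 / 5 - tau p)"
  unfolding double_torus_def tau_def by (simp add: power2_eq_square algebra_simps) linarith

lemma tau_range:
  assumes "p \<in> double_torus"
  shows "0 \<le> tau p" "tau p \<le> 1 / 5"
proof -
  have "0 \<le> tau p * (1 / 5 - tau p)" using assms by (metis double_torus_iff zero_le_power2)
  then have "0 \<le> tau p \<and> tau p \<le> 1 / 5" by (auto simp: zero_le_mult_iff)
  then show "0 \<le> tau p" "tau p \<le> 1 / 5" by auto
qed

lemma y_square: "(p $ 2)\<^sup>2 = 7 / 20 - tau p - ((p $ 1)\<^sup>2 - 1 / 2)\<^sup>2"
  by (simp add: tau_def power2_eq_square power4_eq_xxxx algebra_simps)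

lemma hi_lo:
  assumes "t \<le> 1 / 5"
  shows "lo t < hi t" "0 \<le> lo t" "0 < hi t"
proof -
  have "0 < sqrt (7 / 20 - t)" using assms by simp
  then show "lo t < hi t" "0 \<le> lo t" "0 < hi t" by (auto simp: lo_def hi_def intro!: add_pos_pos)
qed

lemma lo_zero: "t \<le> 1 / 10 ==> lo t = 0"
  using real_sqrt_le_mono[of "1 / 4" "7 / 20 - t"] by (simp add: lo_def real_sqrt_divide)

lemma lo_nz: "1 / 10 \<le> t ==> lo t = 1 / 2 - sqrt (7 / 20 - t)"
  using real_sqrt_le_mono[of "7 / 20 - t" "1 / 4"] by (simp add: lo_def real_sqrt_divide)

lemma between_iff:
  assumes "t \<le> 1 / 5"
  shows "0 \<le> s \<and> (s - 1 / 2)\<^sup>2 \<le> 7 / 20 - t \<longleftrightarrow> lo t \<le> s \<and> s \<le> hi t"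
proof -
  have "(s - 1 / 2)\<^sup>2 \<le> 7 / 20 - t \<longleftrightarrow> \<bar>s - 1 / 2\<bar> \<le> sqrt (7 / 20 - t)"
    using assms by (metis real_sqrt_abs real_sqrt_le_iff)
  then show ?thesis by (auto simp: lo_def hi_def abs_le_iff)
qed

lemma x_between:
  assumes "p \<in> double_torus"
  shows "lo (tau p) \<le> (p $ 1)\<^sup>2" "(p $ 1)\<^sup>2 \<le> hi (tau p)"
proof -
  have "((p $ 1)\<^sup>2 - 1 / 2)\<^sup>2 \<le> 7 / 20 - tau p" using y_square[of p] zero_le_power2[of "p $ 2"] by linarith
  then have "lo (tau p) \<le> (p $ 1)\<^sup>2 \<and> (p $ 1)\<^sup>2 \<le> hi (tau p)"
    using between_iff[OF tau_range(2)[OF assms], of "(p $ 1)\<^sup>2"] by simp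
  then show "lo (tau p) \<le> (p $ 1)\<^sup>2" "(p $ 1)\<^sup>2 \<le> hi (tau p)" by auto
qed

lemma Ka: "0 \<le> b ==> b \<le> 1 ==> 0 < Ka b" "Ka b \<le> 1" "Ka b \<le> (1 - b / 2) * (4 / 3)"
  by (simp add: Ka_def, simp add: Ka_def, unfold Ka_def, rule min.cobounded2)

lemma pb_range: "p \<in> double_torus ==> 0 \<le> pb p \<and> pb p \<le> 1"
  using tau_range[of p] by (simp add: pb_def)

lemma ratio:
  assumes "p \<in> double_torus"
  defines "q \<equiv> (hi (tau p) - (p $ 1)\<^sup>2) / (hi (tau p) - lo (tau p))"
  shows "0 \<le> q" "q \<le> 1" "q = 0 \<longleftrightarrow> (p $ 1)\<^sup>2 = hi (tau p)" "q = 1 \<longleftrightarrow> (p $ 1)\<^sup>2 = lo (tau p)"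
  using x_between[OF assms(1)] hi_lo(1)[OF tau_range(2)[OF assms(1)]] unfolding q_def
  by (auto simp: field_simps)

lemma pent_pab: "p \<in> double_torus ==> pent (pa p) (pb p)"
proof -
  assume p: "p \<in> double_torus"
  note b = pb_range[OF p] and r = ratio[OF p]
  have K: "0 < Ka (pb p)" using Ka(1) b by blast
  have e: "pa p = Ka (pb p) * ((hi (tau p) - (p $ 1)\<^sup>2) / (hi (tau p) - lo (tau p)))" by (simp add: pa_def pb_def)
  have "pa p \<le> Ka (pb p)" unfolding e using r(2) K mult_left_le by fastforce
  moreover have "0 \<le> pa p" unfolding e using r(1) K by (intro mult_nonneg_nonneg) auto
  ultimately show ?thesis using b Ka(2,3)[of "pb p"] by (auto simp: pent_def)
qed

lemma pa_Ka: "p \<in> double_torus ==> pa p \<le> Ka (pb p)" "p \<in> double_torus ==> pa p = Ka (pb p) \<longleftrightarrow> (p $ 1)\<^sup>2 = lo (tau p)"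
proof -
  assume p: "p \<in> double_torus"
  note b = pb_range[OF p] and r = ratio[OF p]
  have K: "0 < Ka (pb p)" using Ka(1) b by blast
  have e: "pa p = Ka (pb p) * ((hi (tau p) - (p $ 1)\<^sup>2) / (hi (tau p) - lo (tau p)))" by (simp add: pa_def pb_def)
  show "pa p \<le> Ka (pb p)" unfolding e using r(2) K mult_left_le by fastforce
  have "Ka (pb p) * q = Ka (pb p) \<longleftrightarrow> q = 1" for q using K by simp
  then show "pa p = Ka (pb p) \<longleftrightarrow> (p $ 1)\<^sup>2 = lo (tau p)" unfolding e using r(4) by blast
qed

lemma x_zero_iff:
  assumes p: "p \<in> double_torus"
  shows "p $ 1 = 0 \<longleftrightarrow> pa p = 1"
proof
  assume "p $ 1 = 0"
  then have "tau p \<le> 1 / 10" by (simp add: tau_def)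
  then have "lo (tau p) = (p $ 1)\<^sup>2" "Ka (pb p) = 1" using \<open>p $ 1 = 0\<close> lo_zero by (auto simp: Ka_def pb_def)
  then show "pa p = 1" using pa_Ka(2)[OF p] by simp
next
  assume "pa p = 1"
  then have K: "Ka (pb p) = 1" using pa_Ka(1)[OF p] Ka(2)[of "pb p"] by simp
  then have "tau p \<le> 1 / 10" by (simp add: Ka_def pb_def min_def split: if_splits)
  then have "(p $ 1)\<^sup>2 = 0" using pa_Ka(2)[OF p] K \<open>pa p = 1\<close> lo_zero by simp
  then show "p $ 1 = 0" by simp
qed

lemma y_zero_iff:
  assumes p: "p \<in> double_torus"
  shows "p $ 2 = 0 \<longleftrightarrow> pa p = 0 \<or> 3 / 2 * pa p + pb p = 2"
proof -
  have K: "0 < Ka (pb p)" using Ka(1) pb_range[OF p] by blast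
  have a0: "pa p = 0 \<longleftrightarrow> (p $ 1)\<^sup>2 = hi (tau p)"
    using ratio(3)[OF p] K by (simp add: pa_def pb_def)
  have d: "0 \<le> sqrt (7 / 20 - tau p)" "(sqrt (7 / 20 - tau p))\<^sup>2 = 7 / 20 - tau p"
    using tau_range[OF p] by auto
  have "p $ 2 = 0 \<longleftrightarrow> ((p $ 1)\<^sup>2 - 1 / 2)\<^sup>2 = (sqrt (7 / 20 - tau p))\<^sup>2"
    using y_square[of p] d(2) by (auto simp: power2_eq_square)
  also have "\<dots> \<longleftrightarrow> (p $ 1)\<^sup>2 = hi (tau p) \<or> (p $ 1)\<^sup>2 = 1 / 2 - sqrt (7 / 20 - tau p)"
    unfolding power2_eq_iff hi_def by auto
  also have "\<dots> \<longleftrightarrow> pa p = 0 \<or> 3 / 2 * pa p + pb p = 2"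
  proof -
    have "3 / 2 * pa p + pb p = 2" if e: "(p $ 1)\<^sup>2 = 1 / 2 - sqrt (7 / 20 - tau p)"
    proof -
      have "sqrt (7 / 20 - tau p) \<le> 1 / 2" using e zero_le_power2[of "p $ 1"] by linarith
      then have "7 / 20 - tau p \<le> 1 / 4"
        using d power_mono[of "sqrt (7 / 20 - tau p)" "1 / 2" 2] by (simp add: power2_eq_square)
      then have "1 / 10 \<le> tau p" by simp
      then have "(p $ 1)\<^sup>2 = lo (tau p)" "Ka (pb p) = (1 - pb p / 2) * (4 / 3)"
        using e lo_nz by (auto simp: Ka_def pb_def)
      then show ?thesis using pa_Ka(2)[OF p] by simp
    qed
    moreover have "(p $ 1)\<^sup>2 = 1 / 2 - sqrt (7 / 20 - tau p)" if e: "3 / 2 * pa p + pb p = 2"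
    proof -
      have "pa p = (1 - pb p / 2) * (4 / 3)" using e by simp
      then have *: "pa p = Ka (pb p)" "Ka (pb p) = (1 - pb p / 2) * (4 / 3)"
        using pa_Ka(1)[OF p] Ka(3)[of "pb p"] by auto
      then have "1 / 10 \<le> tau p" by (simp add: Ka_def pb_def min_def split: if_splits)
      then show ?thesis using * pa_Ka(2)[OF p] lo_nz by simp
    qed
    ultimately show ?thesis using a0 by blast
  qed
  finally show ?thesis .
qed

lemma z_zero_iff:
  assumes p: "p \<in> double_torus"
  shows "p $ 3 = 0 \<longleftrightarrow> pb p = 0 \<or> pb p = 1"
proof -
  have "p $ 3 = 0 \<longleftrightarrow> tau p * (1 / 5 - tau p) = 0" using p double_torus_iff by (metis power_zero_numeral zero_eq_power2)
  then show ?thesis by (auto simp: pb_def)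
qed

section \<open>The inverse map from the pentagon to the positive octant\<close>

definition sS :: "real => real => real" where
  "sS a b = hi (b / 5) - a / Ka b * (hi (b / 5) - lo (b / 5))"

definition Psi :: "real => real => real ^ 3" where
  "Psi a b = vector [sqrt (sS a b), sqrt (7 / 20 - b / 5 - (sS a b - 1 / 2)\<^sup>2), sqrt (b / 5 * (1 / 5 - b / 5))]"

lemma pent_Ka: "pent a b ==> 0 \<le> a / Ka b \<and> a / Ka b \<le> 1 \<and> 0 < Ka b"
  using Ka(1)[of b] by (auto simp: pent_def Ka_def field_simps)

lemma Psi:
  assumes "pent a b"
  shows "Psi a b \<in> double_torus" "pa (Psi a b) = a" "pb (Psi a b) = b" "0 \<le> Psi a b $ c"
proof -
  have b: "0 \<le> b" "b \<le> 1" using assms by (auto simp: pent_def)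
  have hl: "0 < hi (b / 5) - lo (b / 5)" using hi_lo(1)[of "b / 5"] b by simp
  have r: "0 \<le> a / Ka b" "a / Ka b \<le> 1" "Ka b ~= 0" using pent_Ka[OF assms] by auto
  define w where "w = a / Ka b * (hi (b / 5) - lo (b / 5))"
  have "0 \<le> w" unfolding w_def using r hl by (intro mult_nonneg_nonneg) auto
  moreover have "w \<le> 1 * (hi (b / 5) - lo (b / 5))" unfolding w_def using r hl by (intro mult_right_mono) auto
  ultimately have "lo (b / 5) \<le> sS a b" "sS a b \<le> hi (b / 5)" unfolding sS_def w_def[symmetric] by auto
  then have s: "0 \<le> sS a b" "(sS a b - 1 / 2)\<^sup>2 \<le> 7 / 20 - b / 5"
    using between_iff[of "b / 5" "sS a b"] b by auto
  have sq: "(Psi a b $ 1)\<^sup>2 = sS a b" "(Psi a b $ 2)\<^sup>2 = 7 / 20 - b / 5 - (sS a b - 1 / 2)\<^sup>2"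
    "(Psi a b $ 3)\<^sup>2 = b / 5 * (1 / 5 - b / 5)"
    using s b by (simp_all add: Psi_def)
  have t: "tau (Psi a b) = b / 5" using y_square[of "Psi a b"] unfolding sq by simp
  show "Psi a b \<in> double_torus" unfolding double_torus_iff t sq ..
  show "pb (Psi a b) = b" by (simp add: pb_def t)
  show "pa (Psi a b) = a" unfolding pa_def t sq sS_def using r hl by simp
  show "0 \<le> Psi a b $ c" using exhaust_3[of c] s b by (auto simp: Psi_def)
qed

text \<open>\<open>pa\<close> and \<open>pb\<close> depend on squares of coordinates only, so
  \<open>Psi\<close> can recover a point just up to the signs of its coordinates.\<close>

lemma Psi_pab:
  assumes p: "p \<in> double_torus"
  shows "Psi (pa p) (pb p) $ c = \<bar>p $ c\<bar>"
proof -
  have K: "0 < Ka (5 * tau p)" using Ka(1) pb_range[OF p] by (simp add: pb_def)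
  have hl: "0 < hi (tau p) - lo (tau p)" using hi_lo(1)[OF tau_range(2)[OF p]] by simp
  have s: "sS (pa p) (pb p) = (p $ 1)\<^sup>2" using K hl by (simp add: sS_def pa_def pb_def)
  have "pb p / 5 = tau p" by (simp add: pb_def)
  then have "Psi (pa p) (pb p) = vector [sqrt ((p $ 1)\<^sup>2), sqrt ((p $ 2)\<^sup>2), sqrt ((p $ 3)\<^sup>2)]"
    unfolding Psi_def s using p by (simp add: y_square double_torus_iff)
  then show ?thesis using exhaust_3[of c] by auto
qed

lemma continuous_pab: "continuous_on double_torus pa" "continuous_on double_torus pb"
proof -
  have t: "continuous_on double_torus tau" unfolding tau_def by (intro continuous_intros)
  show "continuous_on double_torus pb" unfolding pb_def by (intro continuous_intros t)
  show "continuous_on double_torus pa"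
  proof -
    have "continuous_on double_torus (%p. hi (tau p))" "continuous_on double_torus (%p. lo (tau p))"
      unfolding hi_def lo_def by (intro continuous_intros t)+
    moreover have "hi (tau p) - lo (tau p) ~= 0" if "p \<in> double_torus" for p
      using hi_lo(1)[OF tau_range(2)[OF that]] by simp
    ultimately show ?thesis unfolding pa_def Ka_def by (intro continuous_intros t) auto
  qed
qed

lemma continuous_Psi:
  assumes "continuous_on A f" "continuous_on A g" "\<And>x. x \<in> A ==> pent (f x) (g x)"
  shows "continuous_on A (%x. Psi (f x) (g x) $ c)"
proof -
  have K: "continuous_on A (%x. Ka (g x))" unfolding Ka_def by (intro continuous_intros assms) auto
  have K0: "Ka (g x) ~= 0" if "x \<in> A" for x using pent_Ka[OF assms(3)[OF that]] by simp
  have s: "continuous_on A (%x. sS (f x) (g x))"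
    unfolding sS_def hi_def lo_def by (intro continuous_intros assms(1,2) K) (use K0 in auto)
  have "continuous_on A (%x. Psi (f x) (g x) $ 1)" unfolding Psi_def vector_3
    by (intro continuous_intros s)
  moreover have "continuous_on A (%x. Psi (f x) (g x) $ 2)" unfolding Psi_def vector_3
    by (intro continuous_intros s assms(1,2)) auto
  moreover have "continuous_on A (%x. Psi (f x) (g x) $ 3)" unfolding Psi_def vector_3
    by (intro continuous_intros assms(1,2)) auto
  ultimately show ?thesis using exhaust_3[of c] by auto
qed

section \<open>The pentagon in the hyperboloid\<close>

text \<open>\<open>om\<close> normalises the Klein point
  \<open>(sqrt 3 / 2 * a, sqrt 2 / 2 * b)\<close> to the hyperboloid. The line orthogonal to both
  \<open>a = 1\<close> and \<open>b = 1\<close> passes through their poles and so has the equation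
  \<open>3 / 4 * a + b / 2 = 1\<close>, the slanted side of \<open>pent\<close>; it meets the disc
  because \<open>3 / 4 + 1 / 2 > 1\<close>. These scales put its corner with \<open>a = 1\<close> at
  \<open>b = 1 / 2\<close>, where \<open>Ka\<close> bends.\<close>

definition om :: "real => real => real" where "om a b = 1 / sqrt (1 - 3 / 4 * a\<^sup>2 - b\<^sup>2 / 2)"

definition Xv :: "real => real => real ^ 3" where
  "Xv a b = vector [sqrt 3 / 2 * a * om a b, sqrt 2 / 2 * b * om a b, om a b]"

definition lform :: "real ^ 3 => real ^ 3 => real" where
  "lform X Y = X $ 1 * Y $ 1 + X $ 2 * Y $ 2 - X $ 3 * Y $ 3"

definition Hyp :: "(real ^ 3) set" where "Hyp = {X. lform X X = -1 \<and> 0 < X $ 3}"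

lemma om_pos:
  assumes "pent a b"
  shows "0 < 1 - 3 / 4 * a\<^sup>2 - b\<^sup>2 / 2" "0 < om a b"
proof -
  have "a\<^sup>2 \<le> a" "b\<^sup>2 \<le> b" using assms by (auto simp: pent_def power2_eq_square mult_left_le)
  moreover have "3 / 4 * a + b / 2 \<le> 1" using assms by (auto simp: pent_def)
  \<comment> \<open>Equality throughout would place \<open>a\<close> and \<open>b\<close> in
    \<open>{0, 1}\<close> and on the slanted side, but none of these four points lies on it.\<close>
  moreover have "\<not> (a\<^sup>2 = a \<and> b\<^sup>2 = b \<and> 3 / 4 * a + b / 2 = 1)"
    by (auto simp: power2_eq_square)
  ultimately show 1: "0 < 1 - 3 / 4 * a\<^sup>2 - b\<^sup>2 / 2"
    by (cases "a\<^sup>2 = a"; cases "b\<^sup>2 = b") linarith+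
  from 1 show "0 < om a b" by (simp add: om_def)
qed

lemma Xv_Hyp:
  assumes "pent a b"
  shows "Xv a b \<in> Hyp"
proof -
  note o = om_pos[OF assms]
  have "(om a b)\<^sup>2 * (1 - 3 / 4 * a\<^sup>2 - b\<^sup>2 / 2) = 1" using o by (simp add: om_def power_divide)
  then have "lform (Xv a b) (Xv a b) = -1"
    by (simp add: lform_def Xv_def power2_eq_square algebra_simps)
  then show ?thesis using o by (simp add: Hyp_def Xv_def)
qed

text \<open>The sides \<open>a = 0\<close>, \<open>b = 0\<close>, \<open>a = 1\<close>, \<open>3 a / 2 + b = 2\<close>, \<open>b = 1\<close> as linear functionals on
  Minkowski space, and the functionals \<open>tv i\<close> which complete two consecutive ones to a Lorentz frame.\<close>

definition nv :: "nat => real ^ 3" where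
  "nv i = (if i = 0 then vector [1, 0, 0] else if i = 1 then vector [0, 1, 0]
    else if i = 2 then vector [-2, 0, sqrt 3] else if i = 3 then vector [- sqrt 3, - sqrt 2, 2]
    else vector [0, - sqrt 2, 1])"

definition tv :: "nat => real ^ 3" where
  "tv i = (if i = 0 then vector [0, 0, 1] else if i = 1 then vector [- sqrt 3, 0, 2]
    else if i = 2 then vector [- (sqrt 2 * sqrt 3), -1, 2 * sqrt 2]
    else if i = 3 then vector [- sqrt 2, - sqrt 3, sqrt 2 * sqrt 3]
    else vector [0, -1, sqrt 2])"

definition nx :: "nat => nat" where "nx i = (if i = 4 then 0 else Suc i)"

text \<open>The coordinate that vanishes on the arc matched with side \<open>i\<close>. Consecutive
  sides get different colours, so four octants meet at every corner and their right angles close up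
  to a full turn.\<close>

definition col :: "nat => 3" where
  "col i = (if i = 0 then 2 else if i = 1 then 3 else if i = 2 then 1 else if i = 3 then 2 else 3)"

definition third :: "nat => 3" where
  "third i = (if i = 0 then 1 else if i = 1 then 2 else if i = 2 then 3 else if i = 3 then 1 else 1)"

lemma less5: "i < 5 ==> i = 0 \<or> i = 1 \<or> i = 2 \<or> i = 3 \<or> i = (4::nat)"
  by linarith

lemma ex5: "(\<exists>k<5. P k) \<longleftrightarrow> P 0 \<or> P 1 \<or> P 2 \<or> P 3 \<or> P (4::nat)"
proof
  assume "\<exists>k<5. P k"
  then obtain k where "k < 5" "P k" by blast
  then show "P 0 \<or> P 1 \<or> P 2 \<or> P 3 \<or> P 4" using less5[of k] by auto
next
  assume "P 0 \<or> P 1 \<or> P 2 \<or> P 3 \<or> P 4"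
  moreover have "(0::nat) < 5" "(1::nat) < 5" "(2::nat) < 5" "(3::nat) < 5" "(4::nat) < 5" by auto
  ultimately show "\<exists>k<5. P k" by metis
qed

lemma all5: "(\<forall>k<5. P k) \<longleftrightarrow> P 0 \<and> P 1 \<and> P 2 \<and> P 3 \<and> P (4::nat)"
  using ex5[of "%k. \<not> P k"] by blast

lemma nx5: "i < 5 ==> nx i < 5" "i < 5 ==> nx i ~= i"
  using less5[of i] by (auto simp: nx_def)

lemma three_neq [simp]: "(1::3) ~= 2" "(1::3) ~= 3" "(2::3) ~= 1" "(2::3) ~= 3" "(3::3) ~= 1" "(3::3) ~= 2"
  by auto

lemma colors: "i < 5 ==> col i ~= col (nx i)" "i < 5 ==> third i ~= col i" "i < 5 ==> third i ~= col (nx i)"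
  "i < 5 ==> c = col i \<or> c = col (nx i) \<or> c = third i"
  using less5[of i] exhaust_3[of c] by (auto simp: nx_def col_def third_def)

definition ell :: "nat => real ^ 3 => real" where "ell k p = nv k \<bullet> Xv (pa p) (pb p)"

lemma inner3: "(x::real ^ 3) \<bullet> y = x $ 1 * y $ 1 + x $ 2 * y $ 2 + x $ 3 * y $ 3"
  by (simp add: inner_vec_def sum_3)

lemma nv_Xv:
  "nv 0 \<bullet> Xv a b = om a b * (sqrt 3 / 2 * a)" "nv 1 \<bullet> Xv a b = om a b * (sqrt 2 / 2 * b)"
  "nv 2 \<bullet> Xv a b = om a b * (sqrt 3 * (1 - a))" "nv 3 \<bullet> Xv a b = om a b * (2 - 3 / 2 * a - b)"
  "nv 4 \<bullet> Xv a b = om a b * (1 - b)"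
proof -
  have "sqrt 3 * (sqrt 3 / 2 * a * om a b) = 3 / 2 * a * om a b" "sqrt 2 * (sqrt 2 / 2 * b * om a b) = b * om a b"
    by (simp_all add: mult.assoc[symmetric])
  then show
  "nv 0 \<bullet> Xv a b = om a b * (sqrt 3 / 2 * a)" "nv 1 \<bullet> Xv a b = om a b * (sqrt 2 / 2 * b)"
  "nv 2 \<bullet> Xv a b = om a b * (sqrt 3 * (1 - a))" "nv 3 \<bullet> Xv a b = om a b * (2 - 3 / 2 * a - b)"
  "nv 4 \<bullet> Xv a b = om a b * (1 - b)"
    by (simp_all add: inner3 nv_def Xv_def algebra_simps)
qed

lemma ell_nonneg:
  assumes "p \<in> double_torus" "k < 5"
  shows "0 \<le> ell k p"
proof -
  have "pent (pa p) (pb p)" by (rule pent_pab[OF assms(1)])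
  then have "0 \<le> om (pa p) (pb p)" "0 \<le> pa p" "0 \<le> pb p" "0 \<le> 1 - pa p" "0 \<le> 2 - 3 / 2 * pa p - pb p" "0 \<le> 1 - pb p"
    using om_pos(2)[of "pa p" "pb p"] by (auto simp: pent_def)
  then have "0 \<le> ell 0 p" "0 \<le> ell 1 p" "0 \<le> ell 2 p" "0 \<le> ell 3 p" "0 \<le> ell 4 p"
    unfolding ell_def nv_Xv by (intro mult_nonneg_nonneg; simp)+
  then show ?thesis using less5[OF assms(2)] by auto
qed

lemma ell_zero:
  assumes "p \<in> double_torus"
  shows "ell 0 p = 0 \<longleftrightarrow> pa p = 0" "ell 1 p = 0 \<longleftrightarrow> pb p = 0" "ell 2 p = 0 \<longleftrightarrow> pa p = 1"
    "ell 3 p = 0 \<longleftrightarrow> 3 / 2 * pa p + pb p = 2" "ell 4 p = 0 \<longleftrightarrow> pb p = 1"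
  using nv_Xv[of "pa p" "pb p"] om_pos(2)[OF pent_pab[OF assms]] unfolding ell_def by auto

lemma coordinate_zero_iff:
  assumes p: "p \<in> double_torus"
  shows "p $ c = 0 \<longleftrightarrow> (\<exists>k<5. col k = c \<and> ell k p = 0)"
proof -
  have c: "col 0 = 2" "col 1 = 3" "col 2 = 1" "col 3 = 2" "col 4 = 3" by (simp_all add: col_def)
  show ?thesis
    unfolding ex5 c ell_zero[OF p]
    using exhaust_3[of c] x_zero_iff[OF p] y_zero_iff[OF p] z_zero_iff[OF p] by auto
qed

text \<open>Sides that are not consecutive are disjoint, so at most two functionals vanish at a
  point, and if two do they belong to consecutive sides.\<close>

lemma star_cover:
  assumes p: "p \<in> double_torus"
  shows "\<exists>i<5. \<forall>k<5. k ~= i --> k ~= nx i --> 0 < ell k p"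
proof -
  note z = ell_zero[OF p]
  have "pent (pa p) (pb p)" by (rule pent_pab[OF p])
  then have n: "\<not> (ell 0 p = 0 \<and> ell 2 p = 0)" "\<not> (ell 1 p = 0 \<and> ell 3 p = 0)" "\<not> (ell 2 p = 0 \<and> ell 4 p = 0)"
    "\<not> (ell 3 p = 0 \<and> ell 0 p = 0)" "\<not> (ell 4 p = 0 \<and> ell 1 p = 0)"
    unfolding z pent_def by auto
  have pos: "0 < ell k p" if "k < 5" "ell k p ~= 0" for k using ell_nonneg[OF p that(1)] that(2) by simp
  have "\<exists>i<5. \<forall>k<5. k ~= i --> k ~= nx i --> ell k p ~= 0"
    unfolding ex5 all5 nx_def using n by simp blast
  then show ?thesis using pos by blast
qed

text \<open>Division by the third coordinate returns to the Klein model, where the five linear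
  inequalities become those of \<open>pent\<close>; this inverts \<open>Xv\<close>.\<close>

lemma Hyp_pent:
  assumes X: "X \<in> Hyp" "\<And>k. k < 5 ==> 0 \<le> nv k \<bullet> X"
  defines "a \<equiv> 2 / sqrt 3 * (X $ 1 / X $ 3)" and "b \<equiv> sqrt 2 * (X $ 2 / X $ 3)"
  shows "pent a b" "Xv a b = X"
proof -
  have X3: "0 < X $ 3" and q: "(X $ 3)\<^sup>2 = 1 + (X $ 1)\<^sup>2 + (X $ 2)\<^sup>2"
    using X(1) by (auto simp: Hyp_def lform_def power2_eq_square)
  have r: "sqrt 3 * sqrt 3 = (3::real)" "sqrt 2 * sqrt 2 = (2::real)" by simp_all
  have aX: "a * X $ 3 = 2 / sqrt 3 * X $ 1" "b * X $ 3 = sqrt 2 * X $ 2" using X3 by (simp_all add: a_def b_def)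
  have X12: "X $ 1 = sqrt 3 / 2 * (a * X $ 3)" "X $ 2 = sqrt 2 / 2 * (b * X $ 3)"
  proof -
    have "sqrt 3 / 2 * (2 / sqrt 3 * t) = t" "sqrt 2 / 2 * (sqrt 2 * t) = t" for t :: real
      by (simp_all add: mult.assoc[symmetric])
    then show "X $ 1 = sqrt 3 / 2 * (a * X $ 3)" "X $ 2 = sqrt 2 / 2 * (b * X $ 3)" unfolding aX by metis+
  qed
  have s3: "sqrt 3 * X $ 1 = 3 / 2 * (a * X $ 3)" unfolding X12(1) by (simp add: mult.assoc[symmetric])
  have n: "0 \<le> X $ 1" "0 \<le> X $ 2" "0 \<le> - 2 * X $ 1 + sqrt 3 * X $ 3"
    "0 \<le> - sqrt 3 * X $ 1 - sqrt 2 * X $ 2 + 2 * X $ 3" "0 \<le> - sqrt 2 * X $ 2 + X $ 3"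
    using X(2)[of 0] X(2)[of 1] X(2)[of 2] X(2)[of 3] X(2)[of 4] by (simp_all add: nv_def inner3)
  have "0 \<le> a" "0 \<le> b" using n(1,2) X3 by (auto simp: a_def b_def)
  moreover have "a \<le> 1"
  proof -
    have "0 \<le> sqrt 3 * ((1 - a) * X $ 3)" using n(3) unfolding X12 by (simp add: algebra_simps)
    then show ?thesis using X3 by (simp add: zero_le_mult_iff)
  qed
  moreover have "b \<le> 1"
  proof -
    have "0 \<le> (1 - b) * X $ 3" using n(5) aX(2) by (simp add: algebra_simps)
    then show ?thesis using X3 by (simp add: zero_le_mult_iff)
  qed
  moreover have "3 / 4 * a + b / 2 \<le> 1"
  proof -
    have "0 \<le> 2 * ((1 - (3 / 4 * a + b / 2)) * X $ 3)"
      using n(4) aX(2) s3 by (simp add: algebra_simps)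
    then show ?thesis using X3 by (simp add: zero_le_mult_iff)
  qed
  ultimately show p: "pent a b" by (simp add: pent_def)
  have "(X $ 3)\<^sup>2 * (1 - 3 / 4 * a\<^sup>2 - b\<^sup>2 / 2) = 1"
    using q unfolding X12 by (simp add: power_mult_distrib power_divide algebra_simps)
  then have "(om a b)\<^sup>2 = (X $ 3)\<^sup>2"
    using om_pos(1)[OF p] by (simp add: om_def power_divide field_simps)
  then have "om a b = X $ 3" using om_pos(2)[OF p] X3 by (simp add: power2_eq_iff_nonneg)
  then show "Xv a b = X"
    using X12 by (simp add: Xv_def vec_eq_iff forall_3)
qed

section \<open>Lorentz transformations acting on the hyperboloid\<close>

definition hl :: "real ^ 2 => real ^ 3" where "hl x = lift x (sqrt (1 + x \<bullet> x))"

definition lor :: "real ^ 3 ^ 3 => bool" where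
  "lor M \<longleftrightarrow> (\<forall>X Y. lform (M *v X) (M *v Y) = lform X Y) \<and> (\<forall>X\<in>Hyp. M *v X \<in> Hyp)"

definition TT :: "real ^ 3 ^ 3 => real ^ 2 => real ^ 2" where "TT M x = hor (M *v hl x)"

lemma inner2: "(x::real ^ 2) \<bullet> y = x $ 1 * y $ 1 + x $ 2 * y $ 2"
  by (simp add: inner_vec_def sum_2)

lemma hl_Hyp: "hl x \<in> Hyp"
proof -
  have "0 < 1 + x \<bullet> x" by (rule one_plus_inner_pos)
  then show ?thesis by (simp add: Hyp_def lform_def hl_def) (simp add: inner2)
qed

lemma hl_hor: "X \<in> Hyp ==> hl (hor X) = X"
proof -
  assume "X \<in> Hyp"
  then have "(X $ 3)\<^sup>2 = 1 + hor X \<bullet> hor X" "0 < X $ 3"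
    by (auto simp: Hyp_def lform_def power2_eq_square inner2)
  then have "sqrt (1 + hor X \<bullet> hor X) = X $ 3" by (metis real_sqrt_unique less_imp_le)
  then show ?thesis unfolding hl_def by simp
qed

lemma lor_hl: "lor M ==> hl (TT M x) = M *v hl x"
  unfolding TT_def by (rule hl_hor) (simp add: lor_def hl_Hyp)

lemma lor_mult: "lor A ==> lor B ==> lor (A ** B)"
  by (simp add: lor_def matrix_vector_mul_assoc[symmetric])

lemma C_inf_hl: "C_inf UNIV hl"
  unfolding hl_def by (intro C_inf_lift C_inf_id C_inf_sqrt C_inf_inner_self open_UNIV one_plus_inner_pos)

lemma C_inf_TT: "C_inf UNIV (TT M)"
proof -
  note h = C_inf_hl
  have "C_inf UNIV (%x. M *v hl x)"
    by (rule C_inf_linear_comp[OF open_UNIV _ h]) (rule matrix_vector_mul_bounded_linear)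
  then show ?thesis unfolding TT_def by (intro C_inf_hor open_UNIV)
qed

lemma hl_has_derivative: "(hl has_derivative (%u. lift u ((x \<bullet> u) / sqrt (1 + x \<bullet> x)))) (at x)"
proof -
  have p: "0 < 1 + x \<bullet> x" by (rule one_plus_inner_pos)
  have "((%x. sqrt (1 + x \<bullet> x)) has_derivative (%u. (x \<bullet> u) / sqrt (1 + x \<bullet> x))) (at x)"
    using p by (auto intro!: derivative_eq_intros simp: inner_commute field_simps)
  then show ?thesis unfolding hl_def[abs_def] by (intro has_derivative_lift has_derivative_ident)
qed

lemma lform_hl_derivative:
  "lform (lift u ((x \<bullet> u) / sqrt (1 + x \<bullet> x))) (lift v ((x \<bullet> v) / sqrt (1 + x \<bullet> x))) = bilin (hyp_metric x) u v"
proof -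
  have "sqrt (1 + x \<bullet> x) * sqrt (1 + x \<bullet> x) = 1 + x \<bullet> x" using one_plus_inner_pos[of x] by simp
  then show ?thesis by (simp add: lform_def bilin_hyp_metric inner2[of u v])
qed

text \<open>\<open>hl\<close> embeds \<open>hyp_metric\<close> isometrically into Minkowski space
  and intertwines \<open>TT M\<close> with the linear map \<open>M\<close>, which is its own
  derivative and preserves \<open>lform\<close>.\<close>

lemma TT_isometry:
  assumes M: "lor M" and D: "(TT M has_derivative D) (at x)"
  shows "bilin (hyp_metric (TT M x)) (D u) (D v) = bilin (hyp_metric x) u v"
proof -
  define E where "E x u = lift u ((x \<bullet> u) / sqrt (1 + x \<bullet> x))" for x u :: "real ^ 2"
  have "((%x. hl (TT M x)) has_derivative (%u. E (TT M x) (D u))) (at x)"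
    using has_derivative_compose[OF D hl_has_derivative] by (simp add: E_def)
  moreover have "((%x. M *v hl x) has_derivative (%u. M *v E x u)) (at x)"
    unfolding E_def by (rule bounded_linear.has_derivative[OF matrix_vector_mul_bounded_linear hl_has_derivative])
  ultimately have "(%u. E (TT M x) (D u)) = (%u. M *v E x u)"
    unfolding lor_hl[OF M] by (rule has_derivative_unique)
  then have "E (TT M x) (D u) = M *v E x u" for u by metis
  then show ?thesis
    using M lform_hl_derivative[of _ "TT M x"] lform_hl_derivative[of _ x] unfolding lor_def E_def by metis
qed

definition eta :: "real ^ 3 ^ 3" where "eta = vector [vector [1, 0, 0], vector [0, 1, 0], vector [0, 0, -1]]"

lemma lform_eta: "lform X Y = X \<bullet> (eta *v Y)"
  by (simp add: lform_def inner3 eta_def matrix_vector_mult_def sum_3)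

lemma eta_eta: "eta ** eta = mat 1"
  by (simp add: vec_eq_iff forall_3 matrix_matrix_mult_def sum_3 eta_def mat_def)

lemma transpose_eta: "transpose eta = eta"
  by (simp add: vec_eq_iff forall_3 transpose_def eta_def)

text \<open>By Lagrange's identity and the two normalisations the spatial part of the product is
  dominated by the product of the time components: the reversed Cauchy-Schwarz inequality.\<close>

lemma timelike_pos:
  assumes t: "lform t t = -1" "0 < t $ 3" and X: "X \<in> Hyp"
  shows "0 < t \<bullet> X"
proof -
  have X': "0 < X $ 3" "(X $ 1)\<^sup>2 + (X $ 2)\<^sup>2 = (X $ 3)\<^sup>2 - 1" using X by (auto simp: Hyp_def lform_def power2_eq_square)
  have t': "(t $ 1)\<^sup>2 + (t $ 2)\<^sup>2 = (t $ 3)\<^sup>2 - 1" using t by (auto simp: lform_def power2_eq_square)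
  let ?s = "t $ 1 * X $ 1 + t $ 2 * X $ 2"
  have "((t $ 1)\<^sup>2 + (t $ 2)\<^sup>2) * ((X $ 1)\<^sup>2 + (X $ 2)\<^sup>2) = ?s\<^sup>2 + (t $ 1 * X $ 2 - t $ 2 * X $ 1)\<^sup>2"
    by (simp add: power2_eq_square algebra_simps)
  then have "?s\<^sup>2 \<le> ((t $ 3)\<^sup>2 - 1) * ((X $ 3)\<^sup>2 - 1)" unfolding X' t' by simp
  also have "\<dots> = (t $ 3 * X $ 3)\<^sup>2 + 1 - ((t $ 3)\<^sup>2 + (X $ 3)\<^sup>2)" by (simp add: power2_eq_square algebra_simps)
  also have "\<dots> < (t $ 3 * X $ 3)\<^sup>2"
    using t' X' zero_le_power2[of "t $ 1"] zero_le_power2[of "t $ 2"] zero_le_power2[of "X $ 1"] zero_le_power2[of "X $ 2"] by linarith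
  finally have "\<bar>?s\<bar>\<^sup>2 < (t $ 3 * X $ 3)\<^sup>2" by simp
  then have "\<bar>?s\<bar> < t $ 3 * X $ 3" by (rule power2_less_imp_less) (use t(2) X'(1) in simp)
  then show ?thesis by (simp add: inner3)
qed

text \<open>The hypothesis says that the rows of \<open>M\<close> form a Lorentz frame. A right
  inverse of a square matrix is also a left inverse, so the columns satisfy the same relation, and
  one argument covers \<open>M\<close> and its inverse.\<close>

lemma lor_criterion:
  assumes M: "M ** eta ** transpose M = eta" "0 < M $ 3 $ 3"
  shows "lor M" "lor (eta ** transpose M ** eta)" "(eta ** transpose M ** eta) ** M = mat 1"
proof -
  have "M ** (eta ** transpose M ** eta) = mat 1" using M(1) eta_eta by (simp add: matrix_mul_assoc)
  then show inv: "(eta ** transpose M ** eta) ** M = mat 1" using matrix_left_right_inverse by blast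
  have "transpose M ** eta ** M = eta ** ((eta ** transpose M ** eta) ** M)"
    by (simp add: matrix_mul_assoc eta_eta)
  then have M': "transpose M ** eta ** M = eta" unfolding inv by simp
  have *: "lor N" if N: "transpose N ** eta ** N = eta" "N ** eta ** transpose N = eta" "0 < N $ 3 $ 3" for N
  proof -
    have f: "lform (N *v X) (N *v Y) = lform X Y" for X Y
    proof -
      have "lform (N *v X) (N *v Y) = X \<bullet> ((transpose N ** eta ** N) *v Y)"
        unfolding lform_eta
        by (metis dot_lmul_matrix inner_commute matrix_vector_mul_assoc transpose_transpose vector_transpose_matrix)
      then show ?thesis by (simp add: N(1) lform_eta)
    qed
    have "lform (N $ 3) (N $ 3) = (N ** eta ** transpose N) $ 3 $ 3"
      by (simp add: lform_def matrix_matrix_mult_def sum_3 transpose_def eta_def)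
    then have l: "lform (N $ 3) (N $ 3) = -1" unfolding N(2) by (simp add: eta_def)
    have "N *v X \<in> Hyp" if X: "X \<in> Hyp" for X
    proof -
      have "(N *v X) $ 3 = N $ 3 \<bullet> X" by (simp add: matrix_vector_mult_def inner3 sum_3)
      then show ?thesis using timelike_pos[OF l N(3) X] X f[of X X] by (simp add: Hyp_def)
    qed
    then show ?thesis using f by (simp add: lor_def)
  qed
  show "lor M" by (rule *[OF M' M(1,2)])
  show "lor (eta ** transpose M ** eta)"
  proof (rule *)
    have tr: "transpose (eta ** transpose M ** eta) = eta ** M ** eta"
      by (simp add: matrix_transpose_mul transpose_eta matrix_mul_assoc)
    have "transpose (eta ** transpose M ** eta) ** eta ** (eta ** transpose M ** eta)
        = eta ** (M ** (eta ** (eta ** eta)) ** transpose M) ** eta"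
      unfolding tr by (simp add: matrix_mul_assoc)
    then show "transpose (eta ** transpose M ** eta) ** eta ** (eta ** transpose M ** eta) = eta"
      by (simp add: eta_eta matrix_mul_rid M(1))
    have "(eta ** transpose M ** eta) ** eta ** transpose (eta ** transpose M ** eta)
        = eta ** (transpose M ** (eta ** (eta ** eta)) ** M) ** eta"
      unfolding tr by (simp add: matrix_mul_assoc)
    then show "(eta ** transpose M ** eta) ** eta ** transpose (eta ** transpose M ** eta) = eta"
      by (simp add: eta_eta matrix_mul_rid M')
    show "0 < (eta ** transpose M ** eta) $ 3 $ 3"
      using M(2) by (simp add: matrix_matrix_mult_def sum_3 transpose_def eta_def)
  qed
qed

section \<open>Sign changes, corner frames and reflections\<close>

definition dg :: "real => real => real ^ 3 ^ 3" where
  "dg a b = vector [vector [a, 0, 0], vector [0, b, 0], vector [0, 0, 1]]"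

lemma dg_mult: "dg a b *v X = vector [a * X $ 1, b * X $ 2, X $ 3]"
  by (simp add: vec_eq_iff forall_3 matrix_vector_mult_def sum_3 dg_def)

lemma lor_dg: "a * a = 1 ==> b * b = 1 ==> lor (dg a b)"
  by (rule lor_criterion(1))
    (simp_all add: vec_eq_iff forall_3 matrix_matrix_mult_def sum_3 transpose_def eta_def dg_def)

text \<open>The isometry that moves corner \<open>i\<close> of the pentagon to
  \<open>(0, 0, 1)\<close> and its two sides to the coordinate axes.\<close>

definition LT :: "nat => real ^ 3 ^ 3" where "LT i = vector [nv i, nv (nx i), tv i]"

definition Linv :: "nat => real ^ 3 ^ 3" where "Linv i = eta ** transpose (LT i) ** eta"

lemma LT_nth: "(LT i *v X) $ 1 = nv i \<bullet> X" "(LT i *v X) $ 2 = nv (nx i) \<bullet> X" "(LT i *v X) $ 3 = tv i \<bullet> X"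
  by (simp_all add: LT_def matrix_vector_mult_def inner3 sum_3)

text \<open>The right angles of the pentagon: normals of consecutive sides are orthogonal, and
  \<open>tv\<close> completes each such pair to a frame. The five corners are checked
  explicitly.\<close>

lemma gram:
  assumes "i < 5"
  shows "lform (nv i) (nv i) = 1" "lform (nv i) (nv (nx i)) = 0" "lform (nv i) (tv i) = 0"
    "lform (nv (nx i)) (tv i) = 0" "lform (tv i) (tv i) = -1" "0 < tv i $ 3"
proof -
  have r: "sqrt 2 * (sqrt 2 * t) = 2 * t" "sqrt 3 * (sqrt 3 * t) = 3 * t" for t :: real
    by (simp_all add: mult.assoc[symmetric])
  show "lform (nv i) (nv i) = 1" "lform (nv i) (nv (nx i)) = 0" "lform (nv i) (tv i) = 0"
    "lform (nv (nx i)) (tv i) = 0" "lform (tv i) (tv i) = -1" "0 < tv i $ 3"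
    using less5[OF assms] by (auto simp: lform_def nv_def tv_def nx_def r algebra_simps)
qed

lemma lform_sym: "lform X Y = lform Y X"
  by (simp add: lform_def mult.commute)

lemma LT_lor:
  assumes "i < 5"
  shows "lor (LT i)" "lor (Linv i)" "Linv i ** LT i = mat 1"
proof -
  have e: "(LT i ** eta ** transpose (LT i)) $ a $ b = lform (LT i $ a) (LT i $ b)" for a b
    by (simp add: lform_def matrix_matrix_mult_def sum_3 transpose_def eta_def)
  have r: "LT i $ 1 = nv i" "LT i $ 2 = nv (nx i)" "LT i $ 3 = tv i" by (simp_all add: LT_def)
  note g = gram[OF assms] gram(1)[OF nx5(1)[OF assms]] lform_sym[of "nv (nx i)" "nv i"]
      lform_sym[of "tv i" "nv i"] lform_sym[of "tv i" "nv (nx i)"]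
  have "LT i ** eta ** transpose (LT i) = eta"
    unfolding vec_eq_iff forall_3 e r g by (simp add: eta_def)
  moreover have "0 < LT i $ 3 $ 3" using gram(6)[OF assms] by (simp add: LT_def)
  ultimately show "lor (LT i)" "lor (Linv i)" "Linv i ** LT i = mat 1"
    unfolding Linv_def by (rule lor_criterion)+
qed

lemma LT_Linv: "i < 5 ==> LT i *v (Linv i *v X) = X"
  using LT_lor(3) matrix_left_right_inverse by (metis matrix_vector_mul_assoc matrix_vector_mul_lid)

lemma Linv_LT: "i < 5 ==> Linv i *v (LT i *v X) = X"
  using LT_lor(3) by (metis matrix_vector_mul_assoc matrix_vector_mul_lid)

text \<open>The Lorentz reflection in side \<open>k\<close>; \<open>eta *v nv k\<close> is the
  vector which the form associates with the functional \<open>nv k\<close>.\<close>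

definition refl :: "nat => real ^ 3 => real ^ 3" where
  "refl k X = X - (2 * (nv k \<bullet> X)) *\<^sub>R (eta *v nv k)"

lemma inner_refl: "w \<bullet> refl k X = w \<bullet> X - 2 * (nv k \<bullet> X) * lform w (nv k)"
  by (simp add: refl_def inner_diff_right lform_eta)

lemma LT_refl:
  assumes "i < 5"
  shows "LT i *v refl i X = dg (-1) 1 *v (LT i *v X)" "LT i *v refl (nx i) X = dg 1 (-1) *v (LT i *v X)"
  using gram[OF assms] gram(1)[OF nx5(1)[OF assms]]
  by (simp_all add: vec_eq_iff forall_3 LT_nth dg_mult inner_refl lform_sym[of "tv i" "nv i"] lform_sym[of "tv i" "nv (nx i)"] lform_sym[of "nv (nx i)" "nv i"])

section \<open>The charts of the surface\<close>

abbreviation "XX p \<equiv> Xv (pa p) (pb p)"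

text \<open>The functionals are hyperbolic sines of the distances to the two sides at corner
  \<open>i\<close>, which are hyperboloid coordinates there; the signs of the matching space
  coordinates unfold the four octants around the corner.\<close>

definition ch :: "nat => real ^ 3 => real ^ 2" where
  "ch i p = vector [sgn (p $ col i) * ell i p, sgn (p $ col (nx i)) * ell (nx i) p]"

definition star :: "nat => (real ^ 3) set" where
  "star i = {p \<in> double_torus. \<forall>k<5. k ~= i --> k ~= nx i --> 0 < ell k p}"

text \<open>A corner of the pentagon occurs at two opposite vertices of the surface, told apart by
  the sign of the coordinate that does not vanish there. Since \<open>ch i\<close> ignores this
  sign, it becomes injective only after fixing \<open>ee\<close>.\<close>

definition UU :: "nat => real => (real ^ 3) set" where
  "UU i ee = {p \<in> star i. 0 < ee * p $ third i}"

lemma XX_Hyp: "p \<in> double_torus ==> XX p \<in> Hyp"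
  by (rule Xv_Hyp[OF pent_pab])

lemma star_zero:
  assumes "i < 5" "p \<in> star i"
  shows "p $ col i = 0 \<longleftrightarrow> ell i p = 0" "p $ col (nx i) = 0 \<longleftrightarrow> ell (nx i) p = 0" "p $ third i ~= 0"
proof -
  have p: "p \<in> double_torus" using assms(2) by (simp add: star_def)
  have only: "k = i \<or> k = nx i" if "k < 5" "ell k p = 0" for k
    using assms(2) that by (force simp: star_def)
  show "p $ col i = 0 \<longleftrightarrow> ell i p = 0" "p $ col (nx i) = 0 \<longleftrightarrow> ell (nx i) p = 0" "p $ third i ~= 0"
    using coordinate_zero_iff[OF p] only colors[OF assms(1)] nx5[OF assms(1)] assms(1) by metis+
qed

text \<open>On the star a functional of the corner vanishes exactly when its coordinate does, so at
  a zero either sign may be used. The weak inequality on \<open>\<sigma>\<close> records this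
  freedom.\<close>

lemma hl_ch:
  assumes i: "i < 5" "p \<in> star i" and \<sigma>: "\<And>c. \<sigma> c = 1 \<or> \<sigma> c = -1" "\<And>c. 0 \<le> \<sigma> c * p $ c"
  shows "hl (ch i p) = dg (\<sigma> (col i)) (\<sigma> (col (nx i))) *v (LT i *v XX p)"
proof -
  have p: "p \<in> double_torus" using i by (simp add: star_def)
  have s: "sgn (p $ col k) * ell k p = \<sigma> (col k) * ell k p" if "p $ col k = 0 \<longleftrightarrow> ell k p = 0" for k
    using \<sigma>(1)[of "col k"] \<sigma>(2)[of "col k"] that by (auto simp: sgn_if)
  define Y where "Y = dg (\<sigma> (col i)) (\<sigma> (col (nx i))) *v (LT i *v XX p)"
  have "\<sigma> c * \<sigma> c = 1" for c using \<sigma>(1)[of c] by auto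
  then have "Y \<in> Hyp" unfolding Y_def using XX_Hyp[OF p] LT_lor(1)[OF i(1)] lor_dg unfolding lor_def by blast
  moreover have "hor Y = ch i p"
    unfolding ch_def s[OF star_zero(1)[OF i]] s[OF star_zero(2)[OF i]]
    by (simp add: Y_def vec_eq_iff forall_2 dg_mult LT_nth) (simp add: ell_def)
  ultimately show ?thesis using hl_hor Y_def by metis
qed

lemma TT_dg: "TT (dg (-1) (-1)) x = - x"
  by (simp add: TT_def dg_mult vec_eq_iff forall_2) (simp add: hl_def)

lemma TT_id: "TT (mat 1) x = x"
  by (simp add: TT_def hl_def)

lemma lor_id: "lor (mat 1)"
  by (simp add: lor_def)

text \<open>On each octant the transition is a Lorentz map built from corner frames and sign
  changes; the point is that one matrix serves all octants near \<open>p0\<close>. For different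
  corners, a mirror through \<open>p0\<close> carries a side \<open>k\<close> common to both, and
  the reflection in it is absorbed equally by the two charts.\<close>

lemma ch_transition:
  assumes i: "i < 5" "p0 \<in> star i" and j: "j < 5" "p0 \<in> star j"
  shows "\<exists>M W. lor M \<and> open W \<and> p0 \<in> W \<and> (\<forall>p\<in>W \<inter> star i \<inter> star j. ch j p = TT M (ch i p))"
proof (cases "i = j")
  case True
  then show ?thesis by (intro exI[of _ "mat 1"] exI[of _ UNIV]) (simp add: TT_id lor_id)
next
  case False
  \<comment> \<open>A coordinate that vanishes at \<open>p0\<close> receives the sign
    \<open>1\<close>; points of \<open>W\<close> can violate this choice in such a coordinate
    only.\<close>
  define \<sigma> where "\<sigma> c = (if 0 \<le> p0 $ c then 1 else -1 :: real)" for c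
  define A where "A \<sigma> i = dg (\<sigma> (col i)) (\<sigma> (col (nx i)))" for \<sigma> :: "3 => real" and i
  define W where "W = {p. \<forall>c. p0 $ c ~= 0 --> 0 < \<sigma> c * p $ c}"
  define M where "M = A \<sigma> j ** LT j ** Linv i ** A \<sigma> i"
  have \<sigma>1: "\<sigma> c = 1 \<or> \<sigma> c = -1" for c by (simp add: \<sigma>_def)
  have "open {p. p0 $ c ~= 0 --> 0 < \<sigma> c * p $ c}" for c
    by (cases "p0 $ c = 0") (auto intro!: open_Collect_less continuous_intros)
  then have "open (\<Inter>c\<in>(UNIV::3 set). {p. p0 $ c ~= 0 --> 0 < \<sigma> c * p $ c})"
    by (intro open_INT ballI finite)
  moreover have "(\<Inter>c\<in>(UNIV::3 set). {p. p0 $ c ~= 0 --> 0 < \<sigma> c * p $ c}) = W" by (auto simp: W_def)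
  ultimately have W: "open W" by (rule back_subst)
  have p0W: "p0 \<in> W" by (auto simp: W_def \<sigma>_def)
  have lorA: "lor (A \<sigma> i)" for i unfolding A_def using \<sigma>1 by (intro lor_dg) (auto simp: \<sigma>_def)
  have M: "lor M" unfolding M_def by (intro lor_mult lorA LT_lor i j)
  have AA: "A \<sigma> i *v (A \<sigma> i *v X) = X" if "\<And>c. \<sigma> c = 1 \<or> \<sigma> c = -1" for \<sigma> i X
    using that[of "col i"] that[of "col (nx i)"]
    by (auto simp: A_def dg_mult vec_eq_iff forall_3)
  have base: "TT M (ch i p) = hor (A \<sigma> j *v (LT j *v (Linv i *v (A \<sigma> i *v hl (ch i p)))))" for p
    by (simp add: TT_def M_def matrix_vector_mul_assoc matrix_mul_assoc)
  have "ch j p = TT M (ch i p)" if p: "p \<in> W" "p \<in> star i" "p \<in> star j" for p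
  proof -
    have hor_hl: "hor (hl x) = x" for x by (simp add: hl_def)
    show ?thesis
    proof (cases "\<forall>c. 0 \<le> \<sigma> c * p $ c")
      case True
      have "hl (ch i p) = A \<sigma> i *v (LT i *v XX p)" "hl (ch j p) = A \<sigma> j *v (LT j *v XX p)"
        unfolding A_def using hl_ch[OF i(1) p(2), of \<sigma>] hl_ch[OF j(1) p(3), of \<sigma>] \<sigma>1 True by auto
      then have "A \<sigma> j *v (LT j *v (Linv i *v (A \<sigma> i *v hl (ch i p)))) = hl (ch j p)"
        by (simp add: AA[OF \<sigma>1] Linv_LT[OF i(1)])
      then show ?thesis unfolding base by (simp add: hor_hl)
    next
      case False
      then obtain c where c: "\<sigma> c * p $ c < 0" unfolding not_all not_le by blast
      then have p0c: "p0 $ c = 0" using p(1) unfolding W_def by force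
      have zero: "\<exists>k<5. col k = d \<and> (k = i \<or> k = nx i) \<and> (k = j \<or> k = nx j)" if "p0 $ d = 0" for d
      proof -
        have "p0 \<in> double_torus" using i by (simp add: star_def)
        from coordinate_zero_iff[OF this, of d] that
        obtain k where k: "k < 5" "col k = d" "ell k p0 = 0" by auto
        moreover have "k = l \<or> k = nx l" if "p0 \<in> star l" for l
          using that k unfolding star_def by (metis (mono_tags, lifting) less_irrefl mem_Collect_eq)
        ultimately show ?thesis using i(2) j(2) by blast
      qed
      obtain k where k: "k < 5" "col k = c" "k = i \<or> k = nx i" "k = j \<or> k = nx j" using zero[OF p0c] by blast
      \<comment> \<open>Different corners share at most one side, so a second coordinate of the
        wrong sign is impossible.\<close>
      have other: "0 \<le> \<sigma> d * p $ d" if "d ~= c" for d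
      proof (rule ccontr)
        assume "\<not> 0 \<le> \<sigma> d * p $ d"
        then have "p0 $ d = 0" using p(1) unfolding W_def by force
        then obtain l where l: "l < 5" "col l = d" "l = i \<or> l = nx i" "l = j \<or> l = nx j" using zero by blast
        have "nx (nx i) ~= i" using less5[OF i(1)] by (auto simp: nx_def)
        then show False using k l that False \<open>i ~= j\<close> by metis
      qed
      define \<sigma>' where "\<sigma>' = \<sigma>(c := - \<sigma> c)"
      have \<sigma>'1: "\<sigma>' d = 1 \<or> \<sigma>' d = -1" for d using \<sigma>1[of d] by (auto simp: \<sigma>'_def)
      have \<sigma>'2: "0 \<le> \<sigma>' d * p $ d" for d using c other[of d] by (auto simp: \<sigma>'_def)
      have h: "hl (ch i p) = A \<sigma>' i *v (LT i *v XX p)" "hl (ch j p) = A \<sigma>' j *v (LT j *v XX p)"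
        unfolding A_def using hl_ch[OF i(1) p(2), of \<sigma>'] hl_ch[OF j(1) p(3), of \<sigma>'] \<sigma>'1 \<sigma>'2 by auto
      \<comment> \<open>Changing the sign of colour \<open>c\<close> in a corner frame amounts to
        reflecting in side \<open>k\<close> first, so both charts are evaluated at the same point
        \<open>refl k (XX p)\<close> with the original signs.\<close>
      have flip: "A \<sigma>' l *v (LT l *v X) = A \<sigma> l *v (LT l *v refl k X)" if l: "l < 5" "k = l \<or> k = nx l" for l X
        using l(2)
      proof
        assume "k = l"
        then show ?thesis
          unfolding A_def \<sigma>'_def using LT_refl(1)[OF l(1), of X] k(2) colors(1)[OF l(1)]
          by (simp add: dg_mult vec_eq_iff forall_3)
      next
        assume "k = nx l"
        then show ?thesis
          unfolding A_def \<sigma>'_def using LT_refl(2)[OF l(1), of X] k(2) colors(1)[OF l(1)]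
          by (simp add: dg_mult vec_eq_iff forall_3)
      qed
      have "A \<sigma> j *v (LT j *v (Linv i *v (A \<sigma> i *v hl (ch i p)))) = A \<sigma> j *v (LT j *v refl k (XX p))"
        unfolding h(1) flip[OF i(1) k(3)] by (simp add: AA[OF \<sigma>1] Linv_LT[OF i(1)])
      also have "\<dots> = hl (ch j p)" unfolding h(2) flip[OF j(1) k(4)] ..
      finally show ?thesis unfolding base by (simp add: hor_hl)
    qed
  qed
  then show ?thesis using M W p0W by blast
qed

section \<open>The antipodal map in the charts\<close>

lemma pab_uminus [simp]: "pa (- p) = pa p" "pb (- p) = pb p"
  by (simp_all add: pa_def pb_def tau_def)

lemma double_torus_uminus: "- p \<in> double_torus \<longleftrightarrow> p \<in> double_torus"
  by (simp add: double_torus_def)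

lemma ell_uminus [simp]: "ell k (- p) = ell k p"
  by (simp add: ell_def)

lemma star_uminus: "- p \<in> star i \<longleftrightarrow> p \<in> star i"
  by (simp add: star_def double_torus_uminus)

lemma UU_uminus: "- p \<in> UU i ee \<longleftrightarrow> p \<in> UU i (- ee)"
  by (simp add: UU_def star_uminus)

lemma ch_uminus: "ch i (- p) = - ch i p"
  by (simp add: ch_def vec_eq_iff forall_2 sgn_minus)

section \<open>Inverse charts\<close>

definition absv :: "real ^ 2 => real ^ 2" where "absv x = (\<chi> i. \<bar>x $ i\<bar>)"

lemma absv_nth [simp]: "absv x $ i = \<bar>x $ i\<bar>"
  by (simp add: absv_def)

abbreviation "pm t \<equiv> t = 1 \<or> t = (-1::real)"

definition img :: "nat => (real ^ 2) set" where
  "img i = {x. \<forall>k<5. k ~= i --> k ~= nx i --> 0 < nv k \<bullet> (Linv i *v hl (absv x))}"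

text \<open>The preimage in the closed positive octant: \<open>absv\<close> folds the four quadrants
  onto one pentagon, and \<open>chinv\<close> restores the signs afterwards.\<close>

definition pt :: "nat => real ^ 2 => real ^ 3" where
  "pt i x = (let X = Linv i *v hl (absv x)
    in Psi (2 / sqrt 3 * (X $ 1 / X $ 3)) (sqrt 2 * (X $ 2 / X $ 3)))"

definition chinv :: "nat => real => real ^ 2 => real ^ 3" where
  "chinv i ee x = (\<chi> c. if c = col i then sgn (x $ 1) * pt i x $ c
    else if c = col (nx i) then sgn (x $ 2) * pt i x $ c else ee * pt i x $ c)"

lemma continuous_on_cart:
  fixes f :: "'a::topological_space => 'b::topological_space ^ 'n::finite"
  assumes "\<And>c. continuous_on A (%x. f x $ c)"
  shows "continuous_on A f"
  using continuous_on_vec_lambda[of A "%c x. f x $ c", OF assms] by simp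

text \<open>The jump of \<open>sgn\<close> at a zero of \<open>f\<close> is harmless because
  \<open>g\<close> vanishes there as well; away from zeros \<open>sgn\<close> is continuous.\<close>

lemma continuous_sgn_mult:
  fixes f g :: "'a::topological_space => real"
  assumes f: "continuous_on A f" and g: "continuous_on A g" and 0: "\<And>x. x \<in> A ==> f x = 0 ==> g x = 0"
  shows "continuous_on A (%x. sgn (f x) * g x)"
  unfolding continuous_on_def
proof
  fix x assume x: "x \<in> A"
  have fx: "(f \<longlongrightarrow> f x) (at x within A)" and gx: "(g \<longlongrightarrow> g x) (at x within A)"
    using f g x by (auto simp: continuous_on_def)
  show "((%x. sgn (f x) * g x) \<longlongrightarrow> sgn (f x) * g x) (at x within A)"
  proof (cases "f x = 0")
    case True
    then have "g x = 0" using 0 x by blast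
    then have "((%x. \<bar>g x\<bar>) \<longlongrightarrow> 0) (at x within A)" using tendsto_rabs[OF gx] by simp
    then have "((%x. sgn (f x) * g x) \<longlongrightarrow> 0) (at x within A)"
      by (rule Lim_null_comparison[rotated]) (auto simp: abs_mult sgn_if)
    then show ?thesis using True by simp
  next
    case False
    then have "((%x. sgn (f x)) \<longlongrightarrow> sgn (f x)) (at x within A)" by (rule tendsto_sgn[OF fx])
    then show ?thesis by (intro tendsto_mult gx)
  qed
qed

lemma continuous_ell: "continuous_on double_torus (ell k)"
proof -
  have "1 - 3 / 4 * (pa p)\<^sup>2 - (pb p)\<^sup>2 / 2 ~= 0" if "p \<in> double_torus" for p
    using om_pos(1)[OF pent_pab[OF that]] by simp
  then have "continuous_on double_torus (%p. om (pa p) (pb p))"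
    unfolding om_def by (intro continuous_intros continuous_pab) auto
  then show ?thesis
    unfolding ell_def inner3 Xv_def vector_3 by (intro continuous_intros continuous_pab) auto
qed

lemma continuous_ch: "i < 5 ==> continuous_on (star i) (ch i)"
proof -
  assume i: "i < 5"
  have s: "star i \<subseteq> double_torus" by (auto simp: star_def)
  have "continuous_on (star i) (%p. sgn (p $ col i) * ell i p)"
    "continuous_on (star i) (%p. sgn (p $ col (nx i)) * ell (nx i) p)"
    by (rule continuous_sgn_mult; use star_zero[OF i] in "auto intro!: continuous_intros continuous_on_subset[OF continuous_ell s]")+
  then have "continuous_on (star i) (%p. ch i p $ c)" for c
    using exhaust_2[of c] by (auto simp: ch_def)
  then show ?thesis by (rule continuous_on_cart)
qed

lemma pt:
  assumes i: "i < 5" and x: "x \<in> img i"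
  shows "pt i x \<in> double_torus" "0 \<le> pt i x $ c" "XX (pt i x) = Linv i *v hl (absv x)"
    "ell i (pt i x) = \<bar>x $ 1\<bar>" "ell (nx i) (pt i x) = \<bar>x $ 2\<bar>" "pt i x \<in> star i"
    "pent (2 / sqrt 3 * ((Linv i *v hl (absv x)) $ 1 / (Linv i *v hl (absv x)) $ 3))
      (sqrt 2 * ((Linv i *v hl (absv x)) $ 2 / (Linv i *v hl (absv x)) $ 3))"
proof -
  define X where "X = Linv i *v hl (absv x)"
  have X: "X \<in> Hyp" unfolding X_def using LT_lor(2)[OF i] hl_Hyp by (simp add: lor_def)
  have L: "LT i *v X = hl (absv x)" unfolding X_def by (rule LT_Linv[OF i])
  have n: "nv i \<bullet> X = \<bar>x $ 1\<bar>" "nv (nx i) \<bullet> X = \<bar>x $ 2\<bar>"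
    using LT_nth(1,2)[of i X] unfolding L by (simp_all add: hl_def)
  have o: "0 < nv k \<bullet> X" if "k < 5" "k ~= i" "k ~= nx i" for k using x that by (simp add: img_def X_def)
  have "0 \<le> nv k \<bullet> X" if "k < 5" for k using n o[OF that] by (cases "k = i \<or> k = nx i") auto
  note P = Hyp_pent[OF X this]
  then show "pent (2 / sqrt 3 * ((Linv i *v hl (absv x)) $ 1 / (Linv i *v hl (absv x)) $ 3))
      (sqrt 2 * ((Linv i *v hl (absv x)) $ 2 / (Linv i *v hl (absv x)) $ 3))"
    by (simp add: X_def)
  have pt: "pt i x = Psi (2 / sqrt 3 * (X $ 1 / X $ 3)) (sqrt 2 * (X $ 2 / X $ 3))" by (simp add: pt_def X_def Let_def)
  note ps = Psi[OF P(1)]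
  show d: "pt i x \<in> double_torus" unfolding pt by (rule ps(1))
  show "0 \<le> pt i x $ c" unfolding pt by (rule Psi(4)[OF P(1)])
  have XX: "XX (pt i x) = X" unfolding pt using ps(2,3) P(2) by simp
  then show "XX (pt i x) = Linv i *v hl (absv x)" by (simp add: X_def)
  show "ell i (pt i x) = \<bar>x $ 1\<bar>" "ell (nx i) (pt i x) = \<bar>x $ 2\<bar>" "pt i x \<in> star i"
    using n o d by (simp_all add: ell_def XX star_def)
qed

lemma abs_eq_pab:
  assumes "\<And>c. \<bar>p $ c\<bar> = \<bar>q $ c\<bar>"
  shows "pa p = pa q" "pb p = pb q" "p \<in> double_torus \<longleftrightarrow> q \<in> double_torus"
proof -
  have "(p $ c)\<^sup>2 = (q $ c)\<^sup>2" for c using assms[of c] by (metis power2_abs)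
  moreover from this have "(p $ c) ^ 4 = (q $ c) ^ 4" for c by (metis power_even_eq power_mult numeral_times_numeral num_double semiring_norm(12))
  ultimately show "pa p = pa q" "pb p = pb q" "p \<in> double_torus \<longleftrightarrow> q \<in> double_torus"
    by (simp_all add: pa_def pb_def tau_def double_torus_def)
qed

lemma abs_sgn: "x ~= 0 ==> \<bar>sgn x * y\<bar> = \<bar>y::real\<bar>" "x ~= 0 ==> 0 < y ==> sgn (sgn x * y) = sgn (x::real)"
  by (auto simp: sgn_if abs_mult)

lemma chinv:
  assumes i: "i < 5" and ee: "pm ee" and x: "x \<in> img i"
  shows "chinv i ee x \<in> UU i ee" "ch i (chinv i ee x) = x"
proof -
  note P = pt[OF i x] and z = star_zero[OF i pt(6)[OF i x]] and c = colors[OF i]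
  have zx: "pt i x $ col i = 0 \<longleftrightarrow> x $ 1 = 0" "pt i x $ col (nx i) = 0 \<longleftrightarrow> x $ 2 = 0" using z P(4,5) by auto
  have e: "chinv i ee x $ col i = sgn (x $ 1) * pt i x $ col i"
    "chinv i ee x $ col (nx i) = sgn (x $ 2) * pt i x $ col (nx i)"
    "chinv i ee x $ third i = ee * pt i x $ third i"
    using c by (auto simp: chinv_def)
  have abs: "\<bar>chinv i ee x $ d\<bar> = \<bar>pt i x $ d\<bar>" for d
  proof -
    have "\<bar>chinv i ee x $ col i\<bar> = \<bar>pt i x $ col i\<bar>" using e(1) zx(1) abs_sgn(1) by (cases "x $ 1 = 0") auto
    moreover have "\<bar>chinv i ee x $ col (nx i)\<bar> = \<bar>pt i x $ col (nx i)\<bar>" using e(2) zx(2) abs_sgn(1) by (cases "x $ 2 = 0") auto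
    moreover have "\<bar>chinv i ee x $ third i\<bar> = \<bar>pt i x $ third i\<bar>" using e(3) ee by (auto simp: abs_mult)
    ultimately show ?thesis using c(4)[of d] by auto
  qed
  have el: "ell k (chinv i ee x) = ell k (pt i x)" for k using abs_eq_pab[OF abs] by (simp add: ell_def)
  have st: "chinv i ee x \<in> star i" using P(6) abs_eq_pab(3)[OF abs] by (simp add: star_def el)
  have "0 < pt i x $ third i" using z(3) P(2)[of "third i"] by simp
  then have "0 < ee * chinv i ee x $ third i" using e(3) ee by auto
  then show "chinv i ee x \<in> UU i ee" using st by (simp add: UU_def)
  have pos: "0 < pt i x $ d" if "pt i x $ d ~= 0" for d using P(2)[of d] that by simp
  have "sgn (chinv i ee x $ col i) * \<bar>x $ 1\<bar> = x $ 1"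
    using e(1) zx(1) pos[of "col i"] abs_sgn(2)[of "x $ 1"] by (cases "x $ 1 = 0") (auto simp: sgn_mult_abs)
  moreover have "sgn (chinv i ee x $ col (nx i)) * \<bar>x $ 2\<bar> = x $ 2"
    using e(2) zx(2) pos[of "col (nx i)"] abs_sgn(2)[of "x $ 2"] by (cases "x $ 2 = 0") (auto simp: sgn_mult_abs)
  ultimately show "ch i (chinv i ee x) = x"
    by (simp add: ch_def vec_eq_iff forall_2 el P(4,5))
qed

lemma ch_chinv:
  assumes i: "i < 5" and ee: "pm ee" and p: "p \<in> UU i ee"
  shows "ch i p \<in> img i" "chinv i ee (ch i p) = p"
proof -
  have st: "p \<in> star i" and d: "p \<in> double_torus" using p by (auto simp: UU_def star_def)
  note z = star_zero[OF i st] and c = colors[OF i]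
  have en: "0 \<le> ell i p" "0 \<le> ell (nx i) p" using ell_nonneg[OF d] i nx5(1)[OF i] by auto
  have ab: "\<bar>ch i p $ 1\<bar> = ell i p" "\<bar>ch i p $ 2\<bar> = ell (nx i) p"
    using z en by (auto simp: ch_def sgn_if abs_mult)
  have "hl (absv (ch i p)) = LT i *v XX p"
  proof -
    have "LT i *v XX p \<in> Hyp" using LT_lor(1)[OF i] XX_Hyp[OF d] by (simp add: lor_def)
    moreover have "hor (LT i *v XX p) = absv (ch i p)"
      by (simp add: vec_eq_iff forall_2 LT_nth ab) (simp add: ell_def)
    ultimately show ?thesis using hl_hor by metis
  qed
  then have X: "Linv i *v hl (absv (ch i p)) = XX p" by (simp add: Linv_LT[OF i])
  show "ch i p \<in> img i" using st by (simp add: img_def X star_def ell_def)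
  have o: "om (pa p) (pb p) ~= 0" using om_pos(2)[OF pent_pab[OF d]] by simp
  have "pt i (ch i p) = Psi (2 / sqrt 3 * (XX p $ 1 / XX p $ 3)) (sqrt 2 * (XX p $ 2 / XX p $ 3))"
    by (simp add: pt_def X Let_def)
  also have "\<dots> = Psi (pa p) (pb p)"
  proof -
    have "2 / sqrt 3 * (XX p $ 1 / XX p $ 3) = pa p" "sqrt 2 * (XX p $ 2 / XX p $ 3) = pb p"
      using o by (simp_all add: Xv_def mult.assoc[symmetric])
    then show ?thesis by simp
  qed
  finally have pt: "pt i (ch i p) $ e = \<bar>p $ e\<bar>" for e using Psi_pab[OF d] by simp
  have s: "sgn (sgn (p $ col k) * ell k p) * \<bar>p $ col k\<bar> = p $ col k"
    if "p $ col k = 0 \<longleftrightarrow> ell k p = 0" "0 \<le> ell k p" for k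
    using that by (cases "p $ col k = 0") (auto simp: sgn_mult sgn_mult_abs)
  have "chinv i ee (ch i p) $ e = p $ e" for e
    using c(4)[of e]
  proof (elim disjE)
    assume "e = col i"
    then show ?thesis using s[OF z(1) en(1)] by (simp add: chinv_def pt) (simp add: ch_def)
  next
    assume "e = col (nx i)"
    then show ?thesis using s[OF z(2) en(2)] c(1) by (simp add: chinv_def pt) (simp add: ch_def)
  next
    assume e: "e = third i"
    have "0 < ee * p $ third i" using p by (simp add: UU_def)
    then show ?thesis using c(2,3) ee e by (auto simp: chinv_def pt)
  qed
  then show "chinv i ee (ch i p) = p" by (simp add: vec_eq_iff)
qed

lemma continuous_hl_absv: "continuous_on A (%x. Linv i *v hl (absv x))"
proof -
  have "continuous_on A absv" unfolding absv_def by (intro continuous_intros)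
  then have "continuous_on A (%x. hl (absv x))"
    by (rule continuous_on_compose2[OF C_inf_continuous[OF C_inf_hl]]) auto
  then show ?thesis
    by (rule bounded_linear.continuous_on[OF matrix_vector_mul_bounded_linear])
qed

lemma open_img: "open (img i)"
proof -
  have "img i = (\<Inter>k\<in>{k. k < 5 \<and> k ~= i \<and> k ~= nx i}. {x. 0 < nv k \<bullet> (Linv i *v hl (absv x))})"
    by (auto simp: img_def)
  moreover have "open {x. 0 < nv k \<bullet> (Linv i *v hl (absv x))}" for k
    by (intro open_Collect_less continuous_intros continuous_hl_absv)
  moreover have "finite {k. k < 5 \<and> k ~= i \<and> k ~= nx i}" by simp
  ultimately show ?thesis by (simp only:) (rule open_INT, auto)
qed

lemma continuous_chinv:
  assumes i: "i < 5"
  shows "continuous_on (img i) (chinv i ee)"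
proof -
  define X where "X x = Linv i *v hl (absv x)" for x
  have X: "continuous_on (img i) X" unfolding X_def by (rule continuous_hl_absv)
  have X3: "X x $ 3 ~= 0" for x
  proof -
    have "X x \<in> Hyp" unfolding X_def using LT_lor(2)[OF i] hl_Hyp by (simp add: lor_def)
    then show ?thesis by (simp add: Hyp_def)
  qed
  have "continuous_on (img i) (%x. Psi (2 / sqrt 3 * (X x $ 1 / X x $ 3)) (sqrt 2 * (X x $ 2 / X x $ 3)) $ c)" for c
    by (rule continuous_Psi) (use X X3 pt(7)[OF i] in "auto simp: X_def[symmetric] intro!: continuous_intros")
  then have pc: "continuous_on (img i) (%x. pt i x $ c)" for c by (simp add: pt_def X_def Let_def)
  have z: "x $ 1 = 0 ==> pt i x $ col i = 0" "x $ 2 = 0 ==> pt i x $ col (nx i) = 0" if "x \<in> img i" for x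
    using star_zero(1,2)[OF i pt(6)[OF i that]] pt(4,5)[OF i that] by auto
  have "continuous_on (img i) (%x. sgn (x $ 1) * pt i x $ col i)" "continuous_on (img i) (%x. sgn (x $ 2) * pt i x $ col (nx i))"
    by (rule continuous_sgn_mult; use z pc in "auto intro!: continuous_intros")+
  then have "continuous_on (img i) (%x. chinv i ee x $ c)" for c
    using pc[of c] by (cases "c = col i"; cases "c = col (nx i)") (auto simp: chinv_def intro!: continuous_intros)
  then show ?thesis by (rule continuous_on_cart)
qed

lemma homeomorphism_ch:
  assumes i: "i < 5" and ee: "pm ee"
  shows "homeomorphism (UU i ee) (img i) (ch i) (chinv i ee)"
proof (rule homeomorphismI)
  show "continuous_on (UU i ee) (ch i)"
    by (rule continuous_on_subset[OF continuous_ch[OF i]]) (auto simp: UU_def)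
  show "continuous_on (img i) (chinv i ee)" by (rule continuous_chinv[OF i])
qed (use chinv[OF i ee] ch_chinv[OF i ee] in auto)

section \<open>Compactness and connectedness of the surface\<close>

lemma compact_double_torus: "compact double_torus"
proof -
  have b: "\<bar>p $ c\<bar> \<le> 2" if p: "p \<in> double_torus" for p c
  proof -
    have t: "0 \<le> tau p" "tau p \<le> 1 / 5" by (rule tau_range[OF p])+
    have "sqrt (7 / 20 - tau p) \<le> 1" using t by simp
    then have h: "hi (tau p) \<le> 2" unfolding hi_def by linarith
    then have "(p $ 1)\<^sup>2 \<le> 2\<^sup>2" using x_between(2)[OF p] by simp
    moreover have "(p $ 2)\<^sup>2 \<le> 4" using y_square[of p] t zero_le_power2[of "(p $ 1)\<^sup>2 - 1 / 2"] by linarith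
    then have "(p $ 2)\<^sup>2 \<le> 2\<^sup>2" by simp
    moreover have "(p $ 3)\<^sup>2 \<le> 2\<^sup>2"
    proof -
      have "tau p * (1 / 5 - tau p) \<le> 1 * 1" using t by (intro mult_mono) auto
      then show ?thesis using p by (simp add: double_torus_iff)
    qed
    ultimately have "(p $ c)\<^sup>2 \<le> 2\<^sup>2" using exhaust_3[of c] by auto
    then show ?thesis using abs_le_square_iff[of "p $ c" 2] by simp
  qed
  have "norm p \<le> 6" if "p \<in> double_torus" for p
    using norm_le_l1_cart[of p] add_mono[OF add_mono[OF b[OF that, of 1] b[OF that, of 2]] b[OF that, of 3]]
    by (simp add: sum_3)
  then have "bounded double_torus" by (rule boundedI)
  moreover have "closed double_torus"
    unfolding double_torus_def by (intro closed_Collect_eq continuous_intros)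
  ultimately show ?thesis by (simp add: compact_eq_bounded_closed)
qed

text \<open>Up to sign the chart coordinates are values of \<open>ell\<close>, which is continuous
  on a compact surface. The bound enters the finiteness of the area and of the integrals along the
  end.\<close>

lemma bounded_img:
  assumes i: "i < 5"
  obtains C where "\<And>x c. x \<in> img i ==> \<bar>x $ c\<bar> \<le> C"
proof -
  have "compact (ell k ` double_torus)" for k
    by (rule compact_continuous_image[OF continuous_ell compact_double_torus])
  then have "\<exists>C. \<forall>p\<in>double_torus. \<bar>ell k p\<bar> \<le> C" for k
    using compact_imp_bounded[of "ell k ` double_torus"] unfolding bounded_iff by auto
  then obtain C where C: "\<And>k p. p \<in> double_torus ==> \<bar>ell k p\<bar> \<le> C k" by metis
  have "\<bar>x $ c\<bar> \<le> max (C i) (C (nx i))" if "x \<in> img i" for x c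
    using pt(1,4,5)[OF i that] C[of "pt i x" i] C[of "pt i x" "nx i"] exhaust_2[of c] by auto
  then show thesis by (rule that)
qed

text \<open>The positive octant is a continuous image of a convex pentagon. Each reflection adds a
  copy that shares a fixed point with what is already there, and three reflections exhaust the
  surface.\<close>

lemma connected_double_torus: "connected double_torus"
proof -
  define P where "P = {x::real ^ 2. pent (x $ 1) (x $ 2)}"
  define S0 where "S0 = (%x. Psi (x $ 1) (x $ 2)) ` P"
  have "convex P"
  proof (rule convexI)
    fix x y :: "real ^ 2" and u v :: real
    assume x: "x \<in> P" and y: "y \<in> P" and uv: "0 \<le> u" "0 \<le> v" "u + v = 1"
    have "u * x $ 1 + v * y $ 1 \<le> 1" "u * x $ 2 + v * y $ 2 \<le> 1"
      "u * (3 / 4 * x $ 1 + x $ 2 / 2) + v * (3 / 4 * y $ 1 + y $ 2 / 2) \<le> 1"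
      by (rule convex_bound_le[OF _ _ uv]; use x y in "simp add: P_def pent_def")+
    moreover have "0 \<le> u * x $ 1 + v * y $ 1" "0 \<le> u * x $ 2 + v * y $ 2"
      using x y uv by (auto simp: P_def pent_def)
    moreover have "3 / 4 * (u * x $ 1 + v * y $ 1) + (u * x $ 2 + v * y $ 2) / 2 =
        u * (3 / 4 * x $ 1 + x $ 2 / 2) + v * (3 / 4 * y $ 1 + y $ 2 / 2)"
      by (simp add: algebra_simps add_divide_distrib)
    ultimately show "u *\<^sub>R x + v *\<^sub>R y \<in> P" unfolding P_def pent_def by simp
  qed
  moreover have "continuous_on P (%x. Psi (x $ 1) (x $ 2))"
  proof -
    have "continuous_on P (%x. Psi (x $ 1) (x $ 2) $ c)" for c
      by (rule continuous_Psi) (auto intro!: continuous_intros simp: P_def)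
    then show ?thesis by (rule continuous_on_cart)
  qed
  ultimately have S0: "connected S0"
    unfolding S0_def by (intro connected_continuous_image convex_connected)
  have S0_iff: "p \<in> S0 \<longleftrightarrow> p \<in> double_torus \<and> (\<forall>c. 0 \<le> p $ c)" for p
  proof
    assume "p \<in> S0"
    then show "p \<in> double_torus \<and> (\<forall>c. 0 \<le> p $ c)" using Psi by (auto simp: S0_def P_def)
  next
    assume p: "p \<in> double_torus \<and> (\<forall>c. 0 \<le> p $ c)"
    then have "p = Psi (pa p) (pb p)" using Psi_pab[of p] by (simp add: vec_eq_iff)
    moreover have "vector [pa p, pb p] \<in> P" using pent_pab p by (simp add: P_def)
    ultimately show "p \<in> S0" unfolding S0_def by (intro image_eqI[of _ _ "vector [pa p, pb p]"]) auto
  qed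
  define rf where "rf d p = (\<chi> c. if c = d then - p $ c else p $ c)" for d :: 3 and p :: "real ^ 3"
  have rf_cont: "continuous_on A (rf d)" for A d
    unfolding rf_def
  proof (intro continuous_intros)
    fix c show "continuous_on A (%x. if c = d then - x $ c else x $ c)"
      by (cases "c = d") (auto intro!: continuous_intros)
  qed
  have step: "connected (A \<union> rf d ` A)" if "connected A" "p \<in> A" "p $ d = 0" for A d p
  proof (rule connected_Un)
    have "rf d p = p" using that(3) by (auto simp: rf_def vec_eq_iff)
    then have "p \<in> A \<inter> rf d ` A" using that(2) by force
    then show "A \<inter> rf d ` A ~= {}" by blast
    show "connected (rf d ` A)" by (rule connected_continuous_image[OF rf_cont that(1)])
  qed (rule that(1))
  define S1 where "S1 = S0 \<union> rf 1 ` S0"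
  define S2 where "S2 = S1 \<union> rf 2 ` S1"
  define S3 where "S3 = S2 \<union> rf 3 ` S2"
  \<comment> \<open>Corners lying on the mirrors: \<open>a = 1\<close> corresponds to
    \<open>x = 0\<close>, and the corner \<open>a = b = 0\<close> lies in both \<open>y = 0\<close>
    and \<open>z = 0\<close>.\<close>
  have pt1: "Psi 1 0 \<in> S0" "Psi 0 0 \<in> S0"
    unfolding S0_def by (rule image_eqI[of _ _ "vector [1, 0]"], simp, simp add: P_def pent_def)
      (rule image_eqI[of _ _ "vector [0, 0]"], simp, simp add: P_def pent_def)
  have pents: "pent 1 0" "pent 0 0" by (auto simp: pent_def)
  have z: "Psi 1 0 $ 1 = 0" using x_zero_iff[OF Psi(1)[OF pents(1)]] Psi(2)[OF pents(1)] by simp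
  have S1: "connected S1" unfolding S1_def by (rule step[OF S0 pt1(1) z])
  have z: "Psi 0 0 $ 2 = 0" using y_zero_iff[OF Psi(1)[OF pents(2)]] Psi(2)[OF pents(2)] by simp
  have S2: "connected S2" unfolding S2_def by (rule step[OF S1 _ z]) (use pt1 in "auto simp: S1_def")
  have z: "Psi 0 0 $ 3 = 0" using z_zero_iff[OF Psi(1)[OF pents(2)]] Psi(3)[OF pents(2)] by simp
  have S3: "connected S3" unfolding S3_def by (rule step[OF S2 _ z]) (use pt1 in "auto simp: S1_def S2_def")
  have rr: "rf d (rf d p) = p" for d p by (simp add: rf_def vec_eq_iff)
  have rS: "rf d p \<in> double_torus \<longleftrightarrow> p \<in> double_torus" for d p
    by (rule abs_eq_pab(3)) (simp add: rf_def)
  have "S3 = double_torus"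
  proof (intro equalityI subsetI)
    fix p assume "p \<in> S3"
    then show "p \<in> double_torus" by (auto simp: S3_def S2_def S1_def S0_iff rS)
  next
    fix p assume p: "p \<in> double_torus"
    have A: "q \<in> S1" if "q \<in> double_torus" "0 \<le> q $ 2" "0 \<le> q $ 3" for q
    proof (cases "0 \<le> q $ 1")
      case True
      then show ?thesis using that by (simp add: S1_def S0_iff forall_3)
    next
      case False
      then have "rf 1 q \<in> S0" using that by (simp add: S0_iff rS forall_3) (simp add: rf_def)
      then show ?thesis unfolding S1_def using rr by (metis UnI2 imageI)
    qed
    have B: "q \<in> S2" if "q \<in> double_torus" "0 \<le> q $ 3" for q
    proof (cases "0 \<le> q $ 2")
      case True
      then show ?thesis using A that by (simp add: S2_def)
    next
      case False
      then have "rf 2 q \<in> S1" using that by (intro A) (simp_all add: rS, simp_all add: rf_def)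
      then show ?thesis unfolding S2_def using rr by (metis UnI2 imageI)
    qed
    show "p \<in> S3"
    proof (cases "0 \<le> p $ 3")
      case True
      then show ?thesis using B p by (simp add: S3_def)
    next
      case False
      then have "rf 3 p \<in> S2" using p by (intro B) (simp_all add: rS, simp_all add: rf_def)
      then show ?thesis unfolding S3_def using rr by (metis UnI2 imageI)
    qed
  qed
  then show ?thesis using S3 by simp
qed

section \<open>The quotient of a cylinder over the surface by an involution\<close>

text \<open>Points are separated by the basic open sets containing them, and sets of natural numbers
  are as many as real numbers. This permits a manifold whose points are reals.\<close>

lemma injection_into_reals: "\<exists>e :: 'a::{second_countable_topology, t2_space} => real. inj e"
proof -
  obtain B :: "'a set set" where B: "countable B" "topological_basis B" using ex_countable_basis by blast
  define f where "f x = {n. x \<in> from_nat_into B n}" for x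
  have "inj f"
  proof (rule injI, rule ccontr)
    fix x y assume e: "f x = f y" and "x ~= y"
    then obtain U where U: "open U" "x \<in> U" "y \<notin> U" using t1_space by blast
    then obtain b where b: "b \<in> B" "x \<in> b" "b \<subseteq> U" using topological_basisE[OF B(2)] by metis
    obtain n where "b = from_nat_into B n" using from_nat_into_surj[OF B(1) b(1)] by blast
    then have "n \<in> f x" "n \<notin> f y" using b U by (auto simp: f_def)
    then show False using e by simp
  qed
  moreover obtain g :: "nat set => real" where "bij g"
    using nat_sets_eqpoll_reals unfolding eqpoll_def by blast
  ultimately show ?thesis by (metis bij_is_inj inj_compose)
qed

text \<open>Quadratic invariants of the joint change of sign, which separate orbits once
  \<open>p\<close> is nonzero. They embed the quotient in a Euclidean space, from which it inherits
  the Hausdorff property and a countable base.\<close>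

definition kap :: "(real ^ 3) \<times> real => (real ^ 3 ^ 3) \<times> (real ^ 3) \<times> real" where
  "kap y = ((\<chi> i j. fst y $ i * fst y $ j), snd y *\<^sub>R fst y, (snd y)\<^sup>2)"

lemma kap_eq:
  assumes "fst y ~= 0"
  shows "kap y = kap y' \<longleftrightarrow> y' = y \<or> y' = - y"
proof
  obtain p s p' s' where y: "y = (p, s)" "y' = (p', s')" by (metis prod.exhaust)
  assume "kap y = kap y'"
  then have e: "p $ i * p $ j = p' $ i * p' $ j" "s *\<^sub>R p = s' *\<^sub>R p'" for i j
    by (auto simp: kap_def y vec_eq_iff)
  have p: "p ~= 0" using assms y by simp
  \<comment> \<open>One nonzero entry of \<open>p\<close> fixes the relative sign, and the products
    with it determine all other entries.\<close>
  then obtain i where i: "p $ i ~= 0" by (auto simp: vec_eq_iff)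
  have "(p $ i - p' $ i) * (p $ i + p' $ i) = 0" using e(1)[of i i] by (simp add: algebra_simps)
  then consider "p' $ i = p $ i" | "p' $ i = - p $ i" by (auto simp: add_eq_0_iff)
  then show "y' = y \<or> y' = - y"
  proof cases
    case 1
    then have "p' $ j = p $ j" for j using e(1)[of i j] i by simp
    then have "p' = p" by (simp add: vec_eq_iff)
    then show ?thesis using e(2) p by (simp add: y)
  next
    case 2
    have p': "p' $ j = - p $ j" for j
    proof -
      have "p $ i * (p $ j + p' $ j) = 0" using e(1)[of i j] 2 by (simp add: distrib_left)
      then show ?thesis using i by (simp add: eq_neg_iff_add_eq_0 add.commute)
    qed
    then have "p' = - p" by (simp add: vec_eq_iff)
    moreover from this have "(s + s') *\<^sub>R p = 0" using e(2) by (simp add: scaleR_add_left)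
    then have "s' = - s" using p by simp
    ultimately show ?thesis by (simp add: y)
  qed
qed (auto simp: kap_def)

section \<open>The orbit space as a topological space of real codes\<close>

definition YY :: "((real ^ 3) \<times> real) set" where "YY = double_torus \<times> {-1..1}"

definition enc :: "(real ^ 3 ^ 3) \<times> (real ^ 3) \<times> real => real" where "enc = (SOME e. inj e)"

lemma inj_enc: "inj enc"
  unfolding enc_def by (rule someI_ex[OF injection_into_reals])

definition qq :: "(real ^ 3) \<times> real => real" where "qq y = enc (kap y)"

definition TB :: "real topology" where "TB = pullback_topology (qq ` YY) (inv enc) euclidean"

lemma torus_nonzero: "p \<in> double_torus ==> p ~= 0"
  by (auto simp: double_torus_def power2_eq_square)

lemma qq_eq: "y \<in> YY ==> qq y = qq y' \<longleftrightarrow> y' = y \<or> y' = - y"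
  unfolding qq_def inj_eq[OF inj_enc] by (rule kap_eq) (auto simp: YY_def dest: torus_nonzero)

lemma qq_uminus: "qq (- y) = qq y"
  by (simp add: qq_def kap_def)

lemma YY_uminus: "- y \<in> YY \<longleftrightarrow> y \<in> YY"
  by (cases y) (auto simp: YY_def double_torus_uminus)

lemma topspace_TB: "topspace TB = qq ` YY"
  by (simp add: TB_def topspace_pullback_topology)

lemma homeomorphic_TB: "homeomorphic_maps TB (top_of_set (kap ` YY)) (inv enc) enc"
  unfolding homeomorphic_maps_def
proof (intro conjI)
  have i: "inv enc (enc x) = x" for x by (rule inv_f_f[OF inj_enc])
  have "continuous_map TB euclidean (id \<circ> inv enc)"
    unfolding TB_def by (rule continuous_map_pullback) simp
  then show "continuous_map TB (top_of_set (kap ` YY)) (inv enc)"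
    by (auto simp: continuous_map_in_subtopology topspace_TB qq_def i)
  have "continuous_map (top_of_set (kap ` YY)) euclidean (inv enc \<circ> enc)"
    by (rule continuous_map_eq[OF continuous_map_from_subtopology[OF continuous_map_id]]) (simp add: i)
  then show "continuous_map (top_of_set (kap ` YY)) TB enc"
    unfolding TB_def by (rule continuous_map_pullback') (auto simp: qq_def)
  show "\<forall>x\<in>topspace TB. enc (inv enc x) = x" by (auto simp: topspace_TB qq_def i)
  show "\<forall>y\<in>topspace (top_of_set (kap ` YY)). inv enc (enc y) = y" by (simp add: i)
qed

lemma homeomorphic_space_TB: "TB homeomorphic_space top_of_set (kap ` YY)"
  using homeomorphic_TB unfolding homeomorphic_space_def by blast

lemma Hausdorff_TB: "Hausdorff_space TB"
  using homeomorphic_Hausdorff_space[OF homeomorphic_space_TB] by (simp add: Hausdorff_space_subtopology)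

lemma second_countable_TB: "second_countable TB"
proof -
  have "second_countable (euclidean :: ((real ^ 3 ^ 3) \<times> (real ^ 3) \<times> real) topology)"
    unfolding second_countable_def
    by (metis ex_countable_basis openin_open_eq open_openin topological_basis_def topological_basisE)
  then show ?thesis
    using homeomorphic_space_second_countability[OF homeomorphic_space_TB] second_countable_subtopology by blast
qed

lemma continuous_qq: "continuous_map (top_of_set YY) TB qq"
proof -
  have "continuous_on YY (%y. (\<chi> i j. fst y $ i * fst y $ j) :: real ^ 3 ^ 3)"
    by (rule continuous_on_cart; rule continuous_on_cart) (auto intro!: continuous_intros)
  then have "continuous_on YY kap" unfolding kap_def[abs_def] by (intro continuous_intros)
  then have "continuous_map (top_of_set YY) (top_of_set (kap ` YY)) kap" by auto
  moreover have "continuous_map (top_of_set (kap ` YY)) TB enc"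
    using homeomorphic_TB by (simp add: homeomorphic_maps_def)
  ultimately have "continuous_map (top_of_set YY) TB (enc \<circ> kap)" by (rule continuous_map_compose)
  then show ?thesis by (simp add: comp_def qq_def[abs_def])
qed

lemma compact_YY: "compact YY"
  unfolding YY_def by (intro compact_Times compact_double_torus) simp

lemma compact_TB: "compact_space TB"
proof -
  have "compactin (top_of_set YY) YY" using compact_YY by (simp add: compactin_subtopology)
  then have "compactin TB (qq ` YY)" by (rule image_compactin[OF _ continuous_qq])
  then show ?thesis by (simp add: compact_space_def topspace_TB)
qed

text \<open>From a compact space to a Hausdorff space \<open>qq\<close> is a closed map. Applied to
  the complement of the saturation of \<open>U\<close> it yields the complement of the image of
  \<open>U\<close>.\<close>

lemma open_qq:
  assumes U: "openin (top_of_set YY) U"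
  shows "openin TB (qq ` U)"
proof -
  have sub: "U \<subseteq> YY" using openin_subset[OF U] by simp
  define W where "W = U \<union> uminus ` U"
  have "openin (top_of_set YY) (uminus ` U)"
  proof -
    obtain O' where O': "open O'" "U = YY \<inter> O'" using U by (meson openin_open)
    have "uminus ` U = YY \<inter> uminus ` O'"
      unfolding O'(2) using YY_uminus by (auto intro!: image_eqI[where f=uminus] simp: image_iff)
    moreover have "open (uminus ` O')" by (rule open_negations[OF O'(1)])
    ultimately show ?thesis by (simp add: openin_open_Int)
  qed
  then have "openin (top_of_set YY) W" unfolding W_def using U by blast
  then have "closedin (top_of_set YY) (YY - W)" by (metis closedin_diff closedin_topspace topspace_euclidean_subtopology)
  then have "compactin (top_of_set YY) (YY - W)"
    using compact_YY closedin_compact_space[of "top_of_set YY"] by (simp add: compact_space_subtopology)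
  then have "closedin TB (qq ` (YY - W))"
    by (rule compactin_imp_closedin[OF Hausdorff_TB image_compactin[OF _ continuous_qq]])
  moreover have "qq ` (YY - W) = topspace TB - qq ` U"
  proof (intro equalityI subsetI)
    fix r assume "r \<in> qq ` (YY - W)"
    then obtain y where y: "y \<in> YY" "y \<notin> W" "r = qq y" by blast
    have "qq y \<notin> qq ` U"
    proof
      assume "qq y \<in> qq ` U"
      then obtain u where "u \<in> U" "qq y = qq u" by blast
      then have "u = y \<or> u = - y" using qq_eq[OF y(1)] by blast
      then have "y \<in> W" using \<open>u \<in> U\<close> unfolding W_def by (metis UnI1 UnI2 imageI minus_minus)
      then show False using y by blast
    qed
    then show "r \<in> topspace TB - qq ` U" using y by (simp add: topspace_TB)
  next
    fix r assume r: "r \<in> topspace TB - qq ` U"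
    then obtain y where y: "y \<in> YY" "r = qq y" by (auto simp: topspace_TB)
    then have "y \<notin> W" using r qq_uminus unfolding W_def by force
    then show "r \<in> qq ` (YY - W)" using y by blast
  qed
  ultimately have "closedin TB (topspace TB - qq ` U)" by simp
  moreover have "qq ` U \<subseteq> topspace TB" using sub by (auto simp: topspace_TB)
  ultimately show ?thesis by (simp add: openin_closedin)
qed

lemma homeomorphic_qq:
  assumes D: "openin (top_of_set YY) D" "inj_on qq D"
  shows "homeomorphic_map (top_of_set D) (subtopology TB (qq ` D)) qq"
    "continuous_map (subtopology TB (qq ` D)) (top_of_set D) (inv_into D qq)"
proof -
  have sub: "D \<subseteq> YY" using openin_subset[OF D(1)] by simp
  then have ts: "topspace (subtopology TB (qq ` D)) = qq ` D" by (auto simp: topspace_TB)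
  have "continuous_map (top_of_set D) TB qq"
    using continuous_map_from_subtopology[OF continuous_qq, of D] sub by (simp add: subtopology_subtopology Int_absorb1)
  then have 1: "continuous_map (top_of_set D) (subtopology TB (qq ` D)) qq" by (auto simp: continuous_map_in_subtopology)
  have "open_map (top_of_set D) (subtopology TB (qq ` D)) qq"
    unfolding open_map_def
  proof (intro allI impI)
    fix U assume U: "openin (top_of_set D) U"
    then have "openin (top_of_set YY) U" using D(1) openin_trans by blast
    then have "openin TB (qq ` U)" by (rule open_qq)
    moreover have "qq ` U \<subseteq> qq ` D" using openin_subset[OF U] by auto
    ultimately show "openin (subtopology TB (qq ` D)) (qq ` U)" by (metis inf.absorb_iff2 openin_subtopology_Int2)
  qed
  then show h: "homeomorphic_map (top_of_set D) (subtopology TB (qq ` D)) qq"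
    using 1 D(2) ts by (intro bijective_open_imp_homeomorphic_map) auto
  obtain g where g: "homeomorphic_maps (top_of_set D) (subtopology TB (qq ` D)) qq g"
    using h homeomorphic_map_maps by blast
  show "continuous_map (subtopology TB (qq ` D)) (top_of_set D) (inv_into D qq)"
    by (rule continuous_map_eq[of _ _ g]) (use g D(2) ts in "auto simp: homeomorphic_maps_def")
qed

lemma is_chart_qq:
  assumes D: "openin (top_of_set YY) D" "inj_on qq D"
    and f: "homeomorphism D I f g" and I: "openin (top_of_set H) I"
  shows "is_chart H TB (qq ` D, %r. f (inv_into D qq r))"
proof -
  have fI: "f ` D = I" "g ` I = D" "\<And>y. y \<in> D ==> g (f y) = y" "\<And>x. x \<in> I ==> f (g x) = x"
    using f by (auto simp: homeomorphism_def)
  have im: "(%r. f (inv_into D qq r)) ` qq ` D = I" using fI D(2) by (force simp: image_image)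
  have ts: "topspace (subtopology TB (qq ` D)) = qq ` D"
    using openin_subset[OF D(1)] by (auto simp: topspace_TB)
  have "homeomorphic_maps (subtopology TB (qq ` D)) (top_of_set I) (%r. f (inv_into D qq r)) (%x. qq (g x))"
    unfolding homeomorphic_maps_def
  proof (intro conjI)
    have "continuous_map (top_of_set D) (top_of_set I) f" "continuous_map (top_of_set I) (top_of_set D) g"
      using f by (auto simp: homeomorphism_def)
    then show "continuous_map (subtopology TB (qq ` D)) (top_of_set I) (%r. f (inv_into D qq r))"
      "continuous_map (top_of_set I) (subtopology TB (qq ` D)) (%x. qq (g x))"
      using continuous_map_compose[OF homeomorphic_qq(2)[OF D], of "top_of_set I" f]
        continuous_map_compose[of "top_of_set I" "top_of_set D" g, OF _ homeomorphic_imp_continuous_map[OF homeomorphic_qq(1)[OF D]]]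
      by (auto simp: comp_def)
    show "\<forall>x\<in>topspace (subtopology TB (qq ` D)). qq (g (f (inv_into D qq x))) = x"
      unfolding ts using fI D(2) by auto
    show "\<forall>y\<in>topspace (top_of_set I). f (inv_into D qq (qq (g y))) = y"
      using fI D(2) by auto
  qed
  then have "homeomorphic_map (subtopology TB (qq ` D)) (top_of_set I) (%r. f (inv_into D qq r))"
    by (rule homeomorphic_maps_imp_map)
  then show ?thesis unfolding is_chart_def using im I open_qq[OF D(1)] by simp
qed

section \<open>The charts of the quotient\<close>

text \<open>The level \<open>s = -1\<close> is left out because a half-space chart has only one
  boundary face; its points reappear at \<open>s = 1\<close> over the opposite copy
  \<open>UU i (- ee)\<close>.\<close>

definition Dm :: "nat => real => ((real ^ 3) \<times> real) set" where "Dm i ee = UU i ee \<times> {-1<..1}"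

definition cc :: "nat => (real ^ 3) \<times> real => real ^ 3" where "cc i y = lift (ch i (fst y)) (1 - snd y)"

definition bc :: "nat => real => (real, 3) chart" where
  "bc i ee = (qq ` Dm i ee, %r. cc i (inv_into (Dm i ee) qq r))"

definition BB :: "(real, 3) chart set" where "BB = {bc i ee |i ee. i < 5 \<and> (pm ee)}"

lemma UU_torus: "p \<in> UU i ee ==> p \<in> double_torus"
  by (simp add: UU_def star_def)

lemma openin_UU: "openin (top_of_set double_torus) (UU i ee)"
proof -
  define K where "K = {k::nat. k < 5 \<and> k ~= i \<and> k ~= nx i}"
  have 1: "openin (top_of_set double_torus) (double_torus \<inter> ell k -` {0<..})" for k
    by (rule continuous_openin_preimage_gen[OF continuous_ell]) simp
  then have "openin (top_of_set double_torus) ((\<Inter>k\<in>K. double_torus \<inter> ell k -` {0<..}) \<inter> topspace (top_of_set double_torus))"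
    by (intro openin_INT) (auto simp: K_def)
  moreover have "openin (top_of_set double_torus) (double_torus \<inter> {p. 0 < ee * p $ third i})"
    by (intro openin_open_Int open_Collect_less continuous_intros)
  moreover have "UU i ee = ((\<Inter>k\<in>K. double_torus \<inter> ell k -` {0<..}) \<inter> topspace (top_of_set double_torus))
      \<inter> (double_torus \<inter> {p. 0 < ee * p $ third i})"
    by (auto simp: UU_def star_def K_def)
  ultimately show ?thesis by (metis openin_Int)
qed

lemma openin_slab:
  assumes "open J"
  shows "openin (top_of_set YY) (UU i ee \<times> ({-1..1} \<inter> J))"
  unfolding YY_def by (rule openin_Times[OF openin_UU]) (use assms in auto)

lemma openin_Dm: "openin (top_of_set YY) (Dm i ee)"
proof -
  have "{-1<..1::real} = {-1..1} \<inter> {-1<..}" by auto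
  then show ?thesis unfolding Dm_def using openin_slab[of "{-1<..}"] by (metis open_greaterThan)
qed

lemma Dm_YY: "y \<in> Dm i ee ==> y \<in> YY"
  by (auto simp: Dm_def YY_def dest: UU_torus)

text \<open>Opposite points differ in the sign of the coordinate \<open>third i\<close>, so they
  never lie in the same copy \<open>UU i ee\<close>.\<close>

lemma inj_qq_Dm: "inj_on qq (Dm i ee)"
proof (rule inj_onI)
  fix y y' assume y: "y \<in> Dm i ee" "y' \<in> Dm i ee" and "qq y = qq y'"
  then have "y' = y \<or> y' = - y" using qq_eq[OF Dm_YY] by blast
  moreover have "y' ~= - y"
  proof
    assume "y' = - y"
    then have "- fst y \<in> UU i ee" "fst y \<in> UU i ee" using y by (auto simp: Dm_def)
    then show False unfolding UU_uminus by (auto simp: UU_def)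
  qed
  ultimately show "y = y'" by simp
qed

lemma bc_apply: "y \<in> Dm i ee ==> snd (bc i ee) (qq y) = cc i y"
  by (simp add: bc_def inj_qq_Dm)

lemma fst_bc: "fst (bc i ee) = qq ` Dm i ee"
  by (simp add: bc_def)

lemma continuous_on_lift:
  assumes "continuous_on A f" "continuous_on A t"
  shows "continuous_on A (%y. lift (f y) (t y))"
proof (rule continuous_on_cart)
  fix c :: 3
  have "continuous_on A (%y. f y $ 1)" "continuous_on A (%y. f y $ 2)"
    by (intro continuous_intros assms)+
  then show "continuous_on A (%y. lift (f y) (t y) $ c)" using exhaust_3[of c] assms by auto
qed

lemma continuous_hor: "continuous_on A hor"
  by (rule linear_continuous_on[OF linear_hor])

definition slab :: "nat => (real ^ 3) set" where "slab i = {x. hor x \<in> img i \<and> 0 \<le> x $ 3 \<and> x $ 3 < 2}"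

lemma homeomorphism_cc:
  assumes i: "i < 5" and ee: "pm ee"
  shows "homeomorphism (Dm i ee) (slab i) (cc i) (%x. (chinv i ee (hor x), 1 - x $ 3))"
proof (rule homeomorphismI)
  note h = homeomorphism_ch[OF i ee]
  have c: "continuous_on (UU i ee) (ch i)" "continuous_on (img i) (chinv i ee)" using h by (auto simp: homeomorphism_def)
  show "continuous_on (Dm i ee) (cc i)" unfolding cc_def[abs_def]
    by (intro continuous_on_lift continuous_intros continuous_on_compose2[OF c(1)]) (auto simp: Dm_def)
  show "continuous_on (slab i) (%x. (chinv i ee (hor x), 1 - x $ 3))"
    by (intro continuous_intros continuous_on_compose2[OF c(2) continuous_hor]) (auto simp: slab_def)
  show "cc i ` Dm i ee \<subseteq> slab i" using ch_chinv[OF i ee] by (auto simp: cc_def Dm_def slab_def)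
  show "(%x. (chinv i ee (hor x), 1 - x $ 3)) ` slab i \<subseteq> Dm i ee"
    using chinv[OF i ee] by (auto simp: Dm_def slab_def)
  show "cc i (chinv i ee (hor x), 1 - x $ 3) = x" if "x \<in> slab i" for x
    using chinv[OF i ee, of "hor x"] that by (auto simp: cc_def slab_def)
  show "(chinv i ee (hor (cc i y)), 1 - cc i y $ 3) = y" if "y \<in> Dm i ee" for y
    using ch_chinv(2)[OF i ee, of "fst y"] that by (cases y) (auto simp: cc_def Dm_def)
qed

lemma openin_slab_half: "openin (top_of_set half_space) (slab i)"
proof -
  have "open (hor -` img i \<inter> {x. x $ 3 < 2})"
    by (intro open_Int open_halfspace_component_lt_cart continuous_open_vimage open_img)
      (rule linear_continuous_at[OF linear_hor])
  moreover have "slab i = half_space \<inter> (hor -` img i \<inter> {x. x $ 3 < 2})" by (auto simp: slab_def half_space_def)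
  ultimately show ?thesis by (metis openin_open_Int)
qed

lemma is_chart_bc: "i < 5 ==> pm ee ==> is_chart half_space TB (bc i ee)"
  unfolding bc_def by (rule is_chart_qq[OF openin_Dm inj_qq_Dm homeomorphism_cc openin_slab_half])

lemma image_bc: "i < 5 ==> pm ee ==> snd (bc i ee) ` fst (bc i ee) = slab i"
  using homeomorphism_image1[OF homeomorphism_cc[of i ee]] bc_apply[of _ i ee]
  unfolding fst_bc image_image by simp

text \<open>The representative is chosen with nonnegative height, which puts it into
  \<open>Dm\<close>. The last clause keeps a point of positive height unchanged; the charts at
  infinity rely on it.\<close>

lemma cover_bc:
  assumes "y \<in> YY"
  obtains i ee z where "i < 5" "pm ee" "z \<in> Dm i ee" "qq z = qq y" "z = y \<or> z = - y" "0 < snd y ==> z = y"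
proof -
  define z where "z = (if 0 < snd y then y else - y)"
  have z: "z \<in> YY" "qq z = qq y" "z = y \<or> z = - y" "0 \<le> snd z" "0 < snd y ==> z = y"
    using assms YY_uminus qq_uminus by (auto simp: z_def)
  then have "fst z \<in> double_torus" by (simp add: YY_def mem_Times_iff)
  then obtain i where i: "i < 5" "fst z \<in> star i" using star_cover by (auto simp: star_def)
  define ee :: real where "ee = (if 0 < fst z $ third i then 1 else -1)"
  have "fst z \<in> UU i ee" using i star_zero(3)[OF i] by (auto simp: UU_def ee_def)
  moreover have "snd z \<le> 1" using z(1) by (auto simp: YY_def)
  ultimately have "z \<in> Dm i ee" using z(4) by (cases z) (auto simp: Dm_def)
  moreover have "pm ee" by (simp add: ee_def)
  ultimately show thesis using that i z by blast
qed

text \<open>The shape of every base transition near a point: a surface isometry, together with the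
  identity (\<open>\<beta> = 1\<close>) or the flip \<open>w \<mapsto> 2 - w\<close>
  (\<open>\<beta> = -1\<close>) of the height \<open>w = 1 - s\<close>, the latter being
  \<open>s \<mapsto> - s\<close>.\<close>

definition FF :: "real ^ 3 ^ 3 => real => real ^ 3 => real ^ 3" where
  "FF M \<beta> x = lift (TT M (hor x)) (1 - \<beta> + \<beta> * x $ 3)"

lemma TT_mult: "lor B ==> TT (A ** B) x = TT A (TT B x)"
  by (simp add: TT_def[of A] lor_hl) (simp add: TT_def matrix_vector_mul_assoc)

lemma bc_overlap:
  assumes i: "i < 5" and j: "j < 5" and y: "y \<in> Dm i ee" and y': "y' \<in> Dm j ee'" and q: "qq y = qq y'"
  shows "\<exists>M \<beta> W. lor M \<and> \<beta> * \<beta> = 1 \<and> openin (top_of_set YY) W \<and> y \<in> W \<and> W \<subseteq> Dm i ee \<and> qq ` W \<subseteq> qq ` Dm j ee' \<and>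
    (\<forall>z\<in>W. snd (bc j ee') (qq z) = FF M \<beta> (snd (bc i ee) (qq z)))"
proof -
  have yY: "y \<in> YY" by (rule Dm_YY[OF y])
  have si: "fst y \<in> star i" using y by (auto simp: Dm_def UU_def)
  consider "y' = y" | "y' = - y" using q qq_eq[OF yY] by blast
  then show ?thesis
  proof cases
    case 1
    then have sj: "fst y \<in> star j" using y' by (auto simp: Dm_def UU_def)
    obtain M W0 where M: "lor M" "open W0" "fst y \<in> W0" "\<And>p. p \<in> W0 \<inter> star i \<inter> star j ==> ch j p = TT M (ch i p)"
      using ch_transition[OF i si j sj] by blast
    define W where "W = Dm i ee \<inter> Dm j ee' \<inter> (YY \<inter> W0 \<times> UNIV)"
    have W: "openin (top_of_set YY) W"
      unfolding W_def by (intro openin_Int openin_Dm openin_open_Int open_Times M open_UNIV)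
    have "snd (bc j ee') (qq z) = FF M 1 (snd (bc i ee) (qq z))" if z: "z \<in> W" for z
    proof -
      have "ch j (fst z) = TT M (ch i (fst z))" by (rule M(4)) (use z in "auto simp: W_def Dm_def UU_def")
      then show ?thesis using z by (simp add: W_def bc_apply cc_def FF_def)
    qed
    moreover have "y \<in> W" using 1 y y' yY M(3) by (cases y) (auto simp: W_def)
    ultimately show ?thesis using W M(1)
      by (intro exI[of _ M] exI[of _ 1] exI[of _ W]) (auto simp: W_def)
  next
    case 2
    then have uj: "fst y \<in> UU j (- ee')" using y' UU_uminus[of "fst y" j ee'] by (simp add: Dm_def mem_Times_iff)
    then have sj: "fst y \<in> star j" by (auto simp: UU_def)
    obtain M W0 where M: "lor M" "open W0" "fst y \<in> W0" "\<And>p. p \<in> W0 \<inter> star i \<inter> star j ==> ch j p = TT M (ch i p)"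
      using ch_transition[OF i si j sj] by blast
    \<comment> \<open>At height \<open>1\<close> the opposite point has height \<open>-1\<close> and
      lies outside every \<open>Dm\<close>; the open interval excludes this level.\<close>
    define W where "W = Dm i ee \<inter> UU j (- ee') \<times> ({-1..1} \<inter> {-1<..<1}) \<inter> (YY \<inter> W0 \<times> UNIV)"
    have W: "openin (top_of_set YY) W"
      unfolding W_def by (intro openin_Int openin_Dm openin_slab openin_open_Int open_Times M open_UNIV open_greaterThanLessThan)
    have m: "- z \<in> Dm j ee'" if z: "z \<in> W" for z
      using z UU_uminus[of "fst z" j ee'] by (cases z) (auto simp: W_def Dm_def)
    \<comment> \<open>\<open>ch j\<close> is odd, so the antipodal identification composes the
      transition with the half-turn \<open>dg (-1) (-1)\<close> and flips the height.\<close>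
    have "snd (bc j ee') (qq z) = FF (dg (-1) (-1) ** M) (-1) (snd (bc i ee) (qq z))" if z: "z \<in> W" for z
    proof -
      have "ch j (fst z) = TT M (ch i (fst z))" by (rule M(4)) (use z in "auto simp: W_def Dm_def UU_def")
      then have "ch j (fst (- z)) = TT (dg (-1) (-1) ** M) (ch i (fst z))"
        using ch_uminus[of j "fst z"] by (simp add: TT_mult[OF M(1)] TT_dg)
      then show ?thesis using z bc_apply[OF m[OF z]] by (simp add: W_def bc_apply cc_def FF_def qq_uminus)
    qed
    moreover have "y \<in> W" using 2 y y' yY M(3) uj by (cases y) (auto simp: W_def Dm_def)
    moreover have "qq ` W \<subseteq> qq ` Dm j ee'" using m qq_uminus by (metis image_eqI image_subsetI)
    moreover have "lor (dg (-1) (-1) ** M)" by (intro lor_mult lor_dg M) auto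
    ultimately show ?thesis using W
      by (intro exI[of _ "dg (-1) (-1) ** M"] exI[of _ "-1"] exI[of _ W]) (auto simp: W_def)
  qed
qed

lemma BB_overlap:
  assumes b: "b \<in> BB" and c: "c \<in> BB" and p: "p \<in> fst b \<inter> fst c"
  shows "\<exists>M \<beta> W. lor M \<and> \<beta> * \<beta> = 1 \<and> openin TB W \<and> p \<in> W \<and> W \<subseteq> fst b \<inter> fst c \<and>
    (\<forall>r\<in>W. snd c r = FF M \<beta> (snd b r))"
proof -
  obtain i ee j ee' where b: "i < 5" "b = bc i ee" and c: "j < 5" "c = bc j ee'" using b c by (auto simp: BB_def)
  obtain y y' where y: "y \<in> Dm i ee" "y' \<in> Dm j ee'" "p = qq y" "qq y = qq y'"
    using p unfolding b c fst_bc by auto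
  obtain M \<beta> W where "lor M" "\<beta> * \<beta> = 1" "openin (top_of_set YY) W" "y \<in> W" "W \<subseteq> Dm i ee" "qq ` W \<subseteq> qq ` Dm j ee'"
    "\<forall>z\<in>W. snd (bc j ee') (qq z) = FF M \<beta> (snd (bc i ee) (qq z))"
    using bc_overlap[OF b(1) c(1) y(1,2,4)] by blast
  then show ?thesis using open_qq[of W] y(3)
    by (intro exI[of _ M] exI[of _ \<beta>] exI[of _ "qq ` W"]) (auto simp: b c fst_bc)
qed

lemma BB_chart: "b \<in> BB ==> is_chart half_space TB b"
  by (auto simp: BB_def is_chart_bc)

lemma C_inf_FF: "C_inf UNIV (FF M \<beta>)"
  unfolding FF_def[abs_def]
  by (intro C_inf_lift C_inf_add C_inf_mult C_inf_const C_inf_nth C_inf_id open_UNIV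
      C_inf_compose[OF open_UNIV open_UNIV _ C_inf_linear[OF open_UNIV linear_hor] C_inf_TT]) auto

lemma FF_has_derivative:
  assumes "(TT M has_derivative E) (at (hor x))"
  shows "(FF M \<beta> has_derivative (%v. lift (E (hor v)) (\<beta> * v $ 3))) (at x)"
proof -
  have "((%x. TT M (hor x)) has_derivative (%v. E (hor v))) (at x)"
    by (rule has_derivative_compose[OF bounded_linear_imp_has_derivative[OF linear_hor] assms])
  moreover have "((%x. 1 - \<beta> + \<beta> * x $ 3) has_derivative (%v. \<beta> * v $ 3)) (at x)"
    by (auto intro!: derivative_eq_intros bounded_linear.has_derivative[OF bounded_linear_vec_nth])
  ultimately show ?thesis unfolding FF_def[abs_def] by (rule has_derivative_lift)
qed

lemma BB_transition_derivative:
  assumes b: "b \<in> BB" and c: "c \<in> BB" and p: "p \<in> fst b \<inter> fst c"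
    and D: "tder b c p D"
  shows "\<exists>M \<beta> E. lor M \<and> \<beta> * \<beta> = 1 \<and> snd c p = FF M \<beta> (snd b p) \<and>
    (TT M has_derivative E) (at (hor (snd b p))) \<and> D = (%v. lift (E (hor v)) (\<beta> * v $ 3))"
proof -
  obtain M \<beta> W where M: "lor M" "\<beta> * \<beta> = 1" and W: "openin TB W" "p \<in> W" "W \<subseteq> fst b \<inter> fst c"
    and e: "\<forall>r\<in>W. snd c r = FF M \<beta> (snd b r)"
    using BB_overlap[OF b c p] by blast
  have So: "openin (top_of_set half_space) (snd b ` W)"
    by (rule is_chart_image_openin[OF BB_chart[OF b] W(1)]) (use W in auto)
  have D': "(transition b c has_derivative D) (at (snd b p) within snd b ` W)"
    by (rule has_derivative_subset[OF D]) (use W in auto)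
  obtain E where E: "(TT M has_derivative E) (at (hor (snd b p)))"
    using C_inf_has_derivative[OF C_inf_TT, of _ M] by blast
  have "(FF M \<beta> has_derivative (%v. lift (E (hor v)) (\<beta> * v $ 3))) (at (snd b p) within snd b ` W)"
    by (rule has_derivative_at_withinI[OF FF_has_derivative[OF E]])
  then have "(transition b c has_derivative (%v. lift (E (hor v)) (\<beta> * v $ 3))) (at (snd b p) within snd b ` W)"
    by (rule has_derivative_transform[rotated 2])
      (use W e transition_apply[OF BB_chart[OF b], of _ c] in auto)
  from thick_derivative_unique[OF thick_half_space So _ D' this] W(2)
  have "D = (%v. lift (E (hor v)) (\<beta> * v $ 3))" by blast
  then show ?thesis using M E e W by blast
qed

lemma BB_smooth_transition:
  assumes b: "b \<in> BB" and c: "c \<in> BB"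
  shows "smooth_transition b c"
proof (rule smooth_transition_local[OF BB_chart[OF b]])
  fix p assume p: "p \<in> fst b \<inter> fst c"
  obtain M \<beta> W where W: "openin TB W" "p \<in> W" "W \<subseteq> fst b \<inter> fst c"
    and e: "\<forall>r\<in>W. snd c r = FF M \<beta> (snd b r)"
    using BB_overlap[OF b c p] by blast
  have "smooth_on (snd b ` W) (FF M \<beta>)" by (rule smooth_on_C_inf[OF open_UNIV C_inf_FF]) auto
  then have "smooth_on (snd b ` W) (transition b c)"
    by (rule smooth_on_cong[rotated]) (use W e transition_apply[OF BB_chart[OF b], of _ c] in auto)
  then show "\<exists>W. openin TB W \<and> p \<in> W \<and> W \<subseteq> fst b \<inter> fst c \<and> smooth_on (snd b ` W) (transition b c)"
    using W by blast
qed

section \<open>The compactified metric on the quotient\<close>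

definition Omf :: "real => real" where "Omf w = w * (2 - w)"

text \<open>In the height \<open>w = 1 - s\<close> the defining function
  \<open>1 - s\<^sup>2\<close> is \<open>Omf w\<close>. This is the coefficient of
  \<open>dw\<^sup>2\<close> that remains after the zero of the profile at the horizon has
  cancelled.\<close>

definition evert :: "real => real" where "evert w = 4 / (1 + Omf w - (Omf w)\<^sup>2)"

text \<open>The factor \<open>1 / 2\<close> of the surface metric is
  \<open>(r * \<Omega>)\<^sup>2\<close>.\<close>

definition gam :: "real ^ 3 => real ^ 3 ^ 3" where "gam = warp (%w. 1 / 2) evert hyp_metric"

text \<open>An open set reaching beyond the face \<open>w = 0\<close>, since smoothness up to the
  boundary is defined through extensions.\<close>

definition Vg :: "(real ^ 3) set" where "Vg = {y. 0 < 1 + Omf (y $ 3) - (Omf (y $ 3))\<^sup>2}"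

lemma Omf_flip: "\<beta> * \<beta> = 1 ==> Omf (1 - \<beta> + \<beta> * w) = Omf w"
proof -
  assume "\<beta> * \<beta> = 1"
  then have "\<beta> = 1 \<or> \<beta> = -1" by (simp add: square_eq_1_iff)
  then show "Omf (1 - \<beta> + \<beta> * w) = Omf w" by (elim disjE) (simp_all add: Omf_def algebra_simps)
qed

lemma C_inf_Omf: "open U ==> C_inf U (%y. Omf (y $ 3))" for U :: "(real ^ 3) set"
  unfolding Omf_def by (intro C_inf_mult C_inf_diff C_inf_const C_inf_nth C_inf_id)

lemma open_Vg: "open Vg"
  unfolding Vg_def Omf_def by (intro open_Collect_less continuous_intros)

lemma C_inf_warp:
  assumes U: "open U" and b: "C_inf U (%y. b (y $ 3))" and e: "C_inf U (%y. e (y $ 3))" and h: "C_inf U (%y. h (hor y))"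
  shows "C_inf U (warp b e h)"
proof (intro C_inf_vec U)
  fix i j
  show "C_inf U (%y. warp b e h y $ i $ j)"
    by (rule cases_up[of i]; rule cases_up[of j]) (auto intro!: C_inf_mult C_inf_nth C_inf_const assms)
qed

lemma C_inf_gam: "C_inf Vg gam"
  unfolding gam_def
proof (rule C_inf_warp[OF open_Vg])
  show "C_inf Vg (%y. 1 / 2)" by (rule C_inf_const[OF open_Vg])
  show "C_inf Vg (%y. evert (y $ 3))"
    unfolding evert_def
    by (intro C_inf_divide C_inf_diff C_inf_add C_inf_power C_inf_const C_inf_Omf open_Vg) (auto simp: Vg_def)
  show "C_inf Vg (%y. hyp_metric (hor y))"
    by (rule C_inf_compose[OF open_Vg open_UNIV _ C_inf_linear[OF open_Vg linear_hor] C_inf_hyp_metric]) auto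
qed

lemma warp_sym: "transpose (h (hor y)) = h (hor y) ==> transpose (warp b e h y) = warp b e h y"
proof -
  assume "transpose (h (hor y)) = h (hor y)"
  then have "h (hor y) $ 1 $ 2 = h (hor y) $ 2 $ 1" unfolding transpose_def vec_eq_iff by simp
  then show ?thesis by (simp add: vec_eq_iff forall_3 transpose_def warp_def)
qed

lemma warp_pos:
  assumes "0 < b (y $ 3)" "0 < e (y $ 3)" "\<And>v. v ~= 0 ==> 0 < bilin (h (hor y)) v v" "v ~= 0"
  shows "0 < bilin (warp b e h y) v v"
proof (cases "hor v = 0")
  case True
  then have "v $ 3 ~= 0" using assms(4) by (auto simp: vec_eq_iff forall_3 forall_2)
  then have "0 < v $ 3 * v $ 3" using not_real_square_gt_zero by blast
  then have "0 < e (y $ 3) * (v $ 3 * v $ 3)" using assms(2) by (rule mult_pos_pos[rotated])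
  then show ?thesis using True by (simp add: bilin_warp mult.assoc) (simp add: bilin_inner)
next
  case False
  then have "0 < b (y $ 3) * bilin (h (hor y)) (hor v) (hor v)" using assms by simp
  moreover have "0 \<le> e (y $ 3) * v $ 3 * v $ 3" using assms(2) by (simp add: mult.assoc)
  ultimately show ?thesis by (simp add: bilin_warp)
qed

lemma slab_Vg: "slab i \<subseteq> Vg"
proof
  fix x assume "x \<in> slab i"
  then have w: "0 \<le> x $ 3" "x $ 3 < 2" by (auto simp: slab_def)
  have o: "0 \<le> Omf (x $ 3)" using w by (simp add: Omf_def)
  moreover have "Omf (x $ 3) = 1 - (x $ 3 - 1)\<^sup>2" by (simp add: Omf_def power2_eq_square algebra_simps)
  then have "Omf (x $ 3) \<le> 1" by simp
  ultimately have "(Omf (x $ 3))\<^sup>2 \<le> Omf (x $ 3)" by (simp add: power2_eq_square mult_left_le)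
  then show "x \<in> Vg" by (simp add: Vg_def)
qed

text \<open>The isometry condition splits: \<open>TT_isometry\<close> handles the surface part, and
  the radial coefficient is invariant under the flip, with \<open>\<beta>\<close> entering through
  its square.\<close>

global_interpretation bar: model_metric half_space TB BB gam Vg
proof
  show "Hausdorff_space TB" "second_countable TB" by (rule Hausdorff_TB, rule second_countable_TB)
  show "is_chart half_space TB b" if "b \<in> BB" for b using BB_chart[OF that] .
  show "compatible b c" if "b \<in> BB" "c \<in> BB" for b c
    using BB_smooth_transition that by (simp add: compatible_iff)
  show "(\<Union>b\<in>BB. fst b) = topspace TB"
  proof
    show "(\<Union>b\<in>BB. fst b) \<subseteq> topspace TB" using BB_chart is_chart_subset by blast
    show "topspace TB \<subseteq> (\<Union>b\<in>BB. fst b)"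
    proof
      fix r assume "r \<in> topspace TB"
      then obtain y where "y \<in> YY" "r = qq y" by (auto simp: topspace_TB)
      then obtain i ee z where "i < 5" "pm ee" "z \<in> Dm i ee" "r = qq z" by (metis cover_bc)
      then have "bc i ee \<in> BB" "r \<in> fst (bc i ee)" unfolding BB_def fst_bc by auto
      then show "r \<in> (\<Union>b\<in>BB. fst b)" by blast
    qed
  qed
  show "thick half_space" by (rule thick_half_space)
  show "open Vg" "C_inf Vg gam" by (rule open_Vg, rule C_inf_gam)
  show "snd b ` fst b \<subseteq> Vg" if "b \<in> BB" for b using that slab_Vg image_bc unfolding BB_def by (smt (verit) mem_Collect_eq)
  show "transpose (gam x) = gam x" if "x \<in> Vg" for x
    unfolding gam_def by (rule warp_sym[OF transpose_hyp_metric])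
  show "0 < bilin (gam x) v v" if "x \<in> Vg" "v ~= 0" for x v
    unfolding gam_def by (rule warp_pos) (use that hyp_metric_pos in "auto simp: evert_def Vg_def")
  fix b c p D u v
  assume b: "b \<in> BB" and c: "c \<in> BB" and p: "p \<in> fst b \<inter> fst c"
    and D: "tder b c p D"
  obtain M \<beta> E where M: "lor M" "\<beta> * \<beta> = 1" "snd c p = FF M \<beta> (snd b p)"
    and E: "(TT M has_derivative E) (at (hor (snd b p)))" and D: "D = (%v. lift (E (hor v)) (\<beta> * v $ 3))"
    using BB_transition_derivative[OF b c p D] by blast
  have e: "evert (1 - \<beta> + \<beta> * t) = evert t" for t by (simp add: evert_def Omf_flip[OF M(2)])
  have \<beta>: "t * (\<beta> * a) * (\<beta> * b) = t * a * b" for t a b using M(2) by (metis mult.assoc mult.left_commute mult_1)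
  show "bilin (gam (snd b p)) u v = bilin (gam (snd c p)) (D u) (D v)"
    unfolding gam_def bilin_warp D M(3) FF_def using TT_isometry[OF M(1) E] by (simp add: e \<beta>)
qed

text \<open>A chart with the same coordinate map as a base chart has the identity as transition to
  it, so its components are still given by \<open>\<gamma>\<close>. This serves restrictions, which
  lie outside the base family.\<close>

lemma (in model_metric) metric_restrict:
  assumes c: "c \<in> Atlas M" "p \<in> fst c" and b: "b \<in> B" "p \<in> fst b" and e: "snd b = snd c"
  shows "metric c (snd c p) = \<gamma> (snd b p)"
proof -
  obtain D where D: "tder c b p D"
    using transition_has_derivative[OF Atlas_compatible[OF c(1) base_in_Atlas[OF b(1)]], of p] c(2) b(2) by blast
  have "D = id"
    by (rule transition_derivative_self[OF thick Atlas_chart[OF c(1)] c(2) e b(2) _ D])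
      (use base_chart[OF b(1)] in "auto simp: is_chart_def")
  then show ?thesis
    using metric_pull[OF c b D] by (simp add: pull_def matrix_id_mat_1 matrix_mul_lid matrix_mul_rid)
qed

lemma bilin_scaleR: "bilin (a *\<^sub>R G) u v = a * bilin G u v"
  by (simp add: bilin_def sum_distrib_left mult.assoc)

lemma conformal_riemannian:
  assumes g: "riemannian_metric Mb gb" and f: "smooth_function Mb f"
    and M: "\<And>c. c \<in> Atlas M ==> c \<in> Atlas Mb \<and> inj_on (snd c) (fst c) \<and> (\<forall>p\<in>fst c. 0 < f p)"
  shows "riemannian_metric M (%c x. (1 / (f (inv_into (fst c) (snd c) x))\<^sup>2) *\<^sub>R gb c x)"
  unfolding riemannian_metric_def
proof (intro conjI ballI allI impI)
  fix c assume c: "c \<in> Atlas M"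
  have "smooth_on (snd c ` fst c) (f \<circ> inv_into (fst c) (snd c))"
    using f M[OF c] by (auto simp: smooth_function_def)
  moreover have "smooth_on {0<..} (%t::real. 1 / t\<^sup>2)"
    by (rule smooth_on_C_inf[of "{0<..}"])
      (auto intro!: C_inf_divide C_inf_const C_inf_power C_inf_id)
  moreover have "(f \<circ> inv_into (fst c) (snd c)) ` snd c ` fst c \<subseteq> {0<..}" using M[OF c] by auto
  ultimately have "smooth_on (snd c ` fst c) (%x. 1 / ((f \<circ> inv_into (fst c) (snd c)) x)\<^sup>2)"
    by (rule smooth_on_compose)
  moreover have "smooth_on (snd c ` fst c) (gb c)" using g M[OF c] by (simp add: riemannian_metric_def)
  ultimately have "smooth_on (snd c ` fst c) (%x. (1 / ((f \<circ> inv_into (fst c) (snd c)) x)\<^sup>2) *\<^sub>R gb c x)"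
    by (rule smooth_on_combine) (intro C_inf_scaleR)
  then show "smooth_on (snd c ` fst c) (%x. (1 / (f (inv_into (fst c) (snd c) x))\<^sup>2) *\<^sub>R gb c x)" by simp
next
  fix c x assume c: "c \<in> Atlas M" and x: "x \<in> snd c ` fst c"
  let ?a = "1 / (f (inv_into (fst c) (snd c) x))\<^sup>2"
  have gx: "transpose (gb c x) = gb c x" "\<And>v. v ~= 0 ==> 0 < bilin (gb c x) v v"
    using g M[OF c] x by (auto simp: riemannian_metric_def)
  have "transpose (?a *\<^sub>R gb c x) = ?a *\<^sub>R transpose (gb c x)" by (simp add: vec_eq_iff transpose_def)
  then show "transpose (?a *\<^sub>R gb c x) = ?a *\<^sub>R gb c x" unfolding gx .
  have "0 < f (inv_into (fst c) (snd c) x)" using M[OF c] x by auto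
  then show "0 < bilin (?a *\<^sub>R gb c x) v v" if "v ~= 0" for v using gx(2)[OF that] by (simp add: bilin_scaleR)
next
  fix c d p D u v assume c: "c \<in> Atlas M" and d: "d \<in> Atlas M" and p: "p \<in> fst c \<inter> fst d"
    and D: "tder c d p D"
  have "bilin (gb c (snd c p)) u v = bilin (gb d (snd d p)) (D u) (D v)"
    using g M[OF c] M[OF d] p D unfolding riemannian_metric_def by blast
  moreover have "inv_into (fst c) (snd c) (snd c p) = p" "inv_into (fst d) (snd d) (snd d p) = p"
    using M[OF c] M[OF d] p by auto
  ultimately show "bilin ((1 / (f (inv_into (fst c) (snd c) (snd c p)))\<^sup>2) *\<^sub>R gb c (snd c p)) u v =
      bilin ((1 / (f (inv_into (fst d) (snd d) (snd d p)))\<^sup>2) *\<^sub>R gb d (snd d p)) (D u) (D v)"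
    by (simp add: bilin_scaleR)
qed

text \<open>Supplies the hypotheses of \<open>coordinate_change\<close> for two charts of a
  manifold. The field \<open>G\<close> has to agree with \<open>g d\<close> on the overlap only, so
  an explicit formula can take its place.\<close>

lemma metric_coordinate_change:
  assumes H: "thick H" and M: "smooth_manifold H M" "riemannian_metric M g" "c \<in> Atlas M" "d \<in> Atlas M"
    and o: "open (snd c ` (fst c \<inter> fst d))" "open (snd d ` (fst c \<inter> fst d))"
    and G: "C_inf (snd d ` (fst c \<inter> fst d)) G" "\<And>y. y \<in> snd d ` (fst c \<inter> fst d) ==> G y = g d y"
  shows "coordinate_change (snd c ` (fst c \<inter> fst d)) (snd d ` (fst c \<inter> fst d)) (transition c d) G (g c)"
proof -
  note ch = smooth_manifold_chart[OF M(1,3)] smooth_manifold_chart[OF M(1,4)]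
  let ?U = "snd c ` (fst c \<inter> fst d)" and ?V = "snd d ` (fst c \<inter> fst d)"
  have cd: "compatible c d" by (rule smooth_manifold_compatible[OF M(1,3,4)])
  have s1: "C_inf ?U (transition c d)" and s2: "C_inf ?V (transition d c)"
    using cd smooth_on_openD[OF o(1)] smooth_on_openD[OF o(2)] by (auto simp: compatible_def)
  define D where "D x = Dat (transition c d) x" for x
  have D: "(transition c d has_derivative D x) (at x)" if "x \<in> ?U" for x
    unfolding D_def by (rule C_inf_has_derivative[OF s1 that])
  have lin: "linear (D x)" if "x \<in> ?U" for x using D[OF that] has_derivative_linear by blast
  show ?thesis
  proof
    show "open ?U" "open ?V" "C_inf ?U (transition c d)" "C_inf ?V G" by (fact o s1 G)+
    show "transition c d ` ?U \<subseteq> ?V" using transition_apply[OF ch(1), of _ d] by auto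
    fix x assume x: "x \<in> ?U"
    then obtain p where p: "p \<in> fst c \<inter> fst d" "x = snd c p" by blast
    have t: "transition c d x = snd d p" using transition_apply[OF ch(1), of p d] p by auto
    have "bilin (g c (snd c p)) u v = bilin (g d (snd d p)) (D x u) (D x v)" for u v
      using M(2-4) p has_derivative_at_withinI[OF D[OF x]] unfolding riemannian_metric_def by blast
    then show "g c x = pull (matrix (Dat (transition c d) x)) (G (transition c d x))"
      unfolding t D_def[symmetric] using G(2)[of "snd d p"] p
      using lin[OF x] by (intro bilin_ext) (simp add: bilin_pull matrix_works)
    define E where "E = Dat (transition d c) (snd d p)"
    have E: "(transition d c has_derivative E) (at (snd d p))"
      unfolding E_def by (rule C_inf_has_derivative[OF s2]) (use p in auto)
    have "E (D x v) = v" for v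
      by (rule transition_derivative_inverse[OF H ch p(1)])
        (use has_derivative_at_withinI[OF D[OF x]] has_derivative_at_withinI[OF E] p in auto)
    then have "E \<circ> D x = id" by auto
    then have "matrix E ** matrix (D x) = mat 1"
      using matrix_compose[OF lin[OF x] has_derivative_linear[OF E]] by (simp add: matrix_id_mat_1)
    then have "det (matrix E) * det (matrix (D x)) = 1" by (metis det_mul det_I)
    then show "det (matrix (Dat (transition c d) x)) ~= 0" unfolding D_def by auto
  next
    fix y assume y: "y \<in> ?V"
    then have "y \<in> snd d ` fst d" by auto
    then have *: "transpose (g d y) = g d y" "\<And>v. v ~= 0 ==> 0 < bilin (g d y) v v"
      using M(2,4) unfolding riemannian_metric_def by blast+
    then show "transpose (G y) = G y" "det (G y) ~= 0" using G(2)[OF y] positive_det_nz[of "G y"] by auto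
  qed
qed

section \<open>The defining function of the boundary\<close>

abbreviation "Mbar \<equiv> generated half_space TB BB"

text \<open>Decodes the invariant \<open>s\<^sup>2\<close>, the last component of
  \<open>kap\<close>.\<close>

definition Om :: "real => real" where "Om r = 1 - snd (snd (inv enc r))"

lemma inv_enc_qq: "inv enc (qq y) = kap y"
  unfolding qq_def by (rule inv_f_f[OF inj_enc])

lemma Om_qq: "Om (qq y) = 1 - (snd y)\<^sup>2"
  unfolding Om_def inv_enc_qq by (simp add: kap_def)

lemma Om_range: "p \<in> topspace TB ==> 0 \<le> Om p \<and> Om p \<le> 1"
  by (auto simp: topspace_TB Om_qq YY_def abs_square_le_1)

lemma Om_base:
  assumes "b \<in> BB" "p \<in> fst b"
  shows "Om p = Omf (snd b p $ 3)" "0 \<le> snd b p $ 3" "snd b p $ 3 < 2"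
proof -
  obtain i ee where b: "b = bc i ee" using assms(1) by (auto simp: BB_def)
  then obtain z where z: "z \<in> Dm i ee" "p = qq z" using assms(2) by (auto simp: fst_bc)
  then have w: "snd b p $ 3 = 1 - snd z" by (simp add: b bc_apply cc_def)
  have "-1 < snd z" "snd z \<le> 1" using z by (auto simp: Dm_def)
  then show "Om p = Omf (snd b p $ 3)" "0 \<le> snd b p $ 3" "snd b p $ 3 < 2"
    unfolding z(2) unfolding w[unfolded z(2)] Om_qq Omf_def by (simp_all add: power2_eq_square algebra_simps)
qed

lemma continuous_Om: "continuous_map TB euclideanreal Om"
proof -
  have "continuous_map TB (top_of_set (kap ` YY)) (inv enc)"
    using homeomorphic_TB by (simp add: homeomorphic_maps_def)
  moreover have "continuous_map (top_of_set (kap ` YY)) euclideanreal (%x. 1 - snd (snd x))"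
    by (auto intro!: continuous_intros)
  ultimately have "continuous_map TB euclideanreal ((%x. 1 - snd (snd x)) \<circ> inv enc)"
    by (rule continuous_map_compose)
  then show ?thesis by (simp add: comp_def Om_def[abs_def])
qed

lemma openin_level: "open J ==> openin TB {p \<in> topspace TB. Om p \<in> J}"
  using openin_continuous_map_preimage[OF continuous_Om, of J] by simp

lemma obtain_BB:
  assumes "p \<in> topspace TB"
  obtains b where "b \<in> BB" "p \<in> fst b"
  using bar.obtain_base[OF assms] .

lemma boundary_Om:
  assumes "p \<in> topspace TB"
  shows "p \<in> boundary_points Mbar \<longleftrightarrow> Om p = 0"
proof -
  obtain b where b: "b \<in> BB" "p \<in> fst b" by (rule obtain_BB[OF assms])
  show ?thesis
    unfolding boundary_points_iff[OF bar.smooth_manifold_generated bar.base_in_Atlas[OF b(1)] b(2)] Om_base(1)[OF b]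
    using Om_base(2,3)[OF b] by (auto simp: Omf_def)
qed

lemma overlap_open:
  assumes c: "c \<in> Atlas Mbar" and b: "b \<in> Atlas Mbar"
  obtains U where "open U" "snd c ` (fst c \<inter> fst b) = half_space \<inter> U" "snd c ` (fst c \<inter> fst b) = snd c ` fst c \<inter> U"
proof -
  have "openin (top_of_set half_space) (snd c ` (fst c \<inter> fst b))"
    by (rule is_chart_image_openin[OF bar.Atlas_chart[OF c]])
      (use bar.Atlas_openin[OF c] bar.Atlas_openin[OF b] in auto)
  then obtain U where U: "open U" "snd c ` (fst c \<inter> fst b) = half_space \<inter> U" by (meson openin_open)
  moreover have "snd c ` (fst c \<inter> fst b) = snd c ` fst c \<inter> U"
    using U(2) is_chart_image_subset[OF bar.Atlas_chart[OF c]] by auto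
  ultimately show thesis by (rule that)
qed

lemma Om_chart:
  assumes c: "c \<in> Atlas Mbar" and b: "b \<in> BB" and x: "x \<in> snd c ` (fst c \<inter> fst b)"
  shows "(Om \<circ> inv_into (fst c) (snd c)) x = Omf (transition c b x $ 3)"
proof -
  obtain p where p: "p \<in> fst c" "p \<in> fst b" "x = snd c p" using x by blast
  show ?thesis
    using is_chart_inv[OF bar.Atlas_chart[OF c] p(1)] transition_apply[OF bar.Atlas_chart[OF c] p(1), of b]
      Om_base(1)[OF b p(2)] p(3) by simp
qed

lemma Atlas_Mbar_base: "c \<in> Atlas Mbar ==> p \<in> fst c ==> \<exists>b\<in>BB. p \<in> fst b"
proof -
  assume "c \<in> Atlas Mbar" "p \<in> fst c"
  then have "p \<in> topspace TB" using is_chart_subset[OF bar.Atlas_chart] by blast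
  then show ?thesis by (rule obtain_BB) blast
qed

lemma smooth_Om: "smooth_function Mbar Om"
  unfolding smooth_function_def
proof (intro ballI, rule smooth_on_local)
  fix c x assume c: "c \<in> Atlas Mbar" and "x \<in> snd c ` fst c"
  then obtain p where p: "p \<in> fst c" "x = snd c p" by blast
  obtain b where b: "b \<in> BB" "p \<in> fst b" using Atlas_Mbar_base[OF c p(1)] by blast
  let ?S = "snd c ` (fst c \<inter> fst b)"
  obtain U where U: "open U" "?S = snd c ` fst c \<inter> U" by (rule overlap_open[OF c bar.base_in_Atlas[OF b(1)]])
  have "smooth_on ?S (transition c b)"
    using bar.Atlas_compatible[OF c bar.base_in_Atlas[OF b(1)]] by (simp add: compatible_def)
  then have "smooth_on ?S (%x. Omf (transition c b x $ 3))"
    by (rule smooth_on_compose[OF _ smooth_on_C_inf[OF open_UNIV C_inf_Omf[OF open_UNIV] order_refl]]) simp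
  then have "smooth_on ?S (Om \<circ> inv_into (fst c) (snd c))"
    by (rule smooth_on_cong[rotated]) (use Om_chart[OF c b(1)] in simp)
  moreover have "x \<in> U" using p b U(2) by auto
  ultimately show "\<exists>U. open U \<and> x \<in> U \<and> smooth_on (snd c ` fst c \<inter> U) (Om \<circ> inv_into (fst c) (snd c))"
    using U by auto
qed

lemma Omf_derivative: "(Omf has_real_derivative 2 - 2 * w) (at w within S)"
  unfolding Omf_def[abs_def] by (auto intro!: derivative_eq_intros)

text \<open>\<open>Omf\<close> has slope \<open>2\<close> at \<open>w = 0\<close>, and the
  derivative of the transition to a base chart is invertible, so the normal component is not
  lost.\<close>

lemma Om_derivative_nonzero:
  assumes c: "c \<in> Atlas Mbar" and p: "p \<in> fst c" and 0: "Om p = 0"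
  shows "\<exists>D. (Om \<circ> inv_into (fst c) (snd c) has_derivative D) (at (snd c p) within snd c ` fst c) \<and> D ~= (%v. 0)"
proof -
  obtain b where b: "b \<in> BB" "p \<in> fst b" using Atlas_Mbar_base[OF c p] by blast
  note bA = bar.base_in_Atlas[OF b(1)]
  let ?S = "snd c ` (fst c \<inter> fst b)"
  obtain U where U: "open U" "?S = snd c ` fst c \<inter> U" by (rule overlap_open[OF c bA])
  obtain D where D: "(transition c b has_derivative D) (at (snd c p) within ?S)"
    using transition_has_derivative[OF bar.Atlas_compatible[OF c bA], of p] p b by blast
  obtain E where E: "tder b c p E"
    using transition_has_derivative[OF bar.Atlas_compatible[OF bA c], of p] p b by blast
  have n: "at (snd c p) within ?S = at (snd c p) within snd c ` fst c"
    by (rule at_within_nhd[OF _ U(1)]) (use p b U(2) in auto)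
  have t: "transition c b (snd c p) $ 3 = 0"
    using transition_apply[OF bar.Atlas_chart[OF c] p, of b] Om_base[OF b] 0 by (auto simp: Omf_def)
  have "((%x. transition c b x $ 3) has_derivative (%v. D v $ 3)) (at (snd c p) within ?S)"
    by (rule bounded_linear.has_derivative[OF bounded_linear_vec_nth D])
  from has_derivative_in_compose[OF this, of Omf "(*) 2"] Omf_derivative[of 0]
  have "((%x. Omf (transition c b x $ 3)) has_derivative (%v. 2 * D v $ 3)) (at (snd c p) within ?S)"
    by (simp add: has_field_derivative_def t)
  then have "(Om \<circ> inv_into (fst c) (snd c) has_derivative (%v. 2 * D v $ 3)) (at (snd c p) within ?S)"
    by (rule has_derivative_transform[rotated 2]) (use p b Om_chart[OF c b(1)] in auto)
  then have "(Om \<circ> inv_into (fst c) (snd c) has_derivative (%v. 2 * D v $ 3)) (at (snd c p) within snd c ` fst c)"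
    using n by simp
  moreover have "(%v. 2 * D v $ 3) ~= (%v. 0)"
  proof
    assume "(%v. 2 * D v $ 3) = (%v. 0)"
    then have "2 * D (E (axis 3 1)) $ 3 = 0" by metis
    moreover have "D (E (axis 3 1)) = axis 3 1"
      by (rule transition_derivative_inverse[OF thick_half_space BB_chart[OF b(1)] bar.Atlas_chart[OF c] _ E D]) (use p b in auto)
    ultimately show False by simp
  qed
  ultimately show ?thesis by blast
qed

section \<open>The interior manifold and its metric\<close>

definition PM :: "real set" where "PM = {p \<in> topspace TB. 0 < Om p}"

definition Mint :: "(real, 3) manifold" where "Mint = open_submanifold Mbar PM"

definition gint :: "(real, 3) tensor2" where
  "gint c x = (1 / (Om (inv_into (fst c) (snd c) x))\<^sup>2) *\<^sub>R bar.metric c x"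

lemma openin_PM: "openin TB PM"
  using openin_level[of "{0<..}"] by (simp add: PM_def)

lemma Points_Mint: "Points Mint = PM"
  using openin_subset[OF openin_PM] by (auto simp: Mint_def open_submanifold_def)

lemma Top_Mint: "Top Mint = subtopology TB PM"
  by (simp add: Mint_def open_submanifold_def)

lemma Atlas_Mint: "c \<in> Atlas Mint \<longleftrightarrow> c \<in> Atlas Mbar \<and> fst c \<subseteq> PM"
  by (simp add: Mint_def open_submanifold_def)

lemma manifold_Mint: "smooth_manifold half_space Mint"
  unfolding Mint_def by (rule smooth_manifold_open_submanifold[OF bar.smooth_manifold_generated]) (simp add: openin_PM)

lemma metric_gint: "riemannian_metric Mint gint"
  unfolding gint_def[abs_def]
proof (rule conformal_riemannian[OF bar.riemannian_metric_metric smooth_Om])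
  fix c assume "c \<in> Atlas Mint"
  then show "c \<in> Atlas Mbar \<and> inj_on (snd c) (fst c) \<and> (\<forall>p\<in>fst c. 0 < Om p)"
    using is_chart_inj[OF bar.Atlas_chart] by (auto simp: Atlas_Mint PM_def)
qed

lemma connected_Mint: "connected_space (Top Mint)"
proof -
  let ?C = "double_torus \<times> {-1<..<1::real}"
  have "connected ?C" by (intro connected_Times connected_double_torus connected_Ioo)
  then have "connectedin (top_of_set YY) ?C" by (auto simp: connectedin_subtopology YY_def)
  then have "connectedin TB (qq ` ?C)" by (rule connectedin_continuous_map_image[OF continuous_qq])
  moreover have "qq ` ?C = PM"
  proof -
    have "p \<in> PM \<longleftrightarrow> (\<exists>y\<in>YY. p = qq y \<and> (snd y)\<^sup>2 < 1)" for p by (auto simp: PM_def topspace_TB Om_qq)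
    moreover have "y \<in> ?C \<longleftrightarrow> y \<in> YY \<and> (snd y)\<^sup>2 < 1" for y by (cases y) (auto simp: YY_def abs_square_less_1)
    ultimately show ?thesis unfolding set_eq_iff image_iff by blast
  qed
  ultimately show ?thesis unfolding Top_Mint by (metis connectedin_def)
qed

lemma boundary_Mint: "boundary_points Mint = {}"
proof -
  have False if "c \<in> Atlas Mint" "p \<in> fst c" "snd c p $ 3 = 0" for c p
  proof -
    have "p \<in> boundary_points Mbar" using that unfolding Atlas_Mint boundary_points_def by blast
    moreover have "p \<in> PM" using that by (auto simp: Atlas_Mint)
    ultimately show False using boundary_Om[of p] by (auto simp: PM_def)
  qed
  then show ?thesis unfolding boundary_points_def by blast
qed

lemma conformal_completion_Mint: "conformal_completion Mint gint Mbar bar.metric Om"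
  unfolding conformal_completion_def Points_Mint
proof (intro conjI ballI)
  show "smooth_manifold half_space Mbar" by (rule bar.smooth_manifold_generated)
  show "riemannian_metric Mbar bar.metric" by (rule bar.riemannian_metric_metric)
  show "openin (Top Mbar) PM" by (simp add: openin_PM)
  show "Mint = open_submanifold Mbar PM" by (rule Mint_def)
  show "Points Mbar - PM \<subseteq> boundary_points Mbar" using boundary_Om Om_range by (force simp: PM_def)
  show "smooth_function Mbar Om" by (rule smooth_Om)
  show "0 \<le> Om p" "Om p = 0 \<longleftrightarrow> p \<notin> PM" if "p \<in> Points Mbar" for p
    using that Om_range[of p] by (auto simp: PM_def)
  show "\<exists>D. (Om \<circ> inv_into (fst c) (snd c) has_derivative D) (at (snd c p) within snd c ` fst c) \<and> D ~= (%v. 0)"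
    if "c \<in> Atlas Mbar" "p \<in> fst c - PM" for c p
  proof (rule Om_derivative_nonzero[OF that(1)])
    have "p \<in> topspace TB" using that is_chart_subset[OF bar.Atlas_chart[OF that(1)]] by auto
    then show "Om p = 0" using that Om_range[of p] by (auto simp: PM_def)
  qed (use that in auto)
  show "gint c (snd c p) = (1 / (Om p)\<^sup>2) *\<^sub>R bar.metric c (snd c p)" if "c \<in> Atlas Mint" "p \<in> fst c" for c p
    using that is_chart_inv[OF bar.Atlas_chart, of c p] by (simp add: gint_def Atlas_Mint)
qed

text \<open>Interior charts avoid the face of the half-space, so their images are open in the whole
  space. This lets curvature and volume be computed in them as on a manifold without
  boundary.\<close>

lemma open_image_Mint:
  assumes c: "c \<in> Atlas Mint" and W: "openin TB W" "W \<subseteq> fst c"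
  shows "open (snd c ` W)"
proof -
  have cA: "c \<in> Atlas Mbar" and s: "fst c \<subseteq> PM" using c by (auto simp: Atlas_Mint)
  have "openin (top_of_set half_space) (snd c ` W)"
    by (rule is_chart_image_openin[OF bar.Atlas_chart[OF cA] W])
  then obtain U where U: "open U" "snd c ` W = half_space \<inter> U" by (meson openin_open)
  have "0 < x $ 3" if x: "x \<in> snd c ` W" for x
  proof -
    obtain p where p: "p \<in> fst c" "x = snd c p" using x W(2) by blast
    then have "p \<notin> boundary_points Mbar" using s boundary_Om[of p] by (auto simp: PM_def)
    then have "x $ 3 ~= 0" using boundary_points_iff[OF bar.smooth_manifold_generated cA p(1)] p by simp
    moreover have "0 \<le> x $ 3" using x U(2) by (auto simp: half_space_def)
    ultimately show ?thesis by simp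
  qed
  then have "snd c ` W = U \<inter> {x. 0 < x $ 3}" using U(2) by (auto simp: half_space_def)
  then show ?thesis using U(1) open_halfspace_component_gt_cart[of 0 3] by auto
qed

lemma chart_Mint:
  assumes c: "c \<in> Atlas Mint"
  shows "is_chart UNIV (Top Mint) c"
  using smooth_manifold_chart[OF manifold_Mint c] open_image_Mint[OF c _ order_refl] bar.Atlas_openin[of c] c
  by (auto simp: is_chart_def Atlas_Mint)

section \<open>Scalar curvature of the interior metric\<close>

definition bint :: "real => real" where "bint w = 1 / (2 * (Omf w)\<^sup>2)"

definition eint :: "real => real" where "eint w = evert w / (Omf w)\<^sup>2"

definition rb :: "(real, 3) chart => real set => (real, 3) chart" where "rb b V = (fst b \<inter> V, snd b)"

lemma rb_Mint: "b \<in> BB ==> openin TB V ==> V \<subseteq> PM ==> rb b V \<in> Atlas Mint"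
  using restrict_in_Atlas[OF bar.smooth_manifold_generated bar.base_in_Atlas, of b V]
  unfolding rb_def Atlas_Mint by auto

lemma gint_base:
  assumes b: "b \<in> BB" and V: "openin TB V" "V \<subseteq> PM" and p: "p \<in> fst b \<inter> V"
  shows "gint (rb b V) (snd b p) = warp bint eint hyp_metric (snd b p)"
proof -
  have A: "rb b V \<in> Atlas Mbar" using rb_Mint[OF b V] by (simp add: Atlas_Mint)
  have i: "inv_into (fst (rb b V)) (snd (rb b V)) (snd b p) = p"
    using is_chart_inv[OF bar.Atlas_chart[OF A], of p] p by (simp add: rb_def)
  have e: "p \<in> fst (rb b V)" "p \<in> fst b" "snd (rb b V) = snd b" using p by (auto simp: rb_def)
  have "bar.metric (rb b V) (snd b p) = gam (snd b p)"
    using bar.metric_restrict[OF A e(1) b e(2) e(3)[symmetric]] unfolding e(3) .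
  then have "gint (rb b V) (snd b p) = (1 / (Omf (snd b p $ 3))\<^sup>2) *\<^sub>R gam (snd b p)"
    using Om_base(1)[OF b, of p] p i unfolding gint_def by simp
  then show ?thesis
    by (intro bilin_ext) (simp add: bilin_scaleR gam_def bilin_warp bint_def eint_def distrib_left)
qed

lemma Omf_bounds:
  assumes "0 < w" "w < 2"
  shows "0 < Omf w" "Omf w \<le> 1" "0 < 1 + Omf w - (Omf w)\<^sup>2"
proof -
  show o: "0 < Omf w" using assms by (simp add: Omf_def)
  have "Omf w = 1 - (w - 1)\<^sup>2" by (simp add: Omf_def power2_eq_square algebra_simps)
  then show l: "Omf w \<le> 1" by simp
  then have "(Omf w)\<^sup>2 \<le> Omf w" using o by (simp add: power2_eq_square mult_left_le)
  then show "0 < 1 + Omf w - (Omf w)\<^sup>2" by simp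
qed

abbreviation "U02 \<equiv> {x::real ^ 3. 0 < x $ 3 \<and> x $ 3 < 2}"

lemma open_U02: "open U02"
  by (intro open_Collect_conj open_Collect_less continuous_intros)

lemma C_inf_warp_int: "C_inf U02 (warp bint eint hyp_metric)"
proof (rule C_inf_warp[OF open_U02])
  note o = Omf_bounds
  show "C_inf U02 (%y. bint (y $ 3))" unfolding bint_def
    by (intro C_inf_divide C_inf_mult C_inf_power C_inf_const C_inf_Omf open_U02) (use o(1) in force)
  show "C_inf U02 (%y. eint (y $ 3))" unfolding eint_def evert_def
    by (intro C_inf_divide C_inf_diff C_inf_add C_inf_power C_inf_const C_inf_Omf open_U02) (use o(1,3) in force)+
  show "C_inf U02 (%y. hyp_metric (hor y))"
    by (rule C_inf_compose[OF open_U02 open_UNIV _ C_inf_linear[OF open_U02 linear_hor] C_inf_hyp_metric]) auto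
qed

text \<open>\<open>2 - 2 * w\<close> is the derivative of \<open>Omf\<close>. All derivatives are
  kept in terms of \<open>Omf w\<close> and this factor, whose square is
  \<open>4 * (1 - Omf w)\<close>.\<close>

definition bint1 :: "real => real" where "bint1 w = - (2 - 2 * w) / (Omf w) ^ 3"

definition bint2 :: "real => real" where "bint2 w = 2 / (Omf w) ^ 3 + 3 * (2 - 2 * w)\<^sup>2 / (Omf w) ^ 4"

definition eint1 :: "real => real" where
  "eint1 w = - 4 * (2 - 2 * w) * (2 + 3 * Omf w - 4 * (Omf w)\<^sup>2) / ((Omf w) ^ 3 * (1 + Omf w - (Omf w)\<^sup>2)\<^sup>2)"

lemma int_derivatives:
  assumes w: "0 < w" "w < 2"
  shows "(bint has_real_derivative bint1 w) (at w)" "(bint1 has_real_derivative bint2 w) (at w)"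
    "(eint has_real_derivative eint1 w) (at w)"
proof -
  note o = Omf_bounds[OF w]
  have nz: "Omf w ~= 0" "1 + Omf w - (Omf w)\<^sup>2 ~= 0" using o by simp_all
  have "((%t::real. 1 / (2 * t\<^sup>2)) has_real_derivative - 1 / t ^ 3) (at t)" if "t ~= 0" for t
    using that by (auto intro!: derivative_eq_intros simp: field_simps power2_eq_square power3_eq_cube)
  from DERIV_chain2[OF this[OF nz(1)] Omf_derivative]
  have "(bint has_real_derivative - 1 / Omf w ^ 3 * (2 - 2 * w)) (at w)" unfolding bint_def[abs_def] .
  moreover have "- 1 / Omf w ^ 3 * (2 - 2 * w) = bint1 w" unfolding bint1_def using nz by (simp add: field_simps)
  ultimately show "(bint has_real_derivative bint1 w) (at w)" by simp
  have 3: "((%t::real. 1 / t ^ 3) has_real_derivative - 3 / t ^ 4) (at t)" if "t ~= 0" for t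
    using that by (auto intro!: derivative_eq_intros simp: field_simps eval_nat_numeral)
  have "((%w. 1 / Omf w ^ 3) has_real_derivative - 3 / Omf w ^ 4 * (2 - 2 * w)) (at w)"
    by (rule DERIV_chain2[OF 3[OF nz(1)] Omf_derivative])
  moreover have "((%w. - (2 - 2 * w)) has_real_derivative 2) (at w)" by (auto intro!: derivative_eq_intros)
  ultimately have "((%w. - (2 - 2 * w) * (1 / Omf w ^ 3)) has_real_derivative
      2 * (1 / Omf w ^ 3) + - 3 / Omf w ^ 4 * (2 - 2 * w) * - (2 - 2 * w)) (at w)"
    by (rule DERIV_mult[rotated])
  moreover have "2 * (1 / Omf w ^ 3) + - 3 / Omf w ^ 4 * (2 - 2 * w) * - (2 - 2 * w) = bint2 w"
    unfolding bint2_def power2_eq_square using nz by (simp add: field_simps)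
  moreover have "(%w. - (2 - 2 * w) * (1 / Omf w ^ 3)) = bint1" by (simp add: bint1_def[abs_def])
  ultimately show "(bint1 has_real_derivative bint2 w) (at w)" by simp
  have 4: "((%t::real. 4 / ((1 + t - t\<^sup>2) * t\<^sup>2)) has_real_derivative
      - 4 * (2 + 3 * t - 4 * t\<^sup>2) / (t ^ 3 * (1 + t - t\<^sup>2)\<^sup>2)) (at t)" if t: "t ~= 0" "1 + t - t\<^sup>2 ~= 0" for t
  proof -
    define q where "q = 1 + t - t\<^sup>2"
    have "((%t::real. (1 + t - t\<^sup>2) * t\<^sup>2) has_real_derivative (1 - 2 * t) * t\<^sup>2 + q * (2 * t)) (at t)"
      unfolding q_def by (auto intro!: derivative_eq_intros simp: algebra_simps power2_eq_square power3_eq_cube)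
    from DERIV_divide[OF DERIV_const[of 4] this]
    have d: "((%t::real. 4 / ((1 + t - t\<^sup>2) * t\<^sup>2)) has_real_derivative
        - (4 * ((1 - 2 * t) * t\<^sup>2 + q * (2 * t))) / ((q * t\<^sup>2) * (q * t\<^sup>2))) (at t)"
      using t by (simp add: q_def)
    have "- (4 * ((1 - 2 * t) * t\<^sup>2 + q * (2 * t))) / ((q * t\<^sup>2) * (q * t\<^sup>2)) = - 4 * (t * (1 - 2 * t) + 2 * q) / (t ^ 3 * q\<^sup>2)"
      using t unfolding q_def[symmetric] by (simp add: field_simps power2_eq_square power3_eq_cube)
    also have "t * (1 - 2 * t) + 2 * q = 2 + 3 * t - 4 * t\<^sup>2" by (simp add: q_def power2_eq_square algebra_simps)
    finally show ?thesis using d unfolding q_def by (rule back_subst[of "%D. (_ has_real_derivative D) _", rotated])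
  qed
  have "((%w. 4 / ((1 + Omf w - (Omf w)\<^sup>2) * (Omf w)\<^sup>2)) has_real_derivative
      - 4 * (2 + 3 * Omf w - 4 * (Omf w)\<^sup>2) / ((Omf w) ^ 3 * (1 + Omf w - (Omf w)\<^sup>2)\<^sup>2) * (2 - 2 * w)) (at w)"
    by (rule DERIV_chain2[OF 4[OF nz] Omf_derivative])
  moreover have "(%w. 4 / ((1 + Omf w - (Omf w)\<^sup>2) * (Omf w)\<^sup>2)) = eint"
    by (simp add: fun_eq_iff eint_def evert_def)
  moreover have "- 4 * K / D * p = - 4 * p * K / D" for K D p :: real by simp
  ultimately show "(eint has_real_derivative eint1 w) (at w)" unfolding eint1_def by metis
qed

text \<open>\<open>p\<close> stands for the derivative of \<open>Omf\<close>, and division by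
  \<open>p\<close> never occurs. The calculation is therefore valid at the horizon too, where
  \<open>p = 0\<close> and \<open>r\<close> fails to be a coordinate.\<close>

lemma scalar_identity:
  fixes o' p q b b1 b2 e e1 :: real
  assumes nz: "o' ~= 0" "q ~= 0" and p: "p\<^sup>2 = 4 * (1 - o')" and q: "q = 1 + o' - o'\<^sup>2"
    and b: "b = 1 / (2 * o'\<^sup>2)" "b1 = - p / o' ^ 3" "b2 = 2 / o' ^ 3 + 3 * p\<^sup>2 / o' ^ 4"
    and e: "e = 4 / (o'\<^sup>2 * q)" "e1 = - 4 * p * (2 + 3 * o' - 4 * o'\<^sup>2) / (o' ^ 3 * q\<^sup>2)"
  shows "2 * (- (b2 * e - b1 * e1) / (2 * e * e) + e1 / (2 * e) * (- b1 / (2 * e)) - 1) / b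
    + 2 * (b1 / (2 * b) * (e1 / (2 * e)) - (b2 * b - b1 * b1) / (2 * b * b) - (b1 / (2 * b))\<^sup>2) / e = -6"
proof -
  define k where "k = 2 + 3 * o' - 4 * o'\<^sup>2"
  have \<beta>: "b1 / (2 * b) = - p / o'" using nz unfolding b by (simp add: field_simps power2_eq_square power3_eq_cube)
  have \<eta>: "e1 / (2 * e) = - p * k / (2 * o' * q)"
    using nz unfolding e k_def[symmetric] by (simp add: field_simps power2_eq_square power3_eq_cube)
  have \<psi>: "- b1 / (2 * e) = p * q / (8 * o')"
    using nz unfolding b e by (simp add: field_simps power2_eq_square power3_eq_cube)
  have "(b2 * b - b1 * b1) / (2 * b * b) = b2 / (2 * b) - 2 * (b1 / (2 * b))\<^sup>2"
    using nz unfolding b(1) by (simp add: field_simps power2_eq_square)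
  also have "\<dots> = 2 / o' + p\<^sup>2 / o'\<^sup>2"
    unfolding \<beta> using nz unfolding b by (simp add: field_simps eval_nat_numeral)
  finally have \<beta>1: "(b2 * b - b1 * b1) / (2 * b * b) = 2 / o' + p\<^sup>2 / o'\<^sup>2" .
  have "- (b2 * e - b1 * e1) / (2 * e * e) = - (b2 / (2 * e)) - 2 * (- b1 / (2 * e)) * (e1 / (2 * e))"
    using nz unfolding e(1) by (simp add: field_simps power2_eq_square)
  also have "b2 / (2 * e) = q * (2 / o' + 3 * p\<^sup>2 / o'\<^sup>2) / 8"
    using nz unfolding b e by (simp add: field_simps eval_nat_numeral)
  also have "- (q * (2 / o' + 3 * p\<^sup>2 / o'\<^sup>2) / 8) - 2 * (- b1 / (2 * e)) * (e1 / (2 * e)) =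
      - (q * (2 / o' + 3 * p\<^sup>2 / o'\<^sup>2) / 8) + p\<^sup>2 * k / (8 * o'\<^sup>2)"
    unfolding \<psi> \<eta> using nz by (simp add: field_simps power2_eq_square)
  finally have \<psi>1: "- (b2 * e - b1 * e1) / (2 * e * e) = - (q * (2 / o' + 3 * p\<^sup>2 / o'\<^sup>2) / 8) + p\<^sup>2 * k / (8 * o'\<^sup>2)" .
  have "2 * (- (q * (2 / o' + 3 * p\<^sup>2 / o'\<^sup>2) / 8) + p\<^sup>2 * k / (8 * o'\<^sup>2) + - p * k / (2 * o' * q) * (p * q / (8 * o')) - 1) / b
      = - q * o' - 3 / 2 * p\<^sup>2 * q + p\<^sup>2 * k / 4 - 4 * o'\<^sup>2"
    using nz unfolding b(1) by (simp add: field_simps power2_eq_square)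
  moreover have "2 * (- p / o' * (- p * k / (2 * o' * q)) - (2 / o' + p\<^sup>2 / o'\<^sup>2) - (- p / o')\<^sup>2) / e
      = p\<^sup>2 * k / 4 - q * o' - p\<^sup>2 * q"
    using nz unfolding e(1) by (simp add: field_simps power2_eq_square)
  \<comment> \<open>All denominators are gone; substituting \<open>p\<^sup>2\<close>,
    \<open>k\<close> and \<open>q\<close> cancels every power of \<open>o'\<close>.\<close>
  moreover have "(- q * o' - 3 / 2 * p\<^sup>2 * q + p\<^sup>2 * k / 4 - 4 * o'\<^sup>2) + (p\<^sup>2 * k / 4 - q * o' - p\<^sup>2 * q) = -6"
    unfolding p k_def q by (simp add: power2_eq_square algebra_simps)
  ultimately show ?thesis unfolding \<psi>1 \<eta> \<psi> \<beta> \<beta>1 by simp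
qed

lemma scalar_int:
  assumes "0 < x $ 3" "x $ 3 < 2"
  shows "scalar (warp bint eint hyp_metric) x = -6"
proof -
  interpret warped UNIV hyp_metric "{0<..<2}" bint bint1 bint2 eint eint1
  proof
    fix w :: real assume "w \<in> {0<..<2}"
    then have w: "0 < w" "w < 2" by auto
    show "(bint has_real_derivative bint1 w) (at w)" "(bint1 has_real_derivative bint2 w) (at w)"
      "(eint has_real_derivative eint1 w) (at w)" by (rule int_derivatives[OF w])+
    show "bint w ~= 0" "eint w ~= 0" using Omf_bounds[OF w] by (auto simp: bint_def eint_def evert_def)
  qed (auto simp: C_inf_hyp_metric transpose_hyp_metric intro!: positive_det_nz hyp_metric_pos)
  define o' where "o' = Omf (x $ 3)"
  note o = Omf_bounds[OF assms, folded o'_def]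
  have "2 * (\<psi>1 (x $ 3) + \<eta> (x $ 3) * \<psi> (x $ 3) - 1) / bint (x $ 3)
    + 2 * (\<beta> (x $ 3) * \<eta> (x $ 3) - \<beta>1 (x $ 3) - (\<beta> (x $ 3))\<^sup>2) / eint (x $ 3) = -6"
    unfolding \<psi>1_def \<eta>_def \<psi>_def \<beta>_def \<beta>1_def
  proof (rule scalar_identity)
    show "o' ~= 0" "1 + o' - o'\<^sup>2 ~= 0" using o by simp_all
    show "(2 - 2 * x $ 3)\<^sup>2 = 4 * (1 - o')" by (simp add: o'_def Omf_def power2_eq_square algebra_simps)
  qed (simp_all add: bint_def bint1_def bint2_def eint_def eint1_def evert_def o'_def mult.commute)
  moreover have "x \<in> R" using assms by (simp add: R_def)
  ultimately show ?thesis using scalar_warp[OF _ hyperbolic_hyp_metric] by simp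
qed

text \<open>An arbitrary chart is compared with a restricted base chart, in which the metric has the
  explicit warped form.\<close>

lemma scalar_gint:
  assumes c: "c \<in> Atlas Mint" and p: "p \<in> fst c"
  shows "scalar (gint c) (snd c p) = -6"
proof -
  have pM: "p \<in> PM" using c p by (auto simp: Atlas_Mint)
  then have "p \<in> topspace TB" by (simp add: PM_def)
  then obtain b where b: "b \<in> BB" "p \<in> fst b" by (rule obtain_BB)
  define d where "d = rb b PM"
  have d: "d \<in> Atlas Mint" "p \<in> fst d" "snd d = snd b" "fst d = fst b \<inter> PM"
    using rb_Mint[OF b(1) openin_PM order_refl] b pM by (auto simp: d_def rb_def)
  have W: "openin TB (fst c \<inter> fst d)"
    using bar.Atlas_openin[of c] bar.Atlas_openin[of d] c d(1) unfolding Atlas_Mint by blast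
  let ?V = "snd d ` (fst c \<inter> fst d)"
  have V02: "?V \<subseteq> U02"
  proof
    fix y assume "y \<in> ?V"
    then obtain r where r: "r \<in> fst b" "r \<in> PM" "y = snd b r" using d by auto
    then have "Omf (y $ 3) > 0" using Om_base(1)[OF b(1) r(1)] by (simp add: PM_def)
    then show "y \<in> U02" using Om_base(2,3)[OF b(1) r(1)] r(3) by (auto simp: Omf_def zero_less_mult_iff)
  qed
  interpret coordinate_change "snd c ` (fst c \<inter> fst d)" ?V "transition c d" "warp bint eint hyp_metric" "gint c"
  proof (rule metric_coordinate_change[OF thick_half_space manifold_Mint metric_gint c d(1)])
    show "open (snd c ` (fst c \<inter> fst d))" by (rule open_image_Mint[OF c W]) auto
    show "open ?V" by (rule open_image_Mint[OF d(1) W]) auto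
    show "C_inf ?V (warp bint eint hyp_metric)" by (rule C_inf_subset[OF C_inf_warp_int V02])
    show "warp bint eint hyp_metric y = gint d y" if "y \<in> ?V" for y
      using that gint_base[OF b(1) openin_PM order_refl] d by (auto simp: d_def)
  qed
  have "scalar (gint c) (snd c p) = scalar (warp bint eint hyp_metric) (transition c d (snd c p))"
    by (rule scalar_transform) (use p d in auto)
  moreover have "transition c d (snd c p) = snd d p"
    by (rule transition_apply[OF chart_Mint[OF c] p])
  moreover have "snd d p \<in> U02" using V02 p d(2) by blast
  ultimately show ?thesis using scalar_int by simp
qed

lemma scalar_curvature_Mint: "p \<in> PM ==> scalar_curvature Mint gint p = -6"
proof -
  assume "p \<in> PM"
  then have "\<exists>c. c \<in> Atlas Mint \<and> p \<in> fst c"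
    using smooth_manifold_cover[OF manifold_Mint] unfolding Points_Mint by blast
  then have "chart_at Mint p \<in> Atlas Mint \<and> p \<in> fst (chart_at Mint p)"
    unfolding chart_at_def by (rule someI_ex)
  then show ?thesis unfolding scalar_curvature_def using scalar_gint by blast
qed

lemma ALH_Mint: "ALH Mint gint Mbar"
  unfolding ALH_def Points_Mint
proof
  fix q
  have "\<forall>\<^sub>F p in atin_within (Top Mbar) q PM. p \<in> PM"
    unfolding atin_within_def by (auto simp: eventually_inf_principal)
  then have "\<forall>\<^sub>F p in atin_within (Top Mbar) q PM. scalar_curvature Mint gint p = -6"
    by (rule eventually_mono) (rule scalar_curvature_Mint)
  then show "(scalar_curvature Mint gint \<longlongrightarrow> -6) (atin_within (Top Mbar) q PM)"
    by (rule tendsto_eventually)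
qed

section \<open>The hyperbolic metric on the boundary\<close>

abbreviation "XN \<equiv> subtopology TB (boundary_points Mbar)"

abbreviation "NB \<equiv> boundary_chart Mbar ` BB"

abbreviation "NN \<equiv> generated UNIV XN NB"

lemma BB_cover: "BB \<subseteq> Atlas Mbar" "Points Mbar \<subseteq> (\<Union>b\<in>BB. fst b)"
  using bar.base_in_Atlas bar.base_cover by auto

lemma base_atlas_N: "base_atlas UNIV XN NB"
  using boundary_manifold_generated(1)[OF bar.smooth_manifold_generated BB_cover] by simp

lemma boundary_manifold_N: "boundary_manifold Mbar = NN"
  using boundary_manifold_generated(2)[OF bar.smooth_manifold_generated BB_cover] by simp

text \<open>Boundary transitions are the surface parts \<open>TT M\<close> of the base transitions:
  on tangential vectors \<open>lift v 0\<close> the height derivative disappears.\<close>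

global_interpretation hb: model_metric UNIV XN NB hyp_metric UNIV
proof (intro model_metric.intro base_atlas_N model_metric_axioms.intro)
  fix b c p D u v
  assume "b \<in> NB" "c \<in> NB" and p: "p \<in> fst b \<inter> fst c"
    and D: "tder b c p D"
  then obtain b0 c0 where b0: "b0 \<in> BB" "b = boundary_chart Mbar b0" and c0: "c0 \<in> BB" "c = boundary_chart Mbar c0" by blast
  have p0: "p \<in> fst b0 \<inter> fst c0 \<inter> boundary_points Mbar" using p unfolding b0(2) c0(2) boundary_chart_alt by auto
  note bA = bar.base_in_Atlas[OF b0(1)] and cA = bar.base_in_Atlas[OF c0(1)]
  obtain D3 where D3: "tder b0 c0 p D3"
    using transition_has_derivative[OF bar.Atlas_compatible[OF bA cA], of p] p0 by blast
  obtain M \<beta> E where M: "lor M" "snd c0 p = FF M \<beta> (snd b0 p)"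
    and E: "(TT M has_derivative E) (at (hor (snd b0 p)))" and D3E: "D3 = (%v. lift (E (hor v)) (\<beta> * v $ 3))"
    using BB_transition_derivative[OF b0(1) c0(1) _ D3] p0 by blast
  note bt = boundary_transition_derivative(1)[OF bar.smooth_manifold_generated bA cA p0 D3, folded b0(2) c0(2)]
  have "is_chart UNIV XN b" "is_chart UNIV XN c"
    unfolding b0(2) c0(2)
    using is_chart_boundary_chart[OF bar.smooth_manifold_generated bA]
      is_chart_boundary_chart[OF bar.smooth_manifold_generated cA] by simp_all
  then have o: "openin (top_of_set UNIV) (snd b ` (fst b \<inter> fst c))"
    by (intro is_chart_image_openin[of UNIV XN b]) (auto simp: is_chart_def)
  have "D = (%v. hor (D3 (lift v 0)))"
    by (rule thick_derivative_unique[OF thick_UNIV o _ D bt]) (use p in auto)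
  then have "D = E" by (simp add: D3E)
  moreover have "snd b p = hor (snd b0 p)" "snd c p = TT M (hor (snd b0 p))"
    by (simp_all add: b0(2) c0(2) boundary_chart_alt M(2) FF_def del: hor_up)
  ultimately show "bilin (hyp_metric (snd b p)) u v = bilin (hyp_metric (snd c p)) (D u) (D v)"
    using TT_isometry[OF M(1) E] by simp
qed (auto simp: thick_UNIV C_inf_hyp_metric transpose_hyp_metric hyp_metric_pos)

lemma metric_positive:
  assumes "riemannian_metric M g" "c \<in> Atlas M" "x \<in> snd c ` fst c"
  shows "transpose (g c x) = g c x" "v ~= 0 ==> 0 < bilin (g c x) v v" "det (g c x) ~= 0"
  using assms positive_det_nz[of "g c x"] unfolding riemannian_metric_def by blast+

lemma open_image_N:
  assumes "c \<in> Atlas NN" "openin XN W" "W \<subseteq> fst c"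
  shows "open (snd c ` W)"
  using is_chart_image_openin[OF hb.Atlas_chart[OF assms(1)] assms(2,3)] by simp

lemma C_inf_h: "c \<in> Atlas NN ==> C_inf (snd c ` fst c) (hb.metric c)"
  using smooth_on_openD[OF open_image_N hb.metric_smooth] hb.Atlas_openin by blast

lemma hyperbolic_h:
  assumes c: "c \<in> Atlas NN" and p: "p \<in> fst c"
  shows "hyperbolic_at (hb.metric c) (snd c p)"
proof -
  have "p \<in> topspace XN" using is_chart_subset[OF hb.Atlas_chart[OF c]] p by auto
  then obtain b where b: "b \<in> NB" "p \<in> fst b" by (rule hb.obtain_base)
  note bA = hb.base_in_Atlas[OF b(1)]
  have W: "openin XN (fst c \<inter> fst b)" using hb.Atlas_openin[OF c] hb.Atlas_openin[OF bA] by blast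
  interpret coordinate_change "snd c ` (fst c \<inter> fst b)" "snd b ` (fst c \<inter> fst b)" "transition c b" hyp_metric "hb.metric c"
  proof (rule metric_coordinate_change[OF thick_UNIV hb.smooth_manifold_generated hb.riemannian_metric_metric c bA])
    show "open (snd c ` (fst c \<inter> fst b))" by (rule open_image_N[OF c W]) auto
    show "open (snd b ` (fst c \<inter> fst b))" by (rule open_image_N[OF bA W]) auto
    show "C_inf (snd b ` (fst c \<inter> fst b)) hyp_metric" by (rule C_inf_subset[OF C_inf_hyp_metric]) auto
    show "hyp_metric y = hb.metric b y" if "y \<in> snd b ` (fst c \<inter> fst b)" for y
      using that hb.metric_base[OF b(1)] by auto
  qed
  show ?thesis by (rule hyperbolic_transform[OF _ hyperbolic_hyp_metric]) (use p b in auto)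
qed

lemma boundary_chart_Atlas:
  assumes "c \<in> Atlas Mbar"
  shows "boundary_chart Mbar c \<in> Atlas NN"
  unfolding boundary_manifold_N[symmetric]
  using is_chart_boundary_chart[OF bar.smooth_manifold_generated assms]
    boundary_smooth_transition[OF bar.smooth_manifold_generated] assms
  by (simp add: boundary_manifold_def compatible_iff)

lemma hyperbolic_representative_h: "hyperbolic_representative Mbar bar.metric hb.metric"
  unfolding hyperbolic_representative_def Let_def boundary_manifold_N
\<comment> \<open>The conformal factor is \<open>2\<close> because the compactified metric restricts
  to half the hyperbolic metric on the boundary.\<close>
proof (intro conjI ballI allI exI[of _ "%_. 2"])
  show "riemannian_metric NN hb.metric" by (rule hb.riemannian_metric_metric)
  show "gauss (hb.metric c) (snd c p) = -1" if "c \<in> Atlas NN" "p \<in> fst c" for c p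
    by (rule gauss_hyperbolic[OF hyperbolic_h[OF that]])
      (rule metric_positive(3)[OF hb.riemannian_metric_metric that(1)], use that in auto)
  fix c p v w assume c: "c \<in> Atlas Mbar" and p: "p \<in> fst c \<inter> boundary_points Mbar"
  let ?c = "boundary_chart Mbar c"
  obtain b where b: "b \<in> BB" "p \<in> fst b" using Atlas_Mbar_base[OF c] p by blast
  note bA = bar.base_in_Atlas[OF b(1)]
  let ?b = "boundary_chart Mbar b"
  obtain D where D: "tder c b p D"
    using transition_has_derivative[OF bar.Atlas_compatible[OF c bA], of p] p b by blast
  have p': "p \<in> fst c \<inter> fst b \<inter> boundary_points Mbar" using p b by auto
  note bt = boundary_transition_derivative[OF bar.smooth_manifold_generated c bA p' D]
  have 1: "bar.metric c (snd c p) = pull (matrix D) (gam (snd b p))"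
    by (rule bar.metric_pull[OF c _ b D]) (use p in auto)
  have 2: "hb.metric ?c (snd ?c p) = pull (matrix (%v. hor (D (lift v 0)))) (hyp_metric (snd ?b p))"
    by (rule hb.metric_pull[OF boundary_chart_Atlas[OF c] _ _ _ bt(1)]) (use p' b in "auto simp: boundary_chart_alt")
  have "snd ?b p = hor (snd b p)" by (simp add: boundary_chart_alt)
  then show "bilin (hb.metric ?c (snd ?c p)) v w = 2 * bilin (bar.metric c (snd c p)) (lift v 0) (lift w 0)"
    unfolding 1 2 using has_derivative_linear[OF D] has_derivative_linear[OF bt(1)]
    by (simp add: bilin_pull matrix_works gam_def bilin_warp bt(2))
qed simp

section \<open>The end\<close>

text \<open>Away from the horizon each orbit has exactly one representative with
  \<open>s > 0\<close>; it is recovered from the invariants \<open>s *\<^sub>R p\<close> and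
  \<open>s\<^sup>2\<close>.\<close>

definition rep :: "real => (real ^ 3) \<times> real" where
  "rep r = (let x = inv enc r in ((1 / sqrt (snd (snd x))) *\<^sub>R fst (snd x), sqrt (snd (snd x))))"

lemma rep_qq: "0 < s ==> rep (qq (p, s)) = (p, s)"
  by (simp add: rep_def inv_enc_qq kap_def)

definition PL :: "real set" where "PL = {p \<in> topspace TB. Om p < 1}"

lemma PL_rep:
  assumes "r \<in> PL"
  obtains p s where "p \<in> double_torus" "0 < s" "s \<le> 1" "r = qq (p, s)" "rep r = (p, s)"
proof -
  obtain y where y: "y \<in> YY" "r = qq y" using assms by (auto simp: PL_def topspace_TB)
  then have "snd y ~= 0" using assms by (auto simp: PL_def Om_qq)
  define z where "z = (if 0 < snd y then y else - y)"
  have z: "z \<in> YY" "r = qq z" "0 < snd z" using y YY_uminus qq_uminus \<open>snd y ~= 0\<close> by (auto simp: z_def)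
  then show thesis using rep_qq[of "snd z" "fst z"] by (intro that[of "fst z" "snd z"]) (auto simp: YY_def)
qed

lemma openin_PL: "openin TB PL"
  using openin_level[of "{..<1}"] by (simp add: PL_def)

lemma continuous_rep: "continuous_map (subtopology TB PL) euclidean rep"
proof -
  let ?K = "{x::(real ^ 3 ^ 3) \<times> (real ^ 3) \<times> real. 0 < snd (snd x)}"
  have "continuous_map TB (top_of_set (kap ` YY)) (inv enc)"
    using homeomorphic_TB by (simp add: homeomorphic_maps_def)
  then have "continuous_map (subtopology TB PL) (top_of_set ?K) (inv enc)"
    by (auto simp: continuous_map_in_subtopology continuous_map_from_subtopology PL_def Om_def)
  moreover have "continuous_on ?K (%x. ((1 / sqrt (snd (snd x))) *\<^sub>R fst (snd x), sqrt (snd (snd x))))"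
    by (intro continuous_intros) auto
  then have "continuous_map (top_of_set ?K) euclidean (%x. ((1 / sqrt (snd (snd x))) *\<^sub>R fst (snd x), sqrt (snd (snd x))))"
    by simp
  ultimately have "continuous_map (subtopology TB PL) euclidean
      ((%x. ((1 / sqrt (snd (snd x))) *\<^sub>R fst (snd x), sqrt (snd (snd x)))) \<circ> inv enc)"
    by (rule continuous_map_compose)
  then show ?thesis by (simp add: comp_def rep_def[abs_def] Let_def)
qed

lemma boundary_qq: "q \<in> boundary_points Mbar \<longleftrightarrow> (\<exists>p\<in>double_torus. q = qq (p, 1))"
proof
  assume q: "q \<in> boundary_points Mbar"
  then have t: "q \<in> topspace TB" using boundary_points_subset[OF bar.smooth_manifold_generated] by auto
  then have "Om q = 0" using boundary_Om q by blast
  then have "q \<in> PL" using t by (simp add: PL_def)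
  then obtain p s where "p \<in> double_torus" "0 < s" "s \<le> 1" "q = qq (p, s)" by (rule PL_rep)
  then show "\<exists>p\<in>double_torus. q = qq (p, 1)" using \<open>Om q = 0\<close> by (auto simp: Om_qq power2_eq_1_iff)
next
  assume "\<exists>p\<in>double_torus. q = qq (p, 1)"
  then obtain p where "p \<in> double_torus" "q = qq (p, 1)" by blast
  then have "q \<in> topspace TB" "Om q = 0" by (auto simp: topspace_TB YY_def Om_qq)
  then show "q \<in> boundary_points Mbar" using boundary_Om by blast
qed

lemma topspace_XN: "topspace XN = boundary_points Mbar"
  using boundary_points_subset[OF bar.smooth_manifold_generated] by auto

lemma boundary_PL: "boundary_points Mbar \<subseteq> PL"
proof
  fix q assume q: "q \<in> boundary_points Mbar"
  then have "q \<in> topspace TB" using topspace_XN by auto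
  then show "q \<in> PL" using boundary_Om q by (simp add: PL_def)
qed

lemma continuous_qq_one: "continuous_map (top_of_set double_torus) XN (%p. qq (p, 1))"
proof -
  have "continuous_map (top_of_set double_torus) (top_of_set YY) (%p. (p, 1))"
    by (auto intro!: continuous_intros simp: YY_def)
  from continuous_map_compose[OF this continuous_qq]
  show ?thesis by (auto simp: comp_def continuous_map_in_subtopology boundary_qq)
qed

lemma genus_two_N: "genus_two (Top (boundary_manifold Mbar))"
proof -
  have "homeomorphic_maps (top_of_set double_torus) XN (%p. qq (p, 1)) (%r. fst (rep r))"
    unfolding homeomorphic_maps_def
  proof (intro conjI continuous_qq_one)
    have "continuous_map XN euclidean rep"
      using continuous_map_from_subtopology[OF continuous_rep, of "boundary_points Mbar"] boundary_PL
      by (simp add: subtopology_subtopology Int_absorb1)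
    then have "continuous_map XN euclidean (%r. fst (rep r))"
      using continuous_map_compose[of XN euclidean rep euclidean fst] by (simp add: comp_def continuous_on_fst)
    then show "continuous_map XN (top_of_set double_torus) (%r. fst (rep r))"
      by (auto simp: continuous_map_in_subtopology boundary_qq rep_qq)
    show "\<forall>p\<in>topspace (top_of_set double_torus). fst (rep (qq (p, 1))) = p" by (simp add: rep_qq)
    show "\<forall>r\<in>topspace XN. qq (fst (rep r), 1) = r" unfolding topspace_XN by (auto simp: boundary_qq rep_qq)
  qed
  then show ?thesis
    unfolding genus_two_def boundary_manifold_N Top_generated
    using homeomorphic_space_def homeomorphic_space_sym by blast
qed

definition prj :: "real => real" where "prj r = qq (fst (rep r), 1)"

definition rr :: "real => real" where "rr p = 1 / (sqrt 2 * Om p)"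

text \<open>The bound on \<open>Om\<close> says \<open>rr p > 2\<close>: outside the horizon radius
  \<open>1 / sqrt 2\<close> and within the range \<open>r > 1\<close> of the background.\<close>

definition EE :: "real set" where "EE = {p \<in> topspace TB. 0 < Om p \<and> Om p < 1 / (2 * sqrt 2)}"

text \<open>The point over \<open>q\<close> at radius \<open>t\<close>; its height solves
  \<open>1 - s\<^sup>2 = 1 / (sqrt 2 * t)\<close>.\<close>

definition bck :: "real => real => real" where "bck t q = qq (fst (rep q), sqrt (1 - 1 / (sqrt 2 * t)))"

lemma sqrt2_bounds: "1 < sqrt (2::real)" "1 / (2 * sqrt 2) < (1::real)"
proof -
  show s: "1 < sqrt (2::real)" by simp
  have "1 < 2 * sqrt (2::real)" using s by linarith
  then show "1 / (2 * sqrt 2) < (1::real)" by simp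
qed

lemma EE_subset: "EE \<subseteq> PM" "EE \<subseteq> PL"
proof -
  show "EE \<subseteq> PM" by (auto simp: EE_def PM_def)
  have "t < 1" if "t < 1 / (2 * sqrt 2)" for t :: real using that sqrt2_bounds(2) by linarith
  then show "EE \<subseteq> PL" by (auto simp: EE_def PL_def)
qed

lemma openin_EE: "openin TB EE"
  using openin_level[of "{0<..<1 / (2 * sqrt 2)}"] by (simp add: EE_def)

lemma EE_forward:
  assumes "p \<in> EE"
  shows "prj p \<in> boundary_points Mbar" "2 < rr p" "bck (rr p) (prj p) = p"
proof -
  obtain z s where z: "z \<in> double_torus" "0 < s" "s \<le> 1" "p = qq (z, s)" "rep p = (z, s)"
    using PL_rep[of p] assms EE_subset by blast
  show "prj p \<in> boundary_points Mbar" using z by (auto simp: prj_def boundary_qq)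
  have o: "0 < Om p" "Om p < 1 / (2 * sqrt 2)" using assms by (auto simp: EE_def)
  then have "sqrt 2 * Om p < 1 / 2" by (simp add: field_simps)
  then have "1 / (1 / 2) < 1 / (sqrt 2 * Om p)" using o by (intro divide_strict_left_mono) auto
  then show "2 < rr p" by (simp add: rr_def)
  have "1 / (sqrt 2 * rr p) = Om p" using o by (simp add: rr_def)
  then have "sqrt (1 - 1 / (sqrt 2 * rr p)) = s" using z by (simp add: Om_qq)
  then show "bck (rr p) (prj p) = p" using z by (simp add: bck_def prj_def rep_qq)
qed

lemma EE_back:
  assumes q: "q \<in> boundary_points Mbar" and t: "2 < t"
  shows "bck t q \<in> EE" "rr (bck t q) = t" "prj (bck t q) = q"
proof -
  obtain z where z: "z \<in> double_torus" "q = qq (z, 1)" using q boundary_qq by blast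
  define o' where "o' = 1 / (sqrt 2 * t)"
  have o: "0 < o'" using t by (simp add: o'_def)
  have "1 / (sqrt 2 * t) < 1 / (2 * sqrt 2)"
    using t by (intro divide_strict_left_mono) auto
  then have o2: "o' < 1 / (2 * sqrt 2)" by (simp add: o'_def)
  then have o1: "o' < 1" using sqrt2_bounds(2) by linarith
  have b: "bck t q = qq (z, sqrt (1 - o'))" using z by (simp add: bck_def rep_qq o'_def)
  have Om: "Om (bck t q) = o'" unfolding b Om_qq using o1 by simp
  have "(z, sqrt (1 - o')) \<in> YY" using z o o1 by (simp add: YY_def) (metis less_eq_real_def neg_le_0_iff_le order_trans real_sqrt_ge_zero zero_le_one diff_ge_0_iff_ge)
  then show "bck t q \<in> EE" using o o2 Om[unfolded b] unfolding b by (auto simp: EE_def topspace_TB)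
  show "rr (bck t q) = t" unfolding rr_def Om using t by (simp add: o'_def)
  show "prj (bck t q) = q" unfolding prj_def b using rep_qq[of "sqrt (1 - o')" z] o1 z by simp
qed

lemma bij_EE: "bij_betw (%p. (rr p, prj p)) EE ({2<..} \<times> boundary_points Mbar)"
  by (rule bij_betw_byWitness[where f'="%(t, q). bck t q"]) (use EE_forward EE_back in auto)

lemma continuous_prj: "continuous_map (subtopology TB PL) XN prj"
proof -
  have "continuous_map (subtopology TB PL) euclidean (%r. fst (rep r))"
    using continuous_map_compose[OF continuous_rep, of euclidean fst] by (simp add: comp_def continuous_on_fst)
  moreover have "fst (rep r) \<in> double_torus" if "r \<in> PL" for r using PL_rep[OF that] by (metis fst_conv)
  ultimately have "continuous_map (subtopology TB PL) (top_of_set double_torus) (%r. fst (rep r))"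
    by (auto simp: continuous_map_in_subtopology)
  from continuous_map_compose[OF this continuous_qq_one] show ?thesis by (simp add: comp_def prj_def[abs_def])
qed

lemma prj_boundary: "q \<in> boundary_points Mbar ==> prj q = q"
  by (auto simp: boundary_qq prj_def rep_qq)

abbreviation "ec \<equiv> end_chart EE rr prj"

lemma ec_simps: "p \<in> fst (ec c) \<longleftrightarrow> p \<in> EE \<and> prj p \<in> fst c" "snd (ec c) p = lift (snd c (prj p)) (rr p)"
  by (simp_all add: end_chart_def)

lemma image_ec:
  assumes c: "c \<in> Atlas NN"
  shows "snd (ec c) ` fst (ec c) = {y. hor y \<in> snd c ` fst c \<and> 2 < y $ 3}"
proof (intro equalityI subsetI)
  fix y assume "y \<in> snd (ec c) ` fst (ec c)"
  then obtain p where p: "p \<in> EE" "prj p \<in> fst c" "y = lift (snd c (prj p)) (rr p)"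
    using ec_simps by blast
  then show "y \<in> {y. hor y \<in> snd c ` fst c \<and> 2 < y $ 3}" using EE_forward(2) by simp
next
  fix y assume "y \<in> {y. hor y \<in> snd c ` fst c \<and> 2 < y $ 3}"
  then obtain q where q: "q \<in> fst c" "hor y = snd c q" "2 < y $ 3" by blast
  have qb: "q \<in> boundary_points Mbar" using is_chart_subset[OF hb.Atlas_chart[OF c]] q(1) topspace_XN by auto
  note e = EE_back[OF qb q(3)]
  have "bck (y $ 3) q \<in> fst (ec c)" using e q by (simp add: ec_simps)
  moreover have "y = snd (ec c) (bck (y $ 3) q)" using e q lift_hor[of y] by (simp add: ec_simps)
  ultimately show "y \<in> snd (ec c) ` fst (ec c)" by blast
qed

lemma openin_ec:
  assumes c: "c \<in> Atlas NN"
  shows "openin TB (fst (ec c))"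
proof -
  have "openin (subtopology TB PL) {p \<in> topspace (subtopology TB PL). prj p \<in> fst c}"
    by (rule openin_continuous_map_preimage[OF continuous_prj hb.Atlas_openin[OF c]])
  then have "openin TB {p \<in> topspace (subtopology TB PL). prj p \<in> fst c}"
    using openin_PL openin_trans_full by blast
  then have "openin TB ({p \<in> topspace (subtopology TB PL). prj p \<in> fst c} \<inter> EE)" using openin_EE by blast
  moreover have "{p \<in> topspace (subtopology TB PL). prj p \<in> fst c} \<inter> EE = fst (ec c)"
    using EE_subset(2) openin_subset[OF openin_EE] by (auto simp: ec_simps)
  ultimately show ?thesis by simp
qed

text \<open>The inverse is explicit, namely \<open>bck\<close> at the given radius and boundary
  point. Continuity in the two directions reduces to that of \<open>prj\<close> and
  \<open>Om\<close>, and of \<open>rep\<close> and \<open>qq\<close>.\<close>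

lemma is_chart_ec:
  assumes c: "c \<in> Atlas NN"
  shows "is_chart half_space TB (ec c)"
proof -
  note ch = hb.Atlas_chart[OF c]
  define I where "I = {y::real ^ 3. hor y \<in> snd c ` fst c \<and> 2 < y $ 3}"
  have im: "snd (ec c) ` fst (ec c) = I" unfolding I_def by (rule image_ec[OF c])
  have cb: "fst c \<subseteq> boundary_points Mbar" using is_chart_subset[OF ch] topspace_XN by auto
  have sub: "fst (ec c) \<subseteq> PL" "fst (ec c) \<subseteq> topspace TB" using EE_subset openin_subset[OF openin_EE] by (auto simp: ec_simps)
  have ts: "topspace (subtopology TB (fst (ec c))) = fst (ec c)" using sub by auto
  have hc: "homeomorphic_map (subtopology XN (fst c)) (top_of_set (snd c ` fst c)) (snd c)"
    using ch by (simp add: is_chart_def)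
  have tc: "topspace (subtopology XN (fst c)) = fst c" using cb topspace_XN by auto
  have 1: "continuous_map (subtopology TB (fst (ec c))) euclidean (%p. snd c (prj p))"
  proof -
    have "continuous_map (subtopology TB (fst (ec c))) XN prj"
      using continuous_map_from_subtopology[OF continuous_prj, of "fst (ec c)"] sub
      by (simp add: subtopology_subtopology Int_absorb1)
    then have "continuous_map (subtopology TB (fst (ec c))) (subtopology XN (fst c)) prj"
      by (rule continuous_map_into_subtopology) (use ts ec_simps(1)[of _ c] in blast)
    from continuous_map_compose[OF this homeomorphic_imp_continuous_map[OF hc]]
    show ?thesis by (auto simp: comp_def continuous_map_in_subtopology)
  qed
  have 2: "continuous_map (subtopology TB (fst (ec c))) euclidean rr"
  proof -
    have "continuous_map (subtopology TB (fst (ec c))) (top_of_set {0<..}) Om"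
    proof (rule continuous_map_into_subtopology[OF continuous_map_from_subtopology[OF continuous_Om]])
      have "0 < Om p" if "p \<in> fst (ec c)" for p using that by (simp add: ec_simps(1)) (simp add: EE_def)
      then show "Om \<in> topspace (subtopology TB (fst (ec c))) \<rightarrow> {0<..}" using ts by blast
    qed
    moreover have "continuous_map (top_of_set {0<..}) euclidean (%t::real. 1 / (sqrt 2 * t))"
      by (auto intro!: continuous_intros)
    ultimately have "continuous_map (subtopology TB (fst (ec c))) euclidean ((%t. 1 / (sqrt 2 * t)) \<circ> Om)"
      by (rule continuous_map_compose)
    then show ?thesis by (simp add: comp_def rr_def[abs_def])
  qed
  have "continuous_map (subtopology TB (fst (ec c))) (prod_topology euclidean euclidean) (%p. (snd c (prj p), rr p))"
    by (rule continuous_map_pairedI[OF 1 2])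
  then have "continuous_map (subtopology TB (fst (ec c))) euclidean (%p. (snd c (prj p), rr p))" by simp
  moreover have "continuous_map (euclidean :: ((real ^ 2) \<times> real) topology) euclidean (%z. lift (fst z) (snd z))"
    by (auto intro!: continuous_on_lift continuous_intros)
  ultimately have "continuous_map (subtopology TB (fst (ec c))) euclidean ((%z. lift (fst z) (snd z)) \<circ> (%p. (snd c (prj p), rr p)))"
    by (rule continuous_map_compose)
  then have "continuous_map (subtopology TB (fst (ec c))) euclidean (snd (ec c))"
    by (simp add: comp_def ec_simps(2)[abs_def])
  then have F: "continuous_map (subtopology TB (fst (ec c))) (top_of_set I) (snd (ec c))"
    using im by (auto intro!: continuous_map_into_subtopology)
  define g where "g = inv_into (fst c) (snd c)"
  have gc: "g (snd c q) = q" if "q \<in> fst c" for q using is_chart_inv[OF ch that] by (simp add: g_def)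
  have 3: "continuous_map (top_of_set (snd c ` fst c)) (subtopology XN (fst c)) g"
  proof -
    obtain k where k: "homeomorphic_maps (subtopology XN (fst c)) (top_of_set (snd c ` fst c)) (snd c) k"
      using hc homeomorphic_map_maps by blast
    have kc: "k (snd c q) = q" if "q \<in> fst c" for q
      using k that tc by (simp add: homeomorphic_maps_def)
    have "continuous_map (top_of_set (snd c ` fst c)) (subtopology XN (fst c)) k"
      using k by (simp only: homeomorphic_maps_def)
    then show ?thesis by (rule continuous_map_eq) (use kc gc in force)
  qed
  have 4: "continuous_map (top_of_set I) euclidean (%y. fst (rep (g (hor y))))"
  proof -
    have "continuous_map (top_of_set I) (top_of_set (snd c ` fst c)) hor"
      by (auto simp: I_def continuous_hor)
    from continuous_map_compose[OF this 3]
    have "continuous_map (top_of_set I) (subtopology TB PL) (g \<circ> hor)"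
      using cb boundary_PL by (auto simp: continuous_map_in_subtopology Pi_iff)
    from continuous_map_compose[OF this continuous_rep]
    have "continuous_map (top_of_set I) euclidean (%y. rep (g (hor y)))" by (simp add: comp_def)
    then show ?thesis by (auto intro!: continuous_intros)
  qed
  have s: "continuous_on I (%y. sqrt (1 - 1 / (sqrt 2 * y $ 3)))"
    by (intro continuous_intros) (auto simp: I_def)
  have "continuous_on I (%y. fst (rep (g (hor y))))" using 4 by simp
  from continuous_on_Pair[OF this s]
  have "continuous_on I (%y. (fst (rep (g (hor y))), sqrt (1 - 1 / (sqrt 2 * y $ 3))))" .
  moreover have bk: "bck (y $ 3) (g (hor y)) = qq (fst (rep (g (hor y))), sqrt (1 - 1 / (sqrt 2 * y $ 3)))" for y
    by (simp add: bck_def)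
  have inY: "(fst (rep (g (hor y))), sqrt (1 - 1 / (sqrt 2 * y $ 3))) \<in> YY" if y: "y \<in> I" for y
  proof -
    obtain q where q: "q \<in> fst c" "hor y = snd c q" using y by (auto simp: I_def)
    then have "q \<in> PL" using cb boundary_PL by blast
    then have "fst (rep (g (hor y))) \<in> double_torus" using PL_rep[of q] q gc by (metis fst_conv)
    moreover have "0 \<le> 1 / (sqrt 2 * y $ 3)" "1 / (sqrt 2 * y $ 3) \<le> 1"
    proof -
      have "1 \<le> sqrt 2 * y $ 3" using sqrt2_bounds(1) y mult_mono[of 1 "sqrt 2" 1 "y $ 3"] by (auto simp: I_def)
      then show "0 \<le> 1 / (sqrt 2 * y $ 3)" "1 / (sqrt 2 * y $ 3) \<le> 1" by auto
    qed
    ultimately show ?thesis by (simp add: YY_def) (meson diff_ge_0_iff_ge order_trans real_sqrt_ge_zero neg_le_0_iff_le zero_le_one)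
  qed
  ultimately have "continuous_map (top_of_set I) (top_of_set YY) (%y. (fst (rep (g (hor y))), sqrt (1 - 1 / (sqrt 2 * y $ 3))))"
    by auto
  from continuous_map_compose[OF this continuous_qq]
  have 5: "continuous_map (top_of_set I) TB (%y. bck (y $ 3) (g (hor y)))" by (simp add: comp_def bk)
  have inv: "bck (y $ 3) (g (hor y)) \<in> fst (ec c)" "snd (ec c) (bck (y $ 3) (g (hor y))) = y" if y: "y \<in> I" for y
  proof -
    obtain q where q: "q \<in> fst c" "hor y = snd c q" "2 < y $ 3" using y by (auto simp: I_def)
    note e = EE_back[OF subsetD[OF cb q(1)] q(3)]
    show "bck (y $ 3) (g (hor y)) \<in> fst (ec c)" "snd (ec c) (bck (y $ 3) (g (hor y))) = y"
      using e q lift_hor[of y] unfolding q(2) gc[OF q(1)] by (simp_all add: ec_simps)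
  qed
  have "homeomorphic_maps (subtopology TB (fst (ec c))) (top_of_set I) (snd (ec c)) (%y. bck (y $ 3) (g (hor y)))"
    unfolding homeomorphic_maps_def
  proof (intro conjI F)
    show "continuous_map (top_of_set I) (subtopology TB (fst (ec c))) (%y. bck (y $ 3) (g (hor y)))"
      using 5 inv(1) by (auto intro!: continuous_map_into_subtopology)
    show "\<forall>p\<in>topspace (subtopology TB (fst (ec c))). bck (snd (ec c) p $ 3) (g (hor (snd (ec c) p))) = p"
      unfolding ts using gc EE_forward(3) by (auto simp: ec_simps)
    show "\<forall>y\<in>topspace (top_of_set I). snd (ec c) (bck (y $ 3) (g (hor y))) = y" using inv(2) by simp
  qed
  then have "homeomorphic_map (subtopology TB (fst (ec c))) (top_of_set I) (snd (ec c))" by (rule homeomorphic_maps_imp_map)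
  moreover have "openin (top_of_set half_space) I"
  proof -
    have "open (snd c ` fst c)" by (rule open_image_N[OF c hb.Atlas_openin[OF c] order_refl])
    then have "open (hor -` (snd c ` fst c) \<inter> {y. 2 < y $ 3})"
      by (intro open_Int open_halfspace_component_gt_cart continuous_open_vimage linear_continuous_at[OF linear_hor])
    moreover have "I = half_space \<inter> (hor -` (snd c ` fst c) \<inter> {y. 2 < y $ 3})" by (auto simp: I_def half_space_def)
    ultimately show ?thesis by (metis openin_open_Int)
  qed
  ultimately show ?thesis unfolding is_chart_def im using openin_ec[OF c] by simp
qed

section \<open>The Kottler profile and the radial variable\<close>

definition kk :: real where "kk = 1 / (2 * sqrt 2)"

definition ff :: "real => real" where "ff t = t\<^sup>2 - 1 + kk / t"

text \<open>The height \<open>w = 1 - s\<close> as a function of the radius, from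
  \<open>1 - s\<^sup>2 = 1 / (sqrt 2 * t)\<close> with \<open>s > 0\<close>.\<close>

definition ww :: "real => real" where "ww t = 1 - sqrt (1 - 1 / (sqrt 2 * t))"

lemma ww_bounds:
  assumes t: "2 < t"
  shows "0 < 1 / (sqrt 2 * t)" "1 / (sqrt 2 * t) < 1" "0 < ww t" "ww t < 2" "Omf (ww t) = 1 / (sqrt 2 * t)"
proof -
  show p: "0 < 1 / (sqrt 2 * t)" using t by simp
  have "1 * 1 < sqrt 2 * t" using sqrt2_bounds(1) t by (intro mult_strict_mono) auto
  then show l: "1 / (sqrt 2 * t) < 1" by simp
  have "sqrt (1 - 1 / (sqrt 2 * t)) < 1" "0 \<le> sqrt (1 - 1 / (sqrt 2 * t))" using p l by simp_all
  then show "0 < ww t" "ww t < 2" unfolding ww_def by linarith+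
  have "Omf (1 - a) = 1 - a\<^sup>2" for a by (simp add: Omf_def power2_eq_square algebra_simps)
  then show "Omf (ww t) = 1 / (sqrt 2 * t)" unfolding ww_def using l by simp
qed

lemma ww_derivative:
  assumes t: "2 < t"
  defines "o' \<equiv> 1 / (sqrt 2 * t)"
  shows "(ww has_real_derivative - (o' / t) / (2 * sqrt (1 - o'))) (at t)"
proof -
  have o1: "0 < 1 - o'" using ww_bounds(2)[OF t] by (simp add: o'_def)
  have "((%t::real. 1 / (sqrt 2 * t)) has_real_derivative - (o' / t)) (at t)"
    unfolding o'_def using t by (auto intro!: derivative_eq_intros simp: field_simps)
  then have "((%t. 1 - 1 / (sqrt 2 * t)) has_real_derivative o' / t) (at t)"
    using DERIV_diff[OF DERIV_const[of 1], of "%t. 1 / (sqrt 2 * t)" "- (o' / t)" t UNIV] by simp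
  from DERIV_chain2[OF DERIV_real_sqrt[OF o1, unfolded o'_def] this]
  have "((%t. sqrt (1 - 1 / (sqrt 2 * t))) has_real_derivative inverse (sqrt (1 - o')) / 2 * (o' / t)) (at t)"
    by (simp add: o'_def)
  then have "(ww has_real_derivative 0 - inverse (sqrt (1 - o')) / 2 * (o' / t)) (at t)"
    unfolding ww_def[abs_def] by (intro DERIV_diff DERIV_const)
  then show ?thesis by (simp add: field_simps)
qed

lemma C_inf_ww: "C_inf {y::real ^ 3. 2 < y $ 3} (%y. ww (y $ 3))"
proof -
  have o: "open {y::real ^ 3. 2 < y $ 3}" using open_halfspace_component_gt_cart[of 2 3] by simp
  have "0 < 1 - 1 / (sqrt 2 * t)" if "2 < t" for t using ww_bounds(2)[OF that] by simp
  then show ?thesis unfolding ww_def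
    by (intro C_inf_diff C_inf_sqrt C_inf_divide C_inf_mult C_inf_const C_inf_nth C_inf_id o) auto
qed

section \<open>The metric near infinity\<close>

text \<open>The part of a base chart in the end over which the representative has positive height.
  There the base coordinates are the boundary coordinates and \<open>ww (rr p)\<close>, free of any
  flip.\<close>

definition VV :: "nat => real => real set" where
  "VV i ee = EE \<inter> qq ` (UU i ee \<times> ({-1..1} \<inter> {0<..}))"

lemma VV: "openin TB (VV i ee)" "VV i ee \<subseteq> PM" "VV i ee \<subseteq> fst (bc i ee)" "VV i ee \<subseteq> EE"
proof -
  show "openin TB (VV i ee)" unfolding VV_def by (intro openin_Int openin_EE open_qq openin_slab open_greaterThan)
  show "VV i ee \<subseteq> PM" using EE_subset by (auto simp: VV_def)
  have "UU i ee \<times> ({-1..1} \<inter> {0<..}) \<subseteq> Dm i ee" by (auto simp: Dm_def)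
  then show "VV i ee \<subseteq> fst (bc i ee)" unfolding fst_bc VV_def by blast
  show "VV i ee \<subseteq> EE" by (simp add: VV_def)
qed

lemma bc_BB: "i < 5 ==> pm ee ==> bc i ee \<in> BB"
  by (auto simp: BB_def)

abbreviation "bd i ee \<equiv> boundary_chart Mbar (bc i ee)"

lemma bd_Atlas: "i < 5 ==> pm ee ==> bd i ee \<in> NB" "i < 5 ==> pm ee ==> bd i ee \<in> Atlas NN"
  using bc_BB hb.base_in_Atlas by blast+

lemma bd_simps:
  assumes "z \<in> UU i ee"
  shows "qq (z, 1) \<in> fst (bd i ee)" "snd (bd i ee) (qq (z, 1)) = ch i z"
proof -
  have D: "(z, 1) \<in> Dm i ee" using assms by (simp add: Dm_def)
  then show "qq (z, 1) \<in> fst (bd i ee)"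
    unfolding boundary_chart_alt fst_bc using UU_torus[OF assms] boundary_qq by auto
  show "snd (bd i ee) (qq (z, 1)) = ch i z"
    unfolding boundary_chart_alt using bc_apply[OF D] by (simp add: cc_def)
qed

lemma VV_simps:
  assumes p: "p \<in> VV i ee"
  shows "prj p \<in> fst (bd i ee)" "hor (snd (bc i ee) p) = snd (bd i ee) (prj p)" "snd (bc i ee) p $ 3 = ww (rr p)"
    "rr p = 1 / (sqrt 2 * Omf (snd (bc i ee) p $ 3))"
proof -
  obtain z s where z: "z \<in> UU i ee" "0 < s" "s \<le> 1" "p = qq (z, s)" using p by (auto simp: VV_def)
  have D: "(z, s) \<in> Dm i ee" using z by (simp add: Dm_def)
  have pr: "prj p = qq (z, 1)" using z by (simp add: prj_def rep_qq)
  have b: "snd (bc i ee) p = lift (ch i z) (1 - s)" unfolding z(4) bc_apply[OF D] by (simp add: cc_def)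
  show "prj p \<in> fst (bd i ee)" "hor (snd (bc i ee) p) = snd (bd i ee) (prj p)"
    unfolding pr b using bd_simps[OF z(1)] by simp_all
  have "Om p ~= 0" using p by (auto simp: VV_def EE_def)
  then have "1 / (sqrt 2 * rr p) = 1 - s\<^sup>2" by (simp add: rr_def) (simp add: z(4) Om_qq)
  then show "snd (bc i ee) p $ 3 = ww (rr p)" unfolding ww_def b using z by simp
  have "Om p = Omf (1 - s)" by (simp add: z(4) Om_qq Omf_def power2_eq_square algebra_simps)
  then show "rr p = 1 / (sqrt 2 * Omf (snd (bc i ee) p $ 3))" unfolding b by (simp add: rr_def)
qed

lemma ec_cover:
  assumes "p \<in> EE"
  obtains i ee where "i < 5" "pm ee" "p \<in> VV i ee"
proof -
  obtain z s where z: "z \<in> double_torus" "0 < s" "s \<le> 1" "p = qq (z, s)"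
    using PL_rep[of p] assms EE_subset by blast
  then have "(z, s) \<in> YY" by (simp add: YY_def)
  then obtain i ee w where "i < 5" "pm ee" "w \<in> Dm i ee" "0 < snd (z, s) ==> w = (z, s)"
    by (rule cover_bc) blast
  then show thesis using that[of i ee] z assms by (auto simp: VV_def Dm_def)
qed

lemma ec_transition:
  assumes c: "c \<in> Atlas NN" and p: "p \<in> fst (ec c) \<inter> VV i ee"
  shows "snd (bc i ee) p = lift (transition c (bd i ee) (hor (snd (ec c) p))) (ww (snd (ec c) p $ 3))"
    "i < 5 ==> pm ee ==> snd (ec c) p = lift (transition (bd i ee) c (hor (snd (bc i ee) p))) (1 / (sqrt 2 * Omf (snd (bc i ee) p $ 3)))"
proof -
  have v: "p \<in> VV i ee" and e: "p \<in> EE" "prj p \<in> fst c" using p ec_simps(1)[of p c] by auto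
  have ec: "snd (ec c) p = lift (snd c (prj p)) (rr p)" by (rule ec_simps)
  note V = VV_simps[OF v]
  have "snd (bc i ee) p = lift (hor (snd (bc i ee) p)) (snd (bc i ee) p $ 3)" by simp
  also have "\<dots> = lift (snd (bd i ee) (prj p)) (ww (rr p))" by (simp only: V(2,3))
  finally show "snd (bc i ee) p = lift (transition c (bd i ee) (hor (snd (ec c) p))) (ww (snd (ec c) p $ 3))"
    unfolding ec by (simp add: transition_apply[OF hb.Atlas_chart[OF c] e(2)])
  assume i: "i < 5" "pm ee"
  show "snd (ec c) p = lift (transition (bd i ee) c (hor (snd (bc i ee) p))) (1 / (sqrt 2 * Omf (snd (bc i ee) p $ 3)))"
    unfolding ec V(2) V(4)[symmetric] transition_apply[OF hb.Atlas_chart[OF bd_Atlas(2)[OF i]] V(1), of c] ..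
qed

abbreviation "vb i ee \<equiv> rb (bc i ee) (VV i ee)"

lemma vb_simps: "fst (vb i ee) = VV i ee" "snd (vb i ee) = snd (bc i ee)"
  using VV(3) by (auto simp: rb_def)

lemma vb_Atlas: "i < 5 ==> pm ee ==> vb i ee \<in> Atlas Mint"
  by (rule rb_Mint[OF bc_BB VV(1,2)])

lemma smooth_on_lift:
  assumes T: "smooth_on A T" and t: "smooth_on S t" and S: "hor ` S \<subseteq> A"
  shows "smooth_on S (%y. lift (T (hor y)) (t y))"
proof (rule smooth_on_combine[where B=lift and f="%y. T (hor y)" and g=t, OF _ t])
  show "smooth_on S (%y. T (hor y))"
    by (rule smooth_on_compose[OF smooth_on_C_inf[OF open_UNIV C_inf_linear[OF open_UNIV linear_hor]] T S]) simp
qed (rule C_inf_lift; assumption)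

text \<open>Both transitions are products of a boundary transition and a radial substitution,
  \<open>ww\<close> or its inverse.\<close>

lemma ec_compatible:
  assumes c: "c \<in> Atlas NN" and i: "i < 5" "pm ee"
  shows "compatible (ec c) (vb i ee)"
  unfolding compatible_iff smooth_transition_def
proof
  note bA = bd_Atlas(2)[OF i]
  have comp: "smooth_on (snd c ` (fst c \<inter> fst (bd i ee))) (transition c (bd i ee))"
    "smooth_on (snd (bd i ee) ` (fst (bd i ee) \<inter> fst c)) (transition (bd i ee) c)"
    using hb.Atlas_compatible[OF c bA] by (auto simp: compatible_def Int_commute)
  let ?S = "snd (ec c) ` (fst (ec c) \<inter> fst (vb i ee))"
  have "smooth_on ?S (%y. lift (transition c (bd i ee) (hor y)) (ww (y $ 3)))"
  proof (rule smooth_on_lift[OF comp(1)])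
    show "smooth_on ?S (%y. ww (y $ 3))"
      by (rule smooth_on_C_inf[OF _ C_inf_ww])
        (use open_halfspace_component_gt_cart[of 2 3] image_ec[OF c] in auto)
    show "hor ` ?S \<subseteq> snd c ` (fst c \<inter> fst (bd i ee))"
      using VV_simps(1)[of _ i ee] ec_simps(1)[of _ c] ec_simps(2)[of c] vb_simps(1)[of i ee] by auto
  qed
  then show "smooth_on ?S (transition (ec c) (vb i ee))"
    by (rule smooth_on_cong[rotated])
      (use ec_transition(1)[OF c, of _ i ee] transition_apply[OF is_chart_ec[OF c], of _ "vb i ee"] vb_simps in auto)
  let ?S = "snd (vb i ee) ` (fst (vb i ee) \<inter> fst (ec c))"
  have "smooth_on ?S (%y. lift (transition (bd i ee) c (hor y)) (1 / (sqrt 2 * Omf (y $ 3))))"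
  proof (rule smooth_on_lift[OF comp(2)])
    have S: "?S \<subseteq> U02"
    proof
      fix y assume "y \<in> ?S"
      then obtain p where p: "p \<in> VV i ee" "y = snd (bc i ee) p" by (auto simp: vb_simps)
      then have "p \<in> EE" by (simp add: VV_def)
      then show "y \<in> U02" using VV_simps(3)[OF p(1)] ww_bounds(3,4)[OF EE_forward(2)] p(2) by simp
    qed
    have "C_inf U02 (%y. 1 / (sqrt 2 * Omf (y $ 3)))"
      using Omf_bounds(1) by (intro C_inf_divide C_inf_mult C_inf_const C_inf_Omf open_U02) force
    then show "smooth_on ?S (%y. 1 / (sqrt 2 * Omf (y $ 3)))"
      by (rule smooth_on_C_inf[OF open_U02 _ S])
    show "hor ` ?S \<subseteq> snd (bd i ee) ` (fst (bd i ee) \<inter> fst c)"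
      using VV_simps(1,2)[of _ i ee] ec_simps(1)[of _ c] by (auto simp: vb_simps simp del: hor_up)
  qed
  then show "smooth_on ?S (transition (vb i ee) (ec c))"
    by (rule smooth_on_cong[rotated])
      (use ec_transition(2)[OF c _ i] transition_apply[OF chart_Mint[OF vb_Atlas[OF i]], of _ "ec c"] vb_simps in auto)
qed

lemma ec_Atlas:
  assumes c: "c \<in> Atlas NN"
  shows "ec c \<in> Atlas Mint"
proof -
  have "ec c \<in> Atlas Mbar"
  proof (rule smooth_manifold_maximal_local[OF bar.smooth_manifold_generated])
    show "is_chart half_space (Top Mbar) (ec c)" using is_chart_ec[OF c] by simp
    fix p assume "p \<in> fst (ec c)"
    then obtain i ee where i: "i < 5" "pm ee" "p \<in> VV i ee" using ec_cover ec_simps by metis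
    then show "\<exists>e\<in>Atlas Mbar. p \<in> fst e \<and> compatible (ec c) e"
      using ec_compatible[OF c i(1,2)] vb_Atlas[OF i(1,2)] by (intro bexI[of _ "vb i ee"]) (auto simp: vb_simps Atlas_Mint)
  qed
  moreover have "fst (ec c) \<subseteq> PM" using EE_subset ec_simps(1)[of _ c] by blast
  ultimately show ?thesis by (simp add: Atlas_Mint)
qed

text \<open>Passing from \<open>w\<close> to \<open>r\<close> multiplies the radial coefficient by
  the squared derivative of \<open>ww\<close>, whose factor \<open>1 / (1 - o')\<close> supplies the
  zero of \<open>ff\<close> at the horizon.\<close>

lemma eint_ff:
  assumes t: "2 < t"
  defines "o' \<equiv> 1 / (sqrt 2 * t)"
  shows "bint (ww t) = t\<^sup>2" "eint (ww t) * (- (o' / t) / (2 * sqrt (1 - o')))\<^sup>2 = 1 / ff t" "0 < ff t"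
proof -
  have o: "0 < o'" "o' < 1" "Omf (ww t) = o'" using ww_bounds[OF t] by (auto simp: o'_def)
  have t2: "t\<^sup>2 = 1 / (2 * o'\<^sup>2)" "1 / t\<^sup>2 = 2 * o'\<^sup>2" "kk / t = o' / 2"
    using t by (auto simp: o'_def kk_def power2_eq_square field_simps)
  show "bint (ww t) = t\<^sup>2" unfolding bint_def o(3) t2 ..
  have q: "0 < 1 + o' - o'\<^sup>2" using Omf_bounds(3)[OF ww_bounds(3,4)[OF t]] by (simp add: o(3))
  \<comment> \<open>The value of \<open>kk\<close> enters here: \<open>kk / t = o' / 2\<close> is
    what makes \<open>1 - o'\<close> a factor.\<close>
  have f: "ff t = (1 + o' - o'\<^sup>2) * (1 - o') / (2 * o'\<^sup>2)"
    unfolding ff_def t2 using o(1) by (simp add: field_simps power2_eq_square)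
  then show "0 < ff t" using o q by simp
  have "(- (o' / t) / (2 * sqrt (1 - o')))\<^sup>2 = o'\<^sup>2 * (1 / t\<^sup>2) / (4 * (1 - o'))"
    using o by (simp add: power_divide power_mult_distrib)
  also have "\<dots> = o'\<^sup>2 * o'\<^sup>2 / (2 * (1 - o'))" unfolding t2 using o by (simp add: frac_eq_eq algebra_simps)
  finally have d: "(- (o' / t) / (2 * sqrt (1 - o')))\<^sup>2 = o'\<^sup>2 * o'\<^sup>2 / (2 * (1 - o'))" .
  have nz: "o' ~= 0" "1 - o' ~= 0" "1 + o' - o'\<^sup>2 ~= 0" using o q by auto
  have k: "4 / a / b * (b * b / (2 * c)) = 1 / (a * c / (2 * b))" if "a ~= 0" "b ~= 0" "c ~= 0" for a b c :: real
    using that by (simp add: field_simps)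
  show "eint (ww t) * (- (o' / t) / (2 * sqrt (1 - o')))\<^sup>2 = 1 / ff t"
    unfolding d f eint_def evert_def o(3) by (rule k) (use nz in auto)
qed

abbreviation "wend \<equiv> warp (%t. t\<^sup>2) (%t. 1 / ff t)"

lemma riemannian_metric_isometry:
  assumes "riemannian_metric M g" "c \<in> Atlas M" "d \<in> Atlas M" "p \<in> fst c \<inter> fst d"
    "tder c d p D"
  shows "bilin (g c (snd c p)) u v = bilin (g d (snd d p)) (D u) (D v)"
  using assms unfolding riemannian_metric_def by blast

lemma gint_ec:
  assumes c: "c \<in> Atlas NN" and p: "p \<in> fst (ec c)"
  shows "gint (ec c) (snd (ec c) p) = wend (hb.metric c) (snd (ec c) p)"
proof -
  obtain i ee where i: "i < 5" "pm ee" "p \<in> VV i ee" using ec_cover ec_simps p by metis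
  note bA = bd_Atlas(2)[OF i(1,2)]
  define y where "y = snd (ec c) p"
  define q where "q = prj p"
  have e: "p \<in> EE" "q \<in> fst c" using p by (auto simp: ec_simps q_def)
  have y: "y = lift (snd c q) (rr p)" unfolding y_def q_def by (rule ec_simps)
  have t: "2 < y $ 3" using EE_forward(2)[OF e(1)] by (simp add: y)
  have qb: "q \<in> fst (bd i ee)" "snd (bd i ee) q = hor (snd (bc i ee) p)" "snd (bc i ee) p $ 3 = ww (y $ 3)"
    using VV_simps[OF i(3)] by (simp_all add: q_def y)
  have W: "openin XN (fst c \<inter> fst (bd i ee))" using hb.Atlas_openin[OF c] hb.Atlas_openin[OF bA] by blast
  have oW: "open (snd c ` (fst c \<inter> fst (bd i ee)))" by (rule open_image_N[OF c W]) auto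
  obtain Dc where Dc: "(transition c (bd i ee) has_derivative Dc) (at (snd c q) within snd c ` (fst c \<inter> fst (bd i ee)))"
    using transition_has_derivative[OF hb.Atlas_compatible[OF c bA], of q] e qb by blast
  have h: "hb.metric c (snd c q) = pull (matrix Dc) (hyp_metric (snd (bd i ee) q))"
    by (rule hb.metric_pull[OF c e(2) bd_Atlas(1)[OF i(1,2)] qb(1) Dc])
  have Dc': "(transition c (bd i ee) has_derivative Dc) (at (hor y))"
    using Dc at_within_open[OF _ oW, of "snd c q"] e qb by (simp add: y)
  define w' where "w' = - (1 / (sqrt 2 * y $ 3) / y $ 3) / (2 * sqrt (1 - 1 / (sqrt 2 * y $ 3)))"
  have d1: "((%y. transition c (bd i ee) (hor y)) has_derivative (%v. Dc (hor v))) (at y)"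
    by (rule has_derivative_compose[OF bounded_linear_imp_has_derivative[OF linear_hor] Dc'])
  have d2: "((%y. ww (y $ 3)) has_derivative (%v. w' * v $ 3)) (at y)"
    using has_derivative_compose[OF bounded_linear_imp_has_derivative[OF bounded_linear_vec_nth]
      ww_derivative[OF t, unfolded has_field_derivative_def]] by (simp add: w'_def)
  have "((%y. lift (transition c (bd i ee) (hor y)) (ww (y $ 3))) has_derivative
      (%v. lift (Dc (hor v)) (w' * v $ 3))) (at y within snd (ec c) ` (fst (ec c) \<inter> fst (vb i ee)))"
    by (rule has_derivative_at_withinI[OF has_derivative_lift[OF d1 d2]])
  then have D: "tder (ec c) (vb i ee) p (%v. lift (Dc (hor v)) (w' * v $ 3))"
    unfolding y_def
    by (rule has_derivative_transform[rotated 2])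
      (use p i(3) ec_transition(1)[OF c, of _ i ee] transition_apply[OF is_chart_ec[OF c], of _ "vb i ee"] vb_simps in auto)
  have pI: "p \<in> fst (ec c) \<inter> fst (vb i ee)" using p i(3) by (simp add: vb_simps)
  have g: "gint (vb i ee) (snd (bc i ee) p) = warp bint eint hyp_metric (snd (bc i ee) p)"
    by (rule gint_base[OF bc_BB[OF i(1,2)] VV(1,2)]) (use i(3) VV(3) in auto)
  show ?thesis
  proof (rule bilin_ext)
    fix u v
    have "bilin (gint (ec c) (snd (ec c) p)) u v = bilin (gint (vb i ee) (snd (vb i ee) p))
        (lift (Dc (hor u)) (w' * u $ 3)) (lift (Dc (hor v)) (w' * v $ 3))"
      by (rule riemannian_metric_isometry[OF metric_gint ec_Atlas[OF c] vb_Atlas[OF i(1,2)] pI D])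
    also have "\<dots> = bint (ww (y $ 3)) * bilin (hyp_metric (snd (bd i ee) q)) (Dc (hor u)) (Dc (hor v))
        + eint (ww (y $ 3)) * w'\<^sup>2 * u $ 3 * v $ 3"
      unfolding vb_simps g bilin_warp qb(2)[symmetric] qb(3) by (simp add: power2_eq_square mult.assoc mult.left_commute)
    also have "\<dots> = bilin (wend (hb.metric c) y) u v"
      unfolding w'_def eint_ff[OF t] bilin_warp using has_derivative_linear[OF Dc]
      by (simp add: y h bilin_pull matrix_works)
    finally show "bilin (gint (ec c) (snd (ec c) p)) u v = bilin (wend (hb.metric c) (snd (ec c) p)) u v"
      unfolding y_def .
  qed
qed

lemma end_identification_EE: "end_identification Mint Mbar EE 2 rr prj"
  unfolding end_identification_def Let_def boundary_manifold_N Points_Mint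
proof (intro conjI ballI)
  show "1 < (2::real)" by simp
  show "EE \<subseteq> PM" by (rule EE_subset)
  have "EE \<union> boundary_points Mbar = {p \<in> topspace TB. Om p \<in> {..<1 / (2 * sqrt 2)}}"
  proof -
    have "0 < 1 / (2 * sqrt (2::real))" by simp
    moreover have "p \<in> boundary_points Mbar \<longleftrightarrow> p \<in> topspace TB \<and> Om p = 0" for p
      using boundary_Om[of p] topspace_XN by auto
    ultimately show ?thesis using Om_range by (auto simp: EE_def simp del: zero_less_divide_iff) (metis less_eq_real_def)
  qed
  then show "openin (Top Mbar) (EE \<union> boundary_points Mbar)" using openin_level[of "{..<1 / (2 * sqrt 2)}"] by simp
  show "bij_betw (%p. (rr p, prj p)) EE ({2<..} \<times> Points NN)" using bij_EE topspace_XN by simp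
  show "ec c \<in> Atlas Mint" if "c \<in> Atlas NN" for c by (rule ec_Atlas[OF that])
  fix q assume "q \<in> Points NN"
  then have q: "q \<in> boundary_points Mbar" "q \<in> topspace TB" using topspace_XN by auto
  then have Oq: "Om q = 0" using boundary_Om by blast
  show "filterlim rr at_top (atin_within (Top Mbar) q PM)"
    unfolding filterlim_at_top_dense
  proof
    fix Z :: real
    define K where "K = max Z 1"
    define J where "J = {p \<in> topspace TB. Om p \<in> {..<1 / (sqrt 2 * K)}}"
    have "openin TB J" unfolding J_def by (rule openin_level) simp
    moreover have "q \<in> J" using q Oq by (simp add: J_def K_def)
    moreover have "Z < rr p" if "p \<in> J" "p \<in> PM" for p
    proof -
      have o: "0 < Om p" "Om p < 1 / (sqrt 2 * K)" using that by (auto simp: J_def PM_def)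
      have K: "0 < K" by (simp add: K_def)
      then have "sqrt 2 * Om p < 1 / K" using o(2) by (simp add: field_simps)
      then have "1 / (1 / K) < 1 / (sqrt 2 * Om p)" using o K by (intro divide_strict_left_mono) auto
      then show ?thesis by (simp add: rr_def K_def)
    qed
    ultimately show "\<forall>\<^sub>F p in atin_within (Top Mbar) q PM. Z < rr p"
      unfolding eventually_atin_within by auto
  qed
  show "limitin (Top Mbar) prj q (atin_within (Top Mbar) q PM)"
    unfolding limitin_def Top_generated
  proof (intro conjI allI impI q(2))
    fix U assume U: "openin TB U \<and> q \<in> U"
    have "openin XN (U \<inter> boundary_points Mbar)" using U openin_subtopology_Int by blast
    then have "openin (subtopology TB PL) {p \<in> topspace (subtopology TB PL). prj p \<in> U \<inter> boundary_points Mbar}"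
      by (rule openin_continuous_map_preimage[OF continuous_prj])
    then have "openin TB {p \<in> topspace (subtopology TB PL). prj p \<in> U \<inter> boundary_points Mbar}"
      using openin_PL openin_trans_full by blast
    moreover have "q \<in> {p \<in> topspace (subtopology TB PL). prj p \<in> U \<inter> boundary_points Mbar}"
      using q U prj_boundary boundary_PL by auto
    ultimately show "\<forall>\<^sub>F p in atin_within TB q PM. prj p \<in> U"
      unfolding eventually_atin_within by blast
  qed
qed

section \<open>Curvature near infinity\<close>

lemma ff_bounds:
  assumes t: "2 < t"
  shows "t\<^sup>2 - 1 \<le> ff t" "ff t \<le> 2 * (t\<^sup>2 - 1)" "t\<^sup>2 / 2 \<le> ff t" "3 < t\<^sup>2 - 1" "0 < kk" "kk \<le> 1 / 2"
proof -
  show k: "0 < kk" by (simp add: kk_def)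
  have "2 \<le> 2 * sqrt (2::real)" using sqrt2_bounds(1) by linarith
  then have "1 / (2 * sqrt 2) \<le> 1 / (2::real)" by (intro divide_left_mono) auto
  then show k2: "kk \<le> 1 / 2" by (simp add: kk_def)
  have "2 * 2 < t * t" using t by (intro mult_strict_mono) auto
  then show t2: "3 < t\<^sup>2 - 1" by (simp add: power2_eq_square)
  define w where "w = kk / t"
  have w: "0 < w" "w \<le> 1" "ff t = t\<^sup>2 - 1 + w"
    using k k2 t by (auto simp: w_def ff_def field_simps)
  show "t\<^sup>2 - 1 \<le> ff t" using w by linarith
  define u where "u = t\<^sup>2 - 1"
  have u: "ff t = u + w" "3 < u" "t\<^sup>2 = u + 1" using w t2 by (auto simp: u_def)
  have "ff t \<le> 2 * u" using u w by linarith
  then show "ff t \<le> 2 * (t\<^sup>2 - 1)" by (simp add: u_def)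
  show "t\<^sup>2 / 2 \<le> ff t" unfolding u(1,3) using u(2) w(1) by (simp add: field_simps)
qed

lemma ff_derivative: "t ~= 0 ==> (ff has_real_derivative 2 * t - kk / t\<^sup>2) (at t)"
  unfolding ff_def[abs_def] by (auto intro!: derivative_eq_intros simp: power2_eq_square)

lemma background_warp: "background h = warp (%t. t\<^sup>2) (%t. 1 / (t\<^sup>2 - 1)) h"
  by (simp add: fun_eq_iff background_def warp_def)

lemma warped_N:
  assumes c: "c \<in> Atlas NN" and e: "\<And>t. 2 < t ==> (e has_real_derivative e1 t) (at t)" "\<And>t. 2 < t ==> e t ~= 0"
  shows "warped (snd c ` fst c) (hb.metric c) {2<..} (%t. t\<^sup>2) (%t. 2 * t) (%t. 2) e e1"
proof
  show "open (snd c ` fst c)" by (rule open_image_N[OF c hb.Atlas_openin[OF c] order_refl])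
  show "C_inf (snd c ` fst c) (hb.metric c)" by (rule C_inf_h[OF c])
  show "det (hb.metric c x) ~= 0" "transpose (hb.metric c x) = hb.metric c x" if "x \<in> snd c ` fst c" for x
    using metric_positive[OF hb.riemannian_metric_metric c that] by auto
qed (auto intro!: derivative_eq_intros e)

text \<open>The background is the Kottler metric with \<open>kk\<close> replaced by
  \<open>0\<close>. Its scalar curvature equals that of the example, so the scalar curvature
  difference in the decay conditions vanishes identically on the end.\<close>

lemma scalar_background:
  assumes c: "c \<in> Atlas NN" and y: "y \<in> snd (ec c) ` fst (ec c)"
  shows "scalar (background (hb.metric c)) y = -6"
proof -
  define e1 where "e1 t = - (2 * t) / (t\<^sup>2 - 1)\<^sup>2" for t :: real
  interpret warped "snd c ` fst c" "hb.metric c" "{2<..}" "%t. t\<^sup>2" "%t. 2 * t" "%t. 2" "%t. 1 / (t\<^sup>2 - 1)" e1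
    by (rule warped_N[OF c]; frule ff_bounds(4))
      (auto intro!: derivative_eq_intros simp: e1_def power2_eq_square)
  obtain q where q: "q \<in> fst c" "hor y = snd c q" and t: "2 < y $ 3" using y image_ec[OF c] by auto
  define t where "t = y $ 3"
  have t2: "0 < t" "t\<^sup>2 - 1 ~= 0" using t ff_bounds(4)[of t] by (auto simp: t_def)
  have "y \<in> R" using q t by (auto simp: R_def)
  from scalar_warp[OF this] hyperbolic_h[OF c q(1)] q(2)
  have "scalar (background (hb.metric c)) y = 2 * (\<psi>1 t + \<eta> t * \<psi> t - 1) / t\<^sup>2
    + 2 * (\<beta> t * \<eta> t - \<beta>1 t - (\<beta> t)\<^sup>2) / (1 / (t\<^sup>2 - 1))"
    by (simp add: background_warp t_def)
  also have "\<psi>1 t = 1 - 3 * t\<^sup>2"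
  proof -
    have "- (2 * (1 / s) - 2 * t * (- (2 * t) / s\<^sup>2)) / (2 * (1 / s) * (1 / s)) = - (s + 2 * t\<^sup>2)" if "s ~= 0" for s
      using that by (simp add: field_simps power2_eq_square)
    from this[OF t2(2)] show ?thesis unfolding \<psi>1_def e1_def by simp
  qed
  also have "\<eta> t = - t / (t\<^sup>2 - 1)"
  proof -
    have "(- (2 * t) / s\<^sup>2) / (2 * (1 / s)) = - t / s" if "s ~= 0" for s
      using that by (simp add: field_simps power2_eq_square)
    from this[OF t2(2)] show ?thesis unfolding \<eta>_def e1_def .
  qed
  also have "\<psi> t = - t * (t\<^sup>2 - 1)" unfolding \<psi>_def by simp
  also have "\<beta> t = 1 / t" using t2 unfolding \<beta>_def by (simp add: power2_eq_square)
  also have "\<beta>1 t = - 1 / t\<^sup>2" using t2 unfolding \<beta>1_def by (simp add: field_simps power2_eq_square)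
  also have "2 * (1 - 3 * t\<^sup>2 + - t / (t\<^sup>2 - 1) * (- t * (t\<^sup>2 - 1)) - 1) / t\<^sup>2 +
      2 * (1 / t * (- t / (t\<^sup>2 - 1)) - - 1 / t\<^sup>2 - (1 / t)\<^sup>2) / (1 / (t\<^sup>2 - 1)) = -6"
  proof -
    have a: "- t / (t\<^sup>2 - 1) * (- t * (t\<^sup>2 - 1)) = t\<^sup>2" using t2 by (simp add: power2_eq_square)
    have b: "1 / t * (- t / (t\<^sup>2 - 1)) - - 1 / t\<^sup>2 - (1 / t)\<^sup>2 = - 1 / (t\<^sup>2 - 1)"
      using t2 by (simp add: power_divide)
    have c: "2 * (1 - 3 * t\<^sup>2 + t\<^sup>2 - 1) / t\<^sup>2 = -4" using t2 by (simp add: field_simps)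
    have d: "2 * (- 1 / s) / (1 / s) = -2" if "s ~= 0" for s :: real using that by simp
    show ?thesis unfolding a b c d[OF t2(2)] by simp
  qed
  finally show ?thesis .
qed

lemma matrix_ident: "matrix (Dat (%x::real ^ 'n::finite. x) x) = mat 1"
  by (simp add: frechet_derivative_ident) (simp add: matrix_id_mat_1[unfolded id_def])

lemma det_hyp: "det (hyp_metric (x :: real ^ 2)) = 1 / (1 + x \<bullet> x)"
proof -
  define n where "n = 1 + x \<bullet> x"
  have n: "n ~= 0" "n = 1 + x $ 1 * x $ 1 + x $ 2 * x $ 2"
    using one_plus_inner_pos[of x] by (auto simp: n_def inner2)
  have "(1 - x $ 1 * x $ 1 / n) * (1 - x $ 2 * x $ 2 / n) - (x $ 1 * x $ 2 / n) * (x $ 2 * x $ 1 / n)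
      = (n - (x $ 1 * x $ 1 + x $ 2 * x $ 2)) / n"
    using n(1) by (simp add: field_simps)
  also have "\<dots> = 1 / n" by (simp add: n(2))
  finally show ?thesis by (simp add: det_2 hyp_metric_def n_def)
qed

lemma det_hyp_bounds: "0 < det (hyp_metric (x :: real ^ 2))" "det (hyp_metric (x :: real ^ 2)) \<le> 1"
  unfolding det_hyp using one_plus_inner_pos[of x] by (auto simp: field_simps)

lemma det_pull: "det (pull J G) = (det J)\<^sup>2 * det G"
  by (simp add: pull_def det_mul det_transpose power2_eq_square)

lemma det_h:
  assumes c: "c \<in> Atlas NN" and q: "q \<in> fst c"
  shows "0 < det (hb.metric c (snd c q))"
proof -
  have "q \<in> topspace XN" using is_chart_subset[OF hb.Atlas_chart[OF c]] q by auto
  then obtain b where b: "b \<in> NB" "q \<in> fst b" by (rule hb.obtain_base)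
  obtain D where D: "(transition c b has_derivative D) (at (snd c q) within snd c ` (fst c \<inter> fst b))"
    using transition_has_derivative[OF hb.Atlas_compatible[OF c hb.base_in_Atlas[OF b(1)]], of q] q b by blast
  have "det (hb.metric c (snd c q)) ~= 0"
    by (rule metric_positive(3)[OF hb.riemannian_metric_metric c]) (use q in auto)
  then show ?thesis
    unfolding hb.metric_pull[OF c q b D] det_pull using det_hyp_bounds(1) by (simp add: zero_less_mult_iff)
qed

text \<open>The gradient of the potential is radial, so only the radial component of the trace-free
  Ricci tensor contributes, and it equals \<open>kk / t ^ 3\<close>. The powers of \<open>t\<close>
  from the gradient and the volume density cancel this decay, leaving \<open>kk\<close> times a
  factor that tends to \<open>1\<close>.\<close>

lemma mass_density_ec:
  assumes c: "c \<in> Atlas NN" and q: "q \<in> fst c" and t: "2 < t"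
  shows "mass_density (gint (ec c)) (lift (snd c q) t) / sqrt (det (hb.metric c (snd c q))) = kk * sqrt (ff t / (t\<^sup>2 - 1))"
proof -
  note fb = ff_bounds[OF t]
  have f0: "0 < ff t" using fb by linarith
  define e1 where "e1 t = - (2 * t - kk / t\<^sup>2) / (ff t)\<^sup>2" for t :: real
  have fpos: "0 < ff t" if "2 < t" for t using ff_bounds(1,4)[OF that] by linarith
  interpret warped "snd c ` fst c" "hb.metric c" "{2<..}" "%t. t\<^sup>2" "%t. 2 * t" "%t. 2" "%t. 1 / ff t" e1
  proof (rule warped_N[OF c])
    fix t :: real assume t: "2 < t"
    show "1 / ff t ~= 0" using fpos[OF t] by simp
    show "((%t. 1 / ff t) has_real_derivative e1 t) (at t)"
      using DERIV_divide[OF DERIV_const[of 1] ff_derivative] fpos[OF t] t by (simp add: e1_def power2_eq_square)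
  qed
  define y where "y = lift (snd c q) t"
  define A where "A = snd (ec c) ` fst (ec c)"
  have A: "A = R" unfolding A_def image_ec[OF c] by (auto simp: R_def)
  have yR: "y \<in> R" using q t by (simp add: R_def y_def)
  have GG: "gint (ec c) z = G z" if "z \<in> R" for z using that gint_ec[OF c] unfolding A[symmetric] A_def by auto
  have pos: "transpose (G z) = G z" "det (G z) ~= 0" if "z \<in> R" for z
    using metric_positive[OF metric_gint ec_Atlas[OF c], of z] GG[OF that] that unfolding A[symmetric] A_def by auto
  have CG: "C_inf R G"
  proof (rule C_inf_warp[OF R])
    show "C_inf R (%y. (y $ 3)\<^sup>2)" by (intro C_inf_power C_inf_nth C_inf_id R)
    have "ff (y $ 3) ~= 0" "y $ 3 ~= 0" if "y \<in> R" for y using that fpos[of "y $ 3"] by (auto simp: R_def)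
    then show "C_inf R (%y. 1 / ff (y $ 3))" unfolding ff_def
      by (intro C_inf_divide C_inf_add C_inf_diff C_inf_power C_inf_const C_inf_nth C_inf_id R) auto
    show "C_inf R (%y. hb.metric c (hor y))"
      by (rule C_inf_compose[OF R S _ C_inf_linear[OF R linear_hor] h(1)]) (auto simp: R_def)
  qed
  \<comment> \<open>The components agree with \<open>G\<close> on the open set \<open>R\<close>
    only, while curvature is formed by differentiating total functions. The identity as a change of
    coordinates transfers the Ricci tensor.\<close>
  interpret cc: coordinate_change R R "%x. x" G "gint (ec c)"
  proof
    show "gint (ec c) x = pull (matrix (Dat (%x. x) x)) (G x)" if "x \<in> R" for x
      unfolding matrix_ident GG[OF that] by (simp add: pull_def matrix_mul_lid matrix_mul_rid)
      show "det (matrix (Dat (%x::real ^ 3. x) x)) ~= 0" for x unfolding matrix_ident by simp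
  qed (use R CG pos in "auto simp: C_inf_id")
  have "(\<chi> i j. ricci (gint (ec c)) i j y) = (\<chi> i j. ricci G i j y)"
    using cc.ricci_transform[OF yR] unfolding cc.J_def matrix_ident by (simp add: pull_def matrix_mul_lid matrix_mul_rid)
  then have ric: "ricci (gint (ec c)) i j y = ricci G i j y" for i j by (simp add: vec_eq_iff)
  have sc: "scalar (gint (ec c)) y = -6"
  proof -
    have "y \<in> A" using yR A by simp
    then obtain p where "p \<in> fst (ec c)" "y = snd (ec c) p" by (auto simp: A_def)
    then show ?thesis using scalar_gint[OF ec_Atlas[OF c]] by simp
  qed
  have t3: "y $ 3 = t" "hor y = snd c q" by (simp_all add: y_def)
  have s0: "0 < t\<^sup>2 - 1" using fb by linarith
  have V: "((%t. sqrt (t\<^sup>2 - 1)) has_real_derivative t / sqrt (t\<^sup>2 - 1)) (at (y $ 3))"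
    unfolding t3 using s0 by (auto intro!: derivative_eq_intros simp: field_simps)
  have pV: "partial (up i) static_potential y = 0" "partial 3 static_potential y = t / sqrt (t\<^sup>2 - 1)" for i
    using partial_vertical[OF V] by (simp_all add: static_potential_def[abs_def])
  have r33: "ff t * ricci G 3 3 y = - 2 + kk / t ^ 3"
  proof -
    have "\<beta> t = 1 / t" "\<eta> t = - (2 * t - kk / t\<^sup>2) / (2 * ff t)" "\<beta>1 t = - 1 / t\<^sup>2"
      using t f0 unfolding \<beta>_def \<eta>_def \<beta>1_def e1_def by (simp_all add: field_simps power2_eq_square)
    then have "ricci G 3 3 y = 2 * (1 / t * (- (2 * t - kk / t\<^sup>2) / (2 * ff t)))"
      unfolding ricci_33[OF yR] t3 by (simp add: power_divide)
    moreover have "f * (2 * (1 / t * (- a / (2 * f)))) = - a / t" if "f ~= 0" for f a using that by simp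
    ultimately have "ff t * ricci G 3 3 y = - (2 * t - kk / t\<^sup>2) / t" using f0 by (metis less_irrefl)
    also have "\<dots> = - 2 + kk / t ^ 3" using t by (simp add: field_simps power2_eq_square power3_eq_cube)
    finally show ?thesis .
  qed
  have i3: "matrix_inv (G y) $ 3 $ 3 = ff t" using inv_G(4)[OF yR] by (simp add: t3)
  have dh: "0 < det (hb.metric c (snd c q))" by (rule det_h[OF c q])
  have "mass_density (gint (ec c)) y = ff t * (t / sqrt (t\<^sup>2 - 1)) * (ff t * ricci G 3 3 y + 2) * sqrt (det (G y))"
    unfolding mass_density_def GG[OF yR] ric sc
    by (simp add: sum_up[of "%j. _ j * _ j"] sum_up pV inv_G(2,3)[OF yR] i3)
  also have "\<dots> = ff t * (t / sqrt (t\<^sup>2 - 1)) * (kk / t ^ 3) * (t\<^sup>2 / sqrt (ff t) * sqrt (det (hb.metric c (snd c q))))"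
  proof -
    have "sqrt (det (G y)) = t\<^sup>2 / sqrt (ff t) * sqrt (det (hb.metric c (snd c q)))"
      unfolding det_warp t3 by (simp only: real_sqrt_mult real_sqrt_divide real_sqrt_abs abs_power2 real_sqrt_one) simp
    then show ?thesis unfolding r33 by simp
  qed
  finally have "mass_density (gint (ec c)) y / sqrt (det (hb.metric c (snd c q))) =
      ff t * (t / sqrt (t\<^sup>2 - 1)) * (kk / t ^ 3) * (t\<^sup>2 / sqrt (ff t))" using dh by simp
  also have "\<dots> = kk * (ff t / sqrt (ff t)) / sqrt (t\<^sup>2 - 1)"
    using t by (simp add: field_simps power2_eq_square power3_eq_cube)
  also have "ff t / sqrt (ff t) = sqrt (ff t)" using f0 by (simp add: real_div_sqrt)
  finally show ?thesis unfolding y_def by (simp add: real_sqrt_divide)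
qed

section \<open>Measures\<close>

text \<open>The ten base charts are numbered by \<open>k < 10\<close>: \<open>k div 2\<close> is the
  corner, and the parity of \<open>k\<close> selects the copy \<open>ee\<close>.\<close>

definition sg :: "nat => real" where "sg k = (if even k then 1 else -1)"

lemma sg: "sg k = 1 \<or> sg k = -1"
  by (simp add: sg_def)

lemma index_10:
  assumes "i < 5" "pm ee"
  obtains k where "k < 10" "k div 2 = i" "sg k = ee"
  using assms that[of "2 * i"] that[of "Suc (2 * i)"] by (auto simp: sg_def)

lemma BB_index:
  assumes "b \<in> BB"
  obtains k where "k < 10" "b = bc (k div 2) (sg k)"
  using assms index_10 unfolding BB_def by (smt (verit, best) mem_Collect_eq)

lemma index_5: "k < 10 ==> k div 2 < (5::nat)"
  by simp

global_interpretation mM: measured_manifold Mint gint "%k. rb (bc (k div 2) (sg k)) PM" 10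
proof
  show "is_chart UNIV (Top Mint) c" if "c \<in> Atlas Mint" for c by (rule chart_Mint[OF that])
  show "compatible c d" if "c \<in> Atlas Mint" "d \<in> Atlas Mint" for c d
    by (rule smooth_manifold_compatible[OF manifold_Mint that])
  show "riemannian_metric Mint gint" by (rule metric_gint)
  show "rb (bc (k div 2) (sg k)) PM \<in> Atlas Mint" if "k < 10" for k
    by (rule rb_Mint[OF bc_BB[OF index_5[OF that] sg] openin_PM order_refl])
  show "Points Mint \<subseteq> (\<Union>k<10. fst (rb (bc (k div 2) (sg k)) PM))"
  proof
    fix p assume "p \<in> Points Mint"
    then have p: "p \<in> PM" "p \<in> topspace TB" by (auto simp: Points_Mint PM_def)
    then obtain b where b: "b \<in> BB" "p \<in> fst b" using obtain_BB by blast
    then show "p \<in> (\<Union>k<10. fst (rb (bc (k div 2) (sg k)) PM))"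
      using p by (elim BB_index) (auto simp: rb_def)
  qed
qed

global_interpretation mN: measured_manifold NN hb.metric "%k. bd (k div 2) (sg k)" 10
proof
  show "is_chart UNIV (Top NN) c" if "c \<in> Atlas NN" for c using hb.Atlas_chart[OF that] by simp
  show "compatible c d" if "c \<in> Atlas NN" "d \<in> Atlas NN" for c d
    by (rule hb.Atlas_compatible[OF that])
  show "riemannian_metric NN hb.metric" by (rule hb.riemannian_metric_metric)
  show "bd (k div 2) (sg k) \<in> Atlas NN" if "k < 10" for k
    by (rule bd_Atlas(2)[OF index_5[OF that] sg])
  show "Points NN \<subseteq> (\<Union>k<10. fst (bd (k div 2) (sg k)))"
  proof
    fix p assume "p \<in> Points NN"
    then have "p \<in> topspace XN" by simp
    then obtain b where b: "b \<in> NB" "p \<in> fst b" by (rule hb.obtain_base)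
    then obtain b0 where b0: "b0 \<in> BB" "b = boundary_chart Mbar b0" by blast
    then show "p \<in> (\<Union>k<10. fst (bd (k div 2) (sg k)))"
      using b by (elim BB_index) auto
  qed
qed

lemma image_bd: "i < 5 ==> pm ee ==> snd (bd i ee) ` fst (bd i ee) = img i"
  unfolding boundary_chart_image[OF bar.smooth_manifold_generated bar.base_in_Atlas[OF bc_BB]] image_bc
  by (simp add: slab_def)

lemma hyp_bd:
  assumes i: "i < 5" "pm ee" and x: "x \<in> img i"
  shows "hb.metric (bd i ee) x = hyp_metric x"
proof -
  obtain q where "q \<in> fst (bd i ee)" "x = snd (bd i ee) q" using x image_bd[OF i] by blast
  then show ?thesis using hb.metric_base[OF bd_Atlas(1)[OF i]] by simp
qed

section \<open>Decay towards the background\<close>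

text \<open>The deviation \<open>(t\<^sup>2 - 1) / ff t - 1\<close> of the radial frame component,
  the only one that differs from the background, cleared of inner fractions.\<close>

definition uu :: "real => real" where "uu t = - kk / (t ^ 3 - t + kk)"

definition uu1 :: "real => real" where "uu1 t = kk * (3 * t\<^sup>2 - 1) / (t ^ 3 - t + kk)\<^sup>2"

lemma uu_facts:
  assumes t: "2 < t"
  shows "(t\<^sup>2 - 1) / ff t = 1 + uu t" "(uu has_real_derivative uu1 t) (at t)"
    "\<bar>uu t\<bar> \<le> 1 / t ^ 3" "\<bar>uu1 t * sqrt (t\<^sup>2 - 1)\<bar> \<le> 6 / t ^ 3"
proof -
  note fb = ff_bounds[OF t]
  define d where "d = t ^ 3 - t + kk"
  have t3: "0 < t ^ 3" using t by simp
  have "4 * t \<le> t\<^sup>2 * t" using fb(4) t by (intro mult_right_mono) auto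
  moreover have "t\<^sup>2 * t = t ^ 3" by (simp add: power2_eq_square power3_eq_cube)
  ultimately have d2: "t ^ 3 / 2 \<le> d" using fb(5) t by (simp add: d_def)
  then have d: "0 < d" using t3 by linarith
  have f: "ff t = d / t" using t by (simp add: ff_def d_def field_simps power2_eq_square power3_eq_cube)
  have n: "(t\<^sup>2 - 1) * t = d - kk" by (simp add: d_def algebra_simps power2_eq_square power3_eq_cube)
  have "(t\<^sup>2 - 1) / ff t = (d - kk) / d" unfolding f n[symmetric] by simp
  also have "\<dots> = 1 + uu t" using d unfolding uu_def d_def[symmetric] by (simp add: diff_divide_distrib)
  finally show "(t\<^sup>2 - 1) / ff t = 1 + uu t" .
  have "((%t. t ^ 3 - t + kk) has_real_derivative 3 * t\<^sup>2 - 1) (at t)"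
    by (auto intro!: derivative_eq_intros)
  from DERIV_divide[OF DERIV_const[of "- kk"] this]
  have "(uu has_real_derivative (0 * (t ^ 3 - t + kk) - (- kk) * (3 * t\<^sup>2 - 1)) / ((t ^ 3 - t + kk) * (t ^ 3 - t + kk))) (at t)"
    using d unfolding uu_def[abs_def] d_def by auto
  moreover have "(0 * (t ^ 3 - t + kk) - (- kk) * (3 * t\<^sup>2 - 1)) / ((t ^ 3 - t + kk) * (t ^ 3 - t + kk)) = uu1 t"
    unfolding uu1_def power2_eq_square[of "t ^ 3 - t + kk"] by simp
  ultimately show "(uu has_real_derivative uu1 t) (at t)" by metis
  have "kk / d \<le> (1 / 2) / (t ^ 3 / 2)" using fb(5,6) d2 t3 by (intro frac_le) auto
  then show "\<bar>uu t\<bar> \<le> 1 / t ^ 3" using d fb(5) by (simp add: uu_def d_def[symmetric])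
  have u1: "0 \<le> uu1 t" using fb(4,5) unfolding uu1_def by (intro divide_nonneg_nonneg mult_nonneg_nonneg) auto
  have "kk * (3 * t\<^sup>2 - 1) \<le> (1 / 2) * (3 * t\<^sup>2)" using fb(4,5,6) by (intro mult_mono) auto
  moreover have "(t ^ 3 / 2)\<^sup>2 \<le> d\<^sup>2" using d2 t3 by (intro power_mono) auto
  ultimately have "uu1 t \<le> ((1 / 2) * (3 * t\<^sup>2)) / (t ^ 3 / 2)\<^sup>2"
    unfolding uu1_def d_def[symmetric] using t3 fb(4,5) by (intro frac_le) auto
  also have "\<dots> = 6 / t ^ 4" using t by (simp add: field_simps eval_nat_numeral)
  finally have u2: "uu1 t \<le> 6 / t ^ 4" .
  have "sqrt (t\<^sup>2 - 1) \<le> sqrt (t\<^sup>2)" by (intro real_sqrt_le_mono) simp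
  then have s: "sqrt (t\<^sup>2 - 1) \<le> t" "0 \<le> sqrt (t\<^sup>2 - 1)" using t fb(4) by auto
  have "uu1 t * sqrt (t\<^sup>2 - 1) \<le> 6 / t ^ 4 * t" using u1 u2 s t by (intro mult_mono) auto
  also have "\<dots> = 6 / t ^ 3" using t by (simp add: field_simps eval_nat_numeral)
  finally show "\<bar>uu1 t * sqrt (t\<^sup>2 - 1)\<bar> \<le> 6 / t ^ 3" using u1 s by simp
qed

text \<open>The inverse square root of the hyperbolic metric provides an orthonormal frame.\<close>

definition fr :: "2 => real ^ 2 => real ^ 2" where
  "fr a x = axis a 1 + (x $ a / (1 + sqrt (1 + x \<bullet> x))) *\<^sub>R x"

lemma fr_orthonormal: "bilin (hyp_metric x) (fr a x) (fr b x) = (if a = b then 1 else 0)"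
proof -
  define s where "s = sqrt (1 + x \<bullet> x)"
  have s: "0 < s" "x \<bullet> x = s * s - 1" using one_plus_inner_pos[of x] by (auto simp: s_def)
  then have s1: "1 + s ~= 0" by simp
  have xf: "x \<bullet> fr c x = x $ c * s" for c
  proof -
    have "x \<bullet> fr c x = x $ c + x $ c / (1 + s) * (s * s - 1)"
      unfolding fr_def s_def[symmetric] s(2)[symmetric] by (simp add: inner_add_right inner_axis)
    also have "\<dots> = x $ c * s" using s1 by (simp add: field_simps)
    finally show ?thesis .
  qed
  have "fr a x \<bullet> fr b x = (if a = b then 1 else 0) + (2 * (x $ a * x $ b) / (1 + s)
      + x $ a * x $ b / ((1 + s) * (1 + s)) * (x \<bullet> x))"
  proof -
    have g: "(u + \<alpha> *\<^sub>R x) \<bullet> (v + \<beta> *\<^sub>R x) = u \<bullet> v + (\<beta> * (u \<bullet> x) + \<alpha> * (x \<bullet> v) + \<alpha> * \<beta> * (x \<bullet> x))" for u v \<alpha> \<beta>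
      by (simp add: inner_add_left inner_add_right algebra_simps)
    have "axis a 1 \<bullet> (axis b 1 :: real ^ 2) = (if a = b then 1 else 0)" "axis a 1 \<bullet> x = x $ a" "x \<bullet> axis b 1 = x $ b"
      by (auto simp: inner_axis inner_axis') (auto simp: axis_def)
    then show ?thesis unfolding fr_def s_def[symmetric] g by (simp add: mult.commute)
  qed
  also have "2 * (x $ a * x $ b) / (1 + s) + x $ a * x $ b / ((1 + s) * (1 + s)) * (x \<bullet> x) = x $ a * x $ b"
  proof -
    have "2 * m / k + m / (k * k) * ((k - 2) * k) = m" if "k ~= 0" for m k :: real
      using that by (simp add: field_simps)
    from this[OF s1, of "x $ a * x $ b"] show ?thesis unfolding s(2) by (simp add: algebra_simps)
  qed
  finally show ?thesis using s(1) by (simp add: bilin_hyp_metric xf s(2))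
qed

lemma C_inf_fr: "C_inf UNIV (fr a)"
proof -
  have p: "0 < 1 + x \<bullet> x" "1 + sqrt (1 + x \<bullet> x) ~= 0" for x :: "real ^ 2"
    using one_plus_inner_pos[of x] real_sqrt_gt_zero[OF one_plus_inner_pos[of x]] by linarith+
  show ?thesis unfolding fr_def[abs_def]
    by (intro C_inf_add C_inf_scaleR C_inf_divide C_inf_nth C_inf_const C_inf_id C_inf_sqrt C_inf_inner_self open_UNIV p)
qed

lemma hor_scaleR: "hor (a *\<^sub>R v) = a *\<^sub>R hor v"
  by (simp add: vec_eq_iff)

lemma frame_up: "frame (fr 1) (fr 2) (up a) z = (1 / z $ 3) *\<^sub>R lift (fr a (hor z)) 0"
  using exhaust_2[of a] by (auto simp: frame_def)

lemma frame_3: "frame ee1 ee2 3 z = lift 0 (sqrt ((z $ 3)\<^sup>2 - 1))"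
  by (simp add: frame_def)

lemma bilin_zero [simp]: "bilin G 0 v = 0" "bilin G u 0 = 0"
  by (simp_all add: bilin_inner)

lemma bilin_scaleR_args: "bilin G (a *\<^sub>R u) (b *\<^sub>R v) = a * b * bilin G u v"
  by (simp add: bilin_inner matrix_vector_mult_scaleR)

lemma frame_components:
  assumes z: "2 < z $ 3"
  shows "bilin (wend hyp_metric z) (frame (fr 1) (fr 2) i z) (frame (fr 1) (fr 2) j z) =
    (if i = 3 \<and> j = 3 then 1 + uu (z $ 3) else if i = j then 1 else 0)"
proof (cases i rule: cases_up; cases j rule: cases_up)
  fix a b assume "i = up a" "j = up b"
  then show ?thesis using z
    by (simp add: bilin_warp frame_up hor_scaleR bilin_scaleR_args fr_orthonormal power2_eq_square del: hor_up)
next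
  fix a assume "i = up a" "j = 3"
  then show ?thesis by (simp add: bilin_warp frame_up frame_3 hor_scaleR del: hor_up)
next
  fix b assume "i = 3" "j = up b"
  then show ?thesis by (simp add: bilin_warp frame_up frame_3 hor_scaleR del: hor_up)
next
  assume "i = 3" "j = 3"
  moreover have "0 \<le> (z $ 3)\<^sup>2 - 1" using ff_bounds(4)[OF z] by linarith
  ultimately show ?thesis using uu_facts(1)[OF z]
    by (simp add: bilin_warp frame_3 del: hor_up)
qed

text \<open>In this frame the surface components match the background exactly. The radial one
  depends on \<open>r\<close> alone, so one value and one derivative survive in the sums.\<close>

lemma deviation_end:
  assumes R: "open R" "\<And>z. z \<in> R ==> 2 < z $ 3 \<and> G z = wend hyp_metric z" and y: "y \<in> R" and \<phi>: "\<phi> 0 = 0"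
  shows "deviation \<phi> G (fr 1) (fr 2) y = \<phi> (uu (y $ 3)) + \<phi> (uu1 (y $ 3) * sqrt ((y $ 3)\<^sup>2 - 1))"
proof -
  define gf where "gf = (%i j z. bilin (G z) (frame (fr 1) (fr 2) i z) (frame (fr 1) (fr 2) j z))"
  have e: "gf i j z = (if i = 3 \<and> j = 3 then 1 + uu (z $ 3) else if i = j then 1 else 0)" if "z \<in> R" for i j z
    unfolding gf_def using R(2)[OF that] frame_components by simp
  have t: "2 < y $ 3" using R(2)[OF y] by simp
  have "((%z. uu (z $ 3)) has_derivative (%v. uu1 (y $ 3) * v $ 3)) (at y)"
    by (rule has_derivative_compose[OF bounded_linear_imp_has_derivative[OF bounded_linear_vec_nth]
      uu_facts(2)[OF t, unfolded has_field_derivative_def]])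
  then have d: "((%z. 1 + uu (z $ 3)) has_derivative (%v. uu1 (y $ 3) * v $ 3)) (at y)"
    by (auto intro!: derivative_eq_intros)
  have "(gf i j has_derivative (%v. if i = 3 \<and> j = 3 then uu1 (y $ 3) * v $ 3 else 0)) (at y)" for i j
  proof (rule has_derivative_transform_within_open[OF _ R(1) y e[symmetric]])
    show "((%z. if i = 3 \<and> j = 3 then 1 + uu (z $ 3) else if i = j then 1 else 0) has_derivative
        (%v. if i = 3 \<and> j = 3 then uu1 (y $ 3) * v $ 3 else 0)) (at y)"
      using d by (cases "i = 3 \<and> j = 3") auto
  qed
  then have fd: "Dat (gf i j) y = (%v. if i = 3 \<and> j = 3 then uu1 (y $ 3) * v $ 3 else 0)" for i j
    by (rule frechet_derivative_at[symmetric])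
  have fr3: "frame (fr 1) (fr 2) k y $ 3 = (if k = 3 then sqrt ((y $ 3)\<^sup>2 - 1) else 0)" for k
    by (rule cases_up[of k]) (auto simp: frame_up frame_3)
  have "deviation \<phi> G (fr 1) (fr 2) y = (\<Sum>i\<in>UNIV. \<Sum>j\<in>UNIV. \<phi> (gf i j y - (if i = j then 1 else 0))) +
       (\<Sum>i\<in>UNIV. \<Sum>j\<in>UNIV. \<Sum>k\<in>UNIV. \<phi> (Dat (gf i j) y (frame (fr 1) (fr 2) k y)))"
    by (simp only: deviation_def Let_def gf_def)
  also have "\<dots> = \<phi> (uu (y $ 3)) + \<phi> (uu1 (y $ 3) * sqrt ((y $ 3)\<^sup>2 - 1))"
    unfolding fd fr3 e[OF y] by (simp add: sum_3 \<phi>)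
  finally show ?thesis .
qed

text \<open>Layers of unit thickness over a square have bounded volume, so the integral is dominated
  by a multiple of the series of inverse squares.\<close>

lemma finite_layers:
  assumes K: "0 \<le> K"
  shows "(\<integral>\<^sup>+x. ennreal (K / (x $ 3)\<^sup>2) * indicator {x::real ^ 3. \<bar>x $ 1\<bar> \<le> C \<and> \<bar>x $ 2\<bar> \<le> C \<and> 1 \<le> x $ 3} x \<partial>lborel) < \<infinity>"
proof -
  define Bx where "Bx n = cbox (vector [- C, - C, real n + 1]) (vector [C, C, real n + 2] :: real ^ 3)" for n
  define W where "W = ennreal \<bar>\<Prod>b\<in>Basis. (vector [2 * C, 2 * C, 1] :: real ^ 3) \<bullet> b\<bar>"
  have mem: "x \<in> Bx n \<longleftrightarrow> \<bar>x $ 1\<bar> \<le> C \<and> \<bar>x $ 2\<bar> \<le> C \<and> real n + 1 \<le> x $ 3 \<and> x $ 3 \<le> real n + 2" for x n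
    by (auto simp: Bx_def mem_box_cart forall_3)
  have diff: "vector [C, C, real n + 2] - vector [- C, - C, real n + 1] = (vector [2 * C, 2 * C, 1] :: real ^ 3)" for n
    by (simp add: vec_eq_iff forall_3)
  have W: "emeasure lborel (Bx n) \<le> W" for n
    unfolding Bx_def emeasure_lborel_cbox_eq diff W_def by (auto intro!: ennreal_leI)
  have "ennreal (K / (x $ 3)\<^sup>2) * indicator {x. \<bar>x $ 1\<bar> \<le> C \<and> \<bar>x $ 2\<bar> \<le> C \<and> 1 \<le> x $ 3} x
      \<le> (\<Sum>n. ennreal (K / (real n + 1)\<^sup>2) * indicator (Bx n) x)" for x :: "real ^ 3"
  proof (cases "\<bar>x $ 1\<bar> \<le> C \<and> \<bar>x $ 2\<bar> \<le> C \<and> 1 \<le> x $ 3")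
    case True
    \<comment> \<open>The layers start at height \<open>1\<close>, hence the shift before rounding
      down.\<close>
    define n where "n = nat \<lfloor>x $ 3 - 1\<rfloor>"
    have n: "real n \<le> x $ 3 - 1" "x $ 3 - 1 \<le> real n + 1" using True unfolding n_def by linarith+
    have "K / (x $ 3)\<^sup>2 \<le> K / (real n + 1)\<^sup>2" using n K by (intro divide_left_mono power_mono) auto
    then have "ennreal (K / (x $ 3)\<^sup>2) \<le> ennreal (K / (real n + 1)\<^sup>2) * indicator (Bx n) x"
      using True n by (auto simp: mem intro!: ennreal_leI)
    also have "\<dots> \<le> (\<Sum>n. ennreal (K / (real n + 1)\<^sup>2) * indicator (Bx n) x)"
    proof -
      define f where "f n = ennreal (K / (real n + 1)\<^sup>2) * indicator (Bx n) x" for n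
      have "f n \<le> suminf f" using sum_le_suminf[of f "{n}"] by simp
      then show ?thesis unfolding f_def .
    qed
    finally show ?thesis using True by simp
  next
    case False
    then show ?thesis by simp
  qed
  then have "(\<integral>\<^sup>+x. ennreal (K / (x $ 3)\<^sup>2) * indicator {x::real ^ 3. \<bar>x $ 1\<bar> \<le> C \<and> \<bar>x $ 2\<bar> \<le> C \<and> 1 \<le> x $ 3} x \<partial>lborel)
      \<le> (\<integral>\<^sup>+x. (\<Sum>n. ennreal (K / (real n + 1)\<^sup>2) * indicator (Bx n) x) \<partial>lborel)"
    by (intro nn_integral_mono)
  also have "\<dots> = (\<Sum>n. \<integral>\<^sup>+x. ennreal (K / (real n + 1)\<^sup>2) * indicator (Bx n) x \<partial>lborel)"
    by (rule nn_integral_suminf) (auto simp: Bx_def)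
  also have "\<dots> = (\<Sum>n. ennreal (K / (real n + 1)\<^sup>2) * emeasure lborel (Bx n))"
    by (subst nn_integral_cmult_indicator) (auto simp: Bx_def)
  also have "\<dots> \<le> (\<Sum>n. ennreal (K / (real n + 1)\<^sup>2) * W)"
    by (intro suminf_le mult_left_mono W) auto
  also have "\<dots> = (\<Sum>n. ennreal (K / (real n + 1)\<^sup>2)) * W" by simp
  also have "\<dots> < \<infinity>"
  proof -
    have "summable (%n. inverse (real (Suc n) ^ 2))"
      using inverse_power_summable[of 2, where 'a=real] by (subst summable_Suc_iff) simp
    then have "summable (%n. K * inverse (real (Suc n) ^ 2))" by (rule summable_mult)
    then have "summable (%n. K / (real n + 1)\<^sup>2)" by (simp add: divide_inverse add.commute)
    then have "(\<Sum>n. ennreal (K / (real n + 1)\<^sup>2)) ~= top" by (rule ennreal_suminf_neq_top) (use K in simp)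
    then show ?thesis by (simp add: W_def ennreal_mult_less_top less_top)
  qed
  finally show ?thesis .
qed

lemma R_bd:
  assumes i: "i < 5" "pm ee"
  defines "R \<equiv> snd (ec (bd i ee)) ` fst (ec (bd i ee))"
  shows "R = {y. hor y \<in> img i \<and> 2 < y $ 3}" "open R"
    "z \<in> R ==> 2 < z $ 3 \<and> gint (ec (bd i ee)) z = wend hyp_metric z"
proof -
  note c = bd_Atlas(2)[OF i]
  show R: "R = {y. hor y \<in> img i \<and> 2 < y $ 3}" unfolding R_def image_ec[OF c] image_bd[OF i] ..
  show "open R" unfolding R_def by (rule mM.open_image[OF ec_Atlas[OF c]])
  assume z: "z \<in> R"
  then obtain p where "p \<in> fst (ec (bd i ee))" "z = snd (ec (bd i ee)) p" by (auto simp: R_def)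
  then have "gint (ec (bd i ee)) z = wend (hb.metric (bd i ee)) z" using gint_ec[OF c] by simp
  moreover have "hb.metric (bd i ee) (hor z) = hyp_metric (hor z)" using z hyp_bd[OF i] by (simp add: R del: hor_up)
  ultimately show "2 < z $ 3 \<and> gint (ec (bd i ee)) z = wend hyp_metric z"
    using z by (simp add: R warp_def del: hor_up)
qed

text \<open>The volume density is at most \<open>2 * t\<close> and the squared deviation at most
  \<open>37 / t ^ 6\<close>, where \<open>37 = 1 + 36\<close> collects the squared bounds of
  \<open>uu_facts\<close>. With the weight \<open>t\<close> this is far below
  \<open>74 / t\<^sup>2\<close>, the form accepted by \<open>finite_layers\<close>.\<close>

lemma integral_end:
  assumes i: "i < 5" "pm ee"
  shows "(\<integral>\<^sup>+p\<in>fst (ec (bd i ee)). ennreal (((uu (rr p))\<^sup>2 + (uu1 (rr p) * sqrt ((rr p)\<^sup>2 - 1))\<^sup>2) * rr p)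
    \<partial>riemannian_measure Mint gint) < \<infinity>"
proof -
  let ?d = "ec (bd i ee)"
  note c = bd_Atlas(2)[OF i] and R = R_bd[OF i]
  define \<phi> where "\<phi> x = ennreal (((uu (x $ 3))\<^sup>2 + (uu1 (x $ 3) * sqrt ((x $ 3)\<^sup>2 - 1))\<^sup>2) * x $ 3)" for x :: "real ^ 3"
  have [measurable]: "(%x::real ^ 3. x $ 3) \<in> borel_measurable borel"
    by (intro borel_measurable_continuous_onI continuous_intros)
  have "\<phi> \<in> borel_measurable borel" unfolding \<phi>_def[abs_def] uu_def uu1_def by measurable
  from mM.riemannian_nn_integral[OF ec_Atlas[OF c] this]
  have I: "(\<integral>\<^sup>+p\<in>fst ?d. \<phi> (snd ?d p) \<partial>riemannian_measure Mint gint) = (\<integral>\<^sup>+x. ennreal (mM.dens ?d x) * \<phi> x \<partial>lborel)" .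
  obtain C where C: "\<And>x c. x \<in> img i ==> \<bar>x $ c\<bar> \<le> C" using bounded_img[OF i(1)] by blast
  have "ennreal (mM.dens ?d x) * \<phi> x \<le> ennreal (74 / (x $ 3)\<^sup>2) * indicator {x. \<bar>x $ 1\<bar> \<le> C \<and> \<bar>x $ 2\<bar> \<le> C \<and> 1 \<le> x $ 3} x" for x
  proof (cases "x \<in> snd ?d ` fst ?d")
    case False
    then show ?thesis by (simp add: mM.dens_def)
  next
    case True
    define t where "t = x $ 3"
    have t: "2 < t" and h: "hor x \<in> img i" using True R(1) by (auto simp: t_def simp del: hor_up)
    note fb = ff_bounds[OF t] and uf = uu_facts[OF t]
    have "0 < t\<^sup>2 / 2" using t by simp
    then have f0: "0 < ff t" using fb(3) by linarith
    have "det (gint ?d x) = (t\<^sup>2)\<^sup>2 * (1 / ff t) * det (hyp_metric (hor x))"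
      using R(3)[OF True] by (simp add: det_warp t_def)
    also have "\<dots> \<le> (t\<^sup>2)\<^sup>2 * (1 / (t\<^sup>2 / 2)) * 1"
      using fb(3) f0 t det_hyp_bounds[of "hor x"] by (intro mult_mono divide_left_mono) auto
    also have "\<dots> \<le> (2 * t)\<^sup>2" using t by (simp add: power2_eq_square field_simps)
    finally have "sqrt (det (gint ?d x)) \<le> 2 * t" using t by (intro real_le_lsqrt) auto
    then have d: "0 \<le> mM.dens ?d x" "mM.dens ?d x \<le> 2 * t" using True t by (auto simp: mM.dens_def)
    have "(uu t)\<^sup>2 \<le> (1 / t ^ 3)\<^sup>2" "(uu1 t * sqrt (t\<^sup>2 - 1))\<^sup>2 \<le> (6 / t ^ 3)\<^sup>2"
      using uf(3,4) t by (simp_all only: abs_le_square_iff[symmetric])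
    then have s: "(uu t)\<^sup>2 + (uu1 t * sqrt (t\<^sup>2 - 1))\<^sup>2 \<le> 37 / t ^ 6"
      by (simp add: power_divide power_mult[symmetric])
    have "mM.dens ?d x * (((uu t)\<^sup>2 + (uu1 t * sqrt (t\<^sup>2 - 1))\<^sup>2) * t) \<le> (2 * t) * (37 / t ^ 6 * t)"
      using d s t by (intro mult_mono) auto
    also have "\<dots> = 74 / (t ^ 2 * t ^ 2)" using t by (simp add: field_simps eval_nat_numeral)
    also have "\<dots> \<le> 74 / (t ^ 2 * 1)" using t fb(4) by (intro divide_left_mono mult_left_mono) auto
    finally have "mM.dens ?d x * (((uu t)\<^sup>2 + (uu1 t * sqrt (t\<^sup>2 - 1))\<^sup>2) * t) \<le> 74 / t\<^sup>2" by simp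
    then have "ennreal (mM.dens ?d x) * \<phi> x \<le> ennreal (74 / t\<^sup>2)"
      unfolding \<phi>_def t_def[symmetric] ennreal_mult'[OF d(1), symmetric] by (rule ennreal_leI)
    moreover have "\<bar>x $ 1\<bar> \<le> C" "\<bar>x $ 2\<bar> \<le> C" using C[OF h, of 1] C[OF h, of 2] by auto
    ultimately show ?thesis using t by (simp add: t_def)
  qed
  then have "(\<integral>\<^sup>+x. ennreal (mM.dens ?d x) * \<phi> x \<partial>lborel) \<le>
      (\<integral>\<^sup>+x. ennreal (74 / (x $ 3)\<^sup>2) * indicator {x::real ^ 3. \<bar>x $ 1\<bar> \<le> C \<and> \<bar>x $ 2\<bar> \<le> C \<and> 1 \<le> x $ 3} x \<partial>lborel)"
    by (intro nn_integral_mono)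
  also have "\<dots> < \<infinity>" by (rule finite_layers) simp
  finally show ?thesis unfolding I[symmetric] by (simp add: \<phi>_def ec_simps(2))
qed

text \<open>Only the radial coefficients differ, and \<open>ff t\<close> lies between
  \<open>t\<^sup>2 - 1\<close> and its double.\<close>

lemma uniformly_equivalent:
  assumes c: "c \<in> Atlas NN" and y: "y \<in> snd (ec c) ` fst (ec c)"
  shows "bilin (background (hb.metric c) y) v v / 2 \<le> bilin (gint (ec c) y) v v"
    "bilin (gint (ec c) y) v v \<le> 2 * bilin (background (hb.metric c) y) v v"
proof -
  define t where "t = y $ 3"
  have t: "2 < t" and h: "hor y \<in> snd c ` fst c" using y image_ec[OF c] by (auto simp: t_def simp del: hor_up)
  note fb = ff_bounds[OF t]
  define p where "p = t\<^sup>2 * bilin (hb.metric c (hor y)) (hor v) (hor v)"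
  have "0 \<le> bilin (hb.metric c (hor y)) (hor v) (hor v)"
    using metric_positive(2)[OF hb.riemannian_metric_metric c h, of "hor v"] by (cases "hor v = 0") auto
  then have p: "0 \<le> p" by (simp add: p_def)
  define v3 where "v3 = v $ 3 * v $ 3"
  have v3: "0 \<le> v3" by (simp add: v3_def)
  have G: "bilin (gint (ec c) y) v v = p + 1 / ff t * v3"
    using y gint_ec[OF c] by (auto simp: bilin_warp p_def v3_def t_def mult.assoc)
  have B: "bilin (background (hb.metric c) y) v v = p + 1 / (t\<^sup>2 - 1) * v3"
    by (simp add: background_warp bilin_warp p_def v3_def t_def mult.assoc)
  define u where "u = t\<^sup>2 - 1"
  have u: "3 < u" "u \<le> ff t" "ff t \<le> 2 * u" using fb by (auto simp: u_def)
  have "1 / (2 * u) \<le> 1 / ff t" "1 / ff t \<le> 1 / u" using u by (intro divide_left_mono; simp)+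
  then have e: "1 / (2 * u) * v3 \<le> 1 / ff t * v3" "1 / ff t * v3 \<le> 1 / u * v3" using v3 by (intro mult_right_mono; simp)+
  have u0: "0 \<le> 1 / u * v3" using u v3 by simp
  have e2: "1 / (2 * u) * v3 = (1 / u * v3) / 2" by simp
  show "bilin (background (hb.metric c) y) v v / 2 \<le> bilin (gint (ec c) y) v v"
    unfolding G B u_def[symmetric] using e(1) p unfolding e2 by (simp only: add_divide_distrib)
  show "bilin (gint (ec c) y) v v \<le> 2 * bilin (background (hb.metric c) y) v v"
  proof -
    have "p + a \<le> 2 * (p + b)" if "a \<le> b" "0 \<le> p" "0 \<le> b" for a b p :: real using that by simp
    from this[OF e(2) p u0] show ?thesis unfolding G B u_def[symmetric] .
  qed
qed

lemma asymptotic_end: "asymptotic_to_background Mint gint NN hb.metric EE rr prj"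
  unfolding asymptotic_to_background_def Let_def
proof (intro conjI ballI, goal_cases)
  case 1
  then show ?case using uniformly_equivalent by (intro exI[of _ 2]) auto
next
  case (2 q)
  then obtain k where k: "k < 10" "q \<in> fst (bd (k div 2) (sg k))" using mN.bs(2) by blast
  define i where "i = k div 2"
  define ee where "ee = sg k"
  have i: "i < 5" "pm ee" using index_5[OF k(1)] sg by (auto simp: i_def ee_def)
  let ?c = "bd i ee"
  let ?G = "gint (ec ?c)" and ?y = "snd (ec ?c)" and ?E = "fst (ec ?c)" and ?\<mu> = "riemannian_measure Mint gint"
  let ?R = "?y ` ?E"
  note c = bd_Atlas(2)[OF i] and R = R_bd[OF i]
  have dev: "deviation \<phi> ?G (fr 1) (fr 2) y = \<phi> (uu (y $ 3)) + \<phi> (uu1 (y $ 3) * sqrt ((y $ 3)\<^sup>2 - 1))"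
    if "y \<in> ?R" "\<phi> 0 = 0" for \<phi> y
    by (rule deviation_end[where R="?R" and G="?G" and \<phi>=\<phi> and y=y, OF R(2) R(3) that])
  have im: "snd ?c ` fst ?c = img i" by (rule image_bd[OF i])
  have on: "orthonormal_frame (hb.metric ?c) (snd ?c ` fst ?c) (fr 1) (fr 2)"
    unfolding orthonormal_frame_def im
    using smooth_on_C_inf[OF open_UNIV C_inf_fr] hyp_bd[OF i] fr_orthonormal by auto
  have decay: "\<exists>\<rho>. \<forall>y\<in>?R. \<rho> < y $ 3 -->
      deviation abs ?G (fr 1) (fr 2) y \<le> \<delta> * (y $ 3) powr (-3/2)" if \<delta>: "0 < \<delta>" for \<delta>
  \<comment> \<open>\<open>7 = 1 + 6\<close> adds the two bounds of \<open>uu_facts\<close>. One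
    factor \<open>1 / t\<close> of the cubic decay absorbs the constant into
    \<open>\<delta>\<close>, and \<open>t powr (-2)\<close> remains.\<close>
  proof (intro exI[of _ "7 / \<delta>"] ballI impI)
    fix y assume y: "y \<in> ?R" and l: "7 / \<delta> < y $ 3"
    define t where "t = y $ 3"
    have t: "2 < t" using R(3)[OF y] by (simp add: t_def)
    have "deviation abs ?G (fr 1) (fr 2) y \<le> 7 / t ^ 3"
      using dev[OF y, of abs] uu_facts(3,4)[OF t] by (simp add: t_def)
    also have "\<dots> = 7 / t * (1 / t\<^sup>2)" by (simp add: power2_eq_square power3_eq_cube)
    also have "\<dots> \<le> \<delta> * (1 / t\<^sup>2)"
      using l t \<delta> by (intro mult_right_mono) (auto simp: t_def field_simps)
    also have "1 / t\<^sup>2 = t powr (-2)" using t by (simp add: powr_minus divide_inverse)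
    also have "\<delta> * t powr (-2) \<le> \<delta> * t powr (-3/2)" using t \<delta> by (intro mult_left_mono powr_mono) auto
    finally show "deviation abs ?G (fr 1) (fr 2) y \<le> \<delta> * (y $ 3) powr (-3/2)" by (simp add: t_def)
  qed
  have L2: "(\<integral>\<^sup>+p\<in>?E. ennreal (deviation (%t. t\<^sup>2) ?G (fr 1) (fr 2) (?y p) * rr p)
      \<partial>?\<mu>) < \<infinity>"
  proof -
    have *: "deviation (%t. t\<^sup>2) ?G (fr 1) (fr 2) (?y p) * rr p
        = ((uu (rr p))\<^sup>2 + (uu1 (rr p) * sqrt ((rr p)\<^sup>2 - 1))\<^sup>2) * rr p" if "p \<in> ?E" for p
      using dev[of "?y p" "%t. t\<^sup>2"] that by (simp add: ec_simps(2))
    have "(\<integral>\<^sup>+p\<in>?E. ennreal (deviation (%t. t\<^sup>2) ?G (fr 1) (fr 2) (?y p) * rr p)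
        \<partial>?\<mu>) =
      (\<integral>\<^sup>+p\<in>?E. ennreal (((uu (rr p))\<^sup>2 + (uu1 (rr p) * sqrt ((rr p)\<^sup>2 - 1))\<^sup>2) * rr p)
        \<partial>?\<mu>)"
    proof (intro nn_integral_cong)
      fix p
      show "ennreal (deviation (%t. t\<^sup>2) ?G (fr 1) (fr 2) (?y p) * rr p) * indicator (?E) p =
          ennreal (((uu (rr p))\<^sup>2 + (uu1 (rr p) * sqrt ((rr p)\<^sup>2 - 1))\<^sup>2) * rr p) * indicator (?E) p"
      proof (cases "p \<in> ?E")
        case True
        show ?thesis unfolding *[OF True] ..
      next
        case False
        then show ?thesis by simp
      qed
    qed
    then show ?thesis using integral_end[OF i] by simp
  qed
  have L1: "(\<integral>\<^sup>+p\<in>?E. ennreal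
      (\<bar>scalar ?G (?y p) - scalar (background (hb.metric ?c)) (?y p)\<bar> * rr p)
      \<partial>?\<mu>) < \<infinity>"
  proof -
    have "scalar ?G (?y p) = scalar (background (hb.metric ?c)) (?y p)" if "p \<in> ?E" for p
      using scalar_gint[OF ec_Atlas[OF c] that] scalar_background[OF c] that by simp
    then have "(\<integral>\<^sup>+p\<in>?E. ennreal
      (\<bar>scalar ?G (?y p) - scalar (background (hb.metric ?c)) (?y p)\<bar> * rr p)
      \<partial>?\<mu>) = (\<integral>\<^sup>+p. 0 \<partial>?\<mu>)"
      by (intro nn_integral_cong) (auto simp: indicator_def)
    then show ?thesis by simp
  qed
  show ?case
    by (rule bexI[OF _ c], rule conjI[OF k(2)[folded i_def ee_def]], rule exI[of _ "fr 1"], rule exI[of _ "fr 2"],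
      intro conjI allI impI on decay L2 L1)
qed

section \<open>The mass\<close>

definition area :: real where "area = measure (riemannian_measure NN hb.metric) (Points NN)"

lemma emeasure_bd:
  assumes i: "i < 5" "pm ee"
  shows "emeasure (riemannian_measure NN hb.metric) (fst (bd i ee)) =
      (\<integral>\<^sup>+x. ennreal (sqrt (det (hyp_metric x))) * indicator (img i) x \<partial>lborel)"
proof -
  note c = bd_Atlas(2)[OF i]
  have "emeasure (riemannian_measure NN hb.metric) (fst (bd i ee)) =
      (\<integral>\<^sup>+x. ennreal (sqrt (det (hb.metric (bd i ee) x))) * indicator (img i) x \<partial>lborel)"
    using mN.riemannian_measure_spec(3)[OF c mN.chart_in_sigma[OF c] order_refl]
      mN.emeasure_\<nu>_image[OF c mN.chart_in_sigma[OF c] order_refl] image_bd[OF i] by simp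
  also have "\<dots> = (\<integral>\<^sup>+x. ennreal (sqrt (det (hyp_metric x))) * indicator (img i) x \<partial>lborel)"
    by (intro nn_integral_cong) (auto simp: indicator_def hyp_bd[OF i])
  finally show ?thesis .
qed

text \<open>\<open>measure\<close> is \<open>0\<close> on sets of infinite measure, so finiteness
  has to be shown along with positivity. The former holds because chart images are bounded and the
  density is at most \<open>1\<close>, the latter because a nonempty open image is not
  negligible.\<close>

lemma area_pos: "0 < area"
proof -
  let ?\<mu> = "riemannian_measure NN hb.metric"
  have sets: "fst (bd (k div 2) (sg k)) \<in> sets ?\<mu>" if "k < 10" for k
    unfolding mN.riemannian_measure_spec(2) by (rule mN.chart_in_sigma[OF bd_Atlas(2)[OF index_5[OF that] sg]])
  have fin: "emeasure ?\<mu> (fst (bd i ee)) < \<infinity>" if i: "i < 5" "pm ee" for i ee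
  proof -
    obtain C where C: "\<And>x c. x \<in> img i ==> \<bar>x $ c\<bar> \<le> C" using bounded_img[OF i(1)] by blast
    then have sub: "img i \<subseteq> cbox (vec (- C)) (vec C :: real ^ 2)" by (auto simp: mem_box_cart abs_le_iff minus_le_iff)
    have "emeasure ?\<mu> (fst (bd i ee)) \<le> (\<integral>\<^sup>+x. indicator (cbox (vec (- C)) (vec C :: real ^ 2)) x \<partial>lborel)"
      unfolding emeasure_bd[OF i]
    proof (intro nn_integral_mono)
      fix x :: "real ^ 2"
      have "sqrt (det (hyp_metric x)) \<le> 1" using det_hyp_bounds[of x] by simp
      then have "ennreal (sqrt (det (hyp_metric x))) \<le> 1" using ennreal_leI by fastforce
      then show "ennreal (sqrt (det (hyp_metric x))) * indicator (img i) x \<le> indicator (cbox (vec (- C)) (vec C :: real ^ 2)) x"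
        using sub by (auto simp: indicator_def)
    qed
    also have "\<dots> < \<infinity>" using emeasure_bounded_finite[OF bounded_cbox] by simp
    finally show ?thesis .
  qed
  have cov: "Points NN = (\<Union>k<10. fst (bd (k div 2) (sg k)))"
    using mN.bs(2) is_chart_subset[OF hb.Atlas_chart[OF bd_Atlas(2)[OF index_5 sg]]] by (intro equalityI) force+
  have "emeasure ?\<mu> (Points NN) \<le> (\<Sum>k<10. emeasure ?\<mu> (fst (bd (k div 2) (sg k))))"
    unfolding cov by (rule emeasure_subadditive_finite) (use sets in auto)
  also have "\<dots> < \<infinity>" using fin[OF index_5 sg] by (simp add: less_top[symmetric])
  finally have 1: "emeasure ?\<mu> (Points NN) < \<infinity>" .
  have "Psi 0 0 \<in> double_torus" by (rule Psi) (simp add: pent_def)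
  then have "qq (Psi 0 0, 1) \<in> Points NN" using boundary_qq topspace_XN by auto
  then obtain k where k: "k < 10" "qq (Psi 0 0, 1) \<in> fst (bd (k div 2) (sg k))" using cov by blast
  define i where "i = k div 2"
  define ee where "ee = sg k"
  have i: "i < 5" "pm ee" using index_5[OF k(1)] sg by (auto simp: i_def ee_def)
  have ne: "img i ~= {}" using k(2) image_bd[OF i] unfolding i_def ee_def by blast
  have "emeasure ?\<mu> (fst (bd i ee)) ~= 0"
  proof
    assume "emeasure ?\<mu> (fst (bd i ee)) = 0"
    moreover have "(%x. ennreal (sqrt (det (hyp_metric x))) * indicator (img i) x) \<in> borel_measurable (lborel :: (real ^ 2) measure)"
    proof -
      have "(%x::real ^ 2. 1 / (1 + x \<bullet> x)) \<in> borel_measurable borel" by measurable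
      moreover have "img i \<in> sets borel" using open_img by simp
      ultimately show ?thesis unfolding det_hyp by measurable
    qed
    ultimately have "AE x in lborel. ennreal (sqrt (det (hyp_metric x))) * indicator (img i) x = 0"
      unfolding emeasure_bd[OF i] by (simp add: nn_integral_0_iff_AE)
    moreover have "ennreal (sqrt (det (hyp_metric x))) ~= 0" for x :: "real ^ 2"
      using det_hyp_bounds(1)[of x] by (simp add: ennreal_eq_0_iff)
    ultimately have "AE x in lborel. x \<notin> img i"
      by (auto elim!: eventually_mono simp: indicator_def split: if_splits)
    then have "img i \<in> null_sets lborel"
      using AE_iff_null_sets[of "img i" lborel] open_img by auto
    then have "negligible (img i)" by (simp add: negligible_iff_null_sets null_sets_completionI)
    then show False using open_not_negligible[OF open_img ne] by blast
  qed
  moreover have "emeasure ?\<mu> (fst (bd i ee)) \<le> emeasure ?\<mu> (Points NN)"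
  proof (rule emeasure_mono)
    show "fst (bd i ee) \<subseteq> Points NN" using cov k(1) unfolding i_def ee_def by blast
    show "Points NN \<in> sets ?\<mu>" using sets.top[of ?\<mu>] mN.riemannian_measure_spec(1) by simp
  qed
  ultimately have "emeasure ?\<mu> (Points NN) ~= 0" by auto
  then show ?thesis using 1 unfolding area_def measure_def
    by (simp add: enn2real_positive_iff less_top[symmetric] zero_less_iff_neq_zero)
qed

text \<open>By \<open>mass_density_ec\<close> the integrand has the same value at every boundary
  point, whichever chart is chosen there.\<close>

lemma mass_flux_end:
  assumes \<rho>: "2 < \<rho>"
  shows "mass_flux gint NN hb.metric EE rr prj \<rho> = area * (kk * sqrt (ff \<rho> / (\<rho>\<^sup>2 - 1)))"
proof -
  let ?\<mu> = "riemannian_measure NN hb.metric"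
  have "chart_at NN q \<in> Atlas NN \<and> q \<in> fst (chart_at NN q)" if "q \<in> Points NN" for q
    unfolding chart_at_def by (rule someI_ex) (use smooth_manifold_cover[OF hb.smooth_manifold_generated that] in blast)
  then have "mass_flux gint NN hb.metric EE rr prj \<rho> = (\<integral>q. kk * sqrt (ff \<rho> / (\<rho>\<^sup>2 - 1)) \<partial>?\<mu>)"
    unfolding mass_flux_def Let_def
    using mass_density_ec[OF _ _ \<rho>] mN.riemannian_measure_spec(1) by (intro Bochner_Integration.integral_cong) auto
  also have "\<dots> = area * (kk * sqrt (ff \<rho> / (\<rho>\<^sup>2 - 1)))"
    unfolding area_def by (simp add: mN.riemannian_measure_spec(1))
  finally show ?thesis .
qed

lemma flux_limit: "((%\<rho>. sqrt (ff \<rho> / (\<rho>\<^sup>2 - 1))) \<longlongrightarrow> 1) at_top"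
proof -
  have k: "((%\<rho>. kk / \<rho>) \<longlongrightarrow> 0) at_top"
    by (rule real_tendsto_divide_at_top[OF tendsto_const filterlim_ident])
  have b: "ff \<rho> / (\<rho>\<^sup>2 - 1) - 1 \<le> kk / \<rho>" "0 \<le> ff \<rho> / (\<rho>\<^sup>2 - 1) - 1" if \<rho>: "2 < \<rho>" for \<rho>
  proof -
    note fb = ff_bounds[OF \<rho>]
    have e: "ff \<rho> / (\<rho>\<^sup>2 - 1) - 1 = (kk / \<rho>) / (\<rho>\<^sup>2 - 1)"
      using fb(4) unfolding ff_def add_divide_distrib by simp
    have "(kk / \<rho>) / (\<rho>\<^sup>2 - 1) \<le> (kk / \<rho>) / 1" using fb(4,5) \<rho> by (intro divide_left_mono) auto
    then show "ff \<rho> / (\<rho>\<^sup>2 - 1) - 1 \<le> kk / \<rho>" unfolding e by simp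
    show "0 \<le> ff \<rho> / (\<rho>\<^sup>2 - 1) - 1" unfolding e using fb(4,5) \<rho> by (intro divide_nonneg_nonneg) auto
  qed
  have "((%\<rho>. ff \<rho> / (\<rho>\<^sup>2 - 1) - 1) \<longlongrightarrow> 0) at_top"
    by (rule tendsto_sandwich[OF eventually_mono[OF eventually_gt_at_top[of 2] b(2)]
          eventually_mono[OF eventually_gt_at_top[of 2] b(1)] tendsto_const k])
  then have "((%\<rho>. ff \<rho> / (\<rho>\<^sup>2 - 1)) \<longlongrightarrow> 1) at_top" by (rule LIM_zero_cancel)
  from tendsto_real_sqrt[OF this] show ?thesis by simp
qed

lemma has_mass_end: "has_mass Mint gint Mbar bar.metric (- (area * kk))"
  unfolding has_mass_def boundary_manifold_N
proof (intro exI conjI)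
  show "hyperbolic_representative Mbar bar.metric hb.metric" by (rule hyperbolic_representative_h)
  show "end_identification Mint Mbar EE 2 rr prj" by (rule end_identification_EE)
  show "asymptotic_to_background Mint gint NN hb.metric EE rr prj" by (rule asymptotic_end)
  have "((%\<rho>. - (area * (kk * sqrt (ff \<rho> / (\<rho>\<^sup>2 - 1))))) \<longlongrightarrow> - (area * (kk * 1))) at_top"
    by (intro tendsto_intros flux_limit)
  moreover have "\<forall>\<^sub>F \<rho> in at_top. - (area * (kk * sqrt (ff \<rho> / (\<rho>\<^sup>2 - 1)))) = - mass_flux gint NN hb.metric EE rr prj \<rho>"
    by (rule eventually_mono[OF eventually_gt_at_top[of 2]]) (simp add: mass_flux_end)
  ultimately have "((%\<rho>. - mass_flux gint NN hb.metric EE rr prj \<rho>) \<longlongrightarrow> - (area * (kk * 1))) at_top"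
    by (rule Lim_transform_eventually)
  then show "((%\<rho>. - mass_flux gint NN hb.metric EE rr prj \<rho>) \<longlongrightarrow> - (area * kk)) at_top" by simp
qed

theorem corollary5p2:
  shows "\<exists>(M :: (real, 3) manifold) g Mbar gbar \<Omega> m.
    smooth_manifold half_space M \<and> riemannian_metric M g \<and>
    connected_space (Top M) \<and>
    boundary_points M = {} \<and>
    conformal_completion M g Mbar gbar \<Omega> \<and> compact_space (Top Mbar) \<and>
    ALH M g Mbar \<and>
    constant_scalar_curvature M g \<and>
    genus_two (Top (boundary_manifold Mbar)) \<and>
    has_mass M g Mbar gbar m \<and> m < 0"
proof (intro exI conjI)
  show "smooth_manifold half_space Mint" by (rule manifold_Mint)
  show "riemannian_metric Mint gint" by (rule metric_gint)
  show "connected_space (Top Mint)" by (rule connected_Mint)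
  show "boundary_points Mint = {}" by (rule boundary_Mint)
  show "conformal_completion Mint gint Mbar bar.metric Om" by (rule conformal_completion_Mint)
  show "compact_space (Top Mbar)" using compact_TB by simp
  show "ALH Mint gint Mbar" by (rule ALH_Mint)
  show "constant_scalar_curvature Mint gint"
    unfolding constant_scalar_curvature_def Points_Mint using scalar_curvature_Mint by blast
  show "genus_two (Top (boundary_manifold Mbar))" by (rule genus_two_N)
  show "has_mass Mint gint Mbar bar.metric (- (area * kk))" by (rule has_mass_end)
  show "- (area * kk) < 0" using area_pos by (simp add: kk_def)
qed

end
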